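(* Let $g$ be a metric on a compact Riemannian manifold $M$ whose Ricci curvature $\rho$ is positive definite, and let $\kappa$ be the scalar curvature of $g$. Then there exists a neighborhood $U(g)$ of $g$ in $\mathcal G$ such that for every metric $\bar g\in U(g)$ with $|v|_{\bar g}\ge |v|_g$ for all $v\in TM$, with scalar curvature $\bar\kappa$, the inequality $\bar\kappa\ge\kappa$ everywhere on $M$ implies $\bar\kappa=\kappa$. Suppose moreover that $2\rho-\kappa$ is negative definite. Then there exists another neighborhood $U'(g)\subset\mathcal G$ of $g$ such that for every metric $\bar g\in U'(g)\cap\mathcal M(g)$, with scalar curvature $\bar\kappa$, the inequality $\bar\kappa\ge\kappa$ everywhere on $M$ implies $\bar\kappa=\kappa$.
   Context: $\mathcal G$ denotes the space of all Riemannian metrics on $M$, equipped with the $C^2$-topology. $\mathcal M(g)$ denotes the set of all Riemannian metrics $\bar g$ on $M$ such that $|v\wedge w|_{\bar g}\ge |v\wedge w|_g$ for all tangent vectors $v,w\in T_pM$ and all $p\in M$. The Ricci curvature $\rho$ is regarded as a symmetric bilinear form on $TM$, and "$2\rho-\kappa$ negative definite" means that the symmetric bilinear form $2\rho-\kappa\,g$ is negative definite at every point of $M$. *)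

theory Defs
  imports "HOL-Analysis.Analysis"
begin

section \<open>Smooth functions on open subsets of Euclidean space\<close>

primrec Ck_on ::
  "nat \<Rightarrow> ('a::real_normed_vector \<Rightarrow> 'b::real_normed_vector) \<Rightarrow> 'a set \<Rightarrow> bool"
where
  "Ck_on 0 f S \<longleftrightarrow> continuous_on S f"
| "Ck_on (Suc k) f S \<longleftrightarrow> (\<forall>x\<in>S. f differentiable (at x)) \<and>
     (\<forall>v. Ck_on k (\<lambda>x. frechet_derivative f (at x) v) S)"

definition smooth_on ::
  "('a::real_normed_vector \<Rightarrow> 'b::real_normed_vector) \<Rightarrow> 'a set \<Rightarrow> bool"
where "smooth_on f S \<longleftrightarrow> (\<forall>k. Ck_on k f S)"

definition partial :: "'n::finite \<Rightarrow> (real^'n \<Rightarrow> real) \<Rightarrow> real^'n \<Rightarrow> real"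
where "partial i f x = frechet_derivative f (at x) (axis i 1)"

section \<open>Smooth manifolds\<close>

text \<open>A chart is a domain together with a coordinate map; the values of the map outside the
  domain are irrelevant. The manifold is a subset of a Hausdorff space, and chart domains are
  open relative to it.\<close>

type_synonym ('a, 'n) chart = "'a set \<times> ('a \<Rightarrow> real^'n)"

abbreviation cdom :: "('a, 'n::finite) chart \<Rightarrow> 'a set" where "cdom \<equiv> fst"
abbreviation cmap :: "('a, 'n::finite) chart \<Rightarrow> 'a \<Rightarrow> real^'n" where "cmap \<equiv> snd"
abbreviation cimg :: "('a, 'n::finite) chart \<Rightarrow> (real^'n) set" where "cimg c \<equiv> cmap c ` cdom c"

definition cinv :: "('a, 'n::finite) chart \<Rightarrow> real^'n \<Rightarrow> 'a"
where "cinv c = inv_into (cdom c) (cmap c)"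

definition chart_on :: "'a::t2_space set \<Rightarrow> ('a, 'n::finite) chart \<Rightarrow> bool"
where "chart_on M c \<longleftrightarrow> openin (top_of_set M) (cdom c) \<and> open (cimg c) \<and>
  homeomorphism (cdom c) (cimg c) (cmap c) (cinv c)"

definition transition ::
  "('a, 'n::finite) chart \<Rightarrow> ('a, 'n) chart \<Rightarrow> real^'n \<Rightarrow> real^'n"
where "transition c d = cmap d \<circ> cinv c"

definition smooth_atlas :: "'a::t2_space set \<Rightarrow> ('a, 'n::finite) chart set \<Rightarrow> bool"
where "smooth_atlas M A \<longleftrightarrow> (\<forall>c\<in>A. chart_on M c) \<and> (\<Union>c\<in>A. cdom c) = M \<and>
  (\<forall>c\<in>A. \<forall>d\<in>A. smooth_on (transition c d) (cmap c ` (cdom c \<inter> cdom d)))"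

text \<open>The manifold has no boundary. Second countability follows from compactness.\<close>

definition compact_manifold :: "'a::t2_space set \<Rightarrow> ('a, 'n::finite) chart set \<Rightarrow> bool"
where "compact_manifold M A \<longleftrightarrow> compact M \<and> smooth_atlas M A"

section \<open>Tangent vectors\<close>

text \<open>A tangent vector at \<open>p\<close> assigns to each chart around \<open>p\<close> a coordinate vector, compatibly
  with the transition maps; it is \<open>0\<close> on all other arguments.\<close>

type_synonym ('a, 'n) tvec = "('a, 'n) chart \<Rightarrow> real^'n"

definition charts_at :: "('a, 'n::finite) chart set \<Rightarrow> 'a \<Rightarrow> ('a, 'n) chart set"
where "charts_at A p = {c \<in> A. p \<in> cdom c}"

definition tangent_space :: "('a, 'n::finite) chart set \<Rightarrow> 'a \<Rightarrow> ('a, 'n) tvec set"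
where "tangent_space A p = {v.
  (\<forall>c\<in>charts_at A p. \<forall>d\<in>charts_at A p.
     v d = frechet_derivative (transition c d) (at (cmap c p)) (v c)) \<and>
  (\<forall>c. c \<notin> charts_at A p \<longrightarrow> v c = 0)}"

text \<open>The coordinate vector field \<open>\<partial>/\<partial>x\<^sub>i\<close> of the chart \<open>c\<close> at \<open>p\<close>.\<close>

definition coord_vec ::
  "('a, 'n::finite) chart set \<Rightarrow> ('a, 'n) chart \<Rightarrow> 'n \<Rightarrow> 'a \<Rightarrow> ('a, 'n) tvec"
where "coord_vec A c i p = (\<lambda>d. if d \<in> charts_at A p
  then frechet_derivative (transition c d) (at (cmap c p)) (axis i 1) else 0)"

definition pos_definite_on :: "('a, 'n::finite) tvec set \<Rightarrow> (('a, 'n) tvec \<Rightarrow> ('a, 'n) tvec \<Rightarrow> real) \<Rightarrow> bool"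
where "pos_definite_on V B \<longleftrightarrow> (\<forall>v\<in>V. v \<noteq> (\<lambda>_. 0) \<longrightarrow> B v v > 0)"

definition neg_definite_on :: "('a, 'n::finite) tvec set \<Rightarrow> (('a, 'n) tvec \<Rightarrow> ('a, 'n) tvec \<Rightarrow> real) \<Rightarrow> bool"
where "neg_definite_on V B \<longleftrightarrow> (\<forall>v\<in>V. v \<noteq> (\<lambda>_. 0) \<longrightarrow> B v v < 0)"

definition sym_bilinear_on :: "('a, 'n::finite) tvec set \<Rightarrow> (('a, 'n) tvec \<Rightarrow> ('a, 'n) tvec \<Rightarrow> real) \<Rightarrow> bool"
where "sym_bilinear_on V B \<longleftrightarrow>
  (\<forall>v\<in>V. \<forall>w\<in>V. B v w = B w v) \<and>
  (\<forall>u\<in>V. \<forall>v\<in>V. \<forall>w\<in>V. \<forall>a b. B (\<lambda>c. a *\<^sub>R u c + b *\<^sub>R v c) w = a * B u w + b * B v w)"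

section \<open>Riemannian metrics\<close>

type_synonym ('a, 'n) form2 = "'a \<Rightarrow> ('a, 'n) tvec \<Rightarrow> ('a, 'n) tvec \<Rightarrow> real"

definition components ::
  "('a, 'n::finite) chart set \<Rightarrow> ('a, 'n) form2 \<Rightarrow> ('a, 'n) chart \<Rightarrow> real^'n \<Rightarrow> real^'n^'n"
where "components A g c x =
  (\<chi> i j. g (cinv c x) (coord_vec A c i (cinv c x)) (coord_vec A c j (cinv c x)))"

text \<open>Riemannian metrics are smooth. The last condition fixes the irrelevant values of the
  underlying total function, so that a metric has exactly one representation.\<close>

definition metrics :: "'a::t2_space set \<Rightarrow> ('a, 'n::finite) chart set \<Rightarrow> ('a, 'n) form2 set"
where "metrics M A = {g.
  (\<forall>p\<in>M. sym_bilinear_on (tangent_space A p) (g p) \<and> pos_definite_on (tangent_space A p) (g p)) \<and>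
  (\<forall>c\<in>A. \<forall>i j. smooth_on (\<lambda>x. components A g c x $ i $ j) (cimg c)) \<and>
  (\<forall>p v w. \<not> (p \<in> M \<and> v \<in> tangent_space A p \<and> w \<in> tangent_space A p) \<longrightarrow> g p v w = 0)}"

definition tnorm :: "('a, 'n::finite) form2 \<Rightarrow> 'a \<Rightarrow> ('a, 'n) tvec \<Rightarrow> real"
where "tnorm g p v = sqrt (g p v v)"

text \<open>The norm of \<open>v \<and> w\<close> for the inner product on the second exterior power induced by \<open>g\<close>.\<close>

definition wedge_norm ::
  "('a, 'n::finite) form2 \<Rightarrow> 'a \<Rightarrow> ('a, 'n) tvec \<Rightarrow> ('a, 'n) tvec \<Rightarrow> real"
where "wedge_norm g p v w = sqrt (g p v v * g p w w - (g p v w)\<^sup>2)"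

definition area_larger_metrics ::
  "'a::t2_space set \<Rightarrow> ('a, 'n::finite) chart set \<Rightarrow> ('a, 'n) form2 \<Rightarrow> ('a, 'n) form2 set"
where "area_larger_metrics M A g = {h \<in> metrics M A.
  \<forall>p\<in>M. \<forall>v\<in>tangent_space A p. \<forall>w\<in>tangent_space A p. wedge_norm h p v w \<ge> wedge_norm g p v w}"

section \<open>The \<open>C\<^sup>2\<close>-topology on the space of metrics\<close>

text \<open>Uniform closeness on compact subsets of charts of all components and their partial
  derivatives up to order two.\<close>

definition C2_nbhd ::
  "'a::t2_space set \<Rightarrow> ('a, 'n::finite) chart set \<Rightarrow> ('a, 'n) form2 \<Rightarrow> ('a, 'n) chart \<Rightarrow>
   (real^'n) set \<Rightarrow> real \<Rightarrow> ('a, 'n) form2 set"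
where "C2_nbhd M A g c K \<epsilon> = {h \<in> metrics M A. \<forall>x\<in>K. \<forall>i j.
  (let f = (\<lambda>y. components A h c y $ i $ j - components A g c y $ i $ j) in
     \<bar>f x\<bar> < \<epsilon> \<and> (\<forall>k. \<bar>partial k f x\<bar> < \<epsilon>) \<and> (\<forall>k l. \<bar>partial k (partial l f) x\<bar> < \<epsilon>))}"

text \<open>The whole space is added to the subbasis only for the case of an empty atlas.\<close>

definition C2_topology ::
  "'a::t2_space set \<Rightarrow> ('a, 'n::finite) chart set \<Rightarrow> ('a, 'n) form2 topology"
where "C2_topology M A = topology_generated_by (insert (metrics M A)
  {C2_nbhd M A g c K \<epsilon> | g c K \<epsilon>.
     g \<in> metrics M A \<and> c \<in> A \<and> compact K \<and> K \<subseteq> cimg c \<and> \<epsilon> > 0})"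

section \<open>Curvature\<close>

text \<open>Coordinate expressions, for a matrix field \<open>G\<close> with inverse \<open>g\<^sup>k\<^sup>l\<close>:
  \<open>\<Gamma>\<^sup>k\<^sub>i\<^sub>j = 1/2 \<Sum>\<^sub>l g\<^sup>k\<^sup>l (\<partial>\<^sub>i g\<^sub>j\<^sub>l + \<partial>\<^sub>j g\<^sub>i\<^sub>l - \<partial>\<^sub>l g\<^sub>i\<^sub>j)\<close>, and the Ricci tensor with the sign for which
  round spheres have positive Ricci curvature.\<close>

definition christoffel ::
  "(real^'n \<Rightarrow> real^'n^'n) \<Rightarrow> 'n::finite \<Rightarrow> 'n \<Rightarrow> 'n \<Rightarrow> real^'n \<Rightarrow> real"
where "christoffel G k i j x = (1/2) * (\<Sum>l\<in>UNIV. matrix_inv (G x) $ k $ l *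
  (partial i (\<lambda>y. G y $ j $ l) x + partial j (\<lambda>y. G y $ i $ l) x - partial l (\<lambda>y. G y $ i $ j) x))"

definition ricci_coord ::
  "(real^'n \<Rightarrow> real^'n^'n) \<Rightarrow> 'n::finite \<Rightarrow> 'n \<Rightarrow> real^'n \<Rightarrow> real"
where "ricci_coord G i j x =
  (\<Sum>k\<in>UNIV. partial k (christoffel G k i j) x - partial j (christoffel G k i k) x) +
  (\<Sum>k\<in>UNIV. \<Sum>l\<in>UNIV. christoffel G k k l x * christoffel G l i j x
                      - christoffel G k j l x * christoffel G l i k x)"

definition scalar_coord :: "(real^'n \<Rightarrow> real^'n^'n) \<Rightarrow> real^'n::finite \<Rightarrow> real"
where "scalar_coord G x =
  (\<Sum>i\<in>UNIV. \<Sum>j\<in>UNIV. matrix_inv (G x) $ i $ j * ricci_coord G i j x)"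

text \<open>The chart chosen at \<open>p\<close> does not matter, since the Ricci tensor and the scalar curvature
  of a metric are invariant under changes of coordinates.\<close>

definition chart_at :: "('a, 'n::finite) chart set \<Rightarrow> 'a \<Rightarrow> ('a, 'n) chart"
where "chart_at A p = (SOME c. c \<in> charts_at A p)"

definition ricci :: "('a, 'n::finite) chart set \<Rightarrow> ('a, 'n) form2 \<Rightarrow> ('a, 'n) form2"
where "ricci A g p v w = (let c = chart_at A p in
  \<Sum>i\<in>UNIV. \<Sum>j\<in>UNIV. ricci_coord (components A g c) i j (cmap c p) * v c $ i * w c $ j)"

definition scalar_curvature :: "('a, 'n::finite) chart set \<Rightarrow> ('a, 'n) form2 \<Rightarrow> 'a \<Rightarrow> real"
where "scalar_curvature A g p = (let c = chart_at A p in
  scalar_coord (components A g c) (cmap c p))"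

end

theory Submission
  imports Defs
begin

text \<open>The theorem compares a metric \<open>h\<close> with a fixed metric \<open>g\<close> of positive Ricci curvature. Let \<open>D\<close> be the difference of
  their Levi-Civita connections, a tensor that is linear in the first derivatives of \<open>E = h - g\<close>. Everything rests on the exact
  identity (\<open>scalar_curvature_decomposition\<close>)

  \<open>\<kappa>\<^sub>h = h\<^sup>i\<^sup>j \<rho>\<^sub>i\<^sub>j + div\<^sub>g V + Q(D)\<close>,

  where \<open>V\<close> is a vector field built from \<open>D\<close>, and \<open>Q\<close> is a quadratic form with coefficients made of the inverse of \<open>h\<close>.
  As \<open>\<kappa>\<^sub>g = g\<^sup>i\<^sup>j \<rho>\<^sub>i\<^sub>j\<close>, the difference \<open>\<kappa>\<^sub>h - \<kappa>\<^sub>g\<close> is a divergence plus \<open>(h\<^sup>i\<^sup>j - g\<^sup>i\<^sup>j) \<rho>\<^sub>i\<^sub>j + Q(D)\<close>. If the last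
  expression is nonpositive everywhere and \<open>\<kappa>\<^sub>h \<ge> \<kappa>\<^sub>g\<close>, then \<open>0 \<le> \<kappa>\<^sub>h - \<kappa>\<^sub>g \<le> div\<^sub>g V\<close>. The integral of a divergence
  over a compact manifold is zero, and therefore \<open>\<kappa>\<^sub>h = \<kappa>\<^sub>g\<close>.

  The Ricci term is at most \<open>- c \<bar>E\<bar>\<close>. In a frame that is orthonormal for \<open>g\<close> and diagonal for \<open>h\<close>, with
  \<open>h(v\<^sub>i,v\<^sub>i) = 1 + \<theta>\<^sub>i\<close>, it equals \<open>- \<Sum>\<^sub>i \<rho>\<^sub>i\<^sub>i \<theta>\<^sub>i / (1 + \<theta>\<^sub>i)\<close>. If \<open>h\<close> is larger on vectors, all \<open>\<theta>\<^sub>i\<close> are nonnegative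
  and positivity of \<open>\<rho>\<close> suffices (\<open>first_variation_length\<close>). If \<open>h\<close> is larger on bivectors, then
  \<open>(1 + \<theta>\<^sub>i)(1 + \<theta>\<^sub>j) \<ge> 1\<close> for \<open>i \<noteq> j\<close>, one of the \<open>\<theta>\<^sub>i\<close> may be negative, and \<open>2\<rho> < \<kappa>\<close> says exactly that the others outweigh
  it (\<open>first_variation_area\<close>).

  The quadratic term is of the order of the squared gradient of \<open>E\<close>, which for general small \<open>E\<close> is not controlled by \<open>\<bar>E\<bar>\<close>.
  But a nonnegative function \<open>u\<close> with second derivatives at most \<open>\<epsilon>\<close> satisfies \<open>\<bar>du\<bar>\<^sup>2 \<le> C \<epsilon> u\<close>, and in both cases the
  tensor \<open>(tr E) g - E\<close> is positive semidefinite and determines \<open>E\<close>. Hence \<open>\<bar>Q(D)\<bar> \<le> C \<epsilon> \<bar>E\<bar>\<close> if \<open>h\<close> is \<open>\<epsilon>\<close>-close to \<open>g\<close> in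
  \<open>C\<^sup>2\<close> (\<open>metric_gradient_bound\<close>), and the Ricci term wins pointwise for small \<open>\<epsilon>\<close> (\<open>scalar_le_plus_divergence\<close>).

  To pass to the manifold one needs that scalar curvature, Ricci curvature and \<open>V\<close> are independent of the chart, which follows
  from the transformation law of the Christoffel symbols (\<open>Gam_transform\<close>), and the divergence theorem
  (\<open>sum_divergence_zero\<close>), obtained from a partition of unity and change of variables.\<close>

section \<open>Functions of class \<open>C\<^sup>k\<close>\<close>

lemma Ck_on_SucD: "Ck_on (Suc k) f S \<Longrightarrow> Ck_on k f S"
proof (induction k arbitrary: f)
  case 0
  then show ?case
    by (auto intro!: continuous_at_imp_continuous_on differentiable_imp_continuous_within)
next
  case (Suc k)
  then show ?case by (metis Ck_on.simps(2))
qed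

lemma Ck_on_mono: "Ck_on m f S \<Longrightarrow> k \<le> m \<Longrightarrow> Ck_on k f S"
  by (induction m) (auto simp: le_Suc_eq dest: Ck_on_SucD simp del: Ck_on.simps(2))

lemma Ck_on_continuous: "Ck_on k f S \<Longrightarrow> continuous_on S f"
  using Ck_on_mono[of k f S 0] by simp

lemma Ck_on_subset: "Ck_on k f S \<Longrightarrow> T \<subseteq> S \<Longrightarrow> Ck_on k f T"
  by (induction k arbitrary: f) (auto intro: continuous_on_subset)

text \<open>Being of class \<open>C\<^sup>k\<close> on an open set depends only on the values there, since derivatives are local. The closure
  properties below differentiate a formula, recognise the derivative as a formula of the same kind, and conclude by
  induction on \<open>k\<close> through this lemma.\<close>

lemma Ck_on_cong:
  assumes "open S" "\<And>x. x \<in> S \<Longrightarrow> f x = g x" "Ck_on k f S"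
  shows "Ck_on k g S"
  using assms(2,3)
proof (induction k arbitrary: f g)
  case 0
  then show ?case by (simp cong: continuous_on_cong)
next
  case (Suc k)
  have *: "frechet_derivative f (at x) = frechet_derivative g (at x)" if "x \<in> S" for x
    using Suc.prems that assms(1) by (intro frechet_derivative_transform_within_open) auto
  have "g differentiable (at x)" if "x \<in> S" for x
    using Suc.prems that assms(1)
    unfolding differentiable_def
    by (metis Ck_on.simps(2) has_derivative_transform_within_open differentiable_def)
  moreover have "Ck_on k (\<lambda>x. frechet_derivative g (at x) v) S" for v
    using Suc.IH[of "\<lambda>x. frechet_derivative f (at x) v"] Suc.prems * by auto
  ultimately show ?case by simp
qed

lemma Ck_on_local:
  assumes "\<And>x. x \<in> S \<Longrightarrow> \<exists>T. open T \<and> x \<in> T \<and> Ck_on k f T"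
  shows "Ck_on k f S"
  using assms
proof (induction k arbitrary: f)
  case 0
  then show ?case
    by (metis Ck_on.simps(1) continuous_at_imp_continuous_on continuous_on_eq_continuous_at)
next
  case (Suc k)
  have "f differentiable (at x)" if "x \<in> S" for x
    using Suc.prems[OF that] by auto
  moreover have "Ck_on k (\<lambda>x. frechet_derivative f (at x) v) S" for v
  proof (rule Suc.IH)
    fix x assume "x \<in> S"
    then show "\<exists>T. open T \<and> x \<in> T \<and> Ck_on k (\<lambda>x. frechet_derivative f (at x) v) T"
      using Suc.prems[of x] by auto
  qed
  ultimately show ?case by simp
qed

lemma Ck_on_const [simp]: "Ck_on k (\<lambda>x. c) S"
  by (induction k arbitrary: c) auto

lemma Ck_on_linear_image:
  assumes "bounded_linear L" "open S" "Ck_on k f S"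
  shows "Ck_on k (\<lambda>x. L (f x)) S"
  using assms(3)
proof (induction k arbitrary: f)
  case 0
  then show ?case
    by (auto intro: bounded_linear.continuous_on[OF assms(1)])
next
  case (Suc k)
  have d: "((\<lambda>x. L (f x)) has_derivative (\<lambda>v. L (frechet_derivative f (at x) v))) (at x)"
    if "x \<in> S" for x
    using Suc.prems that
    by (intro bounded_linear.has_derivative[OF assms(1)]) (auto simp: frechet_derivative_works)
  have "Ck_on k (\<lambda>x. frechet_derivative (\<lambda>x. L (f x)) (at x) v) S" for v
    by (rule Ck_on_cong[OF assms(2), of "\<lambda>x. L (frechet_derivative f (at x) v)"])
       (use frechet_derivative_at[OF d] Suc in \<open>auto simp: fun_eq_iff\<close>)
  then show ?case using d by (auto simp: differentiable_def)
qed

lemma Ck_on_add: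
  assumes "open S" "Ck_on k f S" "Ck_on k g S"
  shows "Ck_on k (\<lambda>x. f x + g x) S"
  using assms(2,3)
proof (induction k arbitrary: f g)
  case 0 then show ?case by (auto intro: continuous_intros)
next
  case (Suc k)
  have d: "((\<lambda>x. f x + g x) has_derivative
      (\<lambda>v. frechet_derivative f (at x) v + frechet_derivative g (at x) v)) (at x)" if "x \<in> S" for x
    using Suc.prems that by (intro has_derivative_add) (auto simp: frechet_derivative_works)
  have "Ck_on k (\<lambda>x. frechet_derivative (\<lambda>x. f x + g x) (at x) v) S" for v
    by (rule Ck_on_cong[OF assms(1), of "\<lambda>x. frechet_derivative f (at x) v + frechet_derivative g (at x) v"])
       (use frechet_derivative_at[OF d] Suc in \<open>auto simp: fun_eq_iff\<close>)
  then show ?case using d by (auto simp: differentiable_def)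
qed

lemma Ck_on_mult:
  fixes f g :: "'a::real_normed_vector \<Rightarrow> real"
  assumes "open S" "Ck_on k f S" "Ck_on k g S"
  shows "Ck_on k (\<lambda>x. f x * g x) S"
  using assms(2,3)
proof (induction k arbitrary: f g)
  case 0 then show ?case by (auto intro: continuous_intros)
next
  case (Suc k)
  have d: "((\<lambda>x. f x * g x) has_derivative
      (\<lambda>v. f x * frechet_derivative g (at x) v + frechet_derivative f (at x) v * g x)) (at x)"
    if "x \<in> S" for x
    using Suc.prems that by (intro has_derivative_mult) (auto simp: frechet_derivative_works)
  have "Ck_on k (\<lambda>x. f x * frechet_derivative g (at x) v + frechet_derivative f (at x) v * g x) S" for v
    by (intro Ck_on_add assms(1) Suc.IH) (use Suc.prems in \<open>auto dest: Ck_on_SucD simp del: Ck_on.simps(2)\<close>, auto)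
  then have "Ck_on k (\<lambda>x. frechet_derivative (\<lambda>x. f x * g x) (at x) v) S" for v
    by (rule Ck_on_cong[OF assms(1), rotated]) (use frechet_derivative_at[OF d] in \<open>auto simp: fun_eq_iff\<close>)
  then show ?case using d by (auto simp: differentiable_def)
qed

lemma Ck_on_inverse:
  fixes f :: "'a::real_normed_vector \<Rightarrow> real"
  assumes "open S" "Ck_on k f S" "\<And>x. x \<in> S \<Longrightarrow> f x \<noteq> 0"
  shows "Ck_on k (\<lambda>x. inverse (f x)) S"
  using assms(2)
proof (induction k)
  case 0 then show ?case using assms(3) by (auto intro: continuous_intros)
next
  case (Suc k)
  have d: "((\<lambda>x. inverse (f x)) has_derivative
      (\<lambda>v. - (inverse (f x) * frechet_derivative f (at x) v * inverse (f x)))) (at x)" if "x \<in> S" for x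
    using Suc.prems that assms(3) by (intro Deriv.has_derivative_inverse) (auto simp: frechet_derivative_works)
  have "Ck_on k (\<lambda>x. - (inverse (f x) * frechet_derivative f (at x) v * inverse (f x))) S" for v
    using Ck_on_SucD[OF Suc.prems] Suc.IH Suc.prems
    by (intro Ck_on_linear_image[OF bounded_linear_minus[OF bounded_linear_ident]] Ck_on_mult assms(1)) auto
  then have "Ck_on k (\<lambda>x. frechet_derivative (\<lambda>x. inverse (f x)) (at x) v) S" for v
    by (rule Ck_on_cong[OF assms(1), rotated]) (use frechet_derivative_at[OF d] in \<open>auto simp: fun_eq_iff\<close>)
  then show ?case using d by (auto simp: differentiable_def)
qed

lemma Ck_on_sum:
  assumes "open S" "\<And>i. i \<in> I \<Longrightarrow> Ck_on k (f i) S"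
  shows "Ck_on k (\<lambda>x. \<Sum>i\<in>I. f i x) S"
  using assms(2) by (induction I rule: infinite_finite_induct) (auto intro: Ck_on_add assms(1))

lemma Ck_on_prod:
  fixes f :: "'i \<Rightarrow> 'a::real_normed_vector \<Rightarrow> real"
  assumes "open S" "\<And>i. i \<in> I \<Longrightarrow> Ck_on k (f i) S"
  shows "Ck_on k (\<lambda>x. \<Prod>i\<in>I. f i x) S"
  using assms(2) by (induction I rule: infinite_finite_induct) (auto intro: Ck_on_mult assms(1))

lemma Ck_on_minus:
  assumes "open S" "Ck_on k f S" shows "Ck_on k (\<lambda>x. - f x) S"
  using Ck_on_linear_image[OF bounded_linear_minus[OF bounded_linear_ident] assms] .

lemma Ck_on_diff:
  assumes "open S" "Ck_on k f S" "Ck_on k g S"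
  shows "Ck_on k (\<lambda>x. f x - g x) S"
  using Ck_on_add[OF assms(1,2) Ck_on_minus[OF assms(1,3)]] by simp

lemma Ck_on_component:
  fixes f :: "'a::real_normed_vector \<Rightarrow> real^'n"
  assumes "open S" "Ck_on k f S" shows "Ck_on k (\<lambda>x. f x $ i) S"
  using Ck_on_linear_image[OF bounded_linear_vec_nth assms] .

lemma Ck_on_partial:
  "Ck_on (Suc k) f S \<Longrightarrow> Ck_on k (partial i f) S"
  unfolding partial_def[abs_def] by auto

lemma frechet_derivative_eq_sum_partial:
  fixes f :: "real^'n \<Rightarrow> real"
  assumes "f differentiable (at x)"
  shows "frechet_derivative f (at x) v = (\<Sum>i\<in>UNIV. partial i f x * v $ i)"
proof -
  have l: "linear (frechet_derivative f (at x))" by (rule linear_frechet_derivative[OF assms])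
  have "frechet_derivative f (at x) v = frechet_derivative f (at x) (\<Sum>i\<in>UNIV. v $ i *\<^sub>R axis i 1)"
    using basis_expansion[of v] by (simp add: scalar_mult_eq_scaleR)
  also have "\<dots> = (\<Sum>i\<in>UNIV. v $ i * frechet_derivative f (at x) (axis i 1))"
    using l by (simp add: linear_sum linear_scale)
  finally show ?thesis by (simp add: partial_def mult.commute)
qed

lemma Ck_on_compose:
  fixes f :: "real^'n \<Rightarrow> real" and \<psi> :: "'a::real_normed_vector \<Rightarrow> real^'n"
  assumes "open S" "open T" "\<psi> ` S \<subseteq> T" "Ck_on k f T" "Ck_on k \<psi> S"
  shows "Ck_on k (\<lambda>x. f (\<psi> x)) S"
  using assms(4,5)
proof (induction k arbitrary: f)
  case 0 then show ?case using assms(3) by (auto intro: continuous_on_compose2)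
next
  case (Suc k)
  have d: "((\<lambda>x. f (\<psi> x)) has_derivative
     (\<lambda>v. frechet_derivative f (at (\<psi> x)) (frechet_derivative \<psi> (at x) v))) (at x)" if "x \<in> S" for x
    using Suc.prems that assms(3)
    by (intro has_derivative_compose[where f=\<psi> and g=f and s=UNIV, simplified])
       (auto simp: frechet_derivative_works)
  have c: "Ck_on k (\<lambda>x. \<Sum>i\<in>UNIV. partial i f (\<psi> x) * frechet_derivative \<psi> (at x) v $ i) S" for v
    using Suc.prems Ck_on_SucD[OF Suc.prems(2)]
    by (intro Ck_on_sum Ck_on_mult Ck_on_component assms(1) Suc.IH Ck_on_partial) auto
  have "Ck_on k (\<lambda>x. frechet_derivative (\<lambda>x. f (\<psi> x)) (at x) v) S" for v
    by (rule Ck_on_cong[OF assms(1) _ c[of v]])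
      (use frechet_derivative_at[OF d] Suc.prems assms(3) in
        \<open>auto simp: fun_eq_iff frechet_derivative_eq_sum_partial[symmetric] image_subset_iff\<close>)
  then show ?case using d by (auto simp: differentiable_def)
qed

lemma Ck_on_differentiable: "Ck_on (Suc k) f S \<Longrightarrow> x \<in> S \<Longrightarrow> f differentiable (at x)"
  by simp

lemma Ck_on_1I:
  fixes f :: "real^'n \<Rightarrow> real"
  assumes S: "open S" and d: "\<And>x. x \<in> S \<Longrightarrow> f differentiable (at x)"
    and c: "\<And>i. continuous_on S (partial i f)"
  shows "Ck_on 1 f S"
proof -
  have "continuous_on S (\<lambda>x. frechet_derivative f (at x) v)" for v
    by (subst continuous_on_cong[OF refl frechet_derivative_eq_sum_partial[OF d]])
      (auto intro!: continuous_intros c)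
  then show ?thesis using d by simp
qed

text \<open>Off the points of differentiability both sides are the same unspecified value, because the choice made by
  \<open>frechet_derivative\<close> then ranges over the empty set of derivatives.\<close>

lemma partial_cong:
  assumes "open S" "x \<in> S" "\<And>y. y \<in> S \<Longrightarrow> f y = g y"
  shows "partial i f x = partial i g x"
proof (cases "f differentiable (at x)")
  case True
  then show ?thesis unfolding partial_def
    using frechet_derivative_transform_within_open[OF True assms] by simp
next
  case False
  have "\<not> g differentiable (at x)"
    using False assms unfolding differentiable_def
    by (metis has_derivative_transform_within_open)
  then have "frechet_derivative f (at x) = frechet_derivative g (at x)"
    using False unfolding frechet_derivative_def differentiable_def by simp
  then show ?thesis by (simp add: partial_def)
qed

lemma partial_const [simp]: "partial i (\<lambda>x. c) x = 0"
  by (simp add: partial_def)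

lemma partial_eqI: "(f has_derivative F) (at x) \<Longrightarrow> partial i f x = F (axis i 1)"
  unfolding partial_def by (metis frechet_derivative_at)

lemma partial_add:
  assumes "f differentiable (at x)" "g differentiable (at x)"
  shows "partial i (\<lambda>x. f x + g x) x = partial i f x + partial i g x"
  using assms unfolding frechet_derivative_works
  by (subst partial_eqI[OF has_derivative_add]) (auto simp: partial_def)

lemma partial_diff:
  assumes "f differentiable (at x)" "g differentiable (at x)"
  shows "partial i (\<lambda>x. f x - g x) x = partial i f x - partial i g x"
  using assms unfolding frechet_derivative_works
  by (subst partial_eqI[OF has_derivative_diff]) (auto simp: partial_def)

lemma partial_mult:
  assumes "f differentiable (at x)" "g differentiable (at x)"
  shows "partial i (\<lambda>x. f x * g x) x = f x * partial i g x + partial i f x * g x"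
  using assms unfolding frechet_derivative_works
  by (subst partial_eqI[OF has_derivative_mult]) (auto simp: partial_def)

lemma partial_sum:
  assumes "\<And>j. j \<in> J \<Longrightarrow> f j differentiable (at x)"
  shows "partial i (\<lambda>x. \<Sum>j\<in>J. f j x) x = (\<Sum>j\<in>J. partial i (f j) x)"
  using assms unfolding frechet_derivative_works
  by (subst partial_eqI[OF has_derivative_sum]) (auto simp: partial_def)

definition jac :: "(real^'n \<Rightarrow> real^'m) \<Rightarrow> real^'n \<Rightarrow> real^'n^'m"
  where "jac \<psi> x = matrix (frechet_derivative \<psi> (at x))"

lemma jac_component:
  assumes "\<psi> differentiable (at x)"
  shows "jac \<psi> x $ m $ i = partial i (\<lambda>x. \<psi> x $ m) x"
proof -
  have "((\<lambda>x. \<psi> x $ m) has_derivative (\<lambda>v. frechet_derivative \<psi> (at x) v $ m)) (at x)"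
    using assms unfolding frechet_derivative_works
    by (intro bounded_linear.has_derivative[OF bounded_linear_vec_nth])
  from partial_eqI[OF this] show ?thesis by (simp add: jac_def matrix_def)
qed

lemma jac_mult:
  assumes "\<psi> differentiable (at x)"
  shows "jac \<psi> x *v v = frechet_derivative \<psi> (at x) v"
  unfolding jac_def using matrix_vector_mul(2)[OF linear_frechet_derivative[OF assms]] by metis

lemma partial_compose:
  fixes f :: "real^'m \<Rightarrow> real" and \<psi> :: "real^'n \<Rightarrow> real^'m"
  assumes "f differentiable (at (\<psi> x))" "\<psi> differentiable (at x)"
  shows "partial i (\<lambda>x. f (\<psi> x)) x = (\<Sum>m\<in>UNIV. partial m f (\<psi> x) * jac \<psi> x $ m $ i)"
proof -
  have "((\<lambda>x. f (\<psi> x)) has_derivative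
     (\<lambda>v. frechet_derivative f (at (\<psi> x)) (frechet_derivative \<psi> (at x) v))) (at x)"
    using assms
    by (intro has_derivative_compose[where f=\<psi> and g=f and s=UNIV, simplified])
       (auto simp: frechet_derivative_works)
  from partial_eqI[OF this] show ?thesis
    by (simp add: frechet_derivative_eq_sum_partial assms(1) jac_def matrix_def)
qed

lemma line_derivative:
  fixes f :: "real^'n \<Rightarrow> real"
  assumes "f differentiable (at (x + s *\<^sub>R axis k 1))"
  shows "((\<lambda>s. f (x + s *\<^sub>R axis k 1)) has_real_derivative partial k f (x + s *\<^sub>R axis k 1)) (at s)"
proof -
  let ?F = "frechet_derivative f (at (x + s *\<^sub>R axis k 1))"
  have g: "((\<lambda>s. x + s *\<^sub>R axis k 1) has_derivative (\<lambda>t. t *\<^sub>R axis k 1)) (at s)"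
    by (auto intro!: derivative_eq_intros)
  have f: "(f has_derivative ?F) (at (x + s *\<^sub>R axis k 1))"
    using assms frechet_derivative_works by blast
  have "((\<lambda>s. f (x + s *\<^sub>R axis k 1)) has_derivative (\<lambda>t. ?F (t *\<^sub>R axis k 1))) (at s)"
    by (rule has_derivative_compose[OF g f])
  moreover have "(\<lambda>t. ?F (t *\<^sub>R axis k 1)) = (*) (partial k f (x + s *\<^sub>R axis k 1))"
    using linear_frechet_derivative[OF assms] by (auto simp: linear_scale partial_def)
  ultimately show ?thesis unfolding has_field_derivative_def by simp
qed

text \<open>The mean value theorem in direction \<open>i\<close>, applied to the difference of \<open>f\<close> along two parallel segments, and then
  in direction \<open>j\<close>. The left-hand side is symmetric in \<open>i\<close> and \<open>j\<close>, which yields the symmetry of second derivatives.\<close>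

lemma second_difference:
  fixes f :: "real^'n \<Rightarrow> real"
  assumes C: "Ck_on 2 f (ball x \<delta>)" and h: "0 < h" "2 * h < \<delta>"
  shows "\<exists>y. dist x y \<le> 2 * h \<and> f (x + h *\<^sub>R axis i 1 + h *\<^sub>R axis j 1) - f (x + h *\<^sub>R axis i 1)
      - f (x + h *\<^sub>R axis j 1) + f x = h * h * partial j (partial i f) y"
proof -
  have near: "x + s *\<^sub>R axis i 1 + t *\<^sub>R axis j 1 \<in> ball x \<delta>"
      "dist x (x + s *\<^sub>R axis i 1 + t *\<^sub>R axis j 1) \<le> 2 * h"
    if "0 \<le> s" "s \<le> h" "0 \<le> t" "t \<le> h" for s t
  proof -
    have dist_add_eq: "dist x (x + s *\<^sub>R axis i 1 + t *\<^sub>R axis j 1) = norm (s *\<^sub>R axis i 1 + t *\<^sub>R axis j 1 :: real^'n)"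
      by (metis add.assoc add_diff_cancel_left' dist_commute dist_norm)
    moreover have "norm (s *\<^sub>R axis i 1 + t *\<^sub>R axis j 1 :: real^'n) \<le> s + t"
      using norm_triangle_ineq[of "s *\<^sub>R axis i 1 :: real^'n" "t *\<^sub>R axis j 1"] that
      by (simp add: norm_axis_1)
    ultimately show "x + s *\<^sub>R axis i 1 + t *\<^sub>R axis j 1 \<in> ball x \<delta>"
      "dist x (x + s *\<^sub>R axis i 1 + t *\<^sub>R axis j 1) \<le> 2 * h"
      using that h by auto
  qed
  have C': "Ck_on (Suc 1) f (ball x \<delta>)" using C by (simp add: numeral_2_eq_2)
  have d1: "f differentiable (at y)" and d2: "partial i f differentiable (at y)" if "y \<in> ball x \<delta>" for y
    using C' Ck_on_partial[OF C', of i] that by auto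
  define \<phi> where "\<phi> s = f (x + h *\<^sub>R axis j 1 + s *\<^sub>R axis i 1) - f (x + s *\<^sub>R axis i 1)" for s
  have "\<exists>s. 0 < s \<and> s < h \<and> \<phi> h - \<phi> 0 = (h - 0) *
     (partial i f (x + h *\<^sub>R axis j 1 + s *\<^sub>R axis i 1) - partial i f (x + s *\<^sub>R axis i 1))"
    unfolding \<phi>_def
    by (rule MVT2[OF h(1)], intro DERIV_diff line_derivative d1)
      (use near[of _ h] near[of _ 0] h in \<open>auto simp: algebra_simps\<close>)
  then obtain s where s: "0 < s" "s < h" and e1: "\<phi> h - \<phi> 0 = h *
     (partial i f (x + h *\<^sub>R axis j 1 + s *\<^sub>R axis i 1) - partial i f (x + s *\<^sub>R axis i 1))" by auto
  have "\<exists>t. 0 < t \<and> t < h \<and>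
     partial i f ((x + s *\<^sub>R axis i 1) + h *\<^sub>R axis j 1) - partial i f ((x + s *\<^sub>R axis i 1) + 0 *\<^sub>R axis j 1)
     = (h - 0) * partial j (partial i f) ((x + s *\<^sub>R axis i 1) + t *\<^sub>R axis j 1)"
    by (rule MVT2[OF h(1)], intro line_derivative d2) (use near[of s] s in auto)
  then obtain t where t: "0 < t" "t < h" and e2: "partial i f (x + s *\<^sub>R axis i 1 + h *\<^sub>R axis j 1)
     - partial i f (x + s *\<^sub>R axis i 1) = h * partial j (partial i f) (x + s *\<^sub>R axis i 1 + t *\<^sub>R axis j 1)"
    by auto
  have "f (x + h *\<^sub>R axis i 1 + h *\<^sub>R axis j 1) - f (x + h *\<^sub>R axis i 1)
      - f (x + h *\<^sub>R axis j 1) + f x = \<phi> h - \<phi> 0"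
    unfolding \<phi>_def by (simp add: algebra_simps)
  also have "\<dots> = h * h * partial j (partial i f) (x + s *\<^sub>R axis i 1 + t *\<^sub>R axis j 1)"
    using e1 e2 by (simp add: algebra_simps)
  finally show ?thesis using near(2)[of s t] s t by force
qed

lemma partial_commute:
  fixes f :: "real^'n \<Rightarrow> real"
  assumes S: "open S" "x \<in> S" and C: "Ck_on 2 f S"
  shows "partial i (partial j f) x = partial j (partial i f) x"
proof -
  obtain \<delta> where \<delta>: "\<delta> > 0" "ball x \<delta> \<subseteq> S" using S by (meson openE)
  have C': "Ck_on 2 f (ball x \<delta>)" using C \<delta> Ck_on_subset by blast
  have cont: "continuous (at x) (partial a (partial b f))" for a b
    using Ck_on_partial[of 0 "partial b f" "ball x \<delta>" a] Ck_on_partial[of 1 f "ball x \<delta>" b] C' \<delta>(1)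
    by (auto simp: numeral_2_eq_2 continuous_on_eq_continuous_at simp del: Ck_on.simps(2))
  have "\<bar>partial i (partial j f) x - partial j (partial i f) x\<bar> \<le> 0 + e" if e: "e > 0" for e
  proof -
    obtain d1 where d1: "d1 > 0" "\<And>y. dist y x < d1 \<Longrightarrow> dist (partial i (partial j f) y) (partial i (partial j f) x) < e/2"
      using cont[of i j] e unfolding continuous_at_eps_delta by (metis half_gt_zero)
    obtain d2 where d2: "d2 > 0" "\<And>y. dist y x < d2 \<Longrightarrow> dist (partial j (partial i f) y) (partial j (partial i f) x) < e/2"
      using cont[of j i] e unfolding continuous_at_eps_delta by (metis half_gt_zero)
    define h where "h = min \<delta> (min d1 d2) / 3"
    have h: "0 < h" "2 * h < \<delta>" "2 * h < d1" "2 * h < d2" using \<delta> d1 d2 by (auto simp: h_def)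
    obtain y where y: "dist x y \<le> 2*h" "f (x + h *\<^sub>R axis i 1 + h *\<^sub>R axis j 1) - f (x + h *\<^sub>R axis i 1)
      - f (x + h *\<^sub>R axis j 1) + f x = h * h * partial j (partial i f) y"
      using second_difference[OF C' h(1,2)] by blast
    obtain z where z: "dist x z \<le> 2*h" "f (x + h *\<^sub>R axis j 1 + h *\<^sub>R axis i 1) - f (x + h *\<^sub>R axis j 1)
      - f (x + h *\<^sub>R axis i 1) + f x = h * h * partial i (partial j f) z"
      using second_difference[OF C' h(1,2)] by blast
    have "h * h * partial j (partial i f) y = h * h * partial i (partial j f) z"
      using y(2) z(2) by (simp add: algebra_simps)
    then have "partial j (partial i f) y = partial i (partial j f) z" using h by simp
    moreover have "dist (partial i (partial j f) z) (partial i (partial j f) x) < e/2"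
      using d1(2)[of z] z(1) h by (simp add: dist_commute)
    moreover have "dist (partial j (partial i f) y) (partial j (partial i f) x) < e/2"
      using d2(2)[of y] y(1) h by (simp add: dist_commute)
    ultimately show ?thesis using e unfolding dist_real_def abs_if by (auto split: if_splits)
  qed
  then show ?thesis using field_le_epsilon[of "\<bar>partial i (partial j f) x - partial j (partial i f) x\<bar>" 0] by simp
qed

section \<open>Smooth functions and matrix fields\<close>

lemma smooth_onD: "smooth_on f S \<Longrightarrow> Ck_on k f S"
  by (simp add: smooth_on_def)

lemma smooth_on_const [simp]: "smooth_on (\<lambda>x. c) S"
  by (simp add: smooth_on_def)

lemma smooth_on_differentiable: "smooth_on f S \<Longrightarrow> x \<in> S \<Longrightarrow> f differentiable (at x)"
  using Ck_on_differentiable[of 0] smooth_onD by blast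

lemma smooth_on_continuous: "smooth_on f S \<Longrightarrow> continuous_on S f"
  using Ck_on_continuous smooth_onD by blast

lemma smooth_on_subset: "smooth_on f S \<Longrightarrow> T \<subseteq> S \<Longrightarrow> smooth_on f T"
  using Ck_on_subset unfolding smooth_on_def by blast

lemma smooth_on_partial: "smooth_on f S \<Longrightarrow> smooth_on (partial i f) S"
  unfolding smooth_on_def using Ck_on_partial by blast

lemma smooth_on_sum:
  "open S \<Longrightarrow> (\<And>i. i \<in> I \<Longrightarrow> smooth_on (f i) S) \<Longrightarrow> smooth_on (\<lambda>x. \<Sum>i\<in>I. f i x) S"
  unfolding smooth_on_def by (auto intro: Ck_on_sum)

lemma smooth_on_prod:
  fixes f :: "'i \<Rightarrow> 'a::real_normed_vector \<Rightarrow> real"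
  shows "open S \<Longrightarrow> (\<And>i. i \<in> I \<Longrightarrow> smooth_on (f i) S) \<Longrightarrow> smooth_on (\<lambda>x. \<Prod>i\<in>I. f i x) S"
  unfolding smooth_on_def by (auto intro: Ck_on_prod)

lemma smooth_on_add: "open S \<Longrightarrow> smooth_on f S \<Longrightarrow> smooth_on g S \<Longrightarrow> smooth_on (\<lambda>x. f x + g x) S"
  unfolding smooth_on_def by (auto intro: Ck_on_add)

lemma smooth_on_diff: "open S \<Longrightarrow> smooth_on f S \<Longrightarrow> smooth_on g S \<Longrightarrow> smooth_on (\<lambda>x. f x - g x) S"
  unfolding smooth_on_def by (auto intro: Ck_on_diff)

lemma smooth_on_mult:
  fixes f g :: "'a::real_normed_vector \<Rightarrow> real"
  shows "open S \<Longrightarrow> smooth_on f S \<Longrightarrow> smooth_on g S \<Longrightarrow> smooth_on (\<lambda>x. f x * g x) S"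
  unfolding smooth_on_def by (auto intro: Ck_on_mult)

lemma smooth_on_inverse:
  fixes f :: "'a::real_normed_vector \<Rightarrow> real"
  shows "open S \<Longrightarrow> smooth_on f S \<Longrightarrow> (\<And>x. x \<in> S \<Longrightarrow> f x \<noteq> 0) \<Longrightarrow> smooth_on (\<lambda>x. inverse (f x)) S"
  unfolding smooth_on_def by (auto intro: Ck_on_inverse)

lemma smooth_on_component:
  fixes f :: "'a::real_normed_vector \<Rightarrow> real^'n"
  shows "open S \<Longrightarrow> smooth_on f S \<Longrightarrow> smooth_on (\<lambda>x. f x $ i) S"
  unfolding smooth_on_def by (auto intro: Ck_on_component)

lemma smooth_on_cong:
  assumes "open S" "\<And>x. x \<in> S \<Longrightarrow> f x = g x" "smooth_on f S"
  shows "smooth_on g S"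
  using assms Ck_on_cong unfolding smooth_on_def by blast

definition msmooth :: "(real^'n \<Rightarrow> real^'m^'k) \<Rightarrow> (real^'n) set \<Rightarrow> bool"
  where "msmooth F S \<longleftrightarrow> (\<forall>i j. smooth_on (\<lambda>x. F x $ i $ j) S)"

definition mdiff :: "(real^'n \<Rightarrow> real^'m^'k) \<Rightarrow> real^'n \<Rightarrow> bool"
  where "mdiff F x \<longleftrightarrow> (\<forall>i j. (\<lambda>y. F y $ i $ j) differentiable (at x))"

definition mpartial :: "'n::finite \<Rightarrow> (real^'n \<Rightarrow> real^'m^'k) \<Rightarrow> real^'n \<Rightarrow> real^'m^'k"
  where "mpartial k F x = (\<chi> i j. partial k (\<lambda>y. F y $ i $ j) x)"

lemma msmooth_mdiff: "msmooth F S \<Longrightarrow> x \<in> S \<Longrightarrow> mdiff F x"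
  unfolding msmooth_def mdiff_def using smooth_on_differentiable by blast

lemma msmooth_partial: "msmooth F S \<Longrightarrow> msmooth (mpartial k F) S"
  unfolding msmooth_def mpartial_def using smooth_on_partial by fastforce

lemma msmooth_subset: "msmooth F S \<Longrightarrow> T \<subseteq> S \<Longrightarrow> msmooth F T"
  unfolding msmooth_def using smooth_on_subset by blast

lemma mpartial_mult:
  fixes F :: "real^'n \<Rightarrow> real^'b^'a" and H :: "real^'n \<Rightarrow> real^'c^'b"
  assumes "mdiff F x" "mdiff H x"
  shows "mpartial k (\<lambda>y. F y ** H y) x = mpartial k F x ** H x + F x ** mpartial k H x"
  using assms unfolding mdiff_def mpartial_def matrix_matrix_mult_def
  by (auto simp: vec_eq_iff partial_sum partial_mult sum.distrib differentiable_mult)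

lemma mdiff_mult:
  fixes F :: "real^'n \<Rightarrow> real^'b^'a" and H :: "real^'n \<Rightarrow> real^'c^'b"
  assumes "mdiff F x" "mdiff H x"
  shows "mdiff (\<lambda>y. F y ** H y) x"
  using assms unfolding mdiff_def matrix_matrix_mult_def by (auto intro!: differentiable_sum differentiable_mult)

lemma mdiff_transpose: "mdiff F x \<Longrightarrow> mdiff (\<lambda>y. transpose (F y)) x"
  unfolding mdiff_def transpose_def by auto

lemma mpartial_transpose: "mpartial k (\<lambda>y. transpose (F y)) x = transpose (mpartial k F x)"
  by (simp add: mpartial_def transpose_def vec_eq_iff)

lemma mpartial_add:
  "mdiff F x \<Longrightarrow> mdiff H x \<Longrightarrow> mpartial k (\<lambda>y. F y + H y) x = mpartial k F x + mpartial k H x"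
  by (simp add: mdiff_def mpartial_def vec_eq_iff partial_add)

lemma mpartial_cong:
  assumes "open S" "x \<in> S" "\<And>y. y \<in> S \<Longrightarrow> F y = H y"
  shows "mpartial k F x = mpartial k H x"
  unfolding mpartial_def by (auto simp: vec_eq_iff assms(3) intro!: partial_cong[OF assms(1,2)])

lemma mdiff_compose:
  assumes "mdiff F (\<psi> x)" "\<psi> differentiable (at x)"
  shows "mdiff (\<lambda>y. F (\<psi> y)) x"
  using assms unfolding mdiff_def
  by (auto intro: differentiable_chain_at[of \<psi> x "\<lambda>y. F y $ _ $ _", unfolded o_def])

lemma mpartial_compose:
  fixes F :: "real^'m \<Rightarrow> real^'b^'a" and \<psi> :: "real^'n \<Rightarrow> real^'m"
  assumes "mdiff F (\<psi> x)" "\<psi> differentiable (at x)"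
  shows "mpartial k (\<lambda>y. F (\<psi> y)) x = (\<Sum>c\<in>UNIV. jac \<psi> x $ c $ k *\<^sub>R mpartial c F (\<psi> x))"
proof -
  have "partial k (\<lambda>y. F (\<psi> y) $ i $ j) x = (\<Sum>c\<in>UNIV. jac \<psi> x $ c $ k * partial c (\<lambda>y. F y $ i $ j) (\<psi> x))" for i j
    by (subst partial_compose) (use assms in \<open>auto simp: mdiff_def intro!: sum.cong\<close>)
  then show ?thesis by (simp add: mpartial_def vec_eq_iff)
qed

lemma mdiff_lincomb:
  assumes "finite I" "\<And>c. c \<in> I \<Longrightarrow> f c differentiable (at x)" "\<And>c. c \<in> I \<Longrightarrow> mdiff (F c) x"
  shows "mdiff (\<lambda>y. \<Sum>c\<in>I. f c y *\<^sub>R F c y) x"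
  using assms unfolding mdiff_def by (auto intro!: differentiable_sum differentiable_mult)

lemma mpartial_lincomb:
  assumes "\<And>c. c \<in> I \<Longrightarrow> f c differentiable (at x)" "\<And>c. c \<in> I \<Longrightarrow> mdiff (F c) x"
  shows "mpartial k (\<lambda>y. \<Sum>c\<in>I. f c y *\<^sub>R F c y) x
    = (\<Sum>c\<in>I. partial k (f c) x *\<^sub>R F c x + f c x *\<^sub>R mpartial k (F c) x)"
proof -
  have "partial k (\<lambda>y. \<Sum>c\<in>I. f c y * F c y $ i $ j) x
     = (\<Sum>c\<in>I. f c x * partial k (\<lambda>y. F c y $ i $ j) x + partial k (f c) x * F c x $ i $ j)" for i j
    using assms unfolding mdiff_def
    by (subst partial_sum) (auto intro!: sum.cong simp: partial_mult differentiable_mult)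
  then show ?thesis by (simp add: mpartial_def vec_eq_iff add.commute)
qed

subsection \<open>Matrix algebra\<close>

lemma matrix_sum_ldistrib: "A ** (\<Sum>i\<in>I. B i) = (\<Sum>i\<in>I. A ** (B i :: real^'c^'b))" for A :: "real^'b^'a"
  by (induction I rule: infinite_finite_induct)
    (auto simp: matrix_matrix_mult_def vec_eq_iff sum.distrib algebra_simps)

lemma matrix_sum_rdistrib: "(\<Sum>i\<in>I. B i) ** A = (\<Sum>i\<in>I. (B i :: real^'b^'a) ** A)" for A :: "real^'c^'b"
  by (induction I rule: infinite_finite_induct)
    (auto simp: matrix_matrix_mult_def vec_eq_iff sum.distrib algebra_simps)

lemma matrix_add_rdistrib: "(B + C) ** A = B ** A + C ** (A :: real^'c^'b)" for B :: "real^'b^'a"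
  by (simp add: matrix_matrix_mult_def vec_eq_iff sum.distrib algebra_simps)

lemma matrix_diff_rdistrib: "(B - C) ** A = B ** A - C ** (A :: real^'c^'b)" for B :: "real^'b^'a"
  by (simp add: matrix_matrix_mult_def vec_eq_iff sum_subtractf algebra_simps)

lemma matrix_diff_ldistrib: "A ** (B - C) = A ** B - A ** (C :: real^'c^'b)" for A :: "real^'b^'a"
  by (simp add: matrix_matrix_mult_def vec_eq_iff sum_subtractf algebra_simps)

lemma matrix_scaleR_left: "(k *\<^sub>R A) ** B = k *\<^sub>R (A ** (B :: real^'c^'b))" for A :: "real^'b^'a"
  by (simp add: matrix_matrix_mult_def vec_eq_iff sum_distrib_left mult.assoc)

lemma matrix_scaleR_right: "A ** (k *\<^sub>R B) = k *\<^sub>R (A ** (B :: real^'c^'b))" for A :: "real^'b^'a"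
  by (simp add: matrix_matrix_mult_def vec_eq_iff sum_distrib_left mult.assoc mult.left_commute)

lemma transpose_add: "transpose (A + B) = transpose A + transpose B"
  by (simp add: transpose_def vec_eq_iff)

lemma transpose_sum: "transpose (\<Sum>i\<in>I. B i) = (\<Sum>i\<in>I. transpose (B i))"
  by (simp add: transpose_def vec_eq_iff)

lemma matrix_inv_works:
  fixes A :: "real^'n^'n"
  assumes "invertible A"
  shows "A ** matrix_inv A = mat 1" "matrix_inv A ** A = mat 1"
  using someI_ex[OF assms[unfolded invertible_def]] unfolding matrix_inv_def by auto

lemma matrix_inv_eqI:
  fixes A B :: "real^'n^'n"
  assumes "A ** B = mat 1" shows "matrix_inv A = B"
proof -
  have "B ** A = mat 1" using assms matrix_left_right_inverse by blast
  then have i: "invertible A" using assms invertible_def by blast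
  then have "matrix_inv A ** (A ** B) = B" by (simp add: matrix_mul_assoc matrix_inv_works)
  then show ?thesis using assms by simp
qed

definition posdef :: "real^'n^'n \<Rightarrow> bool"
  where "posdef A \<longleftrightarrow> transpose A = A \<and> (\<forall>v. v \<noteq> 0 \<longrightarrow> v \<bullet> (A *v v) > 0)"

lemma posdef_invertible: assumes "posdef A" shows "invertible A"
proof -
  have "inj ((*v) A)"
  proof (rule injI)
    fix v w assume "A *v v = A *v w"
    then have "A *v (v - w) = 0" by (simp add: matrix_vector_mult_diff_distrib)
    then show "v = w" using assms unfolding posdef_def
      by (metis inner_zero_right less_irrefl right_minus_eq)
  qed
  then show ?thesis by (simp add: invertible_left_inverse matrix_left_invertible_injective)
qed

lemma posdef_inv_sym:
  assumes "posdef A" shows "transpose (matrix_inv A) = matrix_inv A"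
proof -
  have "A ** matrix_inv A = mat 1" "matrix_inv A ** A = mat 1"
    using matrix_inv_works posdef_invertible assms by blast+
  then have "A ** transpose (matrix_inv A) = mat 1"
    using assms unfolding posdef_def by (metis matrix_transpose_mul transpose_mat)
  then show ?thesis using matrix_inv_eqI by metis
qed

lemma sym_nth: "transpose A = A \<Longrightarrow> A $ i $ j = A $ j $ i"
  by (metis transpose_def vec_lambda_beta)

lemma matrix_mult_nth: "(A ** B) $ i $ j = (\<Sum>k\<in>UNIV. A $ i $ k * B $ k $ j)"
  by (simp add: matrix_matrix_mult_def)

text \<open>By Cramer's rule the entries of the inverse are quotients of polynomials in the entries.\<close>

lemma msmooth_matrix_inv:
  fixes G :: "real^'n \<Rightarrow> real^'m^'m"
  assumes S: "open S" and sm: "msmooth G S" and inv: "\<And>x. x \<in> S \<Longrightarrow> invertible (G x)"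
  shows "msmooth (\<lambda>x. matrix_inv (G x)) S"
  unfolding msmooth_def
proof (intro allI)
  fix k l
  let ?M = "\<lambda>x. (\<chi> i j. if j = k then axis l 1 $ i else G x $ i $ j) :: real^'m^'m"
  have detsm: "smooth_on (\<lambda>x. det (F x)) S" if "msmooth F S" for F :: "real^'n \<Rightarrow> real^'m^'m"
    using that unfolding det_def msmooth_def
    by (intro smooth_on_sum smooth_on_mult smooth_on_prod S) auto
  have "smooth_on (\<lambda>x. ?M x $ i $ j) S" for i j
    using sm unfolding msmooth_def by (cases "j = k") auto
  then have "msmooth ?M S" unfolding msmooth_def by blast
  then have c: "smooth_on (\<lambda>x. det (?M x) * inverse (det (G x))) S"
    using inv sm by (intro smooth_on_mult smooth_on_inverse detsm S) (auto simp: invertible_det_nz)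
  have "det (?M x) * inverse (det (G x)) = matrix_inv (G x) $ k $ l" if "x \<in> S" for x
  proof -
    have "G x *v (matrix_inv (G x) *v axis l 1) = axis l 1"
      using matrix_inv_works[OF inv[OF that]] by (simp add: matrix_vector_mul_assoc)
    then have "matrix_inv (G x) *v axis l 1 =
       (\<chi> k. det(\<chi> i j. if j=k then axis l 1 $ i else G x $i$j) / det (G x))"
      using inv[OF that] cramer[of "G x"] by (simp add: invertible_det_nz)
    moreover have "(matrix_inv (G x) *v axis l 1) $ k = matrix_inv (G x) $ k $ l"
      by (simp add: matrix_vector_mul_component inner_axis)
    ultimately show ?thesis by (simp add: divide_inverse)
  qed
  from smooth_on_cong[OF S this c] show "smooth_on (\<lambda>x. matrix_inv (G x) $ k $ l) S" by simp
qed

section \<open>Metrics in coordinates\<close>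

definition metric_field :: "(real^'n) set \<Rightarrow> (real^'n \<Rightarrow> real^'n^'n) \<Rightarrow> bool"
  where "metric_field S G \<longleftrightarrow> open S \<and> msmooth G S \<and> (\<forall>x\<in>S. posdef (G x))"

text \<open>The connection matrices: \<open>Gam G k\<close> has the entry \<open>\<Gamma>\<^sup>m\<^sub>k\<^sub>i\<close> in row \<open>m\<close> and column \<open>i\<close>. With this convention metric
  compatibility, changes of coordinates and curvature become identities between matrix products, without indices.\<close>

definition Gam :: "(real^'n \<Rightarrow> real^'n^'n) \<Rightarrow> 'n::finite \<Rightarrow> real^'n \<Rightarrow> real^'n^'n"
  where "Gam G k x = (\<chi> m i. christoffel G m k i x)"

lemma metric_field_sym: "metric_field S G \<Longrightarrow> x \<in> S \<Longrightarrow> G x $ i $ j = G x $ j $ i"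
  unfolding metric_field_def posdef_def by (metis sym_nth)

lemma metric_field_subset: "metric_field S G \<Longrightarrow> open T \<Longrightarrow> T \<subseteq> S \<Longrightarrow> metric_field T G"
  unfolding metric_field_def using msmooth_subset by blast

lemma metric_field_inv:
  assumes "metric_field S G" "x \<in> S"
  shows "G x ** matrix_inv (G x) = mat 1" "matrix_inv (G x) ** G x = mat 1"
    "transpose (matrix_inv (G x)) = matrix_inv (G x)" "transpose (G x) = G x"
  using assms matrix_inv_works posdef_invertible posdef_inv_sym unfolding metric_field_def posdef_def
  by blast+

lemma partial_metric_sym:
  assumes "metric_field S G" "x \<in> S"
  shows "partial k (\<lambda>y. G y $ i $ j) x = partial k (\<lambda>y. G y $ j $ i) x"
  using assms metric_field_sym[OF assms(1)]
  by (intro partial_cong[of S]) (auto simp: metric_field_def)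

lemma Gam_sym:
  assumes "metric_field S G" "x \<in> S"
  shows "Gam G k x $ m $ i = Gam G i x $ m $ k"
  unfolding Gam_def christoffel_def
  using partial_metric_sym[OF assms] by (simp add: algebra_simps)

lemma msmooth_inv:
  assumes "metric_field S G" shows "msmooth (\<lambda>x. matrix_inv (G x)) S"
  using assms msmooth_matrix_inv posdef_invertible unfolding metric_field_def by blast

lemma msmooth_Gam:
  assumes "metric_field S G" shows "msmooth (Gam G k) S"
proof -
  have S: "open S" and G: "\<And>i j. smooth_on (\<lambda>x. G x $ i $ j) S"
    using assms unfolding metric_field_def msmooth_def by auto
  have H: "\<And>i j. smooth_on (\<lambda>x. matrix_inv (G x) $ i $ j) S"
    using msmooth_inv[OF assms] unfolding msmooth_def by auto
  have "smooth_on (christoffel G m k i) S" for m i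
    unfolding christoffel_def[abs_def]
    by (intro smooth_on_mult smooth_on_sum smooth_on_add smooth_on_diff smooth_on_partial
        smooth_on_const G H S)
  then show ?thesis unfolding msmooth_def Gam_def by simp
qed

text \<open>The first-kind Christoffel symbols; the inverse metric in the definition cancels against \<open>G\<close>.\<close>

lemma Gam_lower:
  assumes "metric_field S G" "x \<in> S"
  shows "(G x ** Gam G k x) $ j $ i = (1/2) * (partial k (\<lambda>y. G y $ i $ j) x
    + partial i (\<lambda>y. G y $ k $ j) x - partial j (\<lambda>y. G y $ k $ i) x)"
proof -
  define T :: "real^'a" where "T = (\<chi> l. (1/2) * (partial k (\<lambda>y. G y $ i $ l) x
    + partial i (\<lambda>y. G y $ k $ l) x - partial l (\<lambda>y. G y $ k $ i) x))"
  have "(matrix_inv (G x) *v T) $ m = Gam G k x $ m $ i" for m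
    by (simp add: Gam_def christoffel_def T_def matrix_vector_mult_def sum_distrib_left algebra_simps)
  then have "(G x ** Gam G k x) $ j $ i = (G x *v (matrix_inv (G x) *v T)) $ j"
    by (simp add: matrix_mult_nth matrix_vector_mult_def[of "G x"])
  also have "\<dots> = T $ j"
    using metric_field_inv[OF assms] by (simp add: matrix_vector_mul_assoc)
  finally show ?thesis by (simp add: T_def)
qed

lemma Gam_compat:
  assumes "metric_field S G" "x \<in> S"
  shows "mpartial k G x = transpose (Gam G k x) ** G x + G x ** Gam G k x"
proof -
  have "transpose (Gam G k x) ** G x = transpose (G x ** Gam G k x)"
    using metric_field_inv(4)[OF assms] by (simp add: matrix_transpose_mul)
  then have "(transpose (Gam G k x) ** G x + G x ** Gam G k x) $ i $ j
    = (G x ** Gam G k x) $ j $ i + (G x ** Gam G k x) $ i $ j" for i j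
    by (simp add: transpose_def)
  also have "\<dots> i j = mpartial k G x $ i $ j" for i j
    using partial_metric_sym[OF assms, of k] partial_metric_sym[OF assms, of i] partial_metric_sym[OF assms, of j]
    unfolding Gam_lower[OF assms] by (simp add: mpartial_def field_simps)
  finally show ?thesis by (simp add: vec_eq_iff)
qed

text \<open>The fundamental lemma of Riemannian geometry in coordinates: lowering an index turns compatibility into
  \<open>\<partial>\<^sub>kg\<^sub>i\<^sub>j = c\<^sub>j\<^sub>k\<^sub>i + c\<^sub>i\<^sub>k\<^sub>j\<close>, and with \<open>c\<close> symmetric in its last two places the alternating sum of three such
  equations determines \<open>c\<close>. It is used to recognise the Christoffel symbols in other coordinates.\<close>

lemma Gam_unique:
  assumes M: "metric_field S G" "x \<in> S"
    and sym: "\<And>k m i. C k $ m $ i = C i $ m $ k"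
    and compat: "\<And>k. mpartial k G x = transpose (C k) ** G x + G x ** C k"
  shows "C k = Gam G k x"
proof -
  define c where "c j k i = (G x ** C k) $ j $ i" for j k i
  have csym: "c j k i = c j i k" for j k i
    unfolding c_def matrix_mult_nth using sym[of k _ i] by simp
  have "transpose (C k) ** G x = transpose (G x ** C k)" for k
    using metric_field_inv(4)[OF M] by (simp add: matrix_transpose_mul)
  then have "mpartial k G x $ i $ j = c j k i + c i k j" for k i j
    unfolding compat c_def by (simp add: transpose_def)
  then have "partial k (\<lambda>y. G y $ i $ j) x = c j k i + c i k j" for k i j
    by (simp add: mpartial_def)
  then have "(G x ** C k) $ j $ i = (G x ** Gam G k x) $ j $ i" for j i
    using csym by (simp add: Gam_lower[OF M] c_def[symmetric])
  then have "G x ** C k = G x ** Gam G k x" by (simp add: vec_eq_iff)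
  then have "matrix_inv (G x) ** (G x ** C k) = matrix_inv (G x) ** (G x ** Gam G k x)" by simp
  then show ?thesis using metric_field_inv[OF M] by (simp add: matrix_mul_assoc)
qed

lemma mpartial_inv:
  assumes M: "metric_field S G" "x \<in> S"
  shows "mpartial k (\<lambda>y. matrix_inv (G y)) x
    = - (Gam G k x ** matrix_inv (G x) + matrix_inv (G x) ** transpose (Gam G k x))"
proof -
  let ?H = "\<lambda>y. matrix_inv (G y)"
  have d: "mdiff G x" "mdiff ?H x"
    using M msmooth_inv[OF M(1)] msmooth_mdiff unfolding metric_field_def by blast+
  have "mpartial k (\<lambda>y. ?H y ** G y) x = mpartial k (\<lambda>y. mat 1 :: real^'a^'a) x"
    using M metric_field_inv[OF M(1)] by (intro mpartial_cong[of S]) (auto simp: metric_field_def)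
  also have "\<dots> = 0" by (simp add: mpartial_def vec_eq_iff)
  finally have "mpartial k ?H x ** G x = - (?H x ** mpartial k G x)"
    by (simp add: mpartial_mult d eq_neg_iff_add_eq_0)
  then have "mpartial k ?H x ** G x ** ?H x = - (?H x ** mpartial k G x) ** ?H x" by simp
  then have "mpartial k ?H x = - (?H x ** mpartial k G x) ** ?H x"
    using metric_field_inv[OF M] by (simp add: matrix_mul_assoc[symmetric])
  also have "\<dots> = - (?H x ** mpartial k G x ** ?H x)"
    by (simp add: matrix_matrix_mult_def vec_eq_iff sum_negf)
  also have "?H x ** mpartial k G x ** ?H x = ?H x ** transpose (Gam G k x) ** (G x ** ?H x)
      + (?H x ** G x) ** Gam G k x ** ?H x"
    by (simp add: Gam_compat[OF M] matrix_add_ldistrib matrix_add_rdistrib matrix_mul_assoc)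
  finally show ?thesis using metric_field_inv[OF M] by (simp add: add.commute)
qed

text \<open>The curvature \<open>dC + C \<and> C\<close> of the connection with matrices \<open>C\<^sub>i\<close>; entry \<open>m,l\<close> is \<open>R\<^sup>m\<^sub>l\<^sub>i\<^sub>j\<close>.\<close>

definition curv :: "('n \<Rightarrow> real^'n \<Rightarrow> real^'n^'n) \<Rightarrow> 'n::finite \<Rightarrow> 'n \<Rightarrow> real^'n \<Rightarrow> real^'n^'n"
  where "curv C i j x = mpartial i (C j) x - mpartial j (C i) x + C i x ** C j x - C j x ** C i x"

definition Ric :: "(real^'n \<Rightarrow> real^'n^'n) \<Rightarrow> real^'n \<Rightarrow> real^'n::finite^'n"
  where "Ric G x = (\<chi> i j. ricci_coord G i j x)"

lemma Ric_curv:
  assumes M: "metric_field S G" "x \<in> S"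
  shows "Ric G x $ i $ j = (\<Sum>k\<in>UNIV. curv (Gam G) k j x $ k $ i)"
proof -
  have g: "christoffel G k i j x = Gam G i x $ k $ j" for k i j x by (simp add: Gam_def)
  have p: "partial a (christoffel G k i j) x = partial a (\<lambda>y. Gam G j y $ k $ i) x" for a k i j
    using Gam_sym[OF M(1)] M by (intro partial_cong[of S]) (auto simp: g metric_field_def)
  have s: "christoffel G k i j x = Gam G j x $ k $ i" for k i j
    using Gam_sym[OF M] g by metis
  have "partial k (christoffel G k i j) x - partial j (christoffel G k i k) x
      = (mpartial k (Gam G j) x - mpartial j (Gam G k) x) $ k $ i" for k
    by (simp add: p mpartial_def)
  moreover have "(\<Sum>l\<in>UNIV. christoffel G k k l x * christoffel G l i j x
        - christoffel G k j l x * christoffel G l i k x)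
      = (Gam G k x ** Gam G j x - Gam G j x ** Gam G k x) $ k $ i" for k
    by (simp add: matrix_mult_nth sum_subtractf g[of k] s[of _ i])
  ultimately have "(partial k (christoffel G k i j) x - partial j (christoffel G k i k) x)
     + (\<Sum>l\<in>UNIV. christoffel G k k l x * christoffel G l i j x
        - christoffel G k j l x * christoffel G l i k x) = curv (Gam G) k j x $ k $ i" for k
    by (simp add: curv_def)
  then show ?thesis
    unfolding Ric_def ricci_coord_def by (simp add: sum.distrib[symmetric])
qed

lemma scalar_coord_trace:
  "scalar_coord G x = trace (matrix_inv (G x) ** transpose (Ric G x))"
  by (simp add: scalar_coord_def trace_def matrix_mult_nth transpose_def Ric_def)

section \<open>Change of coordinates\<close>

text \<open>A local diffeomorphism, thought of as the transition between two charts.\<close>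

locale coord_change =
  fixes S T :: "(real^'n) set" and \<psi> :: "real^'n \<Rightarrow> real^'n"
  assumes open_S: "open S" and open_T: "open T" and maps: "\<And>x. x \<in> S \<Longrightarrow> \<psi> x \<in> T"
    and smooth: "smooth_on \<psi> S" and jac_inv: "\<And>x. x \<in> S \<Longrightarrow> invertible (jac \<psi> x)"
begin

abbreviation "J \<equiv> jac \<psi>"

definition pulls_back :: "(real^'n \<Rightarrow> real^'n^'n) \<Rightarrow> (real^'n \<Rightarrow> real^'n^'n) \<Rightarrow> bool"
  where "pulls_back G' G \<longleftrightarrow> metric_field S G' \<and> metric_field T G \<and>
    (\<forall>x\<in>S. G' x = transpose (J x) ** G (\<psi> x) ** J x)"

lemma psi_diff: "x \<in> S \<Longrightarrow> \<psi> differentiable (at x)"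
  using smooth smooth_on_differentiable by blast

lemma J_component: "x \<in> S \<Longrightarrow> J x $ m $ i = partial i (\<lambda>x. \<psi> x $ m) x"
  using jac_component psi_diff by blast

lemma smooth_psi: "smooth_on (\<lambda>x. \<psi> x $ m) S"
  using smooth_on_component[OF open_S smooth] .

lemma smooth_J: "msmooth J S"
  unfolding msmooth_def
  by (intro allI smooth_on_cong[OF open_S _ smooth_on_partial[OF smooth_psi]]) (simp add: J_component)

lemma mdiff_J: "x \<in> S \<Longrightarrow> mdiff J x"
  using msmooth_mdiff smooth_J by blast

lemma diff_J: "x \<in> S \<Longrightarrow> (\<lambda>y. J y $ a $ b) differentiable (at x)"
  using mdiff_J unfolding mdiff_def by blast

lemma partial_J_sym:
  assumes "x \<in> S" shows "partial k (\<lambda>y. J y $ m $ i) x = partial i (\<lambda>y. J y $ m $ k) x"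
proof -
  have "partial k (\<lambda>y. J y $ m $ i) x = partial k (partial i (\<lambda>x. \<psi> x $ m)) x" for k i
    by (rule partial_cong[OF open_S assms J_component])
  then show ?thesis using partial_commute[OF open_S assms smooth_onD[OF smooth_psi]] by simp
qed

lemma mpartial_J_commute:
  assumes "x \<in> S" shows "mpartial i (mpartial j J) x = mpartial j (mpartial i J) x"
  using partial_commute[OF open_S assms smooth_onD] smooth_J
  unfolding msmooth_def mpartial_def by (simp add: vec_eq_iff)

text \<open>The pullback along \<open>\<psi>\<close> of the connection form of \<open>G\<close>, before the gauge transformation by the Jacobian.\<close>

definition pulled_conn :: "(real^'n \<Rightarrow> real^'n^'n) \<Rightarrow> 'n \<Rightarrow> real^'n \<Rightarrow> real^'n^'n"
  where "pulled_conn G k x = (\<Sum>c\<in>UNIV. J x $ c $ k *\<^sub>R Gam G c (\<psi> x))"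

lemma pulled_conn_nth: "pulled_conn G k x $ m $ l = (\<Sum>c\<in>UNIV. J x $ c $ k * Gam G c (\<psi> x) $ m $ l)"
  by (simp add: pulled_conn_def)

text \<open>The inhomogeneous transformation law of Christoffel symbols. Multiplying by \<open>J\<close> instead of conjugating keeps
  derivatives of the inverse of \<open>J\<close> out of the calculation. The matrices defined by the right-hand side are symmetric in the
  lower indices, as second derivatives of \<open>\<psi>\<close> commute, and compatible with the pulled back metric, so that
  \<open>Gam_unique\<close> identifies them.\<close>

lemma Gam_transform:
  assumes pb: "pulls_back G' G" and x: "x \<in> S"
  shows "J x ** Gam G' k x = mpartial k J x + pulled_conn G k x ** J x"
proof -
  have M': "metric_field S G'" and M: "metric_field T G"
    and e: "\<And>x. x \<in> S \<Longrightarrow> G' x = transpose (J x) ** G (\<psi> x) ** J x"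
    using pb unfolding pulls_back_def by auto
  define B where "B k = mpartial k J x + pulled_conn G k x ** J x" for k
  define C where "C k = matrix_inv (J x) ** B k" for k
  have JC: "J x ** C k = B k" for k
    using matrix_inv_works[OF jac_inv[OF x]] by (simp add: C_def matrix_mul_assoc)
  have "(pulled_conn G k x ** J x) $ m $ i = (pulled_conn G i x ** J x) $ m $ k" for k m i
  proof -
    have "(pulled_conn G k x ** J x) $ m $ i = (\<Sum>l\<in>UNIV. \<Sum>c\<in>UNIV. J x $ c $ k * Gam G c (\<psi> x) $ m $ l * J x $ l $ i)"
      by (simp add: matrix_mult_nth pulled_conn_nth sum_distrib_right)
    also have "\<dots> = (\<Sum>c\<in>UNIV. \<Sum>l\<in>UNIV. J x $ c $ k * Gam G c (\<psi> x) $ m $ l * J x $ l $ i)"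
      by (rule sum.swap)
    also have "\<dots> = (\<Sum>c\<in>UNIV. \<Sum>l\<in>UNIV. J x $ l $ i * Gam G l (\<psi> x) $ m $ c * J x $ c $ k)"
      using Gam_sym[OF M maps[OF x]] by (intro sum.cong refl) (simp add: mult.commute mult.left_commute)
    also have "\<dots> = (pulled_conn G i x ** J x) $ m $ k"
      by (simp add: matrix_mult_nth pulled_conn_nth sum_distrib_right)
    finally show ?thesis .
  qed
  then have Bsym: "B k $ m $ i = B i $ m $ k" for k m i
    using partial_J_sym[OF x, of k m i] by (simp add: B_def mpartial_def)
  have "C k $ m $ i = C i $ m $ k" for k m i
    using Bsym unfolding C_def matrix_mult_nth by metis
  moreover have "mpartial k G' x = transpose (C k) ** G' x + G' x ** C k" for k
  proof -
    let ?G = "G (\<psi> x)"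
    have dG: "mdiff G (\<psi> x)" using M maps[OF x] msmooth_mdiff unfolding metric_field_def by blast
    have dGp: "mdiff (\<lambda>y. G (\<psi> y)) x" by (rule mdiff_compose[OF dG psi_diff[OF x]])
    have dT: "mdiff (\<lambda>y. transpose (J y)) x" by (rule mdiff_transpose[OF mdiff_J[OF x]])
    have "mpartial k (\<lambda>y. G (\<psi> y)) x = (\<Sum>c\<in>UNIV. J x $ c $ k *\<^sub>R mpartial c G (\<psi> x))"
      by (rule mpartial_compose[OF dG psi_diff[OF x]])
    also have "\<dots> = transpose (pulled_conn G k x) ** ?G + ?G ** pulled_conn G k x"
      by (simp add: Gam_compat[OF M maps[OF x]] pulled_conn_def transpose_sum transpose_scalar matrix_sum_ldistrib
          matrix_sum_rdistrib matrix_scaleR_left matrix_scaleR_right scaleR_right_distrib sum.distrib)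
    finally have dpG: "mpartial k (\<lambda>y. G (\<psi> y)) x = transpose (pulled_conn G k x) ** ?G + ?G ** pulled_conn G k x" .
    have "mpartial k G' x = mpartial k (\<lambda>y. transpose (J y) ** G (\<psi> y) ** J y) x"
      by (rule mpartial_cong[OF open_S x e])
    also have "\<dots> = (transpose (mpartial k J x) ** ?G
          + transpose (J x) ** (transpose (pulled_conn G k x) ** ?G + ?G ** pulled_conn G k x)) ** J x
          + transpose (J x) ** ?G ** mpartial k J x"
      by (simp add: mpartial_mult mdiff_mult dGp dT mdiff_J[OF x] mpartial_transpose dpG)
    also have "\<dots> = transpose (B k) ** ?G ** J x + transpose (J x) ** ?G ** B k"
      by (simp add: B_def transpose_add matrix_transpose_mul matrix_add_ldistrib matrix_add_rdistrib
          matrix_mul_assoc)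
    also have "\<dots> = transpose (C k) ** G' x + G' x ** C k"
      by (simp add: e[OF x] JC[symmetric] matrix_transpose_mul matrix_mul_assoc)
    finally show ?thesis .
  qed
  ultimately have "C k = Gam G' k x" by (rule Gam_unique[OF M' x])
  then show ?thesis using JC[of k] by (simp add: B_def)
qed

text \<open>The curvature of a gauge transformed connection \<open>C\<close> is the conjugated curvature. The first two equations are
  the derivatives of the last two; antisymmetrising removes the second derivatives \<open>Jij\<close> of the gauge transformation.\<close>

lemma gauge_algebra:
  fixes J0 Ji Jj Jij Ci Cj dCij dCji Ai Aj dAij dAji :: "real^'n^'n"
  assumes "Ji ** Cj + J0 ** dCij = Jij + dAij ** J0 + Aj ** Ji"
    and "Jj ** Ci + J0 ** dCji = Jij + dAji ** J0 + Ai ** Jj"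
    and "J0 ** Ci = Ji + Ai ** J0" "J0 ** Cj = Jj + Aj ** J0"
  shows "J0 ** (dCij - dCji + Ci ** Cj - Cj ** Ci) = (dAij - dAji + Ai ** Aj - Aj ** Ai) ** J0"
proof -
  have 1: "J0 ** dCij = Jij + dAij ** J0 + Aj ** Ji - Ji ** Cj" using assms(1) by (simp add: algebra_simps)
  have 2: "J0 ** dCji = Jij + dAji ** J0 + Ai ** Jj - Jj ** Ci" using assms(2) by (simp add: algebra_simps)
  have 3: "J0 ** (Ci ** Cj) = Ji ** Cj + Ai ** (Jj + Aj ** J0)"
    by (metis assms(3,4) matrix_add_rdistrib matrix_mul_assoc)
  have 4: "J0 ** (Cj ** Ci) = Jj ** Ci + Aj ** (Ji + Ai ** J0)"
    by (metis assms(3,4) matrix_add_rdistrib matrix_mul_assoc)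
  show ?thesis
    unfolding matrix_diff_ldistrib matrix_add_ldistrib matrix_diff_rdistrib matrix_add_rdistrib 1 2 3 4
    by (simp add: matrix_mul_assoc)
qed

lemma mpartial_pulled_conn:
  assumes M: "metric_field T G" and x: "x \<in> S"
  shows "mdiff (pulled_conn G j) x" "mpartial i (pulled_conn G j) x = (\<Sum>b\<in>UNIV. partial i (\<lambda>y. J y $ b $ j) x *\<^sub>R Gam G b (\<psi> x)
     + J x $ b $ j *\<^sub>R (\<Sum>a\<in>UNIV. J x $ a $ i *\<^sub>R mpartial a (Gam G b) (\<psi> x)))"
proof -
  have dG: "mdiff (Gam G b) (\<psi> x)" for b using msmooth_mdiff[OF msmooth_Gam[OF M] maps[OF x]] .
  have dGp: "mdiff (\<lambda>y. Gam G b (\<psi> y)) x" for b by (rule mdiff_compose[OF dG psi_diff[OF x]])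
  have 0: "pulled_conn G j = (\<lambda>y. \<Sum>b\<in>UNIV. J y $ b $ j *\<^sub>R Gam G b (\<psi> y))" by (simp add: pulled_conn_def fun_eq_iff)
  show "mdiff (pulled_conn G j) x" unfolding 0 by (rule mdiff_lincomb) (auto simp: dGp diff_J[OF x])
  show "mpartial i (pulled_conn G j) x = (\<Sum>b\<in>UNIV. partial i (\<lambda>y. J y $ b $ j) x *\<^sub>R Gam G b (\<psi> x)
     + J x $ b $ j *\<^sub>R (\<Sum>a\<in>UNIV. J x $ a $ i *\<^sub>R mpartial a (Gam G b) (\<psi> x)))"
    unfolding 0 by (subst mpartial_lincomb)
      (auto simp: dGp diff_J[OF x] mpartial_compose[OF dG psi_diff[OF x]])
qed

lemma curv_transform:
  assumes pb: "pulls_back G' G" and x: "x \<in> S"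
  shows "J x ** curv (Gam G') i j x =
    (\<Sum>a\<in>UNIV. \<Sum>b\<in>UNIV. (J x $ a $ i * J x $ b $ j) *\<^sub>R curv (Gam G) a b (\<psi> x)) ** J x"
proof -
  have M': "metric_field S G'" and M: "metric_field T G"
    using pb unfolding pulls_back_def by auto
  have dC: "mdiff (Gam G' k) x" for k using msmooth_mdiff[OF msmooth_Gam[OF M'] x] .
  have dJ: "mdiff (mpartial k J) x" for k using msmooth_mdiff[OF msmooth_partial[OF smooth_J] x] .
  have "mpartial i (\<lambda>y. J y ** Gam G' j y) x = mpartial i (\<lambda>y. mpartial j J y + pulled_conn G j y ** J y) x" for i j
    by (rule mpartial_cong[OF open_S x Gam_transform[OF pb]])
  then have e: "mpartial i J x ** Gam G' j x + J x ** mpartial i (Gam G' j) x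
     = mpartial i (mpartial j J) x + mpartial i (pulled_conn G j) x ** J x + pulled_conn G j x ** mpartial i J x" for i j
    by (simp add: mpartial_mult mpartial_add mdiff_mult mdiff_J[OF x] dC dJ mpartial_pulled_conn[OF M x])
  have "J x ** curv (Gam G') i j x = (mpartial i (pulled_conn G j) x - mpartial j (pulled_conn G i) x
      + pulled_conn G i x ** pulled_conn G j x - pulled_conn G j x ** pulled_conn G i x) ** J x"
    unfolding curv_def
    by (rule gauge_algebra[OF e[of i j] e[of j i, unfolded mpartial_J_commute[OF x, of j i]]
          Gam_transform[OF pb x] Gam_transform[OF pb x]])
  also have "mpartial i (pulled_conn G j) x - mpartial j (pulled_conn G i) x + pulled_conn G i x ** pulled_conn G j x - pulled_conn G j x ** pulled_conn G i x =
     (\<Sum>a\<in>UNIV. \<Sum>b\<in>UNIV. (J x $ a $ i * J x $ b $ j) *\<^sub>R curv (Gam G) a b (\<psi> x))"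
  proof -
    have p: "mpartial i (pulled_conn G j) x - mpartial j (pulled_conn G i) x =
       (\<Sum>a\<in>UNIV. \<Sum>b\<in>UNIV. (J x $ a $ i * J x $ b $ j) *\<^sub>R mpartial a (Gam G b) (\<psi> x))
       - (\<Sum>a\<in>UNIV. \<Sum>b\<in>UNIV. (J x $ a $ i * J x $ b $ j) *\<^sub>R mpartial b (Gam G a) (\<psi> x))"
      unfolding mpartial_pulled_conn(2)[OF M x] sum.distrib partial_J_sym[OF x, of i _ j] scaleR_sum_right scaleR_scaleR
      by (subst sum.swap) (simp add: mult.commute)
    have q: "pulled_conn G i x ** pulled_conn G j x =
       (\<Sum>a\<in>UNIV. \<Sum>b\<in>UNIV. (J x $ a $ i * J x $ b $ j) *\<^sub>R (Gam G a (\<psi> x) ** Gam G b (\<psi> x)))" for i j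
      unfolding pulled_conn_def matrix_sum_ldistrib matrix_sum_rdistrib
      by (subst sum.swap) (simp add: matrix_scaleR_left matrix_scaleR_right mult.commute)
    have q': "pulled_conn G j x ** pulled_conn G i x =
       (\<Sum>a\<in>UNIV. \<Sum>b\<in>UNIV. (J x $ a $ i * J x $ b $ j) *\<^sub>R (Gam G b (\<psi> x) ** Gam G a (\<psi> x)))"
    proof -
      have "pulled_conn G j x ** pulled_conn G i x = (\<Sum>b\<in>UNIV. \<Sum>a\<in>UNIV. (J x $ b $ j * J x $ a $ i) *\<^sub>R (Gam G b (\<psi> x) ** Gam G a (\<psi> x)))"
        by (rule q)
      also have "\<dots> = (\<Sum>a\<in>UNIV. \<Sum>b\<in>UNIV. (J x $ b $ j * J x $ a $ i) *\<^sub>R (Gam G b (\<psi> x) ** Gam G a (\<psi> x)))"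
        by (rule sum.swap)
      finally show ?thesis by (simp only: mult.commute)
    qed
    show ?thesis unfolding p q' q[of i j] curv_def
      by (simp add: sum.distrib sum_subtractf scaleR_right_distrib scaleR_right_diff_distrib)
  qed
  finally show ?thesis .
qed

lemma Ric_transform:
  assumes pb: "pulls_back G' G" and x: "x \<in> S"
  shows "Ric G' x = transpose (J x) ** Ric G (\<psi> x) ** J x"
proof -
  have M': "metric_field S G'" and M: "metric_field T G"
    using pb unfolding pulls_back_def by auto
  let ?K = "matrix_inv (J x)"
  have JK: "J x ** ?K = mat 1" "?K ** J x = mat 1" using matrix_inv_works[OF jac_inv[OF x]] by auto
  have "Ric G' x $ i $ j = (transpose (J x) ** Ric G (\<psi> x) ** J x) $ i $ j" for i j
  proof -
    define N where "N a = (\<Sum>b\<in>UNIV. J x $ b $ j *\<^sub>R curv (Gam G) a b (\<psi> x))" for a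
    have c: "curv (Gam G') k j x = ?K ** (\<Sum>a\<in>UNIV. J x $ a $ k *\<^sub>R N a) ** J x" for k
    proof -
      have "?K ** (J x ** curv (Gam G') k j x) = curv (Gam G') k j x" by (simp add: matrix_mul_assoc JK)
      then show ?thesis unfolding curv_transform[OF pb x] N_def
        by (simp add: scaleR_sum_right matrix_mul_assoc)
    qed
    have "Ric G' x $ i $ j = (\<Sum>k\<in>UNIV. (?K ** ((\<Sum>a\<in>UNIV. J x $ a $ k *\<^sub>R N a) ** J x)) $ k $ i)"
      by (simp add: Ric_curv[OF M' x] c matrix_mul_assoc)
    also have "\<dots> = (\<Sum>k\<in>UNIV. \<Sum>m\<in>UNIV. \<Sum>a\<in>UNIV. J x $ a $ k * ?K $ k $ m * (N a ** J x) $ m $ i)"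
      unfolding matrix_mult_nth[of ?K] matrix_sum_rdistrib matrix_scaleR_left
      by (simp add: sum_distrib_left algebra_simps)
    also have "\<dots> = (\<Sum>m\<in>UNIV. \<Sum>k\<in>UNIV. \<Sum>a\<in>UNIV. J x $ a $ k * ?K $ k $ m * (N a ** J x) $ m $ i)"
      by (rule sum.swap)
    also have "\<dots> = (\<Sum>m\<in>UNIV. \<Sum>a\<in>UNIV. \<Sum>k\<in>UNIV. J x $ a $ k * ?K $ k $ m * (N a ** J x) $ m $ i)"
      by (intro sum.cong refl sum.swap)
    also have "\<dots> = (\<Sum>m\<in>UNIV. \<Sum>a\<in>UNIV. (J x ** ?K) $ a $ m * (N a ** J x) $ m $ i)"
      by (simp add: matrix_mult_nth[of "J x"] sum_distrib_right)
    also have "\<dots> = (\<Sum>m\<in>UNIV. (N m ** J x) $ m $ i)"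
      by (simp add: JK mat_def if_distrib[of "\<lambda>t. t * _"] cong: if_cong)
    also have "\<dots> = (\<Sum>m\<in>UNIV. \<Sum>l\<in>UNIV. \<Sum>b\<in>UNIV. J x $ b $ j * curv (Gam G) m b (\<psi> x) $ m $ l * J x $ l $ i)"
      by (simp add: matrix_mult_nth N_def sum_distrib_right)
    also have "\<dots> = (\<Sum>l\<in>UNIV. \<Sum>m\<in>UNIV. \<Sum>b\<in>UNIV. J x $ b $ j * curv (Gam G) m b (\<psi> x) $ m $ l * J x $ l $ i)"
      by (rule sum.swap)
    also have "\<dots> = (\<Sum>l\<in>UNIV. \<Sum>b\<in>UNIV. \<Sum>m\<in>UNIV. J x $ b $ j * curv (Gam G) m b (\<psi> x) $ m $ l * J x $ l $ i)"
      by (intro sum.cong refl sum.swap)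
    also have "\<dots> = (\<Sum>l\<in>UNIV. \<Sum>b\<in>UNIV. J x $ l $ i * Ric G (\<psi> x) $ l $ b * J x $ b $ j)"
      by (simp add: Ric_curv[OF M maps[OF x]] sum_distrib_left sum_distrib_right algebra_simps)
    also have "\<dots> = (\<Sum>b\<in>UNIV. \<Sum>l\<in>UNIV. J x $ l $ i * Ric G (\<psi> x) $ l $ b * J x $ b $ j)"
      by (rule sum.swap)
    also have "\<dots> = (transpose (J x) ** Ric G (\<psi> x) ** J x) $ i $ j"
      by (simp add: matrix_mult_nth transpose_def sum_distrib_right)
    finally show ?thesis .
  qed
  then show ?thesis by (simp add: vec_eq_iff)
qed

lemma metric_inv_transform:
  assumes pb: "pulls_back G' G" and x: "x \<in> S"
  shows "matrix_inv (G' x) = matrix_inv (J x) ** matrix_inv (G (\<psi> x)) ** transpose (matrix_inv (J x))"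
proof (rule matrix_inv_eqI)
  have M: "metric_field T G" and e: "G' x = transpose (J x) ** G (\<psi> x) ** J x"
    using pb x unfolding pulls_back_def by auto
  let ?K = "matrix_inv (J x)" and ?H = "matrix_inv (G (\<psi> x))"
  have JK: "J x ** ?K = mat 1" "?K ** J x = mat 1" using matrix_inv_works[OF jac_inv[OF x]] by auto
  have "G' x ** (?K ** ?H ** transpose ?K) = transpose (J x) ** G (\<psi> x) ** (J x ** ?K) ** ?H ** transpose ?K"
    by (simp add: e matrix_mul_assoc)
  also have "\<dots> = transpose (J x) ** (G (\<psi> x) ** ?H) ** transpose ?K" by (simp add: JK matrix_mul_assoc)
  also have "\<dots> = transpose (?K ** J x)" by (simp add: metric_field_inv[OF M maps[OF x]] matrix_transpose_mul)
  finally show "G' x ** (?K ** ?H ** transpose ?K) = mat 1" by (simp add: JK)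
qed

text \<open>The trace of the inverse metric with the Ricci tensor does not see \<open>J\<close>. This makes the scalar curvature of a
  metric a function on the manifold, although it is defined through a chosen chart at every point.\<close>

lemma scalar_transform:
  assumes pb: "pulls_back G' G" and x: "x \<in> S"
  shows "scalar_coord G' x = scalar_coord G (\<psi> x)"
proof -
  let ?K = "matrix_inv (J x)" and ?H = "matrix_inv (G (\<psi> x))" and ?R = "transpose (Ric G (\<psi> x))"
  have JK: "J x ** ?K = mat 1" using matrix_inv_works[OF jac_inv[OF x]] by auto
  have "scalar_coord G' x = trace (?K ** ?H ** transpose ?K ** (transpose (J x) ** ?R ** J x))"
    by (simp add: scalar_coord_trace metric_inv_transform[OF pb x] Ric_transform[OF pb x]
        matrix_transpose_mul matrix_mul_assoc)
  also have "\<dots> = trace (?K ** (?H ** transpose (J x ** ?K) ** ?R ** J x))"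
    by (simp add: matrix_transpose_mul matrix_mul_assoc)
  also have "\<dots> = trace (?H ** ?R ** (J x ** ?K))"
    by (subst trace_mul_sym) (simp add: JK matrix_mul_assoc[symmetric])
  finally show ?thesis by (simp add: JK scalar_coord_trace)
qed

end

section \<open>The difference of two Levi-Civita connections\<close>

text \<open>The difference \<open>D\<close> of two Levi-Civita connections, which unlike each of them is a tensor.\<close>

definition conn_diff :: "(real^'n \<Rightarrow> real^'n^'n) \<Rightarrow> (real^'n \<Rightarrow> real^'n^'n) \<Rightarrow> 'n::finite \<Rightarrow> real^'n \<Rightarrow> real^'n^'n"
  where "conn_diff G H k x = Gam H k x - Gam G k x"

text \<open>In index notation \<open>V\<^sup>k = h\<^sup>i\<^sup>jD\<^sup>k\<^sub>i\<^sub>j - h\<^sup>k\<^sup>jD\<^sup>i\<^sub>i\<^sub>j\<close>. To first order in \<open>h - g\<close> it is the field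
  \<open>div h - grad (tr h)\<close>, whose divergence is the second-order part of the linearised scalar curvature.\<close>

definition defect_field :: "(real^'n \<Rightarrow> real^'n^'n) \<Rightarrow> (real^'n \<Rightarrow> real^'n^'n) \<Rightarrow> real^'n \<Rightarrow> real^'n::finite"
  where "defect_field G H x = (\<chi> k. (\<Sum>i\<in>UNIV. (conn_diff G H i x ** matrix_inv (H x)) $ k $ i)
     - (\<Sum>j\<in>UNIV. matrix_inv (H x) $ k $ j * trace (conn_diff G H j x)))"

text \<open>The Riemannian divergence \<open>\<nabla>\<^sub>kX\<^sup>k\<close>, since \<open>\<Gamma>\<^sup>l\<^sub>l\<^sub>k\<close> is the trace of \<open>Gam G k\<close>.\<close>

definition divergence :: "(real^'n \<Rightarrow> real^'n^'n) \<Rightarrow> (real^'n \<Rightarrow> real^'n) \<Rightarrow> real^'n::finite \<Rightarrow> real"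
  where "divergence G X x = (\<Sum>k\<in>UNIV. partial k (\<lambda>y. X y $ k) x) + (\<Sum>k\<in>UNIV. trace (Gam G k x) * X x $ k)"

definition quad_defect :: "(real^'n \<Rightarrow> real^'n^'n) \<Rightarrow> (real^'n \<Rightarrow> real^'n^'n) \<Rightarrow> real^'n::finite \<Rightarrow> real"
  where "quad_defect G H x =
    (\<Sum>i\<in>UNIV. \<Sum>j\<in>UNIV. \<Sum>k\<in>UNIV. \<Sum>l\<in>UNIV. matrix_inv (H x) $ i $ j *
       (conn_diff G H j x $ k $ l * conn_diff G H k x $ l $ i))
    - (\<Sum>i\<in>UNIV. \<Sum>j\<in>UNIV. matrix_inv (H x) $ i $ j * (trace (conn_diff G H i x) * trace (conn_diff G H j x)))"

context coord_change
begin

lemma conn_diff_transform: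
  assumes pg: "pulls_back G' G" and ph: "pulls_back H' H" and x: "x \<in> S"
  shows "J x ** conn_diff G' H' i x = (\<Sum>c\<in>UNIV. J x $ c $ i *\<^sub>R conn_diff G H c (\<psi> x)) ** J x"
  unfolding conn_diff_def matrix_diff_ldistrib Gam_transform[OF pg x] Gam_transform[OF ph x]
  by (simp add: pulled_conn_def scaleR_right_diff_distrib sum_subtractf matrix_diff_rdistrib)

lemma defect_field_transform:
  assumes pg: "pulls_back G' G" and ph: "pulls_back H' H" and x: "x \<in> S"
  shows "defect_field G H (\<psi> x) = J x *v defect_field G' H' x"
proof -
  let ?K = "matrix_inv (J x)" and ?H = "matrix_inv (H (\<psi> x))" and ?H' = "matrix_inv (H' x)"
  let ?D = "\<lambda>c. conn_diff G H c (\<psi> x)" and ?D' = "\<lambda>c. conn_diff G' H' c x"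
  have JK: "J x ** ?K = mat 1" "?K ** J x = mat 1" using matrix_inv_works[OF jac_inv[OF x]] by auto
  have KJt: "transpose ?K ** transpose (J x) = mat 1" using JK by (simp add: matrix_transpose_mul[symmetric])
  have JH: "J x ** ?H' = ?H ** transpose ?K"
    unfolding metric_inv_transform[OF ph x] by (simp add: matrix_mul_assoc JK)
  have tr: "trace (?D' j) = (\<Sum>c\<in>UNIV. J x $ c $ j * trace (?D c))" for j
  proof -
    have "trace (?D' j) = trace (?K ** (J x ** ?D' j))" by (simp add: matrix_mul_assoc JK)
    also have "\<dots> = trace ((\<Sum>c\<in>UNIV. J x $ c $ j *\<^sub>R ?D c) ** (J x ** ?K))"
      unfolding conn_diff_transform[OF pg ph x] by (subst trace_mul_sym) (simp add: matrix_mul_assoc)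
    also have "\<dots> = (\<Sum>c\<in>UNIV. J x $ c $ j * trace (?D c))"
      unfolding JK by (simp add: trace_def sum_distrib_left) (rule sum.swap)
    finally show ?thesis .
  qed
  have "(J x *v defect_field G' H' x) $ m = defect_field G H (\<psi> x) $ m" for m
  proof -
    have "(J x *v defect_field G' H' x) $ m =
       (\<Sum>k\<in>UNIV. \<Sum>i\<in>UNIV. J x $ m $ k * (?D' i ** ?H') $ k $ i)
       - (\<Sum>k\<in>UNIV. \<Sum>j\<in>UNIV. J x $ m $ k * ?H' $ k $ j * trace (?D' j))"
      by (simp add: matrix_vector_mult_def defect_field_def algebra_simps sum_subtractf sum_distrib_left)
    also have "(\<Sum>k\<in>UNIV. \<Sum>i\<in>UNIV. J x $ m $ k * (?D' i ** ?H') $ k $ i)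
       = (\<Sum>i\<in>UNIV. (J x ** ?D' i ** ?H') $ m $ i)"
      by (subst sum.swap) (simp add: matrix_mult_nth[of "J x"] matrix_mul_assoc[symmetric])
    also have "\<dots> = (\<Sum>i\<in>UNIV. \<Sum>c\<in>UNIV. J x $ c $ i * (?D c ** (J x ** ?H')) $ m $ i)"
      unfolding conn_diff_transform[OF pg ph x] matrix_sum_rdistrib matrix_scaleR_left
      by (simp add: matrix_mul_assoc)
    also have "\<dots> = (\<Sum>c\<in>UNIV. \<Sum>i\<in>UNIV. (?D c ** ?H ** transpose ?K) $ m $ i * transpose (J x) $ i $ c)"
      unfolding JH by (subst sum.swap) (simp add: transpose_def matrix_mul_assoc mult.commute)
    also have "\<dots> = (\<Sum>c\<in>UNIV. (?D c ** ?H ** (transpose ?K ** transpose (J x))) $ m $ c)"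
      by (simp add: matrix_mult_nth[symmetric] matrix_mul_assoc)
    also have "\<dots> = (\<Sum>c\<in>UNIV. (?D c ** ?H) $ m $ c)" by (simp add: KJt)
    also have "(\<Sum>k\<in>UNIV. \<Sum>j\<in>UNIV. J x $ m $ k * ?H' $ k $ j * trace (?D' j))
       = (\<Sum>j\<in>UNIV. (J x ** ?H') $ m $ j * (\<Sum>c\<in>UNIV. J x $ c $ j * trace (?D c)))"
      unfolding tr[symmetric] by (subst sum.swap) (simp add: matrix_mult_nth sum_distrib_right)
    also have "\<dots> = (\<Sum>c\<in>UNIV. \<Sum>j\<in>UNIV. (?H ** transpose ?K) $ m $ j * transpose (J x) $ j $ c * trace (?D c))"
      unfolding JH sum_distrib_left by (subst sum.swap) (simp add: transpose_def algebra_simps)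
    also have "\<dots> = (\<Sum>c\<in>UNIV. (?H ** (transpose ?K ** transpose (J x))) $ m $ c * trace (?D c))"
      by (simp add: sum_distrib_right[symmetric] matrix_mult_nth[symmetric] matrix_mul_assoc)
    finally show ?thesis by (simp add: KJt defect_field_def)
  qed
  then show ?thesis by (simp add: vec_eq_iff)
qed

end

lemma conn_diff_sym:
  assumes "metric_field S G" "metric_field S H" "x \<in> S"
  shows "conn_diff G H k x $ m $ i = conn_diff G H i x $ m $ k"
  using Gam_sym[OF assms(1,3)] Gam_sym[OF assms(2,3)] by (simp add: conn_diff_def)

lemma curv_conn_diff:
  assumes "metric_field S G" "metric_field S H" "x \<in> S"
  defines "D \<equiv> conn_diff G H"
  shows "curv (Gam H) k j x = curv (Gam G) k j x + mpartial k (D j) x - mpartial j (D k) x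
    + Gam G k x ** D j x + D k x ** Gam G j x - Gam G j x ** D k x - D j x ** Gam G k x
    + D k x ** D j x - D j x ** D k x"
proof -
  have H: "Gam H i = (\<lambda>y. Gam G i y + D i y)" for i by (simp add: D_def conn_diff_def fun_eq_iff)
  have d: "mdiff (Gam G i) x" "mdiff (Gam H i) x" for i
    using msmooth_mdiff[OF msmooth_Gam] assms by blast+
  have dD: "mdiff (D i) x" for i
    using d[of i] unfolding D_def conn_diff_def mdiff_def by (auto intro!: differentiable_diff)
  show ?thesis unfolding curv_def H mpartial_add[OF d(1) dD]
    by (simp add: matrix_add_ldistrib matrix_add_rdistrib algebra_simps)
qed

text \<open>The contraction behind \<open>scalar_curvature_decomposition\<close> at one point: \<open>h\<close> is an inverse metric, \<open>g\<close> the
  connection of the reference metric, \<open>d\<close> the difference tensor with derivatives \<open>dd\<close>, and \<open>dh\<close> the derivatives of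
  \<open>h\<close>, expressed by the fact that \<open>h\<close> is parallel for the connection \<open>g + d\<close>.\<close>

lemma scalar_curvature_algebra:
  fixes h :: "'n::finite \<Rightarrow> 'n \<Rightarrow> real" and g d :: "'n \<Rightarrow> 'n \<Rightarrow> 'n \<Rightarrow> real"
    and dd :: "'n \<Rightarrow> 'n \<Rightarrow> 'n \<Rightarrow> 'n \<Rightarrow> real" and dh :: "'n \<Rightarrow> 'n \<Rightarrow> 'n \<Rightarrow> real"
  assumes hs: "\<And>i j. h i j = h j i" and gs: "\<And>k m i. g k m i = g i m k" and ds: "\<And>k m i. d k m i = d i m k"
    and dds: "\<And>a k m i. dd a k m i = dd a i m k"
    and dh: "\<And>k i j. dh k i j = - ((\<Sum>m\<in>UNIV. (g k i m + d k i m) * h m j) + (\<Sum>m\<in>UNIV. h i m * (g k j m + d k j m)))"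
  shows "(\<Sum>i\<in>UNIV. \<Sum>j\<in>UNIV. h i j * (\<Sum>k\<in>UNIV. dd k j k i - dd j k k i
      + (\<Sum>l\<in>UNIV. g k k l * d j l i) + (\<Sum>l\<in>UNIV. d k k l * g j l i) - (\<Sum>l\<in>UNIV. g j k l * d k l i)
      - (\<Sum>l\<in>UNIV. d j k l * g k l i) + (\<Sum>l\<in>UNIV. d k k l * d j l i) - (\<Sum>l\<in>UNIV. d j k l * d k l i)))
   = (\<Sum>k\<in>UNIV. (\<Sum>i\<in>UNIV. \<Sum>j\<in>UNIV. dd k i k j * h j i + d i k j * dh k j i)
        - (\<Sum>j\<in>UNIV. dh k k j * (\<Sum>i\<in>UNIV. d j i i) + h k j * (\<Sum>i\<in>UNIV. dd k j i i)))
     + (\<Sum>k\<in>UNIV. (\<Sum>m\<in>UNIV. g k m m) * ((\<Sum>i\<in>UNIV. \<Sum>j\<in>UNIV. d i k j * h j i) - (\<Sum>j\<in>UNIV. h k j * (\<Sum>i\<in>UNIV. d j i i))))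
     + ((\<Sum>i\<in>UNIV. \<Sum>j\<in>UNIV. \<Sum>k\<in>UNIV. \<Sum>l\<in>UNIV. h i j * (d j k l * d k l i))
        - (\<Sum>i\<in>UNIV. \<Sum>j\<in>UNIV. h i j * ((\<Sum>k\<in>UNIV. d i k k) * (\<Sum>k\<in>UNIV. d j k k))))"
proof -
  define tg where "tg k = (\<Sum>m\<in>UNIV. g k m m)" for k
  define td where "td k = (\<Sum>m\<in>UNIV. d k m m)" for k
  have tg': "tg k = (\<Sum>m\<in>UNIV. g m m k)" and td': "td k = (\<Sum>m\<in>UNIV. d m m k)" for k
    unfolding tg_def td_def using gs ds by metis+
  \<comment> \<open>Both sides are integer combinations of a few full contractions, of which \<open>E\<close>, \<open>F\<close>, \<open>c\<close> have the two
    tensors or traces as arguments. The Christoffel symbols \<open>g\<close> drop out because \<open>E\<close> is symmetric.\<close>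
  define b1 where "b1 = (\<Sum>i\<in>UNIV. \<Sum>j\<in>UNIV. \<Sum>k\<in>UNIV. h i j * dd k j k i)"
  define b2 where "b2 = (\<Sum>i\<in>UNIV. \<Sum>j\<in>UNIV. \<Sum>k\<in>UNIV. h i j * dd j k k i)"
  define E :: "('n \<Rightarrow> 'n \<Rightarrow> 'n \<Rightarrow> real) \<Rightarrow> ('n \<Rightarrow> 'n \<Rightarrow> 'n \<Rightarrow> real) \<Rightarrow> real"
    where "E p q = (\<Sum>i\<in>UNIV. \<Sum>j\<in>UNIV. \<Sum>k\<in>UNIV. \<Sum>l\<in>UNIV. h i j * (p j k l * q k l i))" for p q
  define F :: "('n \<Rightarrow> real) \<Rightarrow> ('n \<Rightarrow> 'n \<Rightarrow> 'n \<Rightarrow> real) \<Rightarrow> real"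
    where "F t q = (\<Sum>i\<in>UNIV. \<Sum>j\<in>UNIV. \<Sum>l\<in>UNIV. h i j * (t l * q j l i))" for t q
  define c where "c t s = (\<Sum>i\<in>UNIV. \<Sum>j\<in>UNIV. h i j * (t i * s j))" for t s :: "'n \<Rightarrow> real"
  have Esym: "E p q = E q p" if ps: "\<And>k m i. p k m i = p i m k" and qs: "\<And>k m i. q k m i = q i m k" for p q
  proof -
    have "E p q = (\<Sum>j\<in>UNIV. \<Sum>i\<in>UNIV. \<Sum>k\<in>UNIV. \<Sum>l\<in>UNIV. h i j * (p j k l * q k l i))"
      unfolding E_def by (rule sum.swap)
    also have "\<dots> = (\<Sum>j\<in>UNIV. \<Sum>i\<in>UNIV. \<Sum>l\<in>UNIV. \<Sum>k\<in>UNIV. h i j * (p j k l * q k l i))"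
      by (intro sum.cong refl sum.swap)
    also have "\<dots> = E q p"
      unfolding E_def
    proof (intro sum.cong refl)
      fix j i l k
      have "h i j = h j i" "p j k l = p l k j" "q k l i = q i l k" by (rule hs ps qs)+
      then show "h i j * (p j k l * q k l i) = h j i * (q i l k * p l k j)" by simp
    qed
    finally show ?thesis .
  qed
  have Fk: "(\<Sum>i\<in>UNIV. \<Sum>j\<in>UNIV. \<Sum>k\<in>UNIV. \<Sum>l\<in>UNIV. h i j * (p k k l * q j l i)) = F t q"
    if "\<And>k. t k = (\<Sum>m\<in>UNIV. p m m k)" for p q t
  proof -
    have "(\<Sum>k\<in>UNIV. \<Sum>l\<in>UNIV. h i j * (p k k l * q j l i)) = (\<Sum>l\<in>UNIV. h i j * (t l * q j l i))" for i j
      by (subst sum.swap) (simp add: that sum_distrib_left sum_distrib_right)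
    then show ?thesis unfolding F_def by simp
  qed
  have lhs: "(\<Sum>i\<in>UNIV. \<Sum>j\<in>UNIV. h i j * (\<Sum>k\<in>UNIV. dd k j k i - dd j k k i
      + (\<Sum>l\<in>UNIV. g k k l * d j l i) + (\<Sum>l\<in>UNIV. d k k l * g j l i) - (\<Sum>l\<in>UNIV. g j k l * d k l i)
      - (\<Sum>l\<in>UNIV. d j k l * g k l i) + (\<Sum>l\<in>UNIV. d k k l * d j l i) - (\<Sum>l\<in>UNIV. d j k l * d k l i)))
    = b1 - b2 + F tg d + F td g - E g d - E d g + F td d - E d d"
    unfolding b1_def b2_def E_def Fk[of tg g d, OF tg', symmetric] Fk[of td d g, OF td', symmetric] Fk[of td d d, OF td', symmetric]
    by (simp add: sum_distrib_left sum.distrib sum_subtractf right_diff_distrib distrib_left)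
  have 1: "(\<Sum>k\<in>UNIV. \<Sum>i\<in>UNIV. \<Sum>j\<in>UNIV. dd k i k j * h j i) = b1"
  proof -
    have "(\<Sum>k\<in>UNIV. \<Sum>i\<in>UNIV. \<Sum>j\<in>UNIV. dd k i k j * h j i) = (\<Sum>i\<in>UNIV. \<Sum>k\<in>UNIV. \<Sum>j\<in>UNIV. dd k i k j * h j i)"
      by (rule sum.swap)
    also have "\<dots> = (\<Sum>i\<in>UNIV. \<Sum>j\<in>UNIV. \<Sum>k\<in>UNIV. dd k i k j * h j i)" by (intro sum.cong refl sum.swap)
    also have "\<dots> = b1" unfolding b1_def by (subst sum.swap) (simp add: mult.commute)
    finally show ?thesis .
  qed
  have 2: "(\<Sum>k\<in>UNIV. \<Sum>j\<in>UNIV. h k j * (\<Sum>i\<in>UNIV. dd k j i i)) = b2"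
  proof -
    have "h k j * (\<Sum>i\<in>UNIV. dd k j i i) = (\<Sum>i\<in>UNIV. h j k * dd k i i j)" for k j
      unfolding sum_distrib_left using hs[of k j] dds[of k j] by simp
    then show ?thesis unfolding b2_def by (subst sum.swap) simp
  qed
  have 3: "(\<Sum>k\<in>UNIV. \<Sum>i\<in>UNIV. \<Sum>j\<in>UNIV. d i k j * dh k j i) = - 2 * (E d g + E d d)"
  proof -
    have half: "(\<Sum>k\<in>UNIV. \<Sum>i\<in>UNIV. \<Sum>j\<in>UNIV. d i k j * (\<Sum>m\<in>UNIV. h j m * (g k i m + d k i m))) = E d g + E d d"
    proof -
      have "(\<Sum>k\<in>UNIV. \<Sum>i\<in>UNIV. \<Sum>j\<in>UNIV. d i k j * (\<Sum>m\<in>UNIV. h j m * (g k i m + d k i m)))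
         = (\<Sum>k\<in>UNIV. \<Sum>i\<in>UNIV. \<Sum>j\<in>UNIV. \<Sum>m\<in>UNIV. h j m * (d i k j * (g k i m + d k i m)))"
        by (simp add: sum_distrib_left algebra_simps)
      also have "\<dots> = (\<Sum>k\<in>UNIV. \<Sum>j\<in>UNIV. \<Sum>i\<in>UNIV. \<Sum>m\<in>UNIV. h j m * (d i k j * (g k i m + d k i m)))"
        by (intro sum.cong refl sum.swap)
      also have "\<dots> = (\<Sum>j\<in>UNIV. \<Sum>k\<in>UNIV. \<Sum>i\<in>UNIV. \<Sum>m\<in>UNIV. h j m * (d i k j * (g k i m + d k i m)))"
        by (rule sum.swap)
      also have "\<dots> = (\<Sum>j\<in>UNIV. \<Sum>k\<in>UNIV. \<Sum>m\<in>UNIV. \<Sum>i\<in>UNIV. h j m * (d i k j * (g k i m + d k i m)))"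
        by (intro sum.cong refl sum.swap)
      also have "\<dots> = (\<Sum>j\<in>UNIV. \<Sum>m\<in>UNIV. \<Sum>k\<in>UNIV. \<Sum>i\<in>UNIV. h j m * (d i k j * (g k i m + d k i m)))"
        by (intro sum.cong refl sum.swap)
      also have "\<dots> = (\<Sum>m\<in>UNIV. \<Sum>j\<in>UNIV. \<Sum>k\<in>UNIV. \<Sum>i\<in>UNIV. h j m * (d i k j * (g k i m + d k i m)))"
        by (rule sum.swap)
      also have "\<dots> = E d g + E d d"
        unfolding E_def sum.distrib[symmetric]
      proof (intro sum.cong refl)
        fix m j k i
        have "h j m = h m j" "d i k j = d j k i" by (rule hs ds)+
        then show "h j m * (d i k j * (g k i m + d k i m)) = h m j * (d j k i * g k i m) + h m j * (d j k i * d k i m)"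
          by (simp add: algebra_simps)
      qed
      finally show ?thesis .
    qed
    have half': "(\<Sum>k\<in>UNIV. \<Sum>i\<in>UNIV. \<Sum>j\<in>UNIV. d i k j * (\<Sum>m\<in>UNIV. (g k j m + d k j m) * h m i)) = E d g + E d d"
    proof -
      have "(\<Sum>k\<in>UNIV. \<Sum>i\<in>UNIV. \<Sum>j\<in>UNIV. d i k j * (\<Sum>m\<in>UNIV. (g k j m + d k j m) * h m i))
        = (\<Sum>k\<in>UNIV. \<Sum>j\<in>UNIV. \<Sum>i\<in>UNIV. d i k j * (\<Sum>m\<in>UNIV. (g k j m + d k j m) * h m i))"
        by (intro sum.cong refl sum.swap)
      also have "\<dots> = (\<Sum>k\<in>UNIV. \<Sum>i\<in>UNIV. \<Sum>j\<in>UNIV. d i k j * (\<Sum>m\<in>UNIV. h j m * (g k i m + d k i m)))"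
      proof (intro sum.cong refl)
        fix k j i
        show "d i k j * (\<Sum>m\<in>UNIV. (g k j m + d k j m) * h m i) = d j k i * (\<Sum>m\<in>UNIV. h i m * (g k j m + d k j m))"
          using ds[of i k j] hs[of _ i] by (simp add: mult.commute)
      qed
      finally show ?thesis using half by simp
    qed
    show ?thesis
      using half half' unfolding dh by (simp add: right_diff_distrib distrib_left sum.distrib sum_negf sum_subtractf)
  qed
  have 4: "(\<Sum>k\<in>UNIV. \<Sum>j\<in>UNIV. dh k k j * (\<Sum>i\<in>UNIV. d j i i)) = - (c tg td + c td td + F td g + F td d)"
  proof -
    have p: "(\<Sum>k\<in>UNIV. \<Sum>j\<in>UNIV. (\<Sum>m\<in>UNIV. (g k k m + d k k m) * h m j) * td j) = c tg td + c td td"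
    proof -
      have "(\<Sum>k\<in>UNIV. \<Sum>j\<in>UNIV. (\<Sum>m\<in>UNIV. (g k k m + d k k m) * h m j) * td j)
         = (\<Sum>j\<in>UNIV. \<Sum>k\<in>UNIV. \<Sum>m\<in>UNIV. (g k k m + d k k m) * h m j * td j)"
        by (subst sum.swap) (simp add: sum_distrib_right)
      also have "\<dots> = (\<Sum>j\<in>UNIV. \<Sum>m\<in>UNIV. \<Sum>k\<in>UNIV. (g k k m + d k k m) * h m j * td j)"
        by (intro sum.cong refl sum.swap)
      also have "\<dots> = (\<Sum>j\<in>UNIV. \<Sum>m\<in>UNIV. (tg m + td m) * h m j * td j)"
        by (simp add: tg' td' sum_distrib_right sum.distrib distrib_right)
      also have "\<dots> = c tg td + c td td"
        unfolding c_def by (subst sum.swap) (simp add: algebra_simps sum.distrib)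
      finally show ?thesis .
    qed
    have q: "(\<Sum>k\<in>UNIV. \<Sum>j\<in>UNIV. (\<Sum>m\<in>UNIV. h k m * (g k j m + d k j m)) * td j) = F td g + F td d"
    proof -
      have "(\<Sum>k\<in>UNIV. \<Sum>j\<in>UNIV. (\<Sum>m\<in>UNIV. h k m * (g k j m + d k j m)) * td j)
         = (\<Sum>k\<in>UNIV. \<Sum>m\<in>UNIV. \<Sum>j\<in>UNIV. h k m * (g k j m + d k j m) * td j)"
        unfolding sum_distrib_right by (intro sum.cong refl sum.swap)
      also have "\<dots> = F td g + F td d"
        unfolding F_def sum.distrib[symmetric]
      proof (intro sum.cong refl)
        fix k m j
        have "g k j m = g m j k" "d k j m = d m j k" by (rule gs ds)+
        then show "h k m * (g k j m + d k j m) * td j = h k m * (td j * g m j k) + h k m * (td j * d m j k)"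
          by (simp add: algebra_simps)
      qed
      finally show ?thesis .
    qed
    show ?thesis using p q unfolding dh td_def[symmetric]
      by (simp add: left_diff_distrib distrib_right sum.distrib sum_negf sum_subtractf)
  qed
  have 5: "(\<Sum>k\<in>UNIV. \<Sum>i\<in>UNIV. \<Sum>j\<in>UNIV. tg k * (d i k j * h j i)) = F tg d"
  proof -
    have "(\<Sum>k\<in>UNIV. \<Sum>i\<in>UNIV. \<Sum>j\<in>UNIV. tg k * (d i k j * h j i)) = (\<Sum>i\<in>UNIV. \<Sum>k\<in>UNIV. \<Sum>j\<in>UNIV. tg k * (d i k j * h j i))"
      by (rule sum.swap)
    also have "\<dots> = (\<Sum>i\<in>UNIV. \<Sum>j\<in>UNIV. \<Sum>k\<in>UNIV. tg k * (d i k j * h j i))" by (intro sum.cong refl sum.swap)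
    also have "\<dots> = F tg d" unfolding F_def by (subst sum.swap) (simp add: mult.commute mult.left_commute)
    finally show ?thesis .
  qed
  have 6: "(\<Sum>k\<in>UNIV. \<Sum>j\<in>UNIV. tg k * (h k j * td j)) = c tg td"
    unfolding c_def by (simp add: mult.left_commute)
  have "(\<Sum>k\<in>UNIV. (\<Sum>i\<in>UNIV. \<Sum>j\<in>UNIV. dd k i k j * h j i + d i k j * dh k j i)
        - (\<Sum>j\<in>UNIV. dh k k j * (\<Sum>i\<in>UNIV. d j i i) + h k j * (\<Sum>i\<in>UNIV. dd k j i i)))
     = b1 - 2 * (E d g + E d d) + (c tg td + c td td + F td g + F td d) - b2"
    using 1 2 3 4 by (simp add: sum.distrib sum_subtractf)
  moreover have "(\<Sum>k\<in>UNIV. (\<Sum>m\<in>UNIV. g k m m) * ((\<Sum>i\<in>UNIV. \<Sum>j\<in>UNIV. d i k j * h j i)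
      - (\<Sum>j\<in>UNIV. h k j * (\<Sum>i\<in>UNIV. d j i i)))) = F tg d - c tg td"
    using 5 6 unfolding tg_def[symmetric] td_def[symmetric]
    by (simp add: right_diff_distrib sum_distrib_left sum_subtractf)
  ultimately show ?thesis
    unfolding lhs E_def[of d d, symmetric] td_def[symmetric] c_def[of td td, symmetric]
    using Esym[OF gs ds] by simp
qed

text \<open>An exact identity, not only a linearisation. Contracting the curvature of \<open>\<Gamma> + D\<close> with the inverse of
  \<open>H\<close> gives covariant derivatives of \<open>D\<close>. Moving the inverse of \<open>H\<close> under the derivative produces the divergence, and the
  derivative of that inverse is again expressed by \<open>D\<close>, which leaves a quadratic form in \<open>D\<close>.\<close>

lemma scalar_curvature_decomposition:
  assumes MG: "metric_field S G" and MH: "metric_field S H" and x: "x \<in> S"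
  shows "scalar_coord H x = (\<Sum>i\<in>UNIV. \<Sum>j\<in>UNIV. matrix_inv (H x) $ i $ j * Ric G x $ i $ j)
    + divergence G (defect_field G H) x + quad_defect G H x"
proof -
  define h where "h i j = matrix_inv (H x) $ i $ j" for i j
  define g where "g k m i = Gam G k x $ m $ i" for k m i
  define D where "D = conn_diff G H"
  define d where "d k m i = D k x $ m $ i" for k m i
  define dd where "dd a k m i = mpartial a (D k) x $ m $ i" for a k m i
  define dh where "dh k i j = mpartial k (\<lambda>y. matrix_inv (H y)) x $ i $ j" for k i j
  have S: "open S" using MG by (simp add: metric_field_def)
  have hs: "h i j = h j i" for i j
    unfolding h_def using metric_field_inv(3)[OF MH x] sym_nth by blast
  have gs: "g k m i = g i m k" for k m i unfolding g_def by (rule Gam_sym[OF MG x])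
  have ds: "d k m i = d i m k" for k m i unfolding d_def D_def by (rule conn_diff_sym[OF MG MH x])
  have dds: "dd a k m i = dd a i m k" for a k m i
    unfolding dd_def mpartial_def D_def
    by simp (intro partial_cong[OF S x] conn_diff_sym[OF MG MH])
  have H: "Gam H k x = Gam G k x + D k x" for k by (simp add: D_def conn_diff_def)
  have dh: "dh k i j = - ((\<Sum>m\<in>UNIV. (g k i m + d k i m) * h m j) + (\<Sum>m\<in>UNIV. h i m * (g k j m + d k j m)))" for k i j
    unfolding dh_def mpartial_inv[OF MH x] by (simp add: H matrix_mult_nth g_def d_def h_def transpose_def)
  have dD: "mdiff (D i) x" for i
    using msmooth_mdiff[OF msmooth_Gam[OF MG] x] msmooth_mdiff[OF msmooth_Gam[OF MH] x]
    unfolding D_def conn_diff_def mdiff_def by (auto intro!: differentiable_diff)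
  have dH: "mdiff (\<lambda>y. matrix_inv (H y)) x" using msmooth_mdiff[OF msmooth_inv[OF MH] x] .
  have dDn: "(\<lambda>y. D i y $ a $ b) differentiable (at x)" for i a b using dD unfolding mdiff_def by blast
  have dHn: "(\<lambda>y. matrix_inv (H y) $ a $ b) differentiable (at x)" for a b using dH unfolding mdiff_def by blast
  have e0: "scalar_coord H x = (\<Sum>i\<in>UNIV. \<Sum>j\<in>UNIV. h i j * Ric G x $ i $ j)
      + (\<Sum>i\<in>UNIV. \<Sum>j\<in>UNIV. h i j * (\<Sum>k\<in>UNIV. (curv (Gam H) k j x - curv (Gam G) k j x) $ k $ i))"
    unfolding scalar_coord_def h_def Ric_def[of H, symmetric]
  proof -
    have r: "ricci_coord H i j x = Ric G x $ i $ j + (\<Sum>k\<in>UNIV. (curv (Gam H) k j x - curv (Gam G) k j x) $ k $ i)" for i j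
      using Ric_curv[OF MG x, of i j] Ric_curv[OF MH x, of i j] by (simp add: Ric_def[of H] sum_subtractf)
    show "(\<Sum>i\<in>UNIV. \<Sum>j\<in>UNIV. matrix_inv (H x) $ i $ j * ricci_coord H i j x)
      = (\<Sum>i\<in>UNIV. \<Sum>j\<in>UNIV. matrix_inv (H x) $ i $ j * Ric G x $ i $ j)
      + (\<Sum>i\<in>UNIV. \<Sum>j\<in>UNIV. matrix_inv (H x) $ i $ j * (\<Sum>k\<in>UNIV. (curv (Gam H) k j x - curv (Gam G) k j x) $ k $ i))"
      by (simp add: r distrib_left sum.distrib)
  qed
  have c: "(curv (Gam H) k j x - curv (Gam G) k j x) $ k $ i = dd k j k i - dd j k k i
      + (\<Sum>l\<in>UNIV. g k k l * d j l i) + (\<Sum>l\<in>UNIV. d k k l * g j l i) - (\<Sum>l\<in>UNIV. g j k l * d k l i)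
      - (\<Sum>l\<in>UNIV. d j k l * g k l i) + (\<Sum>l\<in>UNIV. d k k l * d j l i) - (\<Sum>l\<in>UNIV. d j k l * d k l i)" for k j i
    unfolding curv_conn_diff[OF MG MH x]
    by (simp add: matrix_mult_nth g_def d_def dd_def D_def)
  note alg = scalar_curvature_algebra[of h g d dd dh, OF hs gs ds dds dh, folded c]
  have p1: "(\<Sum>k\<in>UNIV. (\<Sum>i\<in>UNIV. \<Sum>j\<in>UNIV. dd k i k j * h j i + d i k j * dh k j i)
        - (\<Sum>j\<in>UNIV. dh k k j * (\<Sum>i\<in>UNIV. d j i i) + h k j * (\<Sum>i\<in>UNIV. dd k j i i)))
      = (\<Sum>k\<in>UNIV. partial k (\<lambda>y. defect_field G H y $ k) x)"
  proof (rule sum.cong[OF refl])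
    fix k
    have "partial k (\<lambda>y. defect_field G H y $ k) x
      = partial k (\<lambda>y. (\<Sum>i\<in>UNIV. \<Sum>j\<in>UNIV. D i y $ k $ j * matrix_inv (H y) $ j $ i)
         - (\<Sum>j\<in>UNIV. matrix_inv (H y) $ k $ j * (\<Sum>i\<in>UNIV. D j y $ i $ i))) x"
      by (simp add: defect_field_def D_def matrix_mult_nth trace_def)
    also have "\<dots> = (\<Sum>i\<in>UNIV. \<Sum>j\<in>UNIV. dd k i k j * h j i + d i k j * dh k j i)
        - (\<Sum>j\<in>UNIV. dh k k j * (\<Sum>i\<in>UNIV. d j i i) + h k j * (\<Sum>i\<in>UNIV. dd k j i i))"
      by (simp add: partial_diff partial_sum partial_mult dDn dHn differentiable_mult
          dd_def d_def h_def dh_def mpartial_def add.commute)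
    finally show "(\<Sum>i\<in>UNIV. \<Sum>j\<in>UNIV. dd k i k j * h j i + d i k j * dh k j i)
        - (\<Sum>j\<in>UNIV. dh k k j * (\<Sum>i\<in>UNIV. d j i i) + h k j * (\<Sum>i\<in>UNIV. dd k j i i))
      = partial k (\<lambda>y. defect_field G H y $ k) x" by simp
  qed
  have p2: "(\<Sum>k\<in>UNIV. (\<Sum>m\<in>UNIV. g k m m) * ((\<Sum>i\<in>UNIV. \<Sum>j\<in>UNIV. d i k j * h j i) - (\<Sum>j\<in>UNIV. h k j * (\<Sum>i\<in>UNIV. d j i i))))
     = (\<Sum>k\<in>UNIV. trace (Gam G k x) * defect_field G H x $ k)"
    by (simp add: defect_field_def trace_def g_def d_def h_def D_def matrix_mult_nth)
  show ?thesis
    unfolding e0 alg p1 p2 by (simp add: divergence_def quad_defect_def h_def d_def D_def trace_def)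
qed

section \<open>Simultaneous diagonalisation\<close>

lemma compact_orthonormal_frames: "compact {M :: real^'n^'n. M ** transpose M = mat 1}"
proof -
  have "norm M \<le> sqrt (real CARD('n))" if "M ** transpose M = mat 1" for M :: "real^'n^'n"
  proof -
    have "(norm (M $ i))\<^sup>2 = 1" for i
    proof -
      have "(norm (M $ i))\<^sup>2 = (M ** transpose M) $ i $ i"
        by (simp add: matrix_mult_nth transpose_def norm_eq_sqrt_inner inner_vec_def sum_nonneg)
      then show ?thesis by (simp add: that mat_def)
    qed
    then show ?thesis by (simp add: norm_vec_def L2_set_def)
  qed
  then have "bounded {M :: real^'n^'n. M ** transpose M = mat 1}"
    unfolding bounded_iff by blast
  moreover have "closed {M :: real^'n^'n. M ** transpose M = mat 1}"
  proof -
    have "{M :: real^'n^'n. M ** transpose M = mat 1} =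
        (\<Inter>i. \<Inter>j. {M. (\<Sum>k\<in>UNIV. M $ i $ k * M $ j $ k) = (mat 1 :: real^'n^'n) $ i $ j})"
      by (auto simp: vec_eq_iff matrix_mult_nth transpose_def)
    also have "closed \<dots>"
      by (intro closed_INT ballI closed_Collect_eq continuous_intros)
    finally show ?thesis .
  qed
  ultimately show ?thesis by (simp add: compact_eq_bounded_closed)
qed

lemma frame_nth: "(M ** B ** transpose M) $ i $ j = M $ i \<bullet> (B *v (M $ j))" for M B :: "real^'n^'n"
proof -
  have "(M ** B ** transpose M) $ i $ j = (\<Sum>k\<in>UNIV. \<Sum>l\<in>UNIV. M $ i $ l * B $ l $ k * M $ j $ k)"
    by (simp add: matrix_mult_nth transpose_def sum_distrib_right)
  also have "\<dots> = (\<Sum>l\<in>UNIV. \<Sum>k\<in>UNIV. M $ i $ l * B $ l $ k * M $ j $ k)" by (rule sum.swap)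
  finally show ?thesis by (simp add: inner_vec_def matrix_vector_mult_def sum_distrib_left mult.assoc)
qed

lemma frame_orthonormal: "M ** transpose M = mat 1 \<longleftrightarrow> (\<forall>i j. M $ i \<bullet> M $ j = (if i = j then 1 else 0))"
  for M :: "real^'n^'n"
  by (simp add: vec_eq_iff matrix_mult_nth transpose_def inner_vec_def mat_def)

lemma sym_inner: "transpose B = B \<Longrightarrow> v \<bullet> (B *v w) = w \<bullet> (B *v v)" for B :: "real^'n^'n"
  by (metis dot_lmul_matrix inner_commute transpose_matrix_vector)

lemma inner_diag_delta: "(\<Sum>i\<in>UNIV. d i * (F i :: real)) - (\<Sum>i\<in>UNIV. d i * F' i)
    = d p * (F p - F' p) + d q * (F q - F' q)"
  if "p \<noteq> q" "\<And>i. i \<noteq> p \<Longrightarrow> i \<noteq> q \<Longrightarrow> F i = F' i" for d :: "'n::finite \<Rightarrow> real"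
proof -
  have "(\<Sum>i\<in>UNIV. d i * F i) - (\<Sum>i\<in>UNIV. d i * F' i) = (\<Sum>i\<in>UNIV. d i * (F i - F' i))"
    by (simp add: sum_subtractf algebra_simps)
  also have "\<dots> = (\<Sum>i\<in>{p,q}. d i * (F i - F' i))"
    by (rule sum.mono_neutral_right) (auto simp: that(2))
  finally show ?thesis using that(1) by simp
qed

lemma no_first_order_term:
  fixes A B :: real
  assumes "\<And>t. A * t\<^sup>2 + B * t \<le> 0" shows "B = 0"
proof (rule ccontr)
  assume B: "B \<noteq> 0"
  \<comment> \<open>At this \<open>t\<close> the linear term dominates the quadratic one.\<close>
  define t where "t = B / (1 + \<bar>A\<bar>)"
  have p: "1 + \<bar>A\<bar> > 0" by simp
  have Bt: "B = t * (1 + \<bar>A\<bar>)" using p by (simp add: t_def)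
  have "A * t\<^sup>2 + B * t = t\<^sup>2 * (A + 1 + \<bar>A\<bar>)" by (subst Bt) (simp add: power2_eq_square algebra_simps)
  moreover have "t \<noteq> 0" using B Bt by auto
  ultimately have "A * t\<^sup>2 + B * t > 0" by (simp add: zero_less_mult_iff)
  then show False using assms[of t] by simp
qed

text \<open>The spectral theorem without eigenvalues: maximise \<open>\<Sum>\<^sub>i d\<^sub>i E(v\<^sub>i,v\<^sub>i)\<close> over all orthonormal frames, with
  pairwise different weights \<open>d\<^sub>i\<close>. Rotating the plane of \<open>v\<^sub>p\<close> and \<open>v\<^sub>q\<close> changes the value to first order by a multiple
  of \<open>(d\<^sub>p - d\<^sub>q) E(v\<^sub>p,v\<^sub>q)\<close>, which must vanish at the maximum.\<close>

lemma orthonormal_diagonalisation: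
  fixes E :: "real^'n^'n"
  assumes sym: "transpose E = E"
  shows "\<exists>M::real^'n^'n. M ** transpose M = mat 1 \<and> (\<forall>i j. i \<noteq> j \<longrightarrow> (M ** E ** transpose M) $ i $ j = 0)"
proof -
  obtain d0 :: "'n \<Rightarrow> nat" where d0: "inj d0"
    using finite_imp_inj_to_nat_seg[OF finite_class.finite_UNIV] by blast
  define d where "d i = real (d0 i)" for i
  have d: "d i \<noteq> d j" if "i \<noteq> j" for i j using d0 that by (auto simp: d_def inj_def)
  define f where "f M = (\<Sum>i\<in>UNIV. d i * (M $ i \<bullet> (E *v (M $ i))))" for M :: "real^'n^'n"
  let ?K = "{M :: real^'n^'n. M ** transpose M = mat 1}"
  have "continuous_on ?K f"
    unfolding f_def inner_vec_def matrix_vector_mult_def by (simp, intro continuous_intros)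
  moreover have "mat 1 \<in> ?K" by simp
  ultimately obtain M where M: "M ** transpose M = mat 1" and max: "\<And>N. N ** transpose N = mat 1 \<Longrightarrow> f N \<le> f M"
    using continuous_attains_sup[OF compact_orthonormal_frames] by (metis (mono_tags, lifting) emptyE mem_Collect_eq)
  have on: "M $ i \<bullet> M $ j = (if i = j then 1 else 0)" for i j using M frame_orthonormal by blast
  have "M $ p \<bullet> (E *v (M $ q)) = 0" if pq: "p \<noteq> q" for p q
  proof -
    define a b e where "a = M $ p \<bullet> (E *v (M $ p))" and "b = M $ p \<bullet> (E *v (M $ q))" and "e = M $ q \<bullet> (E *v (M $ q))"
    have b': "M $ q \<bullet> (E *v (M $ p)) = b" unfolding b_def by (rule sym_inner[OF sym])
    have "(d p - d q) * (e - a) * t\<^sup>2 + (d p - d q) * 2 * b * t \<le> 0" for t :: real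
    proof -
       define c s where "c = 1 / sqrt (1 + t\<^sup>2)" and "s = t / sqrt (1 + t\<^sup>2)"
      have pos: "1 + t\<^sup>2 > 0" by (simp add: add_pos_nonneg)
      have cs: "c\<^sup>2 + s\<^sup>2 = 1" and c2: "c\<^sup>2 * (1 + t\<^sup>2) = 1" and st: "s = t * c"
        using pos by (auto simp: c_def s_def power_divide add_divide_distrib[symmetric])
      define N :: "real^'n^'n" where "N = (\<chi> i. if i = p then c *\<^sub>R M $ p + s *\<^sub>R M $ q
          else if i = q then c *\<^sub>R M $ q - s *\<^sub>R M $ p else M $ i)"
      have Np: "N $ p = c *\<^sub>R M $ p + s *\<^sub>R M $ q" and Nq: "N $ q = c *\<^sub>R M $ q - s *\<^sub>R M $ p"
        and Ni: "\<And>i. i \<noteq> p \<Longrightarrow> i \<noteq> q \<Longrightarrow> N $ i = M $ i" using pq by (auto simp: N_def)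
      have "N $ i \<bullet> N $ j = (if i = j then 1 else 0)" for i j
        using cs pq by (cases "i = p"; cases "i = q"; cases "j = p"; cases "j = q")
          (auto simp: Np Nq Ni on inner_add_left inner_add_right inner_diff_left inner_diff_right power2_eq_square)
      then have "f N \<le> f M" by (intro max) (simp add: frame_orthonormal)
      then have "d p * (N $ p \<bullet> (E *v (N $ p)) - a) + d q * (N $ q \<bullet> (E *v (N $ q)) - e) \<le> 0"
        using inner_diag_delta[OF pq, of "\<lambda>i. N $ i \<bullet> (E *v (N $ i))" "\<lambda>i. M $ i \<bullet> (E *v (M $ i))" d] Ni
        unfolding f_def a_def e_def by simp
      moreover have "N $ p \<bullet> (E *v (N $ p)) = c\<^sup>2 * a + 2 * c * s * b + s\<^sup>2 * e"
        "N $ q \<bullet> (E *v (N $ q)) = c\<^sup>2 * e - 2 * c * s * b + s\<^sup>2 * a"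
        unfolding Np Nq by (simp_all add: matrix_vector_right_distrib matrix_vector_mult_diff_distrib
            matrix_vector_mult_scaleR inner_add_left inner_add_right inner_diff_left inner_diff_right
            a_def[symmetric] b_def[symmetric] e_def[symmetric] b' power2_eq_square algebra_simps)
      ultimately have "d p * (c\<^sup>2 * a + 2 * c * s * b + s\<^sup>2 * e - (c\<^sup>2 + s\<^sup>2) * a)
          + d q * (c\<^sup>2 * e - 2 * c * s * b + s\<^sup>2 * a - (c\<^sup>2 + s\<^sup>2) * e) \<le> 0" by (simp add: cs)
      then have "c\<^sup>2 * ((d p - d q) * (e - a) * t\<^sup>2 + (d p - d q) * 2 * b * t) \<le> 0"
        unfolding st by (simp add: power2_eq_square algebra_simps)
      moreover have "c\<^sup>2 > 0" using c2 pos by (metis mult_zero_left zero_less_one zero_less_power2 zero_neq_one power_zero_numeral)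
      ultimately show ?thesis by (simp add: mult_le_0_iff)
    qed
    from no_first_order_term[OF this] show ?thesis using d[OF pq] by (simp add: b_def)
  qed
  then show ?thesis using M by (auto simp: frame_nth)
qed

text \<open>Diagonalise \<open>G\<close>, rescale the frame to be \<open>G\<close>-orthonormal, and diagonalise \<open>E\<close> in that frame.\<close>

lemma simultaneous_diagonalisation:
  fixes G E :: "real^'n^'n"
  assumes G: "posdef G" and E: "transpose E = E"
  shows "\<exists>V::real^'n^'n. V ** G ** transpose V = mat 1 \<and> (\<forall>i j. i \<noteq> j \<longrightarrow> (V ** E ** transpose V) $ i $ j = 0)"
proof -
  obtain M :: "real^'n^'n" where M: "M ** transpose M = mat 1"
    and Md: "\<And>i j. i \<noteq> j \<Longrightarrow> (M ** G ** transpose M) $ i $ j = 0"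
    using orthonormal_diagonalisation[of G] G unfolding posdef_def by metis
  define \<mu> where "\<mu> i = M $ i \<bullet> (G *v (M $ i))" for i
  have "M $ i \<noteq> 0" for i using M frame_orthonormal[of M] by (metis inner_zero_left zero_neq_one)
  then have \<mu>: "\<mu> i > 0" for i using G unfolding posdef_def \<mu>_def by blast
  define W :: "real^'n^'n" where "W = (\<chi> i. (1 / sqrt (\<mu> i)) *\<^sub>R M $ i)"
  have W: "W ** G ** transpose W = mat 1"
  proof -
    have "(W ** G ** transpose W) $ i $ j = (mat 1 :: real^'n^'n) $ i $ j" for i j
    proof (cases "i = j")
      case True
      then show ?thesis using \<mu>[of i]
        by (simp add: frame_nth W_def matrix_vector_mult_scaleR \<mu>_def[symmetric] mat_def real_sqrt_mult[symmetric])
    next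
      case False
      then show ?thesis using Md[OF False]
        by (simp add: frame_nth W_def matrix_vector_mult_scaleR mat_def)
    qed
    then show ?thesis by (simp add: vec_eq_iff)
  qed
  have "transpose (W ** E ** transpose W) = W ** E ** transpose W"
    by (simp add: matrix_transpose_mul E matrix_mul_assoc)
  then obtain N :: "real^'n^'n" where N: "N ** transpose N = mat 1"
    and Nd: "\<And>i j. i \<noteq> j \<Longrightarrow> (N ** (W ** E ** transpose W) ** transpose N) $ i $ j = 0"
    using orthonormal_diagonalisation[of "W ** E ** transpose W"] by metis
  have e: "(N ** W) ** B ** transpose (N ** W) = N ** (W ** B ** transpose W) ** transpose N" for B
    by (simp add: matrix_transpose_mul matrix_mul_assoc)
  show ?thesis
    by (rule exI[of _ "N ** W"]) (simp add: e W N Nd)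
qed

text \<open>Two metrics at a point, in a frame \<open>V\<close> (rows) that is orthonormal for \<open>G\<close> and orthogonal
  for \<open>H\<close>, the squared lengths for \<open>H\<close> being \<open>1 + \<theta>\<close>.\<close>

definition common_frame :: "real^'n^'n \<Rightarrow> real^'n^'n \<Rightarrow> real^'n^'n \<Rightarrow> ('n \<Rightarrow> real) \<Rightarrow> bool"
  where "common_frame G H V \<theta> \<longleftrightarrow> (\<forall>i j. V $ i \<bullet> (G *v (V $ j)) = (if i = j then 1 else 0)) \<and>
    (\<forall>i j. V $ i \<bullet> (H *v (V $ j)) = (if i = j then 1 + \<theta> i else 0)) \<and> (\<forall>i. 1 + \<theta> i > 0)"

lemma common_frame_exists:
  assumes G: "posdef G" and H: "posdef H"
  shows "\<exists>V \<theta>. common_frame G H V \<theta>"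
proof -
  obtain V :: "real^'a^'a" where V: "V ** G ** transpose V = mat 1"
    and d: "\<And>i j. i \<noteq> j \<Longrightarrow> (V ** H ** transpose V) $ i $ j = 0"
    using simultaneous_diagonalisation[OF G, of H] H unfolding posdef_def by blast
  have 1: "V $ i \<bullet> (G *v (V $ j)) = (if i = j then 1 else 0)" for i j
    using V frame_nth[of V G] by (metis (mono_tags) mat_def vec_lambda_beta)
  then have nz: "V $ i \<noteq> 0" for i by (metis inner_zero_left zero_neq_one)
  define \<theta> where "\<theta> i = V $ i \<bullet> (H *v (V $ i)) - 1" for i
  have "common_frame G H V \<theta>"
    unfolding common_frame_def using 1 d nz H by (auto simp: frame_nth \<theta>_def posdef_def)
  then show ?thesis by blast
qed

lemma sum_delta_mult: "(\<Sum>k\<in>UNIV. (if i = k then a else 0) * (f k :: real)) = a * f i" for i :: "'n::finite"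
  by (subst sum.cong[OF refl, of _ _ "\<lambda>k. if i = k then a * f k else 0"]) auto

lemma common_frame_matrix:
  assumes "common_frame G H V \<theta>"
  shows "V ** G ** transpose V = mat 1" "V ** H ** transpose V = (\<chi> i j. if i = j then 1 + \<theta> i else 0)"
    "(G ** transpose V) ** V = mat 1" "transpose V ** (V ** G) = mat 1"
proof -
  show 1: "V ** G ** transpose V = mat 1" and "V ** H ** transpose V = (\<chi> i j. if i = j then 1 + \<theta> i else 0)"
    using assms by (simp_all add: vec_eq_iff frame_nth common_frame_def mat_def)
  show "(G ** transpose V) ** V = mat 1" using 1 matrix_left_right_inverse by (metis matrix_mul_assoc)
  show "transpose V ** (V ** G) = mat 1" using 1 matrix_left_right_inverse by (metis matrix_mul_assoc)
qed

lemma trace_frame: "(\<Sum>i\<in>UNIV. \<Sum>j\<in>UNIV. (\<Sum>k\<in>UNIV. w k * V $ k $ i * V $ k $ j) * R $ i $ j)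
    = (\<Sum>k\<in>UNIV. w k * (V $ k \<bullet> (R *v (V $ k))))" for V R :: "real^'n^'n"
proof -
  have "(\<Sum>i\<in>UNIV. \<Sum>j\<in>UNIV. (\<Sum>k\<in>UNIV. w k * V $ k $ i * V $ k $ j) * R $ i $ j)
     = (\<Sum>i\<in>UNIV. \<Sum>j\<in>UNIV. \<Sum>k\<in>UNIV. w k * V $ k $ i * V $ k $ j * R $ i $ j)"
    by (simp add: sum_distrib_right)
  also have "\<dots> = (\<Sum>i\<in>UNIV. \<Sum>k\<in>UNIV. \<Sum>j\<in>UNIV. w k * V $ k $ i * V $ k $ j * R $ i $ j)"
    by (intro sum.cong refl sum.swap)
  also have "\<dots> = (\<Sum>k\<in>UNIV. \<Sum>i\<in>UNIV. \<Sum>j\<in>UNIV. w k * V $ k $ i * V $ k $ j * R $ i $ j)"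
    by (rule sum.swap)
  also have "\<dots> = (\<Sum>k\<in>UNIV. w k * (V $ k \<bullet> (R *v (V $ k))))"
    by (simp add: inner_vec_def matrix_vector_mult_def sum_distrib_left algebra_simps)
  finally show ?thesis .
qed

lemma common_frame_inv:
  assumes f: "common_frame G H V \<theta>"
  shows "matrix_inv G $ i $ j = (\<Sum>k\<in>UNIV. 1 * V $ k $ i * V $ k $ j)"
    "matrix_inv H $ i $ j = (\<Sum>k\<in>UNIV. (1 / (1 + \<theta> k)) * V $ k $ i * V $ k $ j)"
proof -
  have "G ** (transpose V ** V) = mat 1" using common_frame_matrix(3)[OF f] by (simp add: matrix_mul_assoc)
  from matrix_inv_eqI[OF this] show "matrix_inv G $ i $ j = (\<Sum>k\<in>UNIV. 1 * V $ k $ i * V $ k $ j)"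
    by (simp add: matrix_mult_nth transpose_def)
  define \<Delta> \<Delta>' :: "real^'a^'a" where "\<Delta> = (\<chi> i j. if i = j then 1 + \<theta> i else 0)"
    and "\<Delta>' = (\<chi> i j. if i = j then 1 / (1 + \<theta> i) else 0)"
  have DD: "\<Delta> ** \<Delta>' = mat 1"
    using f by (auto simp: vec_eq_iff matrix_mult_nth \<Delta>_def \<Delta>'_def mat_def sum_delta_mult common_frame_def less_imp_neq[THEN not_sym])
  have VH: "V ** H ** transpose V = \<Delta>" using common_frame_matrix(2)[OF f] by (simp add: \<Delta>_def)
  have "H ** (transpose V ** \<Delta>' ** V) = ((G ** transpose V) ** V) ** H ** (transpose V ** \<Delta>' ** V)"
    by (simp add: common_frame_matrix(3)[OF f])
  also have "\<dots> = G ** transpose V ** (V ** H ** transpose V) ** \<Delta>' ** V" by (simp add: matrix_mul_assoc)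
  also have "\<dots> = G ** transpose V ** (\<Delta> ** \<Delta>') ** V" by (simp add: VH matrix_mul_assoc)
  finally have "H ** (transpose V ** \<Delta>' ** V) = mat 1"
    by (simp add: DD common_frame_matrix(3)[OF f])
  from matrix_inv_eqI[OF this] show "matrix_inv H $ i $ j = (\<Sum>k\<in>UNIV. (1 / (1 + \<theta> k)) * V $ k $ i * V $ k $ j)"
    by (simp add: matrix_mult_nth transpose_def \<Delta>'_def sum_distrib_right if_distrib[of "\<lambda>t. _ * t"] cong: if_cong)
qed

lemma common_frame_trace:
  assumes f: "common_frame G H V \<theta>"
  shows "(\<Sum>i\<in>UNIV. \<Sum>j\<in>UNIV. matrix_inv G $ i $ j * R $ i $ j) = (\<Sum>k\<in>UNIV. V $ k \<bullet> (R *v (V $ k)))"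
    "(\<Sum>i\<in>UNIV. \<Sum>j\<in>UNIV. matrix_inv H $ i $ j * R $ i $ j) = (\<Sum>k\<in>UNIV. (V $ k \<bullet> (R *v (V $ k))) / (1 + \<theta> k))"
  unfolding common_frame_inv[OF f] trace_frame by simp_all

lemma common_frame_expand:
  assumes f: "common_frame G H V \<theta>"
  obtains \<eta> where "\<xi> \<bullet> (G *v \<xi>) = (\<Sum>k\<in>UNIV. (\<eta> k)\<^sup>2)"
    "\<xi> \<bullet> ((H - G) *v \<xi>) = (\<Sum>k\<in>UNIV. \<theta> k * (\<eta> k)\<^sup>2)"
proof -
  define y where "y = (V ** G) *v \<xi>"
  define \<eta> where "\<eta> k = y $ k" for k
  have "\<xi> = transpose V *v y"
    unfolding y_def by (simp add: matrix_vector_mul_assoc common_frame_matrix(4)[OF f] del: transpose_matrix_vector)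
  also have "\<dots> = (\<Sum>k\<in>UNIV. \<eta> k *\<^sub>R V $ k)"
    by (simp add: vec_eq_iff matrix_vector_mult_def transpose_def \<eta>_def mult.commute del: transpose_matrix_vector)
  finally have x: "\<xi> = (\<Sum>k\<in>UNIV. \<eta> k *\<^sub>R V $ k)" .
  have *: "\<xi> \<bullet> (B *v \<xi>) = (\<Sum>k\<in>UNIV. \<Sum>l\<in>UNIV. \<eta> k * \<eta> l * (V $ k \<bullet> (B *v (V $ l))))" for B
  proof -
    have "B *v \<xi> = (\<Sum>l\<in>UNIV. \<eta> l *\<^sub>R (B *v (V $ l)))"
      unfolding x by (simp add: linear_sum[OF matrix_vector_mul_linear] matrix_vector_mult_scaleR)
    then have "\<xi> \<bullet> (B *v \<xi>) = (\<Sum>k\<in>UNIV. \<eta> k *\<^sub>R V $ k) \<bullet> (\<Sum>l\<in>UNIV. \<eta> l *\<^sub>R (B *v (V $ l)))"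
      using x by simp
    then show ?thesis
      by (simp add: inner_sum_left inner_sum_right sum_distrib_left mult.assoc)
        (rule trans[OF sum.swap], simp add: mult.left_commute)
  qed
  have d: "V $ k \<bullet> ((H - G) *v (V $ l)) = (if k = l then \<theta> k else 0)" for k l
    using f by (auto simp: common_frame_def matrix_vector_mult_diff_rdistrib inner_diff_right)
  show thesis
  proof (rule that)
    show "\<xi> \<bullet> (G *v \<xi>) = (\<Sum>k\<in>UNIV. (\<eta> k)\<^sup>2)"
      using f unfolding * common_frame_def
      by (simp add: if_distrib[of "\<lambda>t. _ * t"] power2_eq_square cong: if_cong)
    show "\<xi> \<bullet> ((H - G) *v \<xi>) = (\<Sum>k\<in>UNIV. \<theta> k * (\<eta> k)\<^sup>2)"
      unfolding * d by (simp add: if_distrib[of "\<lambda>t. _ * t"] power2_eq_square mult.commute cong: if_cong)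
  qed
qed

lemma common_frame_diff:
  assumes f: "common_frame G H V \<theta>" and G: "transpose G = G"
  shows "(H - G) $ i $ j = (\<Sum>k\<in>UNIV. \<theta> k * (G *v (V $ k)) $ i * (G *v (V $ k)) $ j)"
proof -
  define L :: "real^'a^'a" where "L = (\<chi> i j. if i = j then \<theta> i else 0)"
  have L: "V ** (H - G) ** transpose V = L"
    using common_frame_matrix(1,2)[OF f]
    by (simp add: matrix_diff_ldistrib matrix_diff_rdistrib L_def) (auto simp: vec_eq_iff mat_def)
  have "H - G = ((G ** transpose V) ** V) ** (H - G) ** (transpose V ** (V ** G))"
    by (simp only: common_frame_matrix(3,4)[OF f] matrix_mul_lid matrix_mul_rid)
  also have "\<dots> = (G ** transpose V) ** L ** (V ** G)"
    unfolding L[symmetric] by (simp add: matrix_mul_assoc)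
  finally have "(H - G) $ i $ j = ((G ** transpose V) ** L ** (V ** G)) $ i $ j" by simp
  moreover have "(G ** transpose V) $ a $ k = (G *v (V $ k)) $ a" for a k
    by (simp add: matrix_mult_nth transpose_def matrix_vector_mult_def)
  moreover have "(V ** G) $ k $ a = (G *v (V $ k)) $ a" for a k
    using sym_nth[OF G] by (simp add: matrix_mult_nth matrix_vector_mult_def mult.commute)
  moreover have "(B ** L) $ a $ k = B $ a $ k * \<theta> k" for B :: "real^'a^'a" and a k
    by (simp add: matrix_mult_nth L_def if_distrib[of "\<lambda>t. _ * t"] cong: if_cong)
  ultimately show ?thesis
    by (simp add: matrix_mult_nth[of "_ ** L"] mult.commute mult.left_commute)
qed

section \<open>The zeroth-order term\<close>

text \<open>The numbers \<open>\<rho>\<^sub>k\<close> are the diagonal entries of a positive Ricci tensor in a common frame; the left-hand side is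
  the contraction of Ricci with the difference of the inverse metrics.\<close>

lemma first_variation_length:
  fixes \<rho> \<theta> :: "'n::finite \<Rightarrow> real"
  assumes "\<And>k. c \<le> \<rho> k" "c > 0" "\<And>k. 0 \<le> \<theta> k" "\<And>k. \<theta> k \<le> 1"
  shows "(\<Sum>k\<in>UNIV. \<rho> k / (1 + \<theta> k)) - (\<Sum>k\<in>UNIV. \<rho> k) \<le> - (c/2) * (\<Sum>k\<in>UNIV. \<bar>\<theta> k\<bar>)"
proof -
  have "\<rho> k / (1 + \<theta> k) - \<rho> k \<le> - (c/2) * \<bar>\<theta> k\<bar>" for k
  proof -
    have l: "0 \<le> \<theta> k" "\<theta> k \<le> 1" "c \<le> \<rho> k" by (rule assms)+
    have "\<rho> k / (1 + \<theta> k) - \<rho> k = - (\<rho> k * (\<theta> k / (1 + \<theta> k)))" using l by (simp add: field_simps)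
    moreover have "c * (\<theta> k / 2) \<le> \<rho> k * (\<theta> k / (1 + \<theta> k))"
      using l assms(2) by (intro mult_mono frac_le) auto
    ultimately show ?thesis using l by simp
  qed
  then show ?thesis by (simp add: sum_subtractf[symmetric] sum_distrib_left sum_mono)
qed

text \<open>The area condition allows one negative \<open>\<theta>\<^sub>p = -a\<close>, and then forces \<open>\<theta>\<^sub>j / (1 + \<theta>\<^sub>j) \<ge> a\<close> for all other \<open>j\<close>.
  The gain is thus at least \<open>a \<Sum>\<^sub>j \<rho>\<^sub>j\<close> over \<open>j \<noteq> p\<close>, the loss is \<open>\<rho>\<^sub>p a / (1 - a)\<close>, and the condition
  \<open>2\<rho>\<^sub>p < \<Sum>\<rho>\<close> says that the gain wins, with a margin that absorbs the factor \<open>1 - a\<close> for small \<open>a\<close>.\<close>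

lemma first_variation_area:
  fixes \<rho> \<theta> :: "'n::finite \<Rightarrow> real"
  assumes c: "\<And>k. c \<le> \<rho> k" "c > 0" and B: "\<And>k. \<rho> k \<le> B"
    and c': "\<And>k. 2 * \<rho> k + c' \<le> (\<Sum>k\<in>UNIV. \<rho> k)" "c' > 0"
    and small: "\<And>k. \<bar>\<theta> k\<bar> \<le> c' / (2 * (B + c'))"
    and area: "\<And>i j. i \<noteq> j \<Longrightarrow> 1 \<le> (1 + \<theta> i) * (1 + \<theta> j)"
  shows "(\<Sum>k\<in>UNIV. \<rho> k / (1 + \<theta> k)) - (\<Sum>k\<in>UNIV. \<rho> k)
    \<le> - (c' / (2 * (B + c')) * (c/4)) * (\<Sum>k\<in>UNIV. \<bar>\<theta> k\<bar>)"
proof -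
  \<comment> \<open>A bound for the \<open>\<theta>\<^sub>k\<close> and at the same time the fraction of the gain that survives.\<close>
  define \<delta> where "\<delta> = c' / (2 * (B + c'))"
  have Bp: "B > 0" using c B by (meson less_le_trans order_trans)
  have \<delta>: "0 < \<delta>" "\<delta> \<le> 1/2" "\<delta> * (B + c') = c' / 2"
    using Bp c'(2) by (auto simp: \<delta>_def field_simps)
  have sm: "\<bar>\<theta> k\<bar> \<le> \<delta>" for k using small by (simp add: \<delta>_def)
  have goal: "(\<Sum>k\<in>UNIV. \<rho> k / (1 + \<theta> k)) - (\<Sum>k\<in>UNIV. \<rho> k) \<le> - (\<delta> * (c/4)) * (\<Sum>k\<in>UNIV. \<bar>\<theta> k\<bar>)"
  proof (cases "\<forall>k. 0 \<le> \<theta> k")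
    case True
    have "\<theta> k \<le> 1" for k using sm[of k] \<delta> by simp
    then have "(\<Sum>k\<in>UNIV. \<rho> k / (1 + \<theta> k)) - (\<Sum>k\<in>UNIV. \<rho> k) \<le> - (c/2) * (\<Sum>k\<in>UNIV. \<bar>\<theta> k\<bar>)"
      using True c by (intro first_variation_length) auto
    also have "\<dots> \<le> - (\<delta> * (c/4)) * (\<Sum>k\<in>UNIV. \<bar>\<theta> k\<bar>)"
    proof (rule mult_right_mono)
      have "\<delta> * (c/4) \<le> (1/2) * (c/4)" using \<delta> c(2) by (intro mult_right_mono) auto
      then show "- (c/2) \<le> - (\<delta> * (c/4))" using c(2) by simp
    qed (simp add: sum_nonneg)
    finally show ?thesis .
  next
    case False
    then obtain p where p: "\<theta> p < 0" by (auto simp: not_le)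
    define a where "a = - \<theta> p"
    have a: "0 < a" "a \<le> \<delta>" using p sm[of p] by (auto simp: a_def)
    have a1: "a \<le> 1/2" using a \<delta> by simp
    have lj: "a \<le> \<theta> j" "a \<le> \<theta> j / (1 + \<theta> j)" "\<theta> j \<le> 1" if "j \<noteq> p" for j
    proof -
      have 1: "1 \<le> (1 - a) * (1 + \<theta> j)" using area[of p j] that by (simp add: a_def)
      show l1: "\<theta> j \<le> 1" using sm[of j] \<delta> by simp
      have "-1 < \<theta> j" using sm[of j] \<delta> by simp
      then show 2: "a \<le> \<theta> j / (1 + \<theta> j)" using 1 by (simp add: field_simps)
      have "a * (1 + \<theta> j) \<le> \<theta> j" using 1 by (simp add: algebra_simps)
      moreover have "0 \<le> \<theta> j"
      proof (rule ccontr)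
        assume "\<not> 0 \<le> \<theta> j"
        then have "(1 - a) * (1 + \<theta> j) < 1 * 1" using a a1 \<open>-1 < \<theta> j\<close> by (intro mult_strict_mono) auto
        then show False using 1 by simp
      qed
      moreover from this have "0 \<le> a * \<theta> j" using a by simp
      ultimately show "a \<le> \<theta> j" by (simp add: distrib_left)
    qed
    define m where "m = (\<Sum>j\<in>UNIV-{p}. \<rho> j * (\<theta> j / (1 + \<theta> j)))"
    have rest: "\<rho> p + c' \<le> (\<Sum>j\<in>UNIV-{p}. \<rho> j)"
      using c'(1)[of p] by (simp add: sum.remove[of UNIV p])
    have rp: "0 < \<rho> p" using c less_le_trans by blast
    have "UNIV - {p} \<noteq> {}" using rest rp c'(2) by (metis add_pos_pos not_less sum.empty)
    then obtain q where q: "q \<noteq> p" by auto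
    have m1: "a * (\<rho> p + c') \<le> m"
    proof -
      have "a * (\<rho> p + c') \<le> (\<Sum>j\<in>UNIV-{p}. \<rho> j * a)"
        using rest a by (simp add: sum_distrib_left[symmetric] mult.commute[of _ a])
      also have "\<dots> \<le> m" unfolding m_def
        using lj(2) c by (intro sum_mono mult_left_mono) (auto intro: less_imp_le less_le_trans)
      finally show ?thesis .
    qed
    have m2: "(c/4) * (\<Sum>k\<in>UNIV. \<bar>\<theta> k\<bar>) \<le> m"
    proof -
      have "a \<le> (\<Sum>j\<in>UNIV-{p}. \<theta> j)"
      proof -
        have "\<theta> q \<le> (\<Sum>j\<in>UNIV-{p}. \<theta> j)"
          using q lj(1) a by (intro member_le_sum) (auto intro: less_imp_le less_le_trans)
        then show ?thesis using lj(1)[OF q] by simp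
      qed
      moreover have "(\<Sum>k\<in>UNIV. \<bar>\<theta> k\<bar>) = a + (\<Sum>j\<in>UNIV-{p}. \<theta> j)"
      proof -
        have "(\<Sum>j\<in>UNIV-{p}. \<bar>\<theta> j\<bar>) = (\<Sum>j\<in>UNIV-{p}. \<theta> j)"
          using lj(1) a by (intro sum.cong refl) (force simp: abs_of_nonneg)
        then show ?thesis using p by (simp add: sum.remove[of UNIV p "\<lambda>k. \<bar>\<theta> k\<bar>"] a_def)
      qed
      ultimately have "(c/4) * (\<Sum>k\<in>UNIV. \<bar>\<theta> k\<bar>) \<le> (c/4) * (2 * (\<Sum>j\<in>UNIV-{p}. \<theta> j))"
        using c(2) by (intro mult_left_mono) auto
      also have "\<dots> = (\<Sum>j\<in>UNIV-{p}. c * (\<theta> j / 2))" by (simp add: sum_distrib_left)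
      also have "\<dots> \<le> m" unfolding m_def
      proof (rule sum_mono)
        fix j assume "j \<in> UNIV - {p}"
        then have l: "a \<le> \<theta> j" "\<theta> j \<le> 1" using lj by auto
        show "c * (\<theta> j / 2) \<le> \<rho> j * (\<theta> j / (1 + \<theta> j))"
          using l a c(1)[of j] c(2) by (intro mult_mono frac_le) auto
      qed
      finally show ?thesis .
    qed
    have m0: "0 \<le> m" using m1 a rp c'(2) by (meson add_pos_pos less_imp_le mult_pos_pos order_trans)
    have "\<rho> p * (a / (1 - a)) \<le> (1 - \<delta>) * m"
    proof -
      have "(a + \<delta>) * (\<rho> p + c') \<le> (2 * \<delta>) * (B + c')"
        using a \<delta> B[of p] rp c'(2) by (intro mult_mono) auto
      then have "(a + \<delta>) * (\<rho> p + c') \<le> c'" using \<delta>(3) by simp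
      then have "\<rho> p \<le> (1 - a - \<delta>) * (\<rho> p + c')" by (simp add: algebra_simps)
      also have "\<dots> \<le> ((1 - a) * (1 - \<delta>)) * (\<rho> p + c')"
        using a \<delta> rp c'(2) by (intro mult_right_mono) (auto simp: algebra_simps)
      finally have "\<rho> p * a \<le> ((1 - a) * (1 - \<delta>)) * (\<rho> p + c') * a" using a by (intro mult_right_mono) auto
      then have "\<rho> p * (a / (1 - a)) \<le> (1 - \<delta>) * (a * (\<rho> p + c'))"
        using a1 by (simp add: field_simps)
      also have "\<dots> \<le> (1 - \<delta>) * m" using m1 \<delta> by (intro mult_left_mono) auto
      finally show ?thesis .
    qed
    moreover have "(\<Sum>k\<in>UNIV. \<rho> k / (1 + \<theta> k)) - (\<Sum>k\<in>UNIV. \<rho> k) = \<rho> p * (a / (1 - a)) - m"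
    proof -
      have e: "\<rho> k / (1 + \<theta> k) - \<rho> k = - (\<rho> k * (\<theta> k / (1 + \<theta> k)))" for k
      proof -
        have "1 + \<theta> k \<noteq> 0" using sm[of k] \<delta> by auto
        then show ?thesis by (simp add: field_simps)
      qed
      have "(\<Sum>k\<in>UNIV. \<rho> k / (1 + \<theta> k)) - (\<Sum>k\<in>UNIV. \<rho> k) = - (\<Sum>k\<in>UNIV. \<rho> k * (\<theta> k / (1 + \<theta> k)))"
        by (simp only: sum_subtractf[symmetric] e sum_negf)
      also have "\<dots> = - (\<rho> p * (\<theta> p / (1 + \<theta> p))) - m"
        by (simp add: sum.remove[of UNIV p] m_def)
      finally show ?thesis by (simp add: a_def)
    qed
    ultimately have "(\<Sum>k\<in>UNIV. \<rho> k / (1 + \<theta> k)) - (\<Sum>k\<in>UNIV. \<rho> k) \<le> - \<delta> * m"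
      by (simp add: algebra_simps)
    also have "\<dots> \<le> - \<delta> * ((c/4) * (\<Sum>k\<in>UNIV. \<bar>\<theta> k\<bar>))"
      using m2 \<delta> by (intro mult_left_mono_neg) auto
    finally show ?thesis by simp
  qed
  then show ?thesis by (simp add: \<delta>_def)
qed

text \<open>By the inequality of arithmetic and geometric means the area condition gives \<open>\<theta>\<^sub>i + \<theta>\<^sub>j \<ge> 0\<close> for \<open>i \<noteq> j\<close>, so at
  most one \<open>\<theta>\<close> is negative. In dimension at least three another index is left to compensate it after \<open>k\<close> is removed.\<close>

lemma area_trace_nonneg:
  fixes \<theta> :: "'n::finite \<Rightarrow> real"
  assumes n: "CARD('n) \<ge> 3" and gt: "\<And>k. 1 + \<theta> k > 0"
    and area: "\<And>i j. i \<noteq> j \<Longrightarrow> 1 \<le> (1 + \<theta> i) * (1 + \<theta> j)"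
  shows "\<theta> k \<le> (\<Sum>j\<in>UNIV. \<theta> j)"
proof -
  have pair: "0 \<le> \<theta> i + \<theta> j" if "i \<noteq> j" for i j
  proof (rule ccontr)
    assume "\<not> 0 \<le> \<theta> i + \<theta> j"
    then have "(1 + \<theta> i) + (1 + \<theta> j) < 2" by simp
    moreover have "0 < (1 + \<theta> i) + (1 + \<theta> j)" using gt[of i] gt[of j] by simp
    ultimately have "((1 + \<theta> i) + (1 + \<theta> j))\<^sup>2 < 2\<^sup>2" by (intro power_strict_mono) auto
    moreover have "4 * ((1 + \<theta> i) * (1 + \<theta> j)) \<le> ((1 + \<theta> i) + (1 + \<theta> j))\<^sup>2"
      using zero_le_power2[of "\<theta> i - \<theta> j"] by (simp add: power2_eq_square algebra_simps)
    ultimately show False using area[OF that] by simp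
  qed
  have "0 \<le> (\<Sum>j\<in>UNIV-{k}. \<theta> j)"
  proof (cases "\<exists>p. p \<noteq> k \<and> \<theta> p < 0")
    case False
    then show ?thesis by (intro sum_nonneg) (auto simp: not_less)
  next
    case True
    then obtain p where p: "p \<noteq> k" "\<theta> p < 0" by blast
    have "card (UNIV - {k,p}) \<ge> 1" using n p by (simp add: card_Diff_subset)
    then have "UNIV - {k,p} \<noteq> {}" by (metis card.empty not_one_le_zero)
    then obtain q where q: "q \<noteq> k" "q \<noteq> p" by auto
    have "(\<Sum>j\<in>UNIV-{k}. \<theta> j) = \<theta> p + (\<theta> q + (\<Sum>j\<in>UNIV-{k}-{p}-{q}. \<theta> j))"
      using p q by (simp add: sum.remove[of "UNIV-{k}" p] sum.remove[of "UNIV-{k}-{p}" q])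
    moreover have "0 \<le> (\<Sum>j\<in>UNIV-{k}-{p}-{q}. \<theta> j)"
      by (rule sum_nonneg) (use pair[of _ p] p in force)
    ultimately show ?thesis using pair[of p q] q by simp
  qed
  then show ?thesis by (simp add: sum.remove[of UNIV k])
qed

section \<open>Gradient estimates for nonnegative functions\<close>

lemma finite_family_bound:
  fixes f :: "'i \<Rightarrow> 'a::topological_space \<Rightarrow> real"
  assumes "compact K" "finite I" "\<And>i. i \<in> I \<Longrightarrow> continuous_on K (f i)"
  obtains B where "B > 0" "\<And>i x. i \<in> I \<Longrightarrow> x \<in> K \<Longrightarrow> \<bar>f i x\<bar> \<le> B"
proof -
  have "\<exists>b. \<forall>x\<in>K. \<bar>f i x\<bar> \<le> b" if "i \<in> I" for i
    using compact_imp_bounded[OF compact_continuous_image[OF assms(3)[OF that] assms(1)]]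
    unfolding bounded_iff by auto
  then obtain b where b: "\<And>i x. i \<in> I \<Longrightarrow> x \<in> K \<Longrightarrow> \<bar>f i x\<bar> \<le> b i" by metis
  have "\<bar>f i x\<bar> \<le> 1 + (\<Sum>i\<in>I. \<bar>b i\<bar>)" if "i \<in> I" "x \<in> K" for i x
    using b[OF that] member_le_sum[of i I "\<lambda>i. \<bar>b i\<bar>"] assms(2) that by fastforce
  moreover have "1 + (\<Sum>i\<in>I. \<bar>b i\<bar>) > 0" by (simp add: add_pos_nonneg sum_nonneg)
  ultimately show thesis using that by blast
qed

text \<open>Landau's inequality: the second-order Taylor polynomial at \<open>x\<close>, evaluated at its minimum \<open>t = - f' / M\<close>, bounds
  a nonnegative value from above. The bound on the first derivative keeps that point in the ball.\<close>

lemma nonneg_gradient_bound: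
  fixes f :: "real^'n \<Rightarrow> real"
  assumes C: "Ck_on 2 f S" and r: "cball x r \<subseteq> S" "r > 0" and M: "M > 0"
    and nonneg: "\<And>y. y \<in> cball x r \<Longrightarrow> 0 \<le> f y"
    and second: "\<And>y. y \<in> cball x r \<Longrightarrow> \<bar>partial k (partial k f) y\<bar> \<le> M"
    and first: "\<bar>partial k f x\<bar> \<le> M * r"
  shows "(partial k f x)\<^sup>2 \<le> 2 * M * f x"
proof (cases "partial k f x = 0")
  case True
  then show ?thesis using nonneg[of x] r M by simp
next
  case False
  define u where "u = partial k f x"
  define t where "t = - u / M"
  have t0: "t \<noteq> 0" using False M by (simp add: t_def u_def)
  have tr: "\<bar>t\<bar> \<le> r" using first M by (simp add: t_def u_def abs_divide divide_le_eq mult.commute)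
  have in_ball: "x + s *\<^sub>R axis k 1 \<in> cball x r" if "\<bar>s\<bar> \<le> r" for s
    using that by (simp add: dist_norm)
  have C': "Ck_on (Suc 1) f S" using C by (simp add: numeral_2_eq_2)
  have d1: "f differentiable (at y)" and d2: "partial k f differentiable (at y)" if "y \<in> cball x r" for y
    using C' Ck_on_partial[OF C', of k] that r by auto
  define D where "D = (\<lambda>(m::nat) s. (if m = 0 then f else if m = 1 then partial k f else partial k (partial k f)) (x + s *\<^sub>R axis k 1))"
  have der: "\<forall>m s. m < 2 \<and> -r \<le> s \<and> s \<le> r \<longrightarrow> DERIV (D m) s :> D (Suc m) s"
  proof (intro allI impI)
    fix m :: nat and s assume a: "m < 2 \<and> -r \<le> s \<and> s \<le> r"
    then have i: "x + s *\<^sub>R axis k 1 \<in> cball x r" by (intro in_ball) auto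
    show "DERIV (D m) s :> D (Suc m) s"
      using a line_derivative[OF d1[OF i]] line_derivative[OF d2[OF i]]
      by (cases "m = 0") (auto simp: D_def less_2_cases_iff)
  qed
  obtain \<sigma> where \<sigma>: "if t < 0 then t < \<sigma> \<and> \<sigma> < 0 else 0 < \<sigma> \<and> \<sigma> < t"
    and tay: "D 0 t = (\<Sum>m<2. (D m 0 / fact m) * (t - 0) ^ m) + (D 2 \<sigma> / fact 2) * (t - 0) ^ 2"
  proof -
    have "-r \<le> t" "t \<le> r" using tr by auto
    then show thesis using Taylor[of 2 D "D 0" "-r" r 0 t, OF _ refl der] t0 r(2) that by auto
  qed
  have "\<bar>\<sigma>\<bar> \<le> r" using \<sigma> tr by (auto split: if_splits)
  then have "\<bar>D 2 \<sigma>\<bar> \<le> M" using second[OF in_ball] by (simp add: D_def)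
  then have "D 2 \<sigma> * t\<^sup>2 \<le> M * t\<^sup>2" by (intro mult_right_mono) auto
  moreover have "0 \<le> D 0 t" using nonneg[OF in_ball[OF tr]] by (simp add: D_def)
  moreover have "D 0 t = f x + u * t + D 2 \<sigma> * t\<^sup>2 / 2"
    using tay by (simp add: numeral_2_eq_2 D_def u_def)
  ultimately have "0 \<le> f x + u * t + M * t\<^sup>2 / 2" by simp
  also have "\<dots> = f x - u\<^sup>2 / (2 * M)" using M by (simp add: t_def power2_eq_square field_simps)
  finally show ?thesis using M by (simp add: u_def field_simps)
qed

lemma sum_abs_bound: "\<bar>\<Sum>i\<in>UNIV. f i\<bar> \<le> real CARD('i) * b" if "\<And>i. \<bar>f i\<bar> \<le> b" for f :: "'i::finite \<Rightarrow> real"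
  using sum_norm_bound[of UNIV f b] that by simp

text \<open>Functions \<open>e\<^sub>i\<close> of \<open>C\<^sup>2\<close>-size \<open>\<epsilon>\<close> need not have a sign, but suppose that the combinations
  \<open>u\<^sub>j = \<Sum>\<^sub>i W\<^sub>j\<^sub>i e\<^sub>i\<close> are nonnegative and determine the \<open>e\<^sub>i\<close> through \<open>Z\<close>. Landau's inequality for the \<open>u\<^sub>j\<close> then bounds
  the gradients of the \<open>e\<^sub>i\<close> by the square root of \<open>\<epsilon> \<Sum> \<bar>e\<^sub>i\<bar>\<close>. The constant depends on the coefficients only, and
  neither on \<open>e\<close> nor on \<open>\<epsilon>\<close>.\<close>

lemma gradient_bound_linear_system:
  fixes W :: "'j::finite \<Rightarrow> 'i::finite \<Rightarrow> real^'n \<Rightarrow> real" and Z :: "'i \<Rightarrow> 'j \<Rightarrow> real^'n \<Rightarrow> real"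
  assumes S: "open S" and r: "cball x0 (2 * r) \<subseteq> S" "r > 0"
    and W: "\<And>j i. smooth_on (W j i) S" and Z: "\<And>i j. smooth_on (Z i j) S"
  obtains C where "C > 0" "\<And>e \<epsilon> x i k. \<epsilon> > 0 \<Longrightarrow> (\<And>i. smooth_on (e i) S) \<Longrightarrow>
     (\<And>y i. y \<in> cball x0 (2 * r) \<Longrightarrow> \<bar>e i y\<bar> \<le> \<epsilon>) \<Longrightarrow>
     (\<And>y i k. y \<in> cball x0 (2 * r) \<Longrightarrow> \<bar>partial k (e i) y\<bar> \<le> \<epsilon>) \<Longrightarrow>
     (\<And>y i k. y \<in> cball x0 (2 * r) \<Longrightarrow> \<bar>partial k (partial k (e i)) y\<bar> \<le> \<epsilon>) \<Longrightarrow>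
     (\<And>y i. y \<in> S \<Longrightarrow> e i y = (\<Sum>j\<in>UNIV. Z i j y * (\<Sum>i\<in>UNIV. W j i y * e i y))) \<Longrightarrow>
     (\<And>y j. y \<in> cball x0 (2 * r) \<Longrightarrow> 0 \<le> (\<Sum>i\<in>UNIV. W j i y * e i y)) \<Longrightarrow>
     x \<in> cball x0 r \<Longrightarrow> (partial k (e i) x)\<^sup>2 \<le> C * \<epsilon> * (\<Sum>i\<in>UNIV. \<bar>e i x\<bar>)"
proof -
  let ?K = "cball x0 (2 * r)"
  have cK: "continuous_on ?K f" if "smooth_on f S" for f :: "real^'n \<Rightarrow> real"
    using continuous_on_subset[OF smooth_on_continuous[OF that] r(1)] .
  obtain B1 where B1: "B1 > 0" "\<And>p x. p \<in> UNIV \<Longrightarrow> x \<in> ?K \<Longrightarrow> \<bar>(\<lambda>(j, i). W j i) p x\<bar> \<le> B1"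
    by (rule finite_family_bound[of ?K UNIV "\<lambda>(j, i). W j i"]) (auto intro: cK W)
  obtain B2 where B2: "B2 > 0" "\<And>p x. p \<in> UNIV \<Longrightarrow> x \<in> ?K \<Longrightarrow> \<bar>(\<lambda>(j, i, k). partial k (W j i)) p x\<bar> \<le> B2"
    by (rule finite_family_bound[of ?K UNIV "\<lambda>(j, i, k). partial k (W j i)"]) (auto intro: cK smooth_on_partial W)
  obtain B3 where B3: "B3 > 0" "\<And>p x. p \<in> UNIV \<Longrightarrow> x \<in> ?K \<Longrightarrow> \<bar>(\<lambda>(j, i, k). partial k (partial k (W j i))) p x\<bar> \<le> B3"
    by (rule finite_family_bound[of ?K UNIV "\<lambda>(j, i, k). partial k (partial k (W j i))"])
      (auto intro: cK smooth_on_partial W)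
  obtain B4 where B4: "B4 > 0" "\<And>p x. p \<in> UNIV \<Longrightarrow> x \<in> ?K \<Longrightarrow> \<bar>(\<lambda>(i, j). Z i j) p x\<bar> \<le> B4"
    by (rule finite_family_bound[of ?K UNIV "\<lambda>(i, j). Z i j"]) (auto intro: cK Z)
  obtain B5 where B5: "B5 > 0" "\<And>p x. p \<in> UNIV \<Longrightarrow> x \<in> ?K \<Longrightarrow> \<bar>(\<lambda>(i, j, k). partial k (Z i j)) p x\<bar> \<le> B5"
    by (rule finite_family_bound[of ?K UNIV "\<lambda>(i, j, k). partial k (Z i j)"]) (auto intro: cK smooth_on_partial Z)
  define B where "B = B1 + B2 + B3 + B4 + B5"
  have B: "B > 0" using B1 B2 B3 B4 B5 by (simp add: B_def)
  have bW: "\<bar>W j i y\<bar> \<le> B" "\<bar>partial k (W j i) y\<bar> \<le> B" "\<bar>partial k (partial k (W j i)) y\<bar> \<le> B"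
    "\<bar>Z i j y\<bar> \<le> B" "\<bar>partial k (Z i j) y\<bar> \<le> B" if "y \<in> ?K" for j i y k
    using B1(2)[OF UNIV_I that, of "(j,i)"] B2(2)[OF UNIV_I that, of "(j,i,k)"] B3(2)[OF UNIV_I that, of "(j,i,k)"]
      B4(2)[OF UNIV_I that, of "(i,j)"] B5(2)[OF UNIV_I that, of "(i,j,k)"] B1(1) B2(1) B3(1) B4(1) B5(1)
    by (auto simp: B_def)
  define c where "c = real CARD('i)"
  define m where "m = real CARD('j)"
  have c: "c > 0" "m > 0" by (auto simp: c_def m_def)
  define C0 where "C0 = 8 * c * B\<^sup>2 * (1 + 1 / r)"
  have C0: "C0 > 0" using c B r by (simp add: C0_def add_pos_pos)
  show thesis
  proof (rule that[of "2 * m\<^sup>2 * B\<^sup>2 * (C0 + B\<^sup>2 * c)"])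
    show "2 * m\<^sup>2 * B\<^sup>2 * (C0 + B\<^sup>2 * c) > 0" using c B C0 by (simp add: add_pos_pos)
  next
    fix e :: "'i \<Rightarrow> real^'n \<Rightarrow> real" and \<epsilon> :: real and x i k
    assume eps: "\<epsilon> > 0" and e: "\<And>i. smooth_on (e i) S"
      and e0: "\<And>y i. y \<in> ?K \<Longrightarrow> \<bar>e i y\<bar> \<le> \<epsilon>"
      and e1: "\<And>y i k. y \<in> ?K \<Longrightarrow> \<bar>partial k (e i) y\<bar> \<le> \<epsilon>"
      and e2: "\<And>y i k. y \<in> ?K \<Longrightarrow> \<bar>partial k (partial k (e i)) y\<bar> \<le> \<epsilon>"
      and rec: "\<And>y i. y \<in> S \<Longrightarrow> e i y = (\<Sum>j\<in>UNIV. Z i j y * (\<Sum>i\<in>UNIV. W j i y * e i y))"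
      and nn: "\<And>y j. y \<in> ?K \<Longrightarrow> 0 \<le> (\<Sum>i\<in>UNIV. W j i y * e i y)"
      and x: "x \<in> cball x0 r"
    define U where "U j y = (\<Sum>i\<in>UNIV. W j i y * e i y)" for j y
    have xr: "cball x r \<subseteq> ?K"
    proof
      fix y assume "y \<in> cball x r"
      then show "y \<in> ?K" using x dist_triangle[of x0 y x] by (simp add: dist_commute)
    qed
    have xK: "x \<in> ?K" using subsetD[OF xr, of x] r(2) by simp
    have KS: "y \<in> S" if "y \<in> ?K" for y using that r by auto
    have df: "f differentiable (at y)" if "smooth_on f S" "y \<in> S" for f :: "real^'n \<Rightarrow> real" and y
      using smooth_on_differentiable that by blast
    have dW: "W j i differentiable (at y)" "partial k (W j i) differentiable (at y)"
      "e i differentiable (at y)" "partial k (e i) differentiable (at y)" if "y \<in> S" for j i k y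
      by (auto intro!: df smooth_on_partial W e that)
    have sU: "smooth_on (U j) S" for j
      unfolding U_def by (intro smooth_on_sum smooth_on_mult S W e)
    have U1: "partial k (U j) y = (\<Sum>i\<in>UNIV. W j i y * partial k (e i) y + partial k (W j i) y * e i y)"
      if "y \<in> S" for j y
      unfolding U_def[abs_def] using that by (simp add: partial_sum partial_mult dW differentiable_mult)
    have U2: "partial k (partial k (U j)) y = (\<Sum>i\<in>UNIV. (W j i y * partial k (partial k (e i)) y + partial k (W j i) y * partial k (e i) y)
         + (partial k (W j i) y * partial k (e i) y + partial k (partial k (W j i)) y * e i y))" if "y \<in> S" for j y
    proof -
      have "partial k (partial k (U j)) y = partial k (\<lambda>y. \<Sum>i\<in>UNIV. W j i y * partial k (e i) y + partial k (W j i) y * e i y) y"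
        by (rule partial_cong[OF S that U1])
      then show ?thesis using that
        by (simp add: partial_sum partial_mult partial_add dW differentiable_mult differentiable_add)
    qed
    have pr: "\<bar>a * b\<bar> \<le> B * \<epsilon>" if "\<bar>a\<bar> \<le> B" "\<bar>b\<bar> \<le> \<epsilon>" for a b
      unfolding abs_mult using that B by (intro mult_mono) auto
    have bU1: "\<bar>partial k (U j) y\<bar> \<le> c * (2 * B * \<epsilon>)" if y: "y \<in> ?K" for j y
      unfolding U1[OF KS[OF y]] c_def
    proof (rule sum_abs_bound)
      fix i
      have "\<bar>W j i y * partial k (e i) y\<bar> \<le> B * \<epsilon>" "\<bar>partial k (W j i) y * e i y\<bar> \<le> B * \<epsilon>"
        by (intro pr bW e0 e1 y)+
      then show "\<bar>W j i y * partial k (e i) y + partial k (W j i) y * e i y\<bar> \<le> 2 * B * \<epsilon>" by linarith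
    qed
    have bU2: "\<bar>partial k (partial k (U j)) y\<bar> \<le> c * (4 * B * \<epsilon>)" if y: "y \<in> ?K" for j y
      unfolding U2[OF KS[OF y]] c_def
    proof (rule sum_abs_bound)
      fix i
      have "\<bar>W j i y * partial k (partial k (e i)) y\<bar> \<le> B * \<epsilon>" "\<bar>partial k (W j i) y * partial k (e i) y\<bar> \<le> B * \<epsilon>"
        "\<bar>partial k (partial k (W j i)) y * e i y\<bar> \<le> B * \<epsilon>"
        by (intro pr bW e0 e1 e2 y)+
      then show "\<bar>(W j i y * partial k (partial k (e i)) y + partial k (W j i) y * partial k (e i) y)
         + (partial k (W j i) y * partial k (e i) y + partial k (partial k (W j i)) y * e i y)\<bar> \<le> 4 * B * \<epsilon>"
        by linarith
    qed
    define s where "s = (\<Sum>i\<in>UNIV. \<bar>e i x\<bar>)"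
    have s: "0 \<le> s" "s \<le> c * \<epsilon>"
      using sum_abs_bound[of "\<lambda>i. \<bar>e i x\<bar>" \<epsilon>] e0[OF xK] by (auto simp: s_def c_def sum_nonneg)
    have U0: "\<bar>U j x\<bar> \<le> B * s" for j
    proof -
      have "\<bar>U j x\<bar> \<le> (\<Sum>i\<in>UNIV. \<bar>W j i x * e i x\<bar>)" unfolding U_def by (rule sum_abs)
      also have "\<dots> \<le> (\<Sum>i\<in>UNIV. B * \<bar>e i x\<bar>)"
        unfolding abs_mult by (intro sum_mono mult_right_mono bW xK) auto
      finally show ?thesis by (simp add: s_def sum_distrib_left)
    qed
    \<comment> \<open>\<open>M\<close> bounds the second derivatives of the \<open>u\<^sub>j\<close>, and \<open>M r\<close> bounds their first derivatives.\<close>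
    define M where "M = 4 * c * B * \<epsilon> * (1 + 1 / r)"
    have M0: "M > 0" using c B eps r by (simp add: M_def add_pos_pos)
    have M1: "4 * c * B * \<epsilon> \<le> M"
      unfolding M_def using mult_left_mono[of 1 "1 + 1/r" "4 * c * B * \<epsilon>"] c B eps r by simp
    have M2: "2 * c * B * \<epsilon> \<le> M * r"
    proof -
      have "M * r = 4 * c * B * \<epsilon> * (r + 1)" using r by (simp add: M_def field_simps)
      moreover have "4 * c * B * \<epsilon> * 1 \<le> 4 * c * B * \<epsilon> * (r + 1)"
        using c B eps r by (intro mult_left_mono) auto
      moreover have "0 < c * B * \<epsilon>" using c B eps by simp
      ultimately show ?thesis by linarith
    qed
    have dU: "(partial k (U j) x)\<^sup>2 \<le> C0 * \<epsilon> * s" for j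
    proof -
      have "(partial k (U j) x)\<^sup>2 \<le> 2 * M * U j x"
      proof (rule nonneg_gradient_bound[OF smooth_onD[OF sU]])
        show "cball x r \<subseteq> S" using xr r by blast
        show "0 \<le> U j y" if "y \<in> cball x r" for y using nn xr that by (auto simp: U_def)
        show "\<bar>partial k (partial k (U j)) y\<bar> \<le> M" if "y \<in> cball x r" for y
          using bU2[of y j] xr that M1 by (auto simp: algebra_simps)
        show "\<bar>partial k (U j) x\<bar> \<le> M * r" using bU1[OF xK, of j] M2 by (simp add: algebra_simps)
      qed (use r M0 in auto)
      also have "\<dots> \<le> 2 * M * (B * s)" using U0[of j] M0 by (intro mult_left_mono) auto
      also have "\<dots> = C0 * \<epsilon> * s" by (simp add: M_def C0_def power2_eq_square)
      finally show ?thesis .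
    qed
    have dU': "\<bar>partial k (U j) x\<bar> \<le> sqrt (C0 * \<epsilon> * s)" for j
      using dU[of j] real_sqrt_le_mono by fastforce
    have "partial k (e i) x = partial k (\<lambda>y. \<Sum>j\<in>UNIV. Z i j y * U j y) x"
      by (rule partial_cong[OF S KS[OF xK]]) (use rec in \<open>simp add: U_def\<close>)
    also have "\<dots> = (\<Sum>j\<in>UNIV. Z i j x * partial k (U j) x + partial k (Z i j) x * U j x)"
      using df[OF Z KS[OF xK]] df[OF sU KS[OF xK]] by (simp add: partial_sum partial_mult differentiable_mult)
    finally have pe: "partial k (e i) x = (\<Sum>j\<in>UNIV. Z i j x * partial k (U j) x + partial k (Z i j) x * U j x)" .
    have "\<bar>partial k (e i) x\<bar> \<le> m * (B * sqrt (C0 * \<epsilon> * s) + B * (B * s))"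
      unfolding pe m_def
    proof (rule sum_abs_bound)
      fix j
      have "\<bar>Z i j x * partial k (U j) x\<bar> \<le> B * sqrt (C0 * \<epsilon> * s)" "\<bar>partial k (Z i j) x * U j x\<bar> \<le> B * (B * s)"
        unfolding abs_mult using B by (intro mult_mono bW xK dU' U0; simp)+
      then show "\<bar>Z i j x * partial k (U j) x + partial k (Z i j) x * U j x\<bar> \<le> B * sqrt (C0 * \<epsilon> * s) + B * (B * s)"
        by linarith
    qed
    then have "(partial k (e i) x)\<^sup>2 \<le> (m * (B * sqrt (C0 * \<epsilon> * s) + B * (B * s)))\<^sup>2"
      by (metis abs_ge_zero power2_abs power_mono)
    also have "\<dots> = m\<^sup>2 * B\<^sup>2 * (sqrt (C0 * \<epsilon> * s) + B * s)\<^sup>2"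
      by (simp add: power2_eq_square algebra_simps)
    also have "\<dots> \<le> m\<^sup>2 * B\<^sup>2 * (2 * (sqrt (C0 * \<epsilon> * s))\<^sup>2 + 2 * (B * s)\<^sup>2)"
    proof (rule mult_left_mono)
      show "(sqrt (C0 * \<epsilon> * s) + B * s)\<^sup>2 \<le> 2 * (sqrt (C0 * \<epsilon> * s))\<^sup>2 + 2 * (B * s)\<^sup>2"
        using zero_le_power2[of "sqrt (C0 * \<epsilon> * s) - B * s"]
        unfolding power2_sum power2_diff by linarith
    qed simp
    also have "(sqrt (C0 * \<epsilon> * s))\<^sup>2 = C0 * \<epsilon> * s" using C0 eps s by simp
    also have "m\<^sup>2 * B\<^sup>2 * (2 * (C0 * \<epsilon> * s) + 2 * (B * s)\<^sup>2) \<le> m\<^sup>2 * B\<^sup>2 * (2 * (C0 * \<epsilon> * s) + 2 * (B\<^sup>2 * (c * \<epsilon> * s)))"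
    proof -
      have "s * s \<le> c * \<epsilon> * s" using s by (intro mult_right_mono) auto
      then have "(B * s)\<^sup>2 \<le> B\<^sup>2 * (c * \<epsilon> * s)"
        unfolding power_mult_distrib power2_eq_square[of s] by (intro mult_left_mono) auto
      then show ?thesis by (intro mult_left_mono add_left_mono) auto
    qed
    also have "\<dots> = 2 * m\<^sup>2 * B\<^sup>2 * (C0 + B\<^sup>2 * c) * \<epsilon> * s" by (simp add: algebra_simps)
    finally show "(partial k (e i) x)\<^sup>2 \<le> 2 * m\<^sup>2 * B\<^sup>2 * (C0 + B\<^sup>2 * c) * \<epsilon> * (\<Sum>i\<in>UNIV. \<bar>e i x\<bar>)"
      by (simp add: s_def)
  qed
qed

section \<open>The local inequality for scalar curvature\<close>

text \<open>The size of a matrix in which all pointwise estimates are expressed.\<close>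

definition entry_sum :: "real^'n^'n \<Rightarrow> real"
  where "entry_sum E = (\<Sum>i\<in>UNIV. \<Sum>j\<in>UNIV. \<bar>E $ i $ j\<bar>)"

lemma entry_sum_nonneg: "0 \<le> entry_sum E"
  by (simp add: entry_sum_def sum_nonneg)

lemma entry_sum_le: "(\<And>i j. \<bar>E $ i $ j\<bar> \<le> b) \<Longrightarrow> entry_sum E \<le> real CARD('n) * (real CARD('n) * b)" for E :: "real^'n^'n"
proof -
  assume b: "\<And>i j. \<bar>E $ i $ j\<bar> \<le> b"
  have "(\<Sum>j\<in>UNIV. \<bar>E $ i $ j\<bar>) \<le> real CARD('n) * b" for i
    using sum_abs_bound[of "\<lambda>j. \<bar>E $ i $ j\<bar>" b] b by simp
  then show ?thesis
    using sum_abs_bound[of "\<lambda>i. \<Sum>j\<in>UNIV. \<bar>E $ i $ j\<bar>" "real CARD('n) * b"]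
    by (simp add: entry_sum_def sum_nonneg)
qed

lemma quadratic_form_bound: "\<bar>\<xi> \<bullet> (E *v \<xi>)\<bar> \<le> entry_sum E * (norm \<xi>)\<^sup>2" for E :: "real^'n^'n"
proof -
  have "\<xi> \<bullet> (E *v \<xi>) = (\<Sum>i\<in>UNIV. \<Sum>j\<in>UNIV. E $ i $ j * (\<xi> $ i * \<xi> $ j))"
    by (simp add: inner_vec_def matrix_vector_mult_def sum_distrib_left algebra_simps)
  also have "\<bar>\<dots>\<bar> \<le> (\<Sum>i\<in>UNIV. \<Sum>j\<in>UNIV. \<bar>E $ i $ j\<bar> * (norm \<xi> * norm \<xi>))"
    by (intro order_trans[OF sum_abs] sum_mono)
      (auto simp: abs_mult intro!: mult_left_mono mult_mono component_le_norm_cart)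
  finally show ?thesis by (simp add: entry_sum_def sum_distrib_right power2_eq_square)
qed

text \<open>The minimum over the compact product of \<open>K\<close> with the unit sphere.\<close>

lemma uniformly_positive:
  fixes R :: "'a::t2_space \<Rightarrow> real^'n^'n"
  assumes K: "compact K" and c: "\<And>i j. continuous_on K (\<lambda>x. R x $ i $ j)"
    and pos: "\<And>x \<xi>. x \<in> K \<Longrightarrow> \<xi> \<noteq> 0 \<Longrightarrow> 0 < \<xi> \<bullet> (R x *v \<xi>)"
  obtains m where "m > 0" "\<And>x \<xi>. x \<in> K \<Longrightarrow> m * (norm \<xi>)\<^sup>2 \<le> \<xi> \<bullet> (R x *v \<xi>)"
proof (cases "K = {}")
  case True
  then show thesis using that[of 1] by simp
next
  case False
  let ?P = "K \<times> sphere (0::real^'n) 1"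
  define f where "f p = snd p \<bullet> (R (fst p) *v snd p)" for p :: "'a \<times> (real^'n)"
  have "norm (axis (undefined::'n) 1 :: real^'n) = 1" by simp
  then have ne: "?P \<noteq> {}" using False by (metis Times_empty mem_sphere_0 empty_iff)
  have "continuous_on ?P f"
    unfolding f_def inner_vec_def matrix_vector_mult_def
    by simp (intro continuous_intros continuous_on_compose2[OF c]; auto)
  moreover have "compact ?P" using K by (simp add: compact_Times)
  ultimately obtain p where p: "p \<in> ?P" "\<And>q. q \<in> ?P \<Longrightarrow> f p \<le> f q"
    using continuous_attains_inf ne by metis
  have "snd p \<noteq> 0" "fst p \<in> K" using p(1) by (auto simp: mem_Times_iff)
  then have fp: "f p > 0" unfolding f_def by (rule pos[rotated])
  show thesis
  proof (rule that[OF fp])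
    fix x \<xi> assume x: "x \<in> K"
    show "f p * (norm \<xi>)\<^sup>2 \<le> \<xi> \<bullet> (R x *v \<xi>)"
    proof (cases "\<xi> = 0")
      case True then show ?thesis by simp
    next
      case nz: False
      define \<zeta> where "\<zeta> = (1 / norm \<xi>) *\<^sub>R \<xi>"
      have "(x, \<zeta>) \<in> ?P" using x nz by (simp add: \<zeta>_def)
      then have "f p \<le> \<zeta> \<bullet> (R x *v \<zeta>)" using p(2)[of "(x, \<zeta>)"] by (simp add: f_def)
      moreover have "\<xi> \<bullet> (R x *v \<xi>) = (norm \<xi>)\<^sup>2 * (\<zeta> \<bullet> (R x *v \<zeta>))"
        using nz by (simp add: \<zeta>_def matrix_vector_mult_scaleR power2_eq_square)
      ultimately show ?thesis by (simp add: mult.commute mult_right_mono)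
    qed
  qed
qed

lemma inverse_entry_bound:
  fixes H :: "real^'n^'n"
  assumes H: "posdef H" and m: "m > 0" "\<And>\<xi>. m * (norm \<xi>)\<^sup>2 \<le> \<xi> \<bullet> (H *v \<xi>)"
  shows "\<bar>matrix_inv H $ i $ j\<bar> \<le> 1 / m"
proof -
  define \<eta> where "\<eta> = matrix_inv H *v axis j 1"
  have "H *v \<eta> = axis j 1"
    using matrix_inv_works[OF posdef_invertible[OF H]] by (simp add: \<eta>_def matrix_vector_mul_assoc)
  then have "m * (norm \<eta>)\<^sup>2 \<le> \<eta> $ j" using m(2)[of \<eta>] by (simp add: inner_axis)
  also have "\<dots> \<le> norm \<eta>" using component_le_norm_cart[of \<eta> j] by simp
  finally have "norm \<eta> * (m * norm \<eta>) \<le> norm \<eta> * 1" by (simp add: power2_eq_square algebra_simps)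
  then have "norm \<eta> \<le> 1 / m"
    using m(1) by (cases "norm \<eta> = 0") (auto simp: mult_le_cancel_left field_simps)
  moreover have "\<eta> $ i = matrix_inv H $ i $ j"
    by (simp add: \<eta>_def matrix_vector_mul_component inner_axis)
  ultimately show ?thesis using component_le_norm_cart[of \<eta> i] by simp
qed

lemma inverse_difference:
  fixes G H :: "real^'n^'n"
  assumes "posdef G" "posdef H"
  shows "matrix_inv H - matrix_inv G = - (matrix_inv H ** (H - G) ** matrix_inv G)"
  using matrix_inv_works[OF posdef_invertible[OF assms(1)]] matrix_inv_works[OF posdef_invertible[OF assms(2)]]
  by (simp add: matrix_diff_ldistrib matrix_diff_rdistrib matrix_mul_assoc[symmetric])

lemma triple_product_bound:
  fixes P E Q :: "real^'n^'n"
  assumes "\<And>i j. \<bar>P $ i $ j\<bar> \<le> b" "\<And>i j. \<bar>Q $ i $ j\<bar> \<le> b"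
  shows "\<bar>(P ** E ** Q) $ i $ j\<bar> \<le> b * b * entry_sum E"
proof -
  have "(P ** E ** Q) $ i $ j = (\<Sum>l\<in>UNIV. \<Sum>k\<in>UNIV. P $ i $ k * E $ k $ l * Q $ l $ j)"
    by (simp add: matrix_mult_nth sum_distrib_right)
  also have "\<dots> = (\<Sum>k\<in>UNIV. \<Sum>l\<in>UNIV. P $ i $ k * E $ k $ l * Q $ l $ j)" by (rule sum.swap)
  also have "\<bar>\<dots>\<bar> \<le> (\<Sum>k\<in>UNIV. \<Sum>l\<in>UNIV. b * b * \<bar>E $ k $ l\<bar>)"
  proof (intro order_trans[OF sum_abs] sum_mono)
    fix k l
    have "\<bar>P $ i $ k\<bar> * \<bar>Q $ l $ j\<bar> \<le> b * b"
      using assms(1)[of i k] assms(2)[of l j] by (intro mult_mono) auto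
    then have "(\<bar>P $ i $ k\<bar> * \<bar>Q $ l $ j\<bar>) * \<bar>E $ k $ l\<bar> \<le> b * b * \<bar>E $ k $ l\<bar>"
      by (rule mult_right_mono) simp
    then show "\<bar>P $ i $ k * E $ k $ l * Q $ l $ j\<bar> \<le> b * b * \<bar>E $ k $ l\<bar>"
      by (simp add: abs_mult mult.commute mult.left_commute)
  qed
  finally show ?thesis by (simp add: entry_sum_def sum_distrib_left)
qed

lemma metric_field_component_smooth: "metric_field S G \<Longrightarrow> smooth_on (\<lambda>x. G x $ i $ j) S"
  by (simp add: metric_field_def msmooth_def)

text \<open>The difference tensor is linear in \<open>H - G\<close> and its first derivatives, up to inverse metrics that stay bounded near
  \<open>G\<close>, and the defect is quadratic in the difference tensor.\<close>

lemma quad_defect_bound: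
  fixes G :: "real^'n \<Rightarrow> real^'n^'n"
  assumes MG: "metric_field S G" and K: "compact K" "K \<subseteq> S"
  obtains C \<epsilon>0 where "C > 0" "\<epsilon>0 > 0"
    "\<And>H x \<tau>. metric_field S H \<Longrightarrow> x \<in> K \<Longrightarrow> (\<And>i j. \<bar>(H x - G x) $ i $ j\<bar> \<le> \<epsilon>0) \<Longrightarrow>
      (\<And>i j k. \<bar>partial k (\<lambda>y. H y $ i $ j - G y $ i $ j) x\<bar> \<le> \<tau>) \<Longrightarrow>
      \<bar>quad_defect G H x\<bar> \<le> C * (\<tau> + entry_sum (H x - G x))\<^sup>2"
proof -
  have pd: "posdef (G x)" if "x \<in> K" for x using MG K that by (auto simp: metric_field_def)
  have cK: "continuous_on K f" if "smooth_on f S" for f :: "real^'n \<Rightarrow> real"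
    using continuous_on_subset[OF smooth_on_continuous[OF that] K(2)] .
  obtain m where m: "m > 0" "\<And>x \<xi>. x \<in> K \<Longrightarrow> m * (norm \<xi>)\<^sup>2 \<le> \<xi> \<bullet> (G x *v \<xi>)"
    by (rule uniformly_positive[of K G]) (use K pd metric_field_component_smooth[OF MG] cK in \<open>auto simp: posdef_def\<close>)
  obtain B where B: "B > 0" "\<And>p x. p \<in> UNIV \<Longrightarrow> x \<in> K \<Longrightarrow> \<bar>(\<lambda>(k, i, j). partial k (\<lambda>y. G y $ i $ j)) p x\<bar> \<le> B"
    by (rule finite_family_bound[of K UNIV "\<lambda>(k, i, j). partial k (\<lambda>y. G y $ i $ j)"])
      (use K in \<open>auto intro!: cK smooth_on_partial metric_field_component_smooth[OF MG]\<close>)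
  have bG: "\<bar>partial k (\<lambda>y. G y $ i $ j) x\<bar> \<le> B" if "x \<in> K" for k i j x
    using B(2)[OF UNIV_I that, of "(k,i,j)"] by simp
  define n where "n = real CARD('n)"
  have n: "n > 0" by (simp add: n_def)
  define b where "b = 2 / m"
  have b: "b > 0" using m by (simp add: b_def)
  \<comment> \<open>Entries of this size change the quadratic form of \<open>G\<close> by at most half of its lower bound \<open>m\<close>.\<close>
  define \<epsilon>0 where "\<epsilon>0 = m / (2 * (n * n))"
  have e0: "\<epsilon>0 > 0" "n * (n * \<epsilon>0) = m / 2" using m n by (auto simp: \<epsilon>0_def field_simps)
  define C1 where "C1 = n * (3 * b + 3 * (b * b) * B)"
  have C1: "C1 > 0" using n b B by (simp add: C1_def add_pos_pos)
  show thesis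
  proof (rule that[of "n * (n * (n * (n * (b * (C1 * C1))))) + n * (n * (b * (n * C1 * (n * C1))))" \<epsilon>0])
    show "n * (n * (n * (n * (b * (C1 * C1))))) + n * (n * (b * (n * C1 * (n * C1)))) > 0"
      using n b C1 by (simp add: add_pos_pos)
    show "\<epsilon>0 > 0" by (rule e0)
    fix H x \<tau>
    assume MH: "metric_field S H" and x: "x \<in> K" and close: "\<And>i j. \<bar>(H x - G x) $ i $ j\<bar> \<le> \<epsilon>0"
      and grad: "\<And>i j k. \<bar>partial k (\<lambda>y. H y $ i $ j - G y $ i $ j) x\<bar> \<le> \<tau>"
    have xS: "x \<in> S" using x K by blast
    have pdH: "posdef (H x)" using MH xS by (auto simp: metric_field_def)
    define N where "N = entry_sum (H x - G x)"
    have N0: "0 \<le> N" "N \<le> m / 2"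
      using entry_sum_nonneg entry_sum_le[of "H x - G x" \<epsilon>0] close e0 unfolding N_def n_def by auto
    have tau: "0 \<le> \<tau>" using grad[of undefined undefined undefined] by linarith
    have "m / 2 * (norm \<xi>)\<^sup>2 \<le> \<xi> \<bullet> (H x *v \<xi>)" for \<xi>
    proof -
      have "\<xi> \<bullet> (H x *v \<xi>) = \<xi> \<bullet> (G x *v \<xi>) + \<xi> \<bullet> ((H x - G x) *v \<xi>)"
        by (simp add: matrix_vector_mult_diff_rdistrib inner_diff_right)
      moreover have "\<bar>\<xi> \<bullet> ((H x - G x) *v \<xi>)\<bar> \<le> N * (norm \<xi>)\<^sup>2"
        unfolding N_def by (rule quadratic_form_bound)
      moreover have "N * (norm \<xi>)\<^sup>2 \<le> m / 2 * (norm \<xi>)\<^sup>2" using N0 by (intro mult_right_mono) auto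
      ultimately show ?thesis using m(2)[OF x, of \<xi>] by linarith
    qed
    then have bH: "\<bar>matrix_inv (H x) $ i $ j\<bar> \<le> b" for i j
      using inverse_entry_bound[OF pdH, of "m/2" i j] m(1) by (simp add: b_def)
    have bGi: "\<bar>matrix_inv (G x) $ i $ j\<bar> \<le> b" for i j
    proof -
      have "\<bar>matrix_inv (G x) $ i $ j\<bar> \<le> 1 / m" by (rule inverse_entry_bound[OF pd[OF x] m(1) m(2)[OF x]])
      also have "\<dots> \<le> b" using m(1) by (simp add: b_def field_simps)
      finally show ?thesis .
    qed
    have bd: "\<bar>matrix_inv (H x) $ i $ j - matrix_inv (G x) $ i $ j\<bar> \<le> b * b * N" for i j
      using triple_product_bound[of "matrix_inv (H x)" b "matrix_inv (G x)" "H x - G x" i j, OF bH bGi]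
        arg_cong[OF inverse_difference[OF pd[OF x] pdH], of "\<lambda>M. M $ i $ j"] by (simp add: N_def)
    have dG: "(\<lambda>y. G y $ i $ j) differentiable (at x)" and dH: "(\<lambda>y. H y $ i $ j) differentiable (at x)" for i j
      using smooth_on_differentiable[OF metric_field_component_smooth xS] MG MH by blast+
    define T where "T F i j l = partial i (\<lambda>y. F y $ j $ l) x + partial j (\<lambda>y. F y $ i $ l) x - partial l (\<lambda>y. F y $ i $ j) x"
      for F :: "real^'n \<Rightarrow> real^'n^'n" and i j l
    have TG: "\<bar>T G i j l\<bar> \<le> 3 * B" for i j l
      using bG[OF x, of i j l] bG[OF x, of j i l] bG[OF x, of l i j] unfolding T_def by linarith
    have TE: "\<bar>T H i j l - T G i j l\<bar> \<le> 3 * \<tau>" for i j l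
      using grad[of i j l] grad[of j i l] grad[of l i j]
        partial_diff[OF dH dG, of i j l j l] partial_diff[OF dH dG, of j i l i l] partial_diff[OF dH dG, of l i j i j]
      unfolding T_def by linarith
    have D: "\<bar>conn_diff G H i x $ k $ j\<bar> \<le> C1 * (\<tau> + N)" for i j k
    proof -
      have "conn_diff G H i x $ k $ j = (1/2) * (\<Sum>l\<in>UNIV. matrix_inv (H x) $ k $ l * (T H i j l - T G i j l)
          + (matrix_inv (H x) $ k $ l - matrix_inv (G x) $ k $ l) * T G i j l)"
        unfolding conn_diff_def Gam_def christoffel_def T_def
        by (simp add: sum_distrib_left sum_subtractf[symmetric] algebra_simps)
      moreover have "\<bar>\<Sum>l\<in>UNIV. matrix_inv (H x) $ k $ l * (T H i j l - T G i j l)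
          + (matrix_inv (H x) $ k $ l - matrix_inv (G x) $ k $ l) * T G i j l\<bar>
          \<le> real CARD('n) * (b * (3 * \<tau>) + b * b * N * (3 * B))"
      proof (rule sum_abs_bound)
        fix l
        have "\<bar>matrix_inv (H x) $ k $ l * (T H i j l - T G i j l)\<bar> \<le> b * (3 * \<tau>)"
          unfolding abs_mult using b by (intro mult_mono bH TE) auto
        moreover have "\<bar>(matrix_inv (H x) $ k $ l - matrix_inv (G x) $ k $ l) * T G i j l\<bar> \<le> b * b * N * (3 * B)"
          unfolding abs_mult using b N0 by (intro mult_mono bd TG) auto
        ultimately show "\<bar>matrix_inv (H x) $ k $ l * (T H i j l - T G i j l)
          + (matrix_inv (H x) $ k $ l - matrix_inv (G x) $ k $ l) * T G i j l\<bar> \<le> b * (3 * \<tau>) + b * b * N * (3 * B)"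
          by linarith
      qed
      moreover have "real CARD('n) * (b * (3 * \<tau>) + b * b * N * (3 * B)) \<le> C1 * (\<tau> + N)"
      proof -
        have "C1 * (\<tau> + N) - n * (b * (3 * \<tau>) + b * b * N * (3 * B)) = n * (3 * b * N + 3 * (b * b) * B * \<tau>)"
          by (simp add: C1_def algebra_simps)
        moreover have "0 \<le> n * (3 * b * N + 3 * (b * b) * B * \<tau>)"
          using n b B N0 tau by (intro mult_nonneg_nonneg add_nonneg_nonneg) auto
        ultimately show ?thesis by (simp add: n_def)
      qed
      ultimately show ?thesis unfolding abs_mult by linarith
    qed
    define d where "d = C1 * (\<tau> + N)"
    have d0: "0 \<le> d" using C1 tau N0 by (simp add: d_def)
    have tr: "\<bar>trace (conn_diff G H i x)\<bar> \<le> n * d" for i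
      unfolding trace_def n_def d_def by (rule sum_abs_bound) (rule D)
    have "\<bar>quad_defect G H x\<bar> \<le> n * (n * (n * (n * (b * (d * d))))) + n * (n * (b * (n * d * (n * d))))"
    proof -
      have "\<bar>\<Sum>i\<in>UNIV. \<Sum>j\<in>UNIV. \<Sum>k\<in>UNIV. \<Sum>l\<in>UNIV. matrix_inv (H x) $ i $ j *
        (conn_diff G H j x $ k $ l * conn_diff G H k x $ l $ i)\<bar> \<le> n * (n * (n * (n * (b * (d * d)))))"
        unfolding n_def
      proof (intro sum_abs_bound)
        fix i j k l
        show "\<bar>matrix_inv (H x) $ i $ j * (conn_diff G H j x $ k $ l * conn_diff G H k x $ l $ i)\<bar> \<le> b * (d * d)"
          unfolding abs_mult d_def using b d0 by (intro mult_mono bH D) (auto simp: d_def)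
      qed
      moreover have "\<bar>\<Sum>i\<in>UNIV. \<Sum>j\<in>UNIV. matrix_inv (H x) $ i $ j * (trace (conn_diff G H i x) * trace (conn_diff G H j x))\<bar>
         \<le> real CARD('n) * (real CARD('n) * (b * (n * d * (n * d))))"
      proof (intro sum_abs_bound)
        fix i j
        show "\<bar>matrix_inv (H x) $ i $ j * (trace (conn_diff G H i x) * trace (conn_diff G H j x))\<bar> \<le> b * (n * d * (n * d))"
          unfolding abs_mult using b n d0 by (intro mult_mono bH tr) auto
      qed
      ultimately show ?thesis unfolding quad_defect_def n_def by linarith
    qed
    also have "\<dots> = (n * (n * (n * (n * (b * (C1 * C1))))) + n * (n * (b * (n * C1 * (n * C1))))) * (\<tau> + N)\<^sup>2"
      by (simp add: d_def power2_eq_square algebra_simps)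
    finally show "\<bar>quad_defect G H x\<bar> \<le> (n * (n * (n * (n * (b * (C1 * C1))))) + n * (n * (b * (n * C1 * (n * C1)))))
        * (\<tau> + entry_sum (H x - G x))\<^sup>2" by (simp add: N_def)
  qed
qed

text \<open>The condition that defines the \<open>C\<^sup>2\<close>-neighbourhoods of a metric, for two matrix fields in a chart.\<close>

definition C2_close :: "(real^'n) set \<Rightarrow> real \<Rightarrow> (real^'n \<Rightarrow> real^'n^'n) \<Rightarrow> (real^'n \<Rightarrow> real^'n^'n) \<Rightarrow> bool"
  where "C2_close K \<epsilon> G H \<longleftrightarrow> (\<forall>x\<in>K. \<forall>i j. (let f = (\<lambda>y. H y $ i $ j - G y $ i $ j) in
     \<bar>f x\<bar> < \<epsilon> \<and> (\<forall>k. \<bar>partial k f x\<bar> < \<epsilon>) \<and> (\<forall>k l. \<bar>partial k (partial l f) x\<bar> < \<epsilon>)))"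

lemma sum_pair: "(\<Sum>p\<in>UNIV. f p) = (\<Sum>i\<in>UNIV. \<Sum>j\<in>UNIV. f (i, j))" for f :: "'a::finite \<times> 'b::finite \<Rightarrow> real"
  by (simp add: sum.cartesian_product UNIV_Times_UNIV)

lemma quadratic_form_axis_sum:
  "(axis a 1 + axis b 1) \<bullet> (B *v (axis a 1 + axis b 1)) = B $ a $ a + B $ b $ b + B $ a $ b + B $ b $ a"
  for B :: "real^'n^'n"
proof -
  have "axis c 1 \<bullet> (B *v axis d 1) = B $ c $ d" for c d
    by (simp add: inner_axis' matrix_vector_mul_component inner_axis)
  then show ?thesis by (simp add: matrix_vector_right_distrib inner_add_left inner_add_right)
qed

lemma inverse_metric_contraction:
  fixes G :: "real^'n \<Rightarrow> real^'n^'n"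
  assumes "metric_field S G" "x \<in> S"
  shows "(\<Sum>i\<in>UNIV. \<Sum>j\<in>UNIV. matrix_inv (G x) $ i $ j * G x $ i $ j) = real CARD('n)"
proof -
  have "(\<Sum>i\<in>UNIV. \<Sum>j\<in>UNIV. matrix_inv (G x) $ i $ j * G x $ i $ j) = trace (matrix_inv (G x) ** G x)"
    using metric_field_sym[OF assms] by (simp add: trace_def matrix_mult_nth)
  then show ?thesis by (simp add: metric_field_inv[OF assms] trace_I)
qed

text \<open>With \<open>E = H - G\<close> and \<open>t\<close> its \<open>G\<close>-trace, the hypothesis says that \<open>P = t G - E\<close> is positive
  semidefinite. Evaluating \<open>P\<close> on sums of two coordinate vectors gives nonnegative functions that are linear in \<open>E\<close>. They
  determine \<open>P\<close> by polarisation, and \<open>P\<close> determines \<open>E\<close> because its trace is \<open>(n - 1) t\<close>; this needs \<open>n \<ge> 2\<close>.\<close>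

lemma metric_gradient_bound:
  fixes G :: "real^'n \<Rightarrow> real^'n^'n"
  assumes MG: "metric_field S G" and r: "cball x0 (2 * r) \<subseteq> S" "r > 0" and n: "CARD('n) \<ge> 2"
  obtains C where "C > 0"
    "\<And>H \<epsilon> x i j k. \<epsilon> > 0 \<Longrightarrow> metric_field S H \<Longrightarrow> C2_close (cball x0 (2 * r)) \<epsilon> G H \<Longrightarrow>
     (\<And>y \<xi>. y \<in> cball x0 (2 * r) \<Longrightarrow> \<xi> \<bullet> ((H y - G y) *v \<xi>)
        \<le> (\<Sum>i\<in>UNIV. \<Sum>j\<in>UNIV. matrix_inv (G y) $ i $ j * (H y - G y) $ i $ j) * (\<xi> \<bullet> (G y *v \<xi>))) \<Longrightarrow>
     x \<in> cball x0 r \<Longrightarrow>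
     (partial k (\<lambda>y. H y $ i $ j - G y $ i $ j) x)\<^sup>2 \<le> C * \<epsilon> * entry_sum (H x - G x)"
proof -
  let ?K = "cball x0 (2 * r)"
  have S: "open S" using MG by (simp add: metric_field_def)
  have sG: "smooth_on (\<lambda>y. G y $ i $ j) S" for i j by (rule metric_field_component_smooth[OF MG])
  have sI: "smooth_on (\<lambda>y. matrix_inv (G y) $ i $ j) S" for i j
    using msmooth_inv[OF MG] by (simp add: msmooth_def)
  define A where "A a b p y = matrix_inv (G y) $ fst p $ snd p * G y $ a $ b - (if p = (a, b) then 1 else 0)"
    for a b :: 'n and p :: "'n \<times> 'n" and y
  define W where "W q p y = A (fst q) (fst q) p y + A (snd q) (snd q) p y + A (fst q) (snd q) p y + A (snd q) (fst q) p y"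
    for q p :: "'n \<times> 'n" and y
  \<comment> \<open>\<open>Y\<close> inverts the polarisation \<open>u(a,b) = P(a,a) + P(b,b) + P(a,b) + P(b,a)\<close>; on the diagonal \<open>u(a,a) = 4 P(a,a)\<close>.\<close>
  define Y :: "'n \<times> 'n \<Rightarrow> 'n \<times> 'n \<Rightarrow> real"
    where "Y p q = (if q = p then 1/2 else 0) - (if q = (fst p, fst p) then 1/8 else 0) - (if q = (snd p, snd p) then 1/8 else 0)" for p q
  \<comment> \<open>\<open>E = t G - P\<close> with \<open>t = tr P / (n - 1)\<close>.\<close>
  define Z where "Z p q y = (1 / (real CARD('n) - 1)) * (G y $ fst p $ snd p * (\<Sum>p'\<in>UNIV. matrix_inv (G y) $ fst p' $ snd p' * Y p' q)) - Y p q"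
    for p q :: "'n \<times> 'n" and y
  have sA: "smooth_on (A a b p) S" for a b p
    unfolding A_def by (intro smooth_on_diff smooth_on_mult smooth_on_const sG sI S)
  have sW: "smooth_on (W q p) S" for q p
    unfolding W_def by (intro smooth_on_add sA S)
  have sZ: "smooth_on (Z p q) S" for p q
    unfolding Z_def by (intro smooth_on_diff smooth_on_mult smooth_on_sum smooth_on_const sG sI S)
  have Ysum: "(\<Sum>q\<in>UNIV. Y p q * f q) = f p / 2 - f (fst p, fst p) / 8 - f (snd p, snd p) / 8" for p f
  proof -
    have d: "(\<Sum>q\<in>UNIV. (if q = p then c else 0) * f q) = c * f p" for p :: "'n \<times> 'n" and c :: real
      by (subst sum.cong[OF refl, of _ _ "\<lambda>q. if q = p then c * f q else 0"]) auto
    show ?thesis unfolding Y_def left_diff_distrib sum_subtractf d by simp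
  qed
  obtain C where C: "C > 0" and bound: "\<And>e \<epsilon> x i k. \<epsilon> > 0 \<Longrightarrow> (\<And>i. smooth_on (e i) S) \<Longrightarrow>
     (\<And>y i. y \<in> ?K \<Longrightarrow> \<bar>e i y\<bar> \<le> \<epsilon>) \<Longrightarrow>
     (\<And>y i k. y \<in> ?K \<Longrightarrow> \<bar>partial k (e i) y\<bar> \<le> \<epsilon>) \<Longrightarrow>
     (\<And>y i k. y \<in> ?K \<Longrightarrow> \<bar>partial k (partial k (e i)) y\<bar> \<le> \<epsilon>) \<Longrightarrow>
     (\<And>y i. y \<in> S \<Longrightarrow> e i y = (\<Sum>j\<in>UNIV. Z i j y * (\<Sum>i\<in>UNIV. W j i y * e i y))) \<Longrightarrow>
     (\<And>y j. y \<in> ?K \<Longrightarrow> 0 \<le> (\<Sum>i\<in>UNIV. W j i y * e i y)) \<Longrightarrow>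
     x \<in> cball x0 r \<Longrightarrow> (partial k (e i) x)\<^sup>2 \<le> C * \<epsilon> * (\<Sum>i\<in>UNIV. \<bar>e i x\<bar>)"
    using gradient_bound_linear_system[OF S r, of W Z, OF sW sZ] by blast
  show thesis
  proof (rule that[OF C])
    fix H \<epsilon> x and i j k :: 'n
    assume eps: "\<epsilon> > 0" and MH: "metric_field S H" and close: "C2_close ?K \<epsilon> G H"
      and cone: "\<And>y \<xi>. y \<in> ?K \<Longrightarrow> \<xi> \<bullet> ((H y - G y) *v \<xi>)
        \<le> (\<Sum>i\<in>UNIV. \<Sum>j\<in>UNIV. matrix_inv (G y) $ i $ j * (H y - G y) $ i $ j) * (\<xi> \<bullet> (G y *v \<xi>))"
      and x: "x \<in> cball x0 r"
    define e where "e p = (\<lambda>y. H y $ fst p $ snd p - G y $ fst p $ snd p)" for p :: "'n \<times> 'n"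
    define t where "t y = (\<Sum>p\<in>UNIV. matrix_inv (G y) $ fst p $ snd p * e p y)" for y
    define P where "P a b y = t y * G y $ a $ b - e (a, b) y" for a b y
    have se: "smooth_on (e p) S" for p
      unfolding e_def by (intro smooth_on_diff S sG metric_field_component_smooth[OF MH])
    have Asum: "(\<Sum>p\<in>UNIV. A a b p y * e p y) = P a b y" for a b y
    proof -
      have "(\<Sum>p\<in>UNIV. (if p = (a, b) then 1 else 0) * e p y) = e (a, b) y"
        by (subst sum.cong[OF refl, of _ _ "\<lambda>q. if q = (a,b) then e q y else 0"]) auto
      then show ?thesis
        by (simp add: A_def left_diff_distrib sum_subtractf P_def t_def sum_distrib_left sum_distrib_right algebra_simps)
    qed
    have Wsum: "(\<Sum>p\<in>UNIV. W q p y * e p y) = P (fst q) (fst q) y + P (snd q) (snd q) y + P (fst q) (snd q) y + P (snd q) (fst q) y" for q y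
      by (simp add: W_def distrib_right sum.distrib Asum)
    have Psym: "P a b y = P b a y" if "y \<in> S" for a b y
      using metric_field_sym[OF MG that] metric_field_sym[OF MH that] by (simp add: P_def e_def)
    have "(partial k (e (i, j)) x)\<^sup>2 \<le> C * \<epsilon> * (\<Sum>i\<in>UNIV. \<bar>e i x\<bar>)"
    proof (rule bound[OF eps se _ _ _ _ _ x])
      fix y p k assume y: "y \<in> ?K"
      show "\<bar>e p y\<bar> \<le> \<epsilon>" "\<bar>partial k (e p) y\<bar> \<le> \<epsilon>" "\<bar>partial k (partial k (e p)) y\<bar> \<le> \<epsilon>"
        using close y unfolding C2_close_def Let_def e_def by (auto intro: less_imp_le)
    next
      fix y q assume y: "y \<in> ?K"
      have "t y = (\<Sum>i\<in>UNIV. \<Sum>j\<in>UNIV. matrix_inv (G y) $ i $ j * (H y - G y) $ i $ j)"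
        by (simp add: t_def sum_pair e_def)
      then have "(axis a 1 + axis b 1) \<bullet> ((H y - G y) *v (axis a 1 + axis b 1)) \<le> t y * ((axis a 1 + axis b 1) \<bullet> (G y *v (axis a 1 + axis b 1)))" for a b
        using cone[OF y] by simp
      from this[of "fst q" "snd q", unfolded quadratic_form_axis_sum] show "0 \<le> (\<Sum>p\<in>UNIV. W q p y * e p y)"
        unfolding Wsum by (simp add: P_def e_def algebra_simps)
    next
      fix y p assume y: "y \<in> S"
      define U where "U q = (\<Sum>p\<in>UNIV. W q p y * e p y)" for q
      have YU: "(\<Sum>q\<in>UNIV. Y p q * U q) = P (fst p) (snd p) y" for p
        unfolding Ysum by (simp add: U_def Wsum Psym[OF y, of "snd p" "fst p"] add_divide_distrib)
      have "(\<Sum>q\<in>UNIV. (\<Sum>p'\<in>UNIV. matrix_inv (G y) $ fst p' $ snd p' * Y p' q) * U q)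
         = (\<Sum>p'\<in>UNIV. \<Sum>q\<in>UNIV. matrix_inv (G y) $ fst p' $ snd p' * (Y p' q * U q))"
        by (subst sum.swap) (simp add: sum_distrib_right mult.assoc)
      also have "\<dots> = (\<Sum>p'\<in>UNIV. matrix_inv (G y) $ fst p' $ snd p' * P (fst p') (snd p') y)"
        by (simp add: sum_distrib_left[symmetric] YU)
      also have "\<dots> = t y * (\<Sum>p\<in>UNIV. matrix_inv (G y) $ fst p $ snd p * G y $ fst p $ snd p) - t y"
        by (simp add: P_def right_diff_distrib sum_subtractf t_def sum_distrib_left algebra_simps)
      also have "(\<Sum>p\<in>UNIV. matrix_inv (G y) $ fst p $ snd p * G y $ fst p $ snd p) = real CARD('n)"
        using inverse_metric_contraction[OF MG y] by (simp add: sum_pair)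
      finally have tr: "(\<Sum>q\<in>UNIV. (\<Sum>p'\<in>UNIV. matrix_inv (G y) $ fst p' $ snd p' * Y p' q) * U q)
         = (real CARD('n) - 1) * t y" by (simp add: algebra_simps)
      have "(\<Sum>q\<in>UNIV. Z p q y * U q) = (1 / (real CARD('n) - 1)) * (G y $ fst p $ snd p *
         (\<Sum>q\<in>UNIV. (\<Sum>p'\<in>UNIV. matrix_inv (G y) $ fst p' $ snd p' * Y p' q) * U q)) - (\<Sum>q\<in>UNIV. Y p q * U q)"
        by (simp only: Z_def left_diff_distrib sum_subtractf mult.assoc sum_distrib_left[symmetric])
      also have "\<dots> = G y $ fst p $ snd p * t y - P (fst p) (snd p) y"
        using n unfolding tr YU by simp
      also have "\<dots> = e p y" by (simp add: P_def)
      finally show "e p y = (\<Sum>q\<in>UNIV. Z p q y * (\<Sum>p\<in>UNIV. W q p y * e p y))" by (simp add: U_def)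
    qed
    then show "(partial k (\<lambda>y. H y $ i $ j - G y $ i $ j) x)\<^sup>2 \<le> C * \<epsilon> * entry_sum (H x - G x)"
      by (simp add: e_def sum_pair entry_sum_def)
  qed
qed

text \<open>The point of the local analysis. The Ricci term of the decomposition is at most \<open>- c0 \<bar>H - G\<bar>\<close>, whereas the
  quadratic term is bounded by \<open>\<bar>\<partial>(H - G)\<bar>\<^sup>2 + \<bar>H - G\<bar>\<^sup>2\<close>, hence by the gradient estimate by a multiple of
  \<open>\<epsilon> \<bar>H - G\<bar>\<close>. For small \<open>\<epsilon>\<close> the first wins at every point, and only the divergence remains. The predicate \<open>Q\<close>
  stands for either of the two ways in which \<open>H\<close> can be larger than \<open>G\<close>.\<close>

lemma scalar_le_plus_divergence:
  fixes G :: "real^'n \<Rightarrow> real^'n^'n"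
  assumes MG: "metric_field S G" and r: "cball x0 (2 * r) \<subseteq> S" "r > 0" and n: "CARD('n) \<ge> 2"
    and c0: "c0 > 0" and e0: "\<epsilon>0 > 0"
    and main: "\<And>x B. x \<in> cball x0 (2 * r) \<Longrightarrow> posdef B \<Longrightarrow> (\<And>i j. \<bar>(B - G x) $ i $ j\<bar> \<le> \<epsilon>0) \<Longrightarrow> Q x B \<Longrightarrow>
       (\<Sum>i\<in>UNIV. \<Sum>j\<in>UNIV. matrix_inv B $ i $ j * Ric G x $ i $ j)
       \<le> (\<Sum>i\<in>UNIV. \<Sum>j\<in>UNIV. matrix_inv (G x) $ i $ j * Ric G x $ i $ j) - c0 * entry_sum (B - G x)"
    and cone: "\<And>x B \<xi>. x \<in> cball x0 (2 * r) \<Longrightarrow> posdef B \<Longrightarrow> Q x B \<Longrightarrow> \<xi> \<bullet> ((B - G x) *v \<xi>)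
       \<le> (\<Sum>i\<in>UNIV. \<Sum>j\<in>UNIV. matrix_inv (G x) $ i $ j * (B - G x) $ i $ j) * (\<xi> \<bullet> (G x *v \<xi>))"
  obtains \<epsilon> where "\<epsilon> > 0" "\<And>H x. metric_field S H \<Longrightarrow> C2_close (cball x0 (2 * r)) \<epsilon> G H \<Longrightarrow>
     (\<And>y. y \<in> cball x0 (2 * r) \<Longrightarrow> Q y (H y)) \<Longrightarrow> x \<in> cball x0 r \<Longrightarrow>
     scalar_coord H x \<le> scalar_coord G x + divergence G (defect_field G H) x"
proof -
  let ?K = "cball x0 (2 * r)"
  obtain C \<epsilon>1 where C: "C > 0" "\<epsilon>1 > 0" and quad:
    "\<And>H x \<tau>. metric_field S H \<Longrightarrow> x \<in> ?K \<Longrightarrow> (\<And>i j. \<bar>(H x - G x) $ i $ j\<bar> \<le> \<epsilon>1) \<Longrightarrow>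
      (\<And>i j k. \<bar>partial k (\<lambda>y. H y $ i $ j - G y $ i $ j) x\<bar> \<le> \<tau>) \<Longrightarrow>
      \<bar>quad_defect G H x\<bar> \<le> C * (\<tau> + entry_sum (H x - G x))\<^sup>2"
    by (rule quad_defect_bound[OF MG compact_cball r(1)]) blast
  obtain C' where C': "C' > 0" and grad:
    "\<And>H \<epsilon> x i j k. \<epsilon> > 0 \<Longrightarrow> metric_field S H \<Longrightarrow> C2_close ?K \<epsilon> G H \<Longrightarrow>
     (\<And>y \<xi>. y \<in> ?K \<Longrightarrow> \<xi> \<bullet> ((H y - G y) *v \<xi>)
        \<le> (\<Sum>i\<in>UNIV. \<Sum>j\<in>UNIV. matrix_inv (G y) $ i $ j * (H y - G y) $ i $ j) * (\<xi> \<bullet> (G y *v \<xi>))) \<Longrightarrow>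
     x \<in> cball x0 r \<Longrightarrow>
     (partial k (\<lambda>y. H y $ i $ j - G y $ i $ j) x)\<^sup>2 \<le> C' * \<epsilon> * entry_sum (H x - G x)"
    by (rule metric_gradient_bound[OF MG r n]) blast
  define m where "m = real CARD('n) * real CARD('n)"
  have m: "m > 0" by (simp add: m_def)
  define L where "L = C * (2 * C' + 2 * m)"
  have L: "L > 0" using C C' m by (simp add: L_def add_pos_pos)
  define \<epsilon> where "\<epsilon> = min (min \<epsilon>0 \<epsilon>1) (c0 / L)"
  have eps: "\<epsilon> > 0" "\<epsilon> \<le> \<epsilon>0" "\<epsilon> \<le> \<epsilon>1" using c0 e0 C L by (auto simp: \<epsilon>_def)
  have epsL: "L * \<epsilon> \<le> c0"
  proof -
    have "\<epsilon> \<le> c0 / L" by (simp add: \<epsilon>_def)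
    then show ?thesis using L by (simp add: pos_le_divide_eq mult.commute)
  qed
  show thesis
  proof (rule that[OF eps(1)])
    fix H x assume MH: "metric_field S H" and close: "C2_close ?K \<epsilon> G H"
      and Q: "\<And>y. y \<in> ?K \<Longrightarrow> Q y (H y)" and x: "x \<in> cball x0 r"
    have xK: "x \<in> ?K" using x r(2) by simp
    have xS: "x \<in> S" using xK r by blast
    have pdH: "posdef (H y)" if "y \<in> ?K" for y using MH r that by (auto simp: metric_field_def)
    have small: "\<bar>(H x - G x) $ i $ j\<bar> \<le> \<epsilon>" for i j
      using close xK unfolding C2_close_def Let_def by (simp add: less_imp_le)
    define N where "N = entry_sum (H x - G x)"
    have N: "0 \<le> N" "N \<le> m * \<epsilon>"
      using entry_sum_nonneg entry_sum_le[OF small] by (auto simp: N_def m_def mult.assoc)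
    define \<tau> where "\<tau> = sqrt (C' * \<epsilon> * N)"
    have "(partial k (\<lambda>y. H y $ i $ j - G y $ i $ j) x)\<^sup>2 \<le> C' * \<epsilon> * N" for i j k
      unfolding N_def by (rule grad[OF eps(1) MH close cone[OF _ pdH Q] x])
    then have "sqrt ((partial k (\<lambda>y. H y $ i $ j - G y $ i $ j) x)\<^sup>2) \<le> \<tau>" for i j k
      unfolding \<tau>_def by (rule real_sqrt_le_mono)
    then have "\<bar>partial k (\<lambda>y. H y $ i $ j - G y $ i $ j) x\<bar> \<le> \<tau>" for i j k by simp
    then have "\<bar>quad_defect G H x\<bar> \<le> C * (\<tau> + N)\<^sup>2"
      unfolding N_def by (intro quad[OF MH xK]) (use small eps order_trans in blast)+
    also have "\<dots> \<le> C * (2 * \<tau>\<^sup>2 + 2 * N\<^sup>2)"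
      using zero_le_power2[of "\<tau> - N"] C unfolding power2_sum power2_diff
      by (intro mult_left_mono) auto
    also have "\<tau>\<^sup>2 = C' * \<epsilon> * N" using C' eps N by (simp add: \<tau>_def)
    also have "C * (2 * (C' * \<epsilon> * N) + 2 * N\<^sup>2) \<le> C * (2 * (C' * \<epsilon> * N) + 2 * (m * \<epsilon> * N))"
      using C N by (intro mult_left_mono add_left_mono) (auto simp: power2_eq_square intro: mult_right_mono)
    also have "\<dots> = (L * \<epsilon>) * N" by (simp add: L_def algebra_simps)
    also have "\<dots> \<le> c0 * N" using epsL N by (intro mult_right_mono) auto
    finally have "quad_defect G H x \<le> c0 * N" by simp
    moreover have "(\<Sum>i\<in>UNIV. \<Sum>j\<in>UNIV. matrix_inv (H x) $ i $ j * Ric G x $ i $ j)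
       \<le> (\<Sum>i\<in>UNIV. \<Sum>j\<in>UNIV. matrix_inv (G x) $ i $ j * Ric G x $ i $ j) - c0 * N"
      unfolding N_def by (rule main[OF xK pdH[OF xK] _ Q[OF xK]]) (use small eps order_trans in blast)
    moreover have "scalar_coord G x = (\<Sum>i\<in>UNIV. \<Sum>j\<in>UNIV. matrix_inv (G x) $ i $ j * Ric G x $ i $ j)"
      by (simp add: scalar_coord_def Ric_def)
    ultimately show "scalar_coord H x \<le> scalar_coord G x + divergence G (defect_field G H) x"
      unfolding scalar_curvature_decomposition[OF MG MH xS] by linarith
  qed
qed

section \<open>Metrics that are larger on vectors or on bivectors\<close>

lemma smooth_Ric:
  assumes MG: "metric_field S G" shows "smooth_on (\<lambda>x. Ric G x $ i $ j) S"
proof -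
  have S: "open S" using MG by (simp add: metric_field_def)
  have g: "smooth_on (\<lambda>x. Gam G k x $ a $ b) S" for k a b
    using msmooth_Gam[OF MG] by (simp add: msmooth_def)
  have dg: "smooth_on (\<lambda>x. mpartial l (Gam G k) x $ a $ b) S" for k l a b
    using msmooth_partial[OF msmooth_Gam[OF MG]] by (simp add: msmooth_def)
  have "smooth_on (\<lambda>x. \<Sum>k\<in>UNIV. mpartial k (Gam G j) x $ k $ i - mpartial j (Gam G k) x $ k $ i
      + (\<Sum>l\<in>UNIV. Gam G k x $ k $ l * Gam G j x $ l $ i) - (\<Sum>l\<in>UNIV. Gam G j x $ k $ l * Gam G k x $ l $ i)) S"
    by (intro smooth_on_sum smooth_on_add smooth_on_diff smooth_on_mult g dg S)
  then show ?thesis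
    by (rule smooth_on_cong[OF S, rotated]) (simp add: Ric_curv[OF MG] curv_def matrix_mult_nth)
qed

lemma smooth_scalar:
  assumes MG: "metric_field S G" shows "smooth_on (scalar_coord G) S"
proof -
  have S: "open S" using MG by (simp add: metric_field_def)
  have "smooth_on (\<lambda>y. matrix_inv (G y) $ i $ j) S" for i j
    using msmooth_inv[OF MG] by (simp add: msmooth_def)
  then have "smooth_on (\<lambda>x. \<Sum>i\<in>UNIV. \<Sum>j\<in>UNIV. matrix_inv (G x) $ i $ j * Ric G x $ i $ j) S"
    by (intro smooth_on_sum smooth_on_mult smooth_Ric[OF MG] S)
  then show ?thesis by (simp add: scalar_coord_def[abs_def] Ric_def)
qed

text \<open>On a curve there is no curvature. Positive Ricci curvature therefore forces dimension at least two.\<close>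

lemma Ric_dimension_one:
  fixes G :: "real^'n \<Rightarrow> real^'n^'n"
  assumes "CARD('n) = 1" shows "Ric G x = 0"
proof -
  obtain a where a: "(UNIV :: 'n set) = {a}" using assms by (rule card_1_singletonE)
  then have "i = a" for i by auto
  then have "ricci_coord G i j x = 0" for i j
    unfolding ricci_coord_def a by (metis (mono_tags, lifting) diff_self sum.neutral add_0 )
  then show ?thesis by (simp add: Ric_def vec_eq_iff)
qed

text \<open>The Euclidean length of \<open>G\<close>-unit vectors is bounded below on \<open>K\<close>.\<close>

lemma frame_lower_bound:
  fixes G R :: "real^'n \<Rightarrow> real^'n^'n"
  assumes MG: "metric_field S G" and K: "compact K" "K \<subseteq> S"
    and c: "\<And>i j. continuous_on K (\<lambda>x. R x $ i $ j)"
    and pos: "\<And>x \<xi>. x \<in> K \<Longrightarrow> \<xi> \<noteq> 0 \<Longrightarrow> 0 < \<xi> \<bullet> (R x *v \<xi>)"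
  obtains m where "m > 0" "\<And>x B V \<theta> k. x \<in> K \<Longrightarrow> common_frame (G x) B V \<theta> \<Longrightarrow> m \<le> V $ k \<bullet> (R x *v (V $ k))"
proof -
  have cG: "continuous_on K (\<lambda>x. G x $ i $ j)" for i j
    using continuous_on_subset[OF smooth_on_continuous[OF metric_field_component_smooth[OF MG]] K(2)] .
  obtain \<beta> where \<beta>: "\<beta> > 0" "\<And>p x. p \<in> UNIV \<Longrightarrow> x \<in> K \<Longrightarrow> \<bar>(\<lambda>_::unit. (\<lambda>x. entry_sum (G x))) p x\<bar> \<le> \<beta>"
    by (rule finite_family_bound[of K UNIV "\<lambda>_::unit. (\<lambda>x. entry_sum (G x))"])
      (use K in \<open>auto simp: entry_sum_def intro!: continuous_intros cG\<close>)
  obtain m where m: "m > 0" "\<And>x \<xi>. x \<in> K \<Longrightarrow> m * (norm \<xi>)\<^sup>2 \<le> \<xi> \<bullet> (R x *v \<xi>)"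
    using uniformly_positive[OF K(1) c pos] by blast
  show thesis
  proof (rule that[of "m / \<beta>"])
    show "m / \<beta> > 0" using m \<beta> by simp
    fix x B V \<theta> k assume x: "x \<in> K" and f: "common_frame (G x) B V \<theta>"
    have "1 = V $ k \<bullet> (G x *v (V $ k))" using f by (simp add: common_frame_def)
    also have "\<dots> \<le> entry_sum (G x) * (norm (V $ k))\<^sup>2" using quadratic_form_bound[of "V $ k" "G x"] by simp
    also have "\<dots> \<le> \<beta> * (norm (V $ k))\<^sup>2" using \<beta>(2)[OF _ x, of "()"] by (intro mult_right_mono) auto
    finally have "m / \<beta> * 1 \<le> m / \<beta> * (\<beta> * (norm (V $ k))\<^sup>2)" using m \<beta> by (intro mult_left_mono) auto
    also have "\<dots> = m * (norm (V $ k))\<^sup>2" using \<beta> by simp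
    also have "\<dots> \<le> V $ k \<bullet> (R x *v (V $ k))" by (rule m(2)[OF x])
    finally show "m / \<beta> \<le> V $ k \<bullet> (R x *v (V $ k))" by simp
  qed
qed

lemma frame_upper_bounds:
  fixes G R :: "real^'n \<Rightarrow> real^'n^'n"
  assumes MG: "metric_field S G" and K: "compact K" "K \<subseteq> S"
    and cR: "\<And>i j. continuous_on K (\<lambda>x. R x $ i $ j)"
  obtains D where "D > 0"
    "\<And>x B V \<theta> k. x \<in> K \<Longrightarrow> common_frame (G x) B V \<theta> \<Longrightarrow> V $ k \<bullet> (R x *v (V $ k)) \<le> D"
    "\<And>x B V \<theta> k. x \<in> K \<Longrightarrow> common_frame (G x) B V \<theta> \<Longrightarrow> \<bar>\<theta> k\<bar> \<le> D * entry_sum (B - G x)"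
    "\<And>x B V \<theta>. x \<in> K \<Longrightarrow> common_frame (G x) B V \<theta> \<Longrightarrow> entry_sum (B - G x) \<le> D * (\<Sum>k\<in>UNIV. \<bar>\<theta> k\<bar>)"
proof -
  have cG: "continuous_on K (\<lambda>x. G x $ i $ j)" for i j
    using continuous_on_subset[OF smooth_on_continuous[OF metric_field_component_smooth[OF MG]] K(2)] .
  have pd: "posdef (G x)" if "x \<in> K" for x using MG K that by (auto simp: metric_field_def)
  obtain \<beta> where \<beta>: "\<beta> > 0" "\<And>p x. p \<in> UNIV \<Longrightarrow> x \<in> K \<Longrightarrow> \<bar>(\<lambda>b. if b then (\<lambda>x. entry_sum (G x)) else (\<lambda>x. entry_sum (R x))) p x\<bar> \<le> \<beta>"
    by (rule finite_family_bound[of K UNIV "\<lambda>b. if b then (\<lambda>x. entry_sum (G x)) else (\<lambda>x. entry_sum (R x))"])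
      (use K in \<open>auto simp: entry_sum_def intro!: continuous_intros cG cR\<close>)
  have bG: "entry_sum (G x) \<le> \<beta>" and bR: "entry_sum (R x) \<le> \<beta>" if "x \<in> K" for x
    using \<beta>(2)[OF UNIV_I that, of True] \<beta>(2)[OF UNIV_I that, of False] by auto
  obtain m where m: "m > 0" "\<And>x \<xi>. x \<in> K \<Longrightarrow> m * (norm \<xi>)\<^sup>2 \<le> \<xi> \<bullet> (G x *v \<xi>)"
    by (rule uniformly_positive[of K G]) (use K pd cG in \<open>auto simp: posdef_def\<close>)
  define n where "n = real CARD('n)"
  have n: "n > 0" by (simp add: n_def)
  have nv: "(norm (V $ k))\<^sup>2 \<le> 1 / m" if "x \<in> K" "common_frame (G x) B V \<theta>" for x B V \<theta> k
  proof -
    have "m * (norm (V $ k))\<^sup>2 \<le> 1" using m(2)[OF that(1), of "V $ k"] that(2) by (simp add: common_frame_def)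
    then show ?thesis using m(1) by (simp add: field_simps)
  qed
  have qf: "\<bar>V $ k \<bullet> (E *v (V $ k))\<bar> \<le> entry_sum E * (1 / m)" if "x \<in> K" "common_frame (G x) B V \<theta>" for x B V \<theta> k E
    using quadratic_form_bound[of "V $ k" E] mult_left_mono[OF nv[OF that, of k] entry_sum_nonneg[of E]] by linarith
  define D where "D = \<beta> * (1 / m) + 1 / m + n * (n * (\<beta> * \<beta> * (1 / m)))"
  have Dp: "0 \<le> \<beta> * (1 / m)" "0 < 1 / m" "0 \<le> n * (n * (\<beta> * \<beta> * (1 / m)))" using \<beta> m n by auto
  show thesis
  proof (rule that[of D])
    show "D > 0" using Dp unfolding D_def by linarith
  next
    fix x B V \<theta> k assume x: "x \<in> K" and f: "common_frame (G x) B V \<theta>"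
    have "V $ k \<bullet> (R x *v (V $ k)) \<le> entry_sum (R x) * (1 / m)" using qf[OF x f, of k "R x"] by linarith
    also have "\<dots> \<le> \<beta> * (1 / m)" using bR[OF x] m(1) by (intro mult_right_mono) auto
    finally show "V $ k \<bullet> (R x *v (V $ k)) \<le> D" using Dp unfolding D_def by linarith
  next
    fix x B V \<theta> k assume x: "x \<in> K" and f: "common_frame (G x) B V \<theta>"
    have "\<theta> k = V $ k \<bullet> ((B - G x) *v (V $ k))"
      using f by (simp add: common_frame_def matrix_vector_mult_diff_rdistrib inner_diff_right)
    then have "\<bar>\<theta> k\<bar> \<le> (1 / m) * entry_sum (B - G x)" using qf[OF x f, of k "B - G x"] by simp
    also have "\<dots> \<le> D * entry_sum (B - G x)"
      using Dp entry_sum_nonneg unfolding D_def by (intro mult_right_mono) auto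
    finally show "\<bar>\<theta> k\<bar> \<le> D * entry_sum (B - G x)" .
  next
    fix x B V \<theta> assume x: "x \<in> K" and f: "common_frame (G x) B V \<theta>"
    have sym: "transpose (G x) = G x" using pd[OF x] by (simp add: posdef_def)
    have Gv: "\<bar>(G x *v (V $ k)) $ i\<bar> \<le> \<beta> * norm (V $ k)" for k i
    proof -
      have "\<bar>(G x *v (V $ k)) $ i\<bar> \<le> (\<Sum>j\<in>UNIV. \<bar>G x $ i $ j\<bar> * norm (V $ k))"
        unfolding matrix_vector_mult_def
        by (simp, intro order_trans[OF sum_abs] sum_mono) (auto simp: abs_mult intro!: mult_left_mono component_le_norm_cart)
      also have "\<dots> \<le> entry_sum (G x) * norm (V $ k)"
        unfolding sum_distrib_right[symmetric] entry_sum_def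
        by (intro mult_right_mono member_le_sum) (auto simp: sum_nonneg)
      also have "\<dots> \<le> \<beta> * norm (V $ k)" using bG[OF x] by (intro mult_right_mono) auto
      finally show ?thesis .
    qed
    have "\<bar>(B - G x) $ i $ j\<bar> \<le> \<beta> * \<beta> * (1 / m) * (\<Sum>k\<in>UNIV. \<bar>\<theta> k\<bar>)" for i j
    proof -
      have "\<bar>(B - G x) $ i $ j\<bar> \<le> (\<Sum>k\<in>UNIV. \<bar>\<theta> k\<bar> * (\<beta> * \<beta> * (1 / m)))"
        unfolding common_frame_diff[OF f sym]
      proof (intro order_trans[OF sum_abs] sum_mono)
        fix k
        have "\<bar>(G x *v (V $ k)) $ i\<bar> * \<bar>(G x *v (V $ k)) $ j\<bar> \<le> (\<beta> * norm (V $ k)) * (\<beta> * norm (V $ k))"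
          using \<beta> by (intro mult_mono Gv) auto
        also have "\<dots> = \<beta> * \<beta> * (norm (V $ k))\<^sup>2" by (simp add: power2_eq_square)
        also have "\<dots> \<le> \<beta> * \<beta> * (1 / m)" using nv[OF x f, of k] by (intro mult_left_mono) auto
        finally show "\<bar>\<theta> k * (G x *v (V $ k)) $ i * (G x *v (V $ k)) $ j\<bar> \<le> \<bar>\<theta> k\<bar> * (\<beta> * \<beta> * (1 / m))"
          unfolding abs_mult mult.assoc by (intro mult_left_mono) auto
      qed
      then show ?thesis by (simp add: sum_distrib_left mult.commute)
    qed
    then have "entry_sum (B - G x) \<le> n * (n * (\<beta> * \<beta> * (1 / m) * (\<Sum>k\<in>UNIV. \<bar>\<theta> k\<bar>)))"
      unfolding n_def by (rule entry_sum_le)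
    also have "\<dots> = n * (n * (\<beta> * \<beta> * (1 / m))) * (\<Sum>k\<in>UNIV. \<bar>\<theta> k\<bar>)" by (simp add: mult.assoc)
    also have "\<dots> \<le> D * (\<Sum>k\<in>UNIV. \<bar>\<theta> k\<bar>)"
      using Dp unfolding D_def by (intro mult_right_mono) (auto simp: sum_nonneg)
    finally show "entry_sum (B - G x) \<le> D * (\<Sum>k\<in>UNIV. \<bar>\<theta> k\<bar>)" .
  qed
qed

text \<open>In a common frame \<open>t G - E\<close> is diagonal with the entries \<open>\<Sum>\<theta> - \<theta>\<^sub>k\<close>.\<close>

lemma cone_from_frame:
  assumes f: "common_frame G B V \<theta>" and tr: "\<And>k. \<theta> k \<le> (\<Sum>j\<in>UNIV. \<theta> j)"
  shows "\<xi> \<bullet> ((B - G) *v \<xi>) \<le> (\<Sum>i\<in>UNIV. \<Sum>j\<in>UNIV. matrix_inv G $ i $ j * (B - G) $ i $ j) * (\<xi> \<bullet> (G *v \<xi>))"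
proof -
  obtain \<eta> where \<eta>: "\<xi> \<bullet> (G *v \<xi>) = (\<Sum>k\<in>UNIV. (\<eta> k)\<^sup>2)" "\<xi> \<bullet> ((B - G) *v \<xi>) = (\<Sum>k\<in>UNIV. \<theta> k * (\<eta> k)\<^sup>2)"
    by (rule common_frame_expand[OF f, of \<xi>])
  have "V $ k \<bullet> ((B - G) *v (V $ k)) = \<theta> k" for k
    using f by (simp add: common_frame_def matrix_vector_mult_diff_rdistrib inner_diff_right)
  then show ?thesis
    unfolding \<eta> common_frame_trace(1)[OF f]
    by (simp add: sum_distrib_left) (intro sum_mono mult_right_mono tr zero_le_power2)
qed

lemma length_estimate:
  fixes G :: "real^'n \<Rightarrow> real^'n^'n"
  assumes MG: "metric_field S G" and r: "cball x0 (2 * r) \<subseteq> S" "r > 0"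
    and pos: "\<And>x \<xi>. x \<in> S \<Longrightarrow> \<xi> \<noteq> 0 \<Longrightarrow> 0 < \<xi> \<bullet> (Ric G x *v \<xi>)"
  obtains \<epsilon> where "\<epsilon> > 0" "\<And>H x. metric_field S H \<Longrightarrow> C2_close (cball x0 (2 * r)) \<epsilon> G H \<Longrightarrow>
     (\<And>y \<xi>. y \<in> cball x0 (2 * r) \<Longrightarrow> \<xi> \<bullet> (G y *v \<xi>) \<le> \<xi> \<bullet> (H y *v \<xi>)) \<Longrightarrow> x \<in> cball x0 r \<Longrightarrow>
     scalar_coord H x \<le> scalar_coord G x + divergence G (defect_field G H) x"
proof -
  let ?K = "cball x0 (2 * r)"
  have x0: "x0 \<in> ?K" "x0 \<in> S" using r by auto
  have "CARD('n) \<noteq> 1" using pos[OF x0(2), of "axis undefined 1"] Ric_dimension_one[of G x0] by auto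
  moreover have "CARD('n) > 0" by simp
  ultimately have n: "CARD('n) \<ge> 2" by linarith
  have cR: "continuous_on ?K (\<lambda>x. Ric G x $ i $ j)" for i j
    using continuous_on_subset[OF smooth_on_continuous[OF smooth_Ric[OF MG]] r(1)] .
  obtain c where c: "c > 0" "\<And>x B V \<theta> k. x \<in> ?K \<Longrightarrow> common_frame (G x) B V \<theta> \<Longrightarrow> c \<le> V $ k \<bullet> (Ric G x *v (V $ k))"
    using frame_lower_bound[OF MG compact_cball r(1) cR] pos r(1) by (metis subsetD)
  obtain D where D: "D > 0"
    "\<And>x B V \<theta> k. x \<in> ?K \<Longrightarrow> common_frame (G x) B V \<theta> \<Longrightarrow> V $ k \<bullet> (Ric G x *v (V $ k)) \<le> D"
    "\<And>x B V \<theta> k. x \<in> ?K \<Longrightarrow> common_frame (G x) B V \<theta> \<Longrightarrow> \<bar>\<theta> k\<bar> \<le> D * entry_sum (B - G x)"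
    "\<And>x B V \<theta>. x \<in> ?K \<Longrightarrow> common_frame (G x) B V \<theta> \<Longrightarrow> entry_sum (B - G x) \<le> D * (\<Sum>k\<in>UNIV. \<bar>\<theta> k\<bar>)"
    using frame_upper_bounds[OF MG compact_cball r(1) cR] by blast
  define m where "m = real CARD('n) * real CARD('n)"
  have m: "m > 0" by (simp add: m_def)
  define Q where "Q x B \<longleftrightarrow> (\<forall>\<xi>. \<xi> \<bullet> (G x *v \<xi>) \<le> \<xi> \<bullet> (B *v \<xi>))" for x B
  have Qpos: "0 \<le> \<theta> k" if "Q x B" "common_frame (G x) B V \<theta>" for x B V \<theta> k
    using that unfolding Q_def common_frame_def by (metis add_le_cancel_left add_0_right)
  have pd: "posdef (G x)" if "x \<in> ?K" for x using MG r that by (auto simp: metric_field_def)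
  obtain \<epsilon> where "\<epsilon> > 0" and E: "\<And>H x. metric_field S H \<Longrightarrow> C2_close ?K \<epsilon> G H \<Longrightarrow>
     (\<And>y. y \<in> ?K \<Longrightarrow> Q y (H y)) \<Longrightarrow> x \<in> cball x0 r \<Longrightarrow>
     scalar_coord H x \<le> scalar_coord G x + divergence G (defect_field G H) x"
  proof (rule scalar_le_plus_divergence[OF MG r n, of "c / (2 * D)" "1 / (D * m)" Q])
    show "c / (2 * D) > 0" "1 / (D * m) > 0" using c D m by auto
  next
    fix x B assume x: "x \<in> ?K" and B: "posdef B" and small: "\<And>i j. \<bar>(B - G x) $ i $ j\<bar> \<le> 1 / (D * m)" and Q: "Q x B"
    obtain V \<theta> where f: "common_frame (G x) B V \<theta>" using common_frame_exists[OF pd[OF x] B] by blast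
    have "entry_sum (B - G x) \<le> 1 / D"
      using entry_sum_le[OF small] m by (simp add: m_def)
    then have "D * entry_sum (B - G x) \<le> 1" using D(1) by (simp add: field_simps)
    then have t1: "\<theta> k \<le> 1" for k using D(3)[OF x f, of k] by linarith
    have "(\<Sum>k\<in>UNIV. (V $ k \<bullet> (Ric G x *v (V $ k))) / (1 + \<theta> k)) - (\<Sum>k\<in>UNIV. V $ k \<bullet> (Ric G x *v (V $ k)))
       \<le> - (c/2) * (\<Sum>k\<in>UNIV. \<bar>\<theta> k\<bar>)"
      by (rule first_variation_length[OF c(2)[OF x f] c(1) Qpos[OF Q f] t1])
    also have "\<dots> \<le> - (c / (2 * D)) * entry_sum (B - G x)"
    proof -
      have "(c / (2 * D)) * entry_sum (B - G x) \<le> (c / (2 * D)) * (D * (\<Sum>k\<in>UNIV. \<bar>\<theta> k\<bar>))"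
        using c D(1) D(4)[OF x f] by (intro mult_left_mono) auto
      then show ?thesis using D(1) by simp
    qed
    finally show "(\<Sum>i\<in>UNIV. \<Sum>j\<in>UNIV. matrix_inv B $ i $ j * Ric G x $ i $ j)
       \<le> (\<Sum>i\<in>UNIV. \<Sum>j\<in>UNIV. matrix_inv (G x) $ i $ j * Ric G x $ i $ j) - c / (2 * D) * entry_sum (B - G x)"
      unfolding common_frame_trace[OF f] by simp
  next
    fix x B and \<xi> :: "real^'n" assume x: "x \<in> ?K" and B: "posdef B" and Q: "Q x B"
    obtain V \<theta> where f: "common_frame (G x) B V \<theta>" using common_frame_exists[OF pd[OF x] B] by blast
    have "\<theta> k \<le> (\<Sum>j\<in>UNIV. \<theta> j)" for k using Qpos[OF Q f] by (intro member_le_sum) auto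
    then show "\<xi> \<bullet> ((B - G x) *v \<xi>)
       \<le> (\<Sum>i\<in>UNIV. \<Sum>j\<in>UNIV. matrix_inv (G x) $ i $ j * (B - G x) $ i $ j) * (\<xi> \<bullet> (G x *v \<xi>))"
      by (rule cone_from_frame[OF f])
  qed blast
  then show thesis using that[of \<epsilon>] unfolding Q_def by blast
qed

text \<open>The squared area of the parallelogram spanned by \<open>\<xi>\<close> and \<open>\<zeta>\<close>.\<close>

definition area_form :: "real^'n^'n \<Rightarrow> real^'n \<Rightarrow> real^'n \<Rightarrow> real"
  where "area_form B \<xi> \<zeta> = (\<xi> \<bullet> (B *v \<xi>)) * (\<zeta> \<bullet> (B *v \<zeta>)) - (\<xi> \<bullet> (B *v \<zeta>))\<^sup>2"

text \<open>Summing \<open>2\<rho>\<^sub>k < \<kappa>\<close> over a frame gives \<open>2\<kappa> < n\<kappa>\<close> with \<open>\<kappa> > 0\<close>, so the hypotheses force \<open>n \<ge> 3\<close>, as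
  the positivity of \<open>t G - E\<close> requires.\<close>

lemma area_estimate:
  fixes G :: "real^'n \<Rightarrow> real^'n^'n"
  assumes MG: "metric_field S G" and r: "cball x0 (2 * r) \<subseteq> S" "r > 0"
    and pos: "\<And>x \<xi>. x \<in> S \<Longrightarrow> \<xi> \<noteq> 0 \<Longrightarrow> 0 < \<xi> \<bullet> (Ric G x *v \<xi>)"
    and neg: "\<And>x \<xi>. x \<in> S \<Longrightarrow> \<xi> \<noteq> 0 \<Longrightarrow> 2 * (\<xi> \<bullet> (Ric G x *v \<xi>)) - scalar_coord G x * (\<xi> \<bullet> (G x *v \<xi>)) < 0"
  obtains \<epsilon> where "\<epsilon> > 0" "\<And>H x. metric_field S H \<Longrightarrow> C2_close (cball x0 (2 * r)) \<epsilon> G H \<Longrightarrow>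
     (\<And>y \<xi> \<zeta>. y \<in> cball x0 (2 * r) \<Longrightarrow> area_form (G y) \<xi> \<zeta> \<le> area_form (H y) \<xi> \<zeta>) \<Longrightarrow> x \<in> cball x0 r \<Longrightarrow>
     scalar_coord H x \<le> scalar_coord G x + divergence G (defect_field G H) x"
proof -
  let ?K = "cball x0 (2 * r)"
  have x0: "x0 \<in> ?K" "x0 \<in> S" using r by auto
  have pd: "posdef (G x)" if "x \<in> ?K" for x using MG r that by (auto simp: metric_field_def)
  have cR: "continuous_on ?K (\<lambda>x. Ric G x $ i $ j)" for i j
    using continuous_on_subset[OF smooth_on_continuous[OF smooth_Ric[OF MG]] r(1)] .
  have cS: "continuous_on ?K (scalar_coord G)"
    using continuous_on_subset[OF smooth_on_continuous[OF smooth_scalar[OF MG]] r(1)] .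
  have cG: "continuous_on ?K (\<lambda>x. G x $ i $ j)" for i j
    using continuous_on_subset[OF smooth_on_continuous[OF metric_field_component_smooth[OF MG]] r(1)] .
  obtain c where c: "c > 0" "\<And>x B V \<theta> k. x \<in> ?K \<Longrightarrow> common_frame (G x) B V \<theta> \<Longrightarrow> c \<le> V $ k \<bullet> (Ric G x *v (V $ k))"
    using frame_lower_bound[OF MG compact_cball r(1) cR] pos r(1) by (metis subsetD)
  \<comment> \<open>The form \<open>\<kappa> g - 2 \<rho>\<close>, positive definite by assumption; on a unit vector of a frame it is \<open>\<Sum>\<rho> - 2 \<rho>\<^sub>k\<close>.\<close>
  define R where "R x = scalar_coord G x *\<^sub>R G x - 2 *\<^sub>R Ric G x" for x
  have Rq: "\<xi> \<bullet> (R x *v \<xi>) = scalar_coord G x * (\<xi> \<bullet> (G x *v \<xi>)) - 2 * (\<xi> \<bullet> (Ric G x *v \<xi>))" for x \<xi>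
    by (simp add: R_def matrix_vector_mult_diff_rdistrib inner_diff_right scaleR_matrix_vector_assoc[symmetric])
  have cR': "continuous_on ?K (\<lambda>x. R x $ i $ j)" for i j
    unfolding R_def by (simp, intro continuous_intros cR cS cG)
  have posR: "0 < \<xi> \<bullet> (R x *v \<xi>)" if "x \<in> ?K" "\<xi> \<noteq> 0" for x \<xi>
    using neg[of x \<xi>] that r(1) unfolding Rq by auto
  obtain c' where c': "c' > 0" "\<And>x B V \<theta> k. x \<in> ?K \<Longrightarrow> common_frame (G x) B V \<theta> \<Longrightarrow> c' \<le> V $ k \<bullet> (R x *v (V $ k))"
    using frame_lower_bound[OF MG compact_cball r(1) cR' posR] by blast
  obtain D where D: "D > 0"
    "\<And>x B V \<theta> k. x \<in> ?K \<Longrightarrow> common_frame (G x) B V \<theta> \<Longrightarrow> V $ k \<bullet> (Ric G x *v (V $ k)) \<le> D"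
    "\<And>x B V \<theta> k. x \<in> ?K \<Longrightarrow> common_frame (G x) B V \<theta> \<Longrightarrow> \<bar>\<theta> k\<bar> \<le> D * entry_sum (B - G x)"
    "\<And>x B V \<theta>. x \<in> ?K \<Longrightarrow> common_frame (G x) B V \<theta> \<Longrightarrow> entry_sum (B - G x) \<le> D * (\<Sum>k\<in>UNIV. \<bar>\<theta> k\<bar>)"
    using frame_upper_bounds[OF MG compact_cball r(1) cR] by blast
  have gap: "2 * (V $ k \<bullet> (Ric G x *v (V $ k))) + c' \<le> (\<Sum>k\<in>UNIV. V $ k \<bullet> (Ric G x *v (V $ k)))"
    if "x \<in> ?K" "common_frame (G x) B V \<theta>" for x B V \<theta> k
  proof -
    have "scalar_coord G x = (\<Sum>k\<in>UNIV. V $ k \<bullet> (Ric G x *v (V $ k)))"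
      using common_frame_trace(1)[OF that(2), of "Ric G x"] by (simp add: scalar_coord_def Ric_def)
    moreover have "V $ k \<bullet> (G x *v (V $ k)) = 1" using that(2) by (simp add: common_frame_def)
    ultimately show ?thesis using c'(2)[OF that, of k] unfolding Rq by simp
  qed
  have n: "CARD('n) \<ge> 3"
  proof -
    obtain V \<theta> where f: "common_frame (G x0) (G x0) V \<theta>" using common_frame_exists[OF pd pd] x0 by blast
    define \<rho> where "\<rho> k = V $ k \<bullet> (Ric G x0 *v (V $ k))" for k
    have rp: "0 < \<rho> k" for k using c(1) c(2)[OF x0(1) f, of k] unfolding \<rho>_def by linarith
    have "2 * \<rho> k < (\<Sum>k\<in>UNIV. \<rho> k)" for k
      using gap[OF x0(1) f, of k] c'(1) unfolding \<rho>_def by linarith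
    then have "(\<Sum>k\<in>UNIV. 2 * \<rho> k) < (\<Sum>k\<in>(UNIV::'n set). (\<Sum>k\<in>UNIV. \<rho> k))"
      by (intro sum_strict_mono) auto
    then have "2 * (\<Sum>k\<in>UNIV. \<rho> k) < real CARD('n) * (\<Sum>k\<in>UNIV. \<rho> k)" by (simp add: sum_distrib_left)
    moreover have "0 < (\<Sum>k\<in>UNIV. \<rho> k)" using rp by (intro sum_pos) auto
    ultimately show ?thesis by simp
  qed
  define m where "m = real CARD('n) * real CARD('n)"
  have m: "m > 0" by (simp add: m_def)
  define \<delta> where "\<delta> = c' / (2 * (D + c'))"
  have \<delta>: "\<delta> > 0" using c' D by (simp add: \<delta>_def)
  define Q where "Q x B \<longleftrightarrow> (\<forall>\<xi> \<zeta>. area_form (G x) \<xi> \<zeta> \<le> area_form B \<xi> \<zeta>)" for x B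
  have Qarea: "1 \<le> (1 + \<theta> i) * (1 + \<theta> j)" if "Q x B" "common_frame (G x) B V \<theta>" "i \<noteq> j" for x B V \<theta> i j
  proof -
    have "area_form (G x) (V $ i) (V $ j) \<le> area_form B (V $ i) (V $ j)" using that(1) by (simp add: Q_def)
    then show ?thesis using that(2,3) by (simp add: area_form_def common_frame_def)
  qed
  have n2: "CARD('n) \<ge> 2" using n by simp
  obtain \<epsilon> where "\<epsilon> > 0" and E: "\<And>H x. metric_field S H \<Longrightarrow> C2_close ?K \<epsilon> G H \<Longrightarrow>
     (\<And>y. y \<in> ?K \<Longrightarrow> Q y (H y)) \<Longrightarrow> x \<in> cball x0 r \<Longrightarrow>
     scalar_coord H x \<le> scalar_coord G x + divergence G (defect_field G H) x"
  proof (rule scalar_le_plus_divergence[OF MG r n2, of "\<delta> * (c/4) / D" "\<delta> / (D * m)" Q])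
    show "\<delta> * (c/4) / D > 0" "\<delta> / (D * m) > 0" using c D m \<delta> by auto
  next
    fix x B assume x: "x \<in> ?K" and B: "posdef B" and small: "\<And>i j. \<bar>(B - G x) $ i $ j\<bar> \<le> \<delta> / (D * m)" and Q: "Q x B"
    obtain V \<theta> where f: "common_frame (G x) B V \<theta>" using common_frame_exists[OF pd[OF x] B] by blast
    have "entry_sum (B - G x) \<le> \<delta> / D"
      using entry_sum_le[OF small] m by (simp add: m_def)
    then have "D * entry_sum (B - G x) \<le> \<delta>" using D(1) by (simp add: field_simps)
    then have t1: "\<bar>\<theta> k\<bar> \<le> c' / (2 * (D + c'))" for k
      using D(3)[OF x f, of k] unfolding \<delta>_def by linarith
    have "(\<Sum>k\<in>UNIV. (V $ k \<bullet> (Ric G x *v (V $ k))) / (1 + \<theta> k)) - (\<Sum>k\<in>UNIV. V $ k \<bullet> (Ric G x *v (V $ k)))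
       \<le> - (\<delta> * (c/4)) * (\<Sum>k\<in>UNIV. \<bar>\<theta> k\<bar>)"
      unfolding \<delta>_def
      by (rule first_variation_area[OF c(2)[OF x f] c(1) D(2)[OF x f] gap[OF x f] c'(1) t1 Qarea[OF Q f]])
    also have "\<dots> \<le> - (\<delta> * (c/4) / D) * entry_sum (B - G x)"
    proof -
      have "(\<delta> * (c/4) / D) * entry_sum (B - G x) \<le> (\<delta> * (c/4) / D) * (D * (\<Sum>k\<in>UNIV. \<bar>\<theta> k\<bar>))"
        using c \<delta> D(1) D(4)[OF x f] by (intro mult_left_mono) auto
      then show ?thesis using D(1) by simp
    qed
    finally show "(\<Sum>i\<in>UNIV. \<Sum>j\<in>UNIV. matrix_inv B $ i $ j * Ric G x $ i $ j)
       \<le> (\<Sum>i\<in>UNIV. \<Sum>j\<in>UNIV. matrix_inv (G x) $ i $ j * Ric G x $ i $ j) - \<delta> * (c/4) / D * entry_sum (B - G x)"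
      unfolding common_frame_trace[OF f] by simp
  next
    fix x B and \<xi> :: "real^'n" assume x: "x \<in> ?K" and B: "posdef B" and Q: "Q x B"
    obtain V \<theta> where f: "common_frame (G x) B V \<theta>" using common_frame_exists[OF pd[OF x] B] by blast
    have gt: "1 + \<theta> k > 0" for k using f by (simp add: common_frame_def)
    have ar: "1 \<le> (1 + \<theta> i) * (1 + \<theta> j)" if "i \<noteq> j" for i j by (rule Qarea[OF Q f that])
    have "\<theta> k \<le> (\<Sum>j\<in>UNIV. \<theta> j)" for k by (rule area_trace_nonneg[OF n gt ar])
    then show "\<xi> \<bullet> ((B - G x) *v \<xi>)
       \<le> (\<Sum>i\<in>UNIV. \<Sum>j\<in>UNIV. matrix_inv (G x) $ i $ j * (B - G x) $ i $ j) * (\<xi> \<bullet> (G x *v \<xi>))"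
      by (rule cone_from_frame[OF f])
  qed blast
  then show thesis using that[of \<epsilon>] unfolding Q_def by blast
qed

section \<open>Integration of continuous functions with compact support\<close>

text \<open>Extension by zero, which reduces integrals over different chart images to integrals over the whole space.\<close>

definition zext :: "'a set \<Rightarrow> ('a \<Rightarrow> real) \<Rightarrow> 'a \<Rightarrow> real"
  where "zext S u = (\<lambda>x. if x \<in> S then u x else 0)"

text \<open>Only the points of \<open>S\<close> count: the values of a function in a chart are arbitrary outside the chart image.\<close>

definition supported :: "'a::t2_space set \<Rightarrow> 'a set \<Rightarrow> ('a \<Rightarrow> real) \<Rightarrow> bool"
  where "supported S K u \<longleftrightarrow> compact K \<and> K \<subseteq> S \<and> (\<forall>x\<in>S - K. u x = 0)"

lemma zext_continuous:
  assumes "open S" "continuous_on S u" "supported S K u"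
  shows "continuous_on UNIV (zext S u)"
proof -
  have K: "open (- K)" using assms(3) compact_imp_closed by (auto simp: supported_def)
  have "continuous_on S (zext S u)"
    using assms(2) by (subst continuous_on_cong[of S S _ u]) (auto simp: zext_def)
  moreover have "continuous_on (- K) (zext S u)"
    using assms(3) by (subst continuous_on_cong[of "- K" "- K" _ "\<lambda>_. 0"]) (auto simp: zext_def supported_def)
  ultimately have "continuous_on (S \<union> - K) (zext S u)" by (rule continuous_on_open_Un[OF assms(1) K])
  moreover have "S \<union> - K = UNIV" using assms(3) by (auto simp: supported_def)
  ultimately show ?thesis by simp
qed

lemma zext_zero: "supported S K u \<Longrightarrow> x \<notin> K \<Longrightarrow> zext S u x = 0"
  by (auto simp: zext_def supported_def)

lemma zext_integral: "integral UNIV (zext S u) = integral S u"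
  unfolding zext_def by (rule integral_restrict_UNIV)

lemma compact_support_integrable:
  fixes F :: "'a::euclidean_space \<Rightarrow> real"
  assumes c: "continuous_on UNIV F" and K: "compact K" and z: "\<And>x. x \<notin> K \<Longrightarrow> F x = 0"
  shows "integrable lborel F" "F absolutely_integrable_on UNIV" "integral UNIV F = integral\<^sup>L lborel F"
proof -
  have "(\<lambda>x. indicator K x *\<^sub>R F x) = F"
    by (rule ext) (use z in \<open>auto simp: indicator_def\<close>)
  then show i: "integrable lborel F"
    using borel_integrable_compact[OF K continuous_on_subset[OF c]] by simp
  then show "F absolutely_integrable_on UNIV"
    by (simp add: set_integrable_def integrable_completion borel_measurable_integrable)
  show "integral UNIV F = integral\<^sup>L lborel F" by (rule integral_lborel[OF i])
qed

lemma supported_integrable: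
  fixes u :: "'a::euclidean_space \<Rightarrow> real"
  assumes "open S" "continuous_on S u" "supported S K u"
  shows "u integrable_on S"
proof -
  have "zext S u absolutely_integrable_on UNIV"
    using compact_support_integrable(2)[OF zext_continuous[OF assms]] zext_zero[OF assms(3)] assms(3)
    by (auto simp: supported_def)
  then have "zext S u integrable_on UNIV" by (simp add: set_lebesgue_integral_eq_integral)
  then show ?thesis unfolding zext_def by (simp add: integrable_restrict_UNIV)
qed

lemma nonneg_integral_zero:
  fixes u :: "'a::euclidean_space \<Rightarrow> real"
  assumes S: "open S" and c: "continuous_on S u" and s: "supported S K u"
    and nn: "\<And>x. x \<in> S \<Longrightarrow> 0 \<le> u x" and z: "integral S u \<le> 0" and x: "x \<in> S"
  shows "u x = 0"
proof -
  obtain a b where ab: "x \<in> box a b" "cbox a b \<subseteq> S" using open_contains_cbox[of S] S x by (metis open_contains_cbox)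
  have i: "u integrable_on S" by (rule supported_integrable[OF S c s])
  have ic: "u integrable_on cbox a b"
    using continuous_on_subset[OF c ab(2)] by (rule integrable_continuous)
  have "integral (cbox a b) u \<le> integral S u" by (rule integral_subset_le[OF ab(2) ic i]) (use nn in blast)
  moreover have "0 \<le> integral (cbox a b) u" using nn ab by (intro integral_nonneg[OF ic]) auto
  ultimately have "integral (cbox a b) u = 0" using z by linarith
  then have "\<forall>x\<in>cbox a b. u x = 0"
    using integral_cbox_eq_0_iff[of a b u] continuous_on_subset[OF c ab(2)] nn ab by blast
  then show ?thesis using ab(1) box_subset_cbox by blast
qed

text \<open>The integral of \<open>u(x + t e\<^sub>k)\<close> over \<open>x\<close> is independent of \<open>t\<close> by translation invariance; differentiating under the
  integral at \<open>t = 0\<close> gives the integral of the partial derivative.\<close>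

lemma integral_partial_eq_0:
  fixes u :: "real^'n \<Rightarrow> real"
  assumes C: "Ck_on 1 u UNIV" and K: "compact K" and z: "\<And>x. x \<notin> K \<Longrightarrow> u x = 0"
  shows "integral UNIV (partial k u) = 0"
proof -
  let ?e = "axis k 1 :: real^'n"
  have cu: "continuous_on UNIV u" using Ck_on_continuous[OF C] .
  have C': "Ck_on (Suc 0) u UNIV" using C by simp
  have cp: "continuous_on UNIV (partial k u)" using Ck_on_partial[OF C'] by simp
  have du: "u differentiable (at x)" for x using C' by simp
  have pz: "partial k u x = 0" if "x \<notin> K" for x
  proof -
    have "partial k u x = partial k (\<lambda>_. 0) x"
      using z that K by (intro partial_cong[of "- K"]) (auto intro: compact_imp_closed)
    then show ?thesis by simp
  qed
  obtain B where B: "B > 0" "\<And>x. x \<in> K \<Longrightarrow> norm x \<le> B" using compact_imp_bounded[OF K] bounded_pos by metis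
  obtain a b where ab: "cball (0::real^'n) (B + 1) \<subseteq> cbox a b"
    using bounded_subset_cbox_symmetric[OF bounded_cball] by metis
  have out: "x + t *\<^sub>R ?e \<notin> K" if "x \<notin> cbox a b" "\<bar>t\<bar> \<le> 1" for x t
  proof
    assume "x + t *\<^sub>R ?e \<in> K"
    then have "norm (x + t *\<^sub>R ?e) \<le> B" by (rule B(2))
    moreover have "norm (t *\<^sub>R ?e) \<le> 1" using that(2) by simp
    ultimately have "norm x \<le> B + 1"
      using norm_triangle_ineq4[of "x + t *\<^sub>R ?e" "t *\<^sub>R ?e"] by simp
    then show False using ab that(1) by (auto simp: subset_iff)
  qed
  \<comment> \<open>For \<open>\<bar>t\<bar> \<le> 1\<close> the translated support stays in the box, on which one may differentiate under the integral.\<close>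
  have const: "integral (cbox a b) (\<lambda>x. u (x + t *\<^sub>R ?e)) = integral UNIV u" if "\<bar>t\<bar> \<le> 1" for t
  proof -
    have "integral (cbox a b) (\<lambda>x. u (x + t *\<^sub>R ?e)) = integral UNIV (\<lambda>x. u (x + t *\<^sub>R ?e))"
      by (subst integral_restrict_UNIV[symmetric], rule arg_cong[of _ _ "integral UNIV"])
         (use z out[OF _ that] in auto)
    also have "\<dots> = integral\<^sup>L lborel (\<lambda>x. u (x + t *\<^sub>R ?e))"
    proof (rule compact_support_integrable(3))
      show "continuous_on UNIV (\<lambda>x. u (x + t *\<^sub>R ?e))"
        by (intro continuous_on_compose2[OF cu] continuous_intros) auto
      show "compact (cbox a b)" by simp
    qed (use z out[OF _ that] in auto)
    also have "\<dots> = integral\<^sup>L (distr lborel borel ((+) (t *\<^sub>R ?e))) u"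
      using cu by (subst integral_distr) (auto simp: add.commute intro: borel_measurable_continuous_onI)
    also have "\<dots> = integral UNIV u"
      unfolding lborel_distr_plus by (rule compact_support_integrable(3)[OF cu K z, symmetric])
    finally show ?thesis .
  qed
  have "((\<lambda>t. integral (cbox a b) (\<lambda>x. u (x + t *\<^sub>R ?e))) has_field_derivative
      integral (cbox a b) (\<lambda>x. partial k u (x + 0 *\<^sub>R ?e))) (at 0 within {-1..1})"
  proof (rule leibniz_rule_field_derivative)
    show "((\<lambda>t. u (x + t *\<^sub>R ?e)) has_field_derivative partial k u (x + t *\<^sub>R ?e)) (at t within {-1..1})" for x t
      by (rule has_field_derivative_at_within[OF line_derivative[OF du]])
    show "(\<lambda>x. u (x + t *\<^sub>R ?e)) integrable_on cbox a b" for t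
      by (intro integrable_continuous continuous_on_compose2[OF cu] continuous_intros) auto
    show "continuous_on ({-1..1} \<times> cbox a b) (\<lambda>(t, x). partial k u (x + t *\<^sub>R ?e))"
      unfolding split_beta by (intro continuous_on_compose2[OF cp] continuous_intros) auto
  qed auto
  then have 0: "((\<lambda>t. integral (cbox a b) (\<lambda>x. u (x + t *\<^sub>R ?e))) has_field_derivative
      integral (cbox a b) (partial k u)) (at 0 within {-1..1})" by simp
  have 1: "((\<lambda>t. integral UNIV u) has_field_derivative integral (cbox a b) (partial k u)) (at 0 within {-1..1})"
    by (rule has_field_derivative_transform_within[OF 0, of 2]) (auto simp: const)
  then have 2: "((\<lambda>t::real. integral UNIV u) has_field_derivative integral (cbox a b) (partial k u)) (at 0)"
    by (simp add: at_within_Icc_at)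
  have "integral (cbox a b) (partial k u) = 0"
    using DERIV_unique[OF 2 DERIV_const] .
  moreover have "integral (cbox a b) (partial k u) = integral UNIV (partial k u)"
    by (subst integral_restrict_UNIV[symmetric], rule arg_cong[of _ _ "integral UNIV"])
       (use pz out[of _ 0] in auto)
  ultimately show ?thesis by simp
qed

section \<open>The Riemannian volume density and the divergence theorem in a chart\<close>

text \<open>Row \<open>i\<close> of \<open>C ** A\<close> is a combination of the rows of \<open>A\<close>, and only row \<open>i\<close> itself contributes to the determinant.\<close>

lemma det_row_replaced:
  fixes A C :: "real^'n^'n"
  shows "det (\<chi> j. if j = i then (C ** A) $ i else A $ j) = C $ i $ i * det A"
proof -
  have "(C ** A) $ i = (\<Sum>l\<in>UNIV. C $ i $ l *s A $ l)"
    by (simp add: vec_eq_iff matrix_mult_nth)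
  then have "det (\<chi> j. if j = i then (C ** A) $ i else A $ j)
      = det (\<chi> j. if j = i then (\<Sum>l\<in>UNIV. C $ i $ l *s A $ l) else A $ j)" by (rule arg_cong)
  also have "\<dots> = (\<Sum>l\<in>UNIV. det (\<chi> j. if j = i then C $ i $ l *s A $ l else A $ j))"
    by (rule det_linear_row_sum[OF finite_class.finite_UNIV, where k = i and a = "\<lambda>_ l. C $ i $ l *s A $ l" and c = "\<lambda>j. A $ j"])
  also have "\<dots> = (\<Sum>l\<in>UNIV. C $ i $ l * det (\<chi> j. if j = i then A $ l else A $ j))"
    using det_row_mul[of i _ "\<lambda>_. A $ _" "\<lambda>j. A $ j"] by simp
  also have "\<dots> = (\<Sum>l\<in>UNIV. if l = i then C $ i $ i * det A else 0)"
  proof (rule sum.cong[OF refl])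
    fix l
    show "C $ i $ l * det (\<chi> j. if j = i then A $ l else A $ j) = (if l = i then C $ i $ i * det A else 0)"
    proof (cases "l = i")
      case True
      then have "(\<chi> j. if j = i then A $ l else A $ j) = A" by (simp add: vec_eq_iff)
      then show ?thesis using True by simp
    next
      case False
      have "det (\<chi> j. if j = i then A $ l else A $ j) = 0"
        by (rule det_identical_rows[OF False]) (use False in \<open>simp add: row_def vec_eq_iff\<close>)
      then show ?thesis using False by simp
    qed
  qed
  finally show ?thesis by simp
qed

text \<open>Jacobi's formula, by differentiating the Leibniz formula row by row: every row of the derivative is that row of
  \<open>(\<partial>G G\<^sup>-\<^sup>1) G\<close>.\<close>

lemma partial_det:
  fixes G :: "real^'n \<Rightarrow> real^'m^'m"
  assumes d: "mdiff G x" and inv: "invertible (G x)"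
  shows "partial k (\<lambda>y. det (G y)) x = det (G x) * trace (mpartial k G x ** matrix_inv (G x))"
proof -
  define C where "C = mpartial k G x ** matrix_inv (G x)"
  have CG: "C ** G x = mpartial k G x"
    using matrix_inv_works[OF inv] by (simp add: C_def matrix_mul_assoc[symmetric])
  have dG: "(\<lambda>y. G y $ i $ j) differentiable (at x)" for i j using d by (simp add: mdiff_def)
  have pp: "partial k (\<lambda>y. \<Prod>i\<in>UNIV. G y $ i $ p i) x
      = (\<Sum>i\<in>UNIV. partial k (\<lambda>y. G y $ i $ p i) x * (\<Prod>j\<in>UNIV-{i}. G x $ j $ p j))" for p
  proof -
    have "((\<lambda>y. G y $ i $ p i) has_derivative frechet_derivative (\<lambda>y. G y $ i $ p i) (at x)) (at x)" for i
      using dG frechet_derivative_works by blast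
    from partial_eqI[OF has_derivative_prod[where I = UNIV and f = "\<lambda>i y. G y $ i $ p i" and f' = "\<lambda>i. frechet_derivative (\<lambda>y. G y $ i $ p i) (at x)", OF this]] show ?thesis by (simp add: partial_def)
  qed
  have dp: "(\<lambda>y. \<Prod>i\<in>UNIV. G y $ i $ p i) differentiable (at x)" for p
  proof -
    have "((\<lambda>y. G y $ i $ p i) has_derivative frechet_derivative (\<lambda>y. G y $ i $ p i) (at x)) (at x)" for i
      using dG frechet_derivative_works by blast
    from has_derivative_prod[where I = UNIV and f = "\<lambda>i y. G y $ i $ p i" and f' = "\<lambda>i. frechet_derivative (\<lambda>y. G y $ i $ p i) (at x)", OF this] show ?thesis unfolding differentiable_def by blast
  qed
  have "partial k (\<lambda>y. det (G y)) x = (\<Sum>p\<in>{p. p permutes UNIV}. of_int (sign p) *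
      (\<Sum>i\<in>UNIV. partial k (\<lambda>y. G y $ i $ p i) x * (\<Prod>j\<in>UNIV-{i}. G x $ j $ p j)))"
    unfolding det_def by (subst partial_sum) (auto simp: partial_mult dp pp)
  also have "\<dots> = (\<Sum>i\<in>UNIV. \<Sum>p\<in>{p. p permutes UNIV}. of_int (sign p) *
      (partial k (\<lambda>y. G y $ i $ p i) x * (\<Prod>j\<in>UNIV-{i}. G x $ j $ p j)))"
    by (simp add: sum_distrib_left) (rule sum.swap)
  also have "\<dots> = (\<Sum>i\<in>UNIV. det (\<chi> j. if j = i then (C ** G x) $ i else G x $ j))"
  proof (rule sum.cong[OF refl])
    fix i
    have "(\<Prod>j\<in>UNIV. (if j = i then (C ** G x) $ i else G x $ j) $ p j)
       = partial k (\<lambda>y. G y $ i $ p i) x * (\<Prod>j\<in>UNIV-{i}. G x $ j $ p j)" for p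
      by (subst prod.remove[of UNIV i]) (auto simp: CG mpartial_def intro!: prod.cong)
    then show "(\<Sum>p\<in>{p. p permutes UNIV}. of_int (sign p) *
      (partial k (\<lambda>y. G y $ i $ p i) x * (\<Prod>j\<in>UNIV-{i}. G x $ j $ p j)))
      = det (\<chi> j. if j = i then (C ** G x) $ i else G x $ j)"
      unfolding det_def by simp
  qed
  also have "\<dots> = det (G x) * trace C"
    unfolding det_row_replaced trace_def by (simp add: sum_distrib_left mult.commute)
  finally show ?thesis by (simp add: C_def)
qed

lemma posdef_det_pos:
  fixes A :: "real^'n^'n" assumes "posdef A" shows "det A > 0"
proof -
  obtain V :: "real^'n^'n" where V: "V ** A ** transpose V = mat 1"
    using simultaneous_diagonalisation[OF assms, of A] assms by (auto simp: posdef_def)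
  have "det V * det A * det V = 1" using arg_cong[OF V, of det] by (simp add: det_mul)
  then have "(det V)\<^sup>2 * det A = 1" by (simp add: power2_eq_square algebra_simps)
  moreover have "0 \<le> (det V)\<^sup>2" by simp
  ultimately show ?thesis by (metis zero_less_one zero_less_mult_pos mult_zero_left less_eq_real_def zero_neq_one)
qed

definition vol :: "(real^'n \<Rightarrow> real^'n^'n) \<Rightarrow> real^'n \<Rightarrow> real"
  where "vol G x = sqrt (det (G x))"

lemma vol_pos: "metric_field S G \<Longrightarrow> x \<in> S \<Longrightarrow> vol G x > 0"
  by (auto simp: vol_def metric_field_def posdef_det_pos)

lemma smooth_det:
  fixes G :: "real^'n \<Rightarrow> real^'n^'n"
  assumes MG: "metric_field S G"
  shows "smooth_on (\<lambda>x. det (G x)) S"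
proof -
  have S: "open S" using MG by (simp add: metric_field_def)
  show ?thesis unfolding det_def
    by (intro smooth_on_sum smooth_on_mult smooth_on_prod smooth_on_const metric_field_component_smooth[OF MG] S)
qed

text \<open>Jacobi's formula and metric compatibility: \<open>\<partial>\<^sub>k log (det G) = 2 \<Gamma>\<^sup>l\<^sub>l\<^sub>k\<close>.\<close>

lemma partial_vol:
  fixes G :: "real^'n \<Rightarrow> real^'n^'n"
  assumes MG: "metric_field S G" and x: "x \<in> S"
  shows "vol G differentiable (at x)" "partial k (vol G) x = vol G x * trace (Gam G k x)"
proof -
  have p: "det (G x) > 0" using MG x by (auto simp: metric_field_def posdef_det_pos)
  have inv: "invertible (G x)" using MG x posdef_invertible by (auto simp: metric_field_def)
  have dm: "mdiff G x" using MG x msmooth_mdiff by (auto simp: metric_field_def)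
  have dd: "((\<lambda>x. det (G x)) has_derivative frechet_derivative (\<lambda>x. det (G x)) (at x)) (at x)"
    using smooth_on_differentiable[OF smooth_det[OF MG] x] frechet_derivative_works by blast
  have h: "(vol G has_derivative (\<lambda>v. frechet_derivative (\<lambda>x. det (G x)) (at x) v * (inverse (sqrt (det (G x))) / 2))) (at x)"
    unfolding vol_def[abs_def] using has_derivative_real_sqrt[OF p dd] by (simp add: mult.commute)
  show "vol G differentiable (at x)" using h unfolding differentiable_def by blast
  have "trace (mpartial k G x ** matrix_inv (G x)) = 2 * trace (Gam G k x)"
  proof -
    have "mpartial k G x ** matrix_inv (G x)
        = transpose (Gam G k x) ** (G x ** matrix_inv (G x)) + G x ** Gam G k x ** matrix_inv (G x)"
      by (simp add: Gam_compat[OF MG x] matrix_add_rdistrib matrix_mul_assoc)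
    moreover have "trace (G x ** Gam G k x ** matrix_inv (G x)) = trace (Gam G k x)"
      by (subst trace_mul_sym) (simp add: matrix_mul_assoc metric_field_inv[OF MG x])
    moreover have "trace (transpose (Gam G k x)) = trace (Gam G k x)" by (simp add: trace_def transpose_def)
    ultimately show ?thesis by (simp add: trace_add metric_field_inv[OF MG x])
  qed
  then have "partial k (\<lambda>y. det (G y)) x = det (G x) * (2 * trace (Gam G k x))"
    by (simp add: partial_det[OF dm inv])
  moreover have "partial k (vol G) x = partial k (\<lambda>y. det (G y)) x * (inverse (sqrt (det (G x))) / 2)"
    unfolding partial_eqI[OF h] by (simp add: partial_def)
  ultimately have "partial k (vol G) x = det (G x) * (2 * trace (Gam G k x)) * (inverse (sqrt (det (G x))) / 2)"
    by simp
  also have "det (G x) * (2 * trace (Gam G k x)) * (inverse (sqrt (det (G x))) / 2) = vol G x * trace (Gam G k x)"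
    using p real_div_sqrt[of "det (G x)"] by (simp add: vol_def field_simps)
  finally show "partial k (vol G) x = vol G x * trace (Gam G k x)" .
qed

lemma continuous_vol: "metric_field S G \<Longrightarrow> continuous_on S (vol G)" for G :: "real^'n \<Rightarrow> real^'n^'n"
  unfolding vol_def[abs_def] by (intro continuous_on_real_sqrt smooth_on_continuous smooth_det)

lemma Ck_vol:
  fixes G :: "real^'n \<Rightarrow> real^'n^'n"
  assumes MG: "metric_field S G" shows "Ck_on 1 (vol G) S"
proof (rule Ck_on_1I)
  show S: "open S" using MG by (simp add: metric_field_def)
  show "vol G differentiable (at x)" if "x \<in> S" for x by (rule partial_vol[OF MG that])
  have "continuous_on S (\<lambda>x. Gam G k x $ i $ j)" for k i j
    using msmooth_Gam[OF MG] smooth_on_continuous unfolding msmooth_def by blast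
  then have "continuous_on S (\<lambda>x. vol G x * trace (Gam G k x))" for k
    unfolding trace_def by (intro continuous_on_mult continuous_on_sum continuous_vol[OF MG])
  then show "continuous_on S (partial k (vol G))" for k
    using partial_vol(2)[OF MG] by (simp cong: continuous_on_cong)
qed

text \<open>Multiplied by the volume density, the Riemannian divergence is the Euclidean divergence of the field \<open>vol G X\<close>.\<close>

lemma divergence_theorem_chart:
  fixes G :: "real^'n \<Rightarrow> real^'n^'n"
  assumes MG: "metric_field S G" and X: "\<And>k. Ck_on 1 (\<lambda>x. X x $ k) S"
    and K: "compact K" "K \<subseteq> S" and z: "\<And>x. x \<in> S - K \<Longrightarrow> X x = 0"
  shows "integral S (\<lambda>x. vol G x * divergence G X x) = 0"
proof -
  have S: "open S" using MG by (simp add: metric_field_def)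
  have oK: "open (- K)" using K compact_imp_closed by auto
  define u where "u k = zext S (\<lambda>x. vol G x * X x $ k)" for k
  have uS: "u k x = vol G x * X x $ k" if "x \<in> S" for k x using that by (simp add: u_def zext_def)
  have u0: "u k x = 0" if "x \<notin> K" for k x using that z by (auto simp: u_def zext_def)
  have "Ck_on 1 (u k) UNIV" for k
  proof (rule Ck_on_local)
    fix x :: "real^'n"
    have 1: "Ck_on 1 (u k) S"
      by (rule Ck_on_cong[OF S _ Ck_on_mult[OF S Ck_vol[OF MG] X[of k]]]) (simp add: uS)
    have 2: "Ck_on 1 (u k) (- K)"
      by (rule Ck_on_cong[OF oK _ Ck_on_const[of 1 0]]) (simp add: u0)
    show "\<exists>T. open T \<and> x \<in> T \<and> Ck_on 1 (u k) T"
      using 1 2 S oK K(2) by (cases "x \<in> S") blast+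
  qed
  then have i0: "integral UNIV (partial k (u k)) = 0" and Cu: "Ck_on 1 (u k) UNIV" for k
    using integral_partial_eq_0[OF _ K(1) u0] by auto
  have pu: "partial k (u k) x = vol G x * partial k (\<lambda>y. X y $ k) x + vol G x * trace (Gam G k x) * X x $ k" if "x \<in> S" for k x
  proof -
    have dX: "(\<lambda>y. X y $ k) differentiable (at x)" using X[of k] that by simp
    have "partial k (u k) x = partial k (\<lambda>y. vol G y * X y $ k) x"
      by (rule partial_cong[OF S that uS])
    then show ?thesis by (simp add: partial_mult[OF partial_vol(1)[OF MG that] dX] partial_vol(2)[OF MG that])
  qed
  have pu0: "partial k (u k) x = 0" if "x \<notin> K" for k x
  proof -
    have "partial k (u k) x = partial k (\<lambda>_. 0) x"
      using that u0 by (intro partial_cong[OF oK]) auto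
    then show ?thesis by simp
  qed
  have cpu: "continuous_on UNIV (partial k (u k))" for k
    using Ck_on_partial[of 0 "u k" UNIV k] Cu by simp
  have ipu: "partial k (u k) integrable_on UNIV" for k
    using compact_support_integrable(2)[OF cpu K(1) pu0] by (simp add: set_lebesgue_integral_eq_integral)
  have "integral S (\<lambda>x. vol G x * divergence G X x) = integral UNIV (zext S (\<lambda>x. vol G x * divergence G X x))"
    by (simp add: zext_integral)
  also have "zext S (\<lambda>x. vol G x * divergence G X x) = (\<lambda>x. \<Sum>k\<in>UNIV. partial k (u k) x)"
  proof
    fix x
    show "zext S (\<lambda>x. vol G x * divergence G X x) x = (\<Sum>k\<in>UNIV. partial k (u k) x)"
    proof (cases "x \<in> S")
      case True
      then show ?thesis
        by (simp add: zext_def divergence_def pu sum.distrib sum_distrib_left distrib_left mult.assoc)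
    next
      case False
      moreover from this have "x \<notin> K" using K(2) by blast
      ultimately show ?thesis using pu0 by (simp add: zext_def)
    qed
  qed
  also have "integral UNIV \<dots> = (\<Sum>k\<in>UNIV. integral UNIV (partial k (u k)))"
    by (rule integral_sum) (auto simp: ipu)
  finally show ?thesis by (simp add: i0)
qed

section \<open>Change of variables\<close>

text \<open>An index type with as many elements as \<open>'n\<close> that also carries a well-order. Change of variables for vectors
  is first obtained over this index type, since its formulation needs a well-order, and then carried back along a bijection of
  the indices.\<close>

typedef ('n::finite) idx = "{k::nat. k < CARD('n)}"
  by (rule exI[of _ 0]) simp

instantiation idx :: (finite) wellorder
begin
definition less_eq_idx :: "'a idx \<Rightarrow> 'a idx \<Rightarrow> bool" where "less_eq_idx x y \<longleftrightarrow> Rep_idx x \<le> Rep_idx y"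
definition less_idx :: "'a idx \<Rightarrow> 'a idx \<Rightarrow> bool" where "less_idx x y \<longleftrightarrow> Rep_idx x < Rep_idx y"
instance
proof
  fix P :: "'a idx \<Rightarrow> bool" and a
  assume step: "\<And>x. (\<And>y. y < x \<Longrightarrow> P y) \<Longrightarrow> P x"
  show "P a"
  proof (induction "Rep_idx a" arbitrary: a rule: less_induct)
    case less
    then show ?case using step[of a] by (simp add: less_idx_def)
  qed
qed (auto simp: less_eq_idx_def less_idx_def Rep_idx_inject)
end

instance idx :: (finite) finite
proof
  have "(UNIV :: 'a idx set) = Abs_idx ` {k. k < CARD('a)}"
    using type_definition.Abs_image[OF type_definition_idx] by metis
  then show "finite (UNIV :: 'a idx set)" by (metis finite_imageI finite_Collect_less_nat)
qed

lemma ex_index_bijection: "\<exists>\<pi> :: 'n::finite idx \<Rightarrow> 'n. bij \<pi>"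
proof -
  have "bij_betw (Rep_idx :: 'n idx \<Rightarrow> nat) UNIV {k. k < CARD('n)}"
    using type_definition.Rep_range[OF type_definition_idx] Rep_idx_inject
    by (auto simp: bij_betw_def inj_on_def)
  moreover have "\<exists>h. bij_betw h {k. k < CARD('n)} (UNIV :: 'n set)"
    using ex_bij_betw_nat_finite[OF finite_class.finite_UNIV[where 'a='n]]
    by (simp add: atLeast0LessThan lessThan_def)
  ultimately show ?thesis using bij_betw_trans by blast
qed

lemma sign_conjugate:
  fixes \<pi> :: "'m::finite \<Rightarrow> 'n::finite"
  assumes \<pi>: "bij \<pi>" and q: "q permutes (UNIV :: 'm set)"
  shows "sign (\<pi> \<circ> q \<circ> inv \<pi>) = sign q"
  using q finite_class.finite_UNIV
proof (induction rule: permutes_induct)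
  case id
  have "\<pi> \<circ> id \<circ> inv \<pi> = id" using \<pi> by (auto simp: fun_eq_iff bij_is_surj surj_f_inv_f)
  then show ?case by simp
next
  case (swap a b p)
  have e: "\<pi> \<circ> (Transposition.transpose a b \<circ> p) \<circ> inv \<pi>
     = Transposition.transpose (\<pi> a) (\<pi> b) \<circ> (\<pi> \<circ> p \<circ> inv \<pi>)"
    using \<pi> by (auto simp: fun_eq_iff Transposition.transpose_def dest: bij_is_inj[THEN injD])
  have "bij p" using swap permutes_bij by blast
  then have "bij (\<pi> \<circ> p \<circ> inv \<pi>)" using \<pi> by (simp add: bij_comp bij_imp_bij_inv)
  then have "permutation (\<pi> \<circ> p \<circ> inv \<pi>)" by (simp add: permutation)
  moreover have "permutation p" using \<open>bij p\<close> by (simp add: permutation)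
  moreover have "\<pi> a \<noteq> \<pi> b" using swap \<pi> by (auto dest: bij_is_inj[THEN injD])
  ultimately show ?case
    unfolding e sign_compose[OF permutation_swap_id \<open>permutation (\<pi> \<circ> p \<circ> inv \<pi>)\<close>]
      sign_compose[OF permutation_swap_id \<open>permutation p\<close>] sign_swap_id swap.IH using swap.hyps by simp
qed

text \<open>Renaming the indices of rows and columns by the same bijection conjugates the permutations in the Leibniz formula.\<close>

lemma det_reindex:
  fixes A :: "real^'n^'n" and \<pi> :: "'m::finite \<Rightarrow> 'n"
  assumes \<pi>: "bij \<pi>"
  shows "det (\<chi> i j. A $ \<pi> i $ \<pi> j) = det A"
proof -
  have l: "inv \<pi> (\<pi> i) = i" and r: "\<pi> (inv \<pi> k) = k" for i k
    using \<pi> by (simp_all add: bij_is_inj bij_is_surj surj_f_inv_f)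
  have bi: "bij (inv \<pi>)" using \<pi> by (rule bij_imp_bij_inv)
  have "det A = (\<Sum>q\<in>{q. q permutes (UNIV :: 'm set)}. of_int (sign (\<pi> \<circ> q \<circ> inv \<pi>)) * (\<Prod>k\<in>UNIV. A $ k $ (\<pi> \<circ> q \<circ> inv \<pi>) k))"
    unfolding det_def
  proof (rule sum.reindex_bij_witness[of _ "\<lambda>q. \<pi> \<circ> q \<circ> inv \<pi>" "\<lambda>p. inv \<pi> \<circ> p \<circ> \<pi>"])
    fix p :: "'n \<Rightarrow> 'n" assume "p \<in> {p. p permutes UNIV}"
    then have "bij p" using permutes_bij by blast
    then have "bij (inv \<pi> \<circ> p \<circ> \<pi>)" using \<pi> bi by (intro bij_comp)
    then show "inv \<pi> \<circ> p \<circ> \<pi> \<in> {q. q permutes UNIV}" using bij_imp_permutes by auto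
  next
    fix q :: "'m \<Rightarrow> 'm" assume "q \<in> {q. q permutes UNIV}"
    then have "bij q" using permutes_bij by blast
    then have "bij (\<pi> \<circ> q \<circ> inv \<pi>)" using \<pi> bi by (intro bij_comp)
    then show "\<pi> \<circ> q \<circ> inv \<pi> \<in> {p. p permutes UNIV}" using bij_imp_permutes by auto
  qed (auto simp: fun_eq_iff l r o_def)
  also have "\<dots> = (\<Sum>q\<in>{q. q permutes (UNIV :: 'm set)}. of_int (sign q) * (\<Prod>i\<in>UNIV. A $ \<pi> i $ \<pi> (q i)))"
  proof (intro sum.cong refl arg_cong2[of _ _ _ _ "(*)"])
    fix q :: "'m \<Rightarrow> 'm" assume "q \<in> {q. q permutes UNIV}"
    then show "real_of_int (sign (\<pi> \<circ> q \<circ> inv \<pi>)) = real_of_int (sign q)" using sign_conjugate[OF \<pi>] by simp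
    show "(\<Prod>k\<in>UNIV. A $ k $ (\<pi> \<circ> q \<circ> inv \<pi>) k) = (\<Prod>i\<in>UNIV. A $ \<pi> i $ \<pi> (q i))"
      by (rule prod.reindex_bij_witness[of _ \<pi> "inv \<pi>"]) (auto simp: l r)
  qed
  finally show ?thesis by (simp add: det_def)
qed

lemma prod_Basis_cart: "(\<Prod>b\<in>(Basis :: (real^'n) set). f b) = (\<Prod>i\<in>UNIV. f (axis i 1))"
proof -
  have 1: "(Basis :: (real^'n) set) = range (\<lambda>i. axis i 1)" by (auto simp: Basis_vec_def)
  have 2: "inj (\<lambda>i::'n. axis i (1::real))" by (auto simp: inj_def axis_eq_axis)
  show ?thesis unfolding 1 prod.reindex[OF 2] by simp
qed

lemma lborel_reindex:
  fixes \<pi> :: "'n::finite \<Rightarrow> 'm::finite"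
  assumes \<pi>: "bij \<pi>"
  defines "\<sigma> \<equiv> \<lambda>y :: real^'m. (\<chi> k. y $ \<pi> k) :: real^'n"
  shows "lborel = distr lborel borel \<sigma>"
proof (rule lborel_eqI)
  have r: "\<pi> (inv \<pi> k) = k" and l: "inv \<pi> (\<pi> j) = j" for k j using \<pi> by (simp_all add: bij_is_surj bij_is_inj surj_f_inv_f)
  fix a b :: "real^'n"
  assume ab: "\<And>c. c \<in> Basis \<Longrightarrow> a \<bullet> c \<le> b \<bullet> c"
  define a' b' :: "real^'m" where "a' = (\<chi> i. a $ inv \<pi> i)" and "b' = (\<chi> i. b $ inv \<pi> i)"
  have "continuous_on UNIV \<sigma>" unfolding \<sigma>_def by (intro continuous_intros)
  then have \<sigma>: "\<sigma> \<in> borel_measurable lborel" using borel_measurable_continuous_onI by simp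
  have le: "a $ i \<le> b $ i" for i using ab[of "axis i 1"] by (simp add: inner_axis)
  have "\<sigma> -` box a b = box a' b'"
  proof (intro set_eqI)
    fix y
    have "(\<forall>i. a $ i < y $ \<pi> i \<and> y $ \<pi> i < b $ i) \<longleftrightarrow> (\<forall>j. a $ inv \<pi> j < y $ j \<and> y $ j < b $ inv \<pi> j)"
      using r l by metis
    then show "y \<in> \<sigma> -` box a b \<longleftrightarrow> y \<in> box a' b'"
      by (simp add: \<sigma>_def mem_box_cart a'_def b'_def)
  qed
  then have "emeasure (distr lborel borel \<sigma>) (box a b) = emeasure lborel (box a' b')"
    using \<sigma> by (simp add: emeasure_distr)
  also have "\<dots> = (\<Prod>c\<in>Basis. (b' - a') \<bullet> c)"
    using le by (intro emeasure_lborel_box) (auto simp: Basis_vec_def inner_axis a'_def b'_def)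
  also have "(\<Prod>c\<in>Basis. (b' - a') \<bullet> c) = (\<Prod>i\<in>UNIV. b $ inv \<pi> i - a $ inv \<pi> i)"
    by (simp add: prod_Basis_cart inner_axis a'_def b'_def)
  also have "\<dots> = (\<Prod>i\<in>UNIV. b $ i - a $ i)"
    by (rule prod.reindex_bij_witness[of _ \<pi> "inv \<pi>"]) (auto simp: l r)
  also have "\<dots> = (\<Prod>c\<in>Basis. (b - a) \<bullet> c)"
    by (simp add: prod_Basis_cart inner_axis)
  finally show "emeasure (distr lborel borel \<sigma>) (box a b) = (\<Prod>c\<in>Basis. (b - a) \<bullet> c)" .
qed simp

lemma integral_reindex:
  fixes \<pi> :: "'n::finite \<Rightarrow> 'm::finite" and F :: "real^'n \<Rightarrow> real"
  assumes \<pi>: "bij \<pi>" and c: "continuous_on UNIV F" and K: "compact K" and z: "\<And>x. x \<notin> K \<Longrightarrow> F x = 0"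
  defines "\<sigma> \<equiv> \<lambda>y :: real^'m. (\<chi> k. y $ \<pi> k) :: real^'n"
  shows "integral UNIV (\<lambda>y. F (\<sigma> y)) = integral UNIV F" "(\<lambda>y. F (\<sigma> y)) absolutely_integrable_on UNIV"
proof -
  define \<tau> :: "real^'n \<Rightarrow> real^'m" where "\<tau> x = (\<chi> i. x $ inv \<pi> i)" for x
  have r: "\<pi> (inv \<pi> k) = k" for k using \<pi> by (simp add: bij_is_surj surj_f_inv_f)
  have ts: "\<tau> (\<sigma> y) = y" for y by (simp add: \<tau>_def \<sigma>_def r)
  have ct: "continuous_on X \<tau>" for X unfolding \<tau>_def by (intro continuous_intros)
  have cs: "continuous_on UNIV \<sigma>" unfolding \<sigma>_def by (intro continuous_intros)
  have cF: "continuous_on UNIV (\<lambda>y. F (\<sigma> y))" by (rule continuous_on_compose2[OF c cs]) auto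
  have K': "compact (\<tau> ` K)" by (rule compact_continuous_image[OF ct K])
  have z': "F (\<sigma> y) = 0" if "y \<notin> \<tau> ` K" for y using z[of "\<sigma> y"] that ts[of y] by (metis imageI)
  show "(\<lambda>y. F (\<sigma> y)) absolutely_integrable_on UNIV" by (rule compact_support_integrable(2)[OF cF K' z'])
  have "integral UNIV F = integral\<^sup>L (distr lborel borel \<sigma>) F"
    using compact_support_integrable(3)[OF c K z] lborel_reindex[OF \<pi>] by (simp add: \<sigma>_def)
  also have "\<dots> = integral\<^sup>L lborel (\<lambda>y. F (\<sigma> y))"
    using c cs by (intro integral_distr) (auto intro: borel_measurable_continuous_onI)
  also have "\<dots> = integral UNIV (\<lambda>y. F (\<sigma> y))" by (rule compact_support_integrable(3)[OF cF K' z', symmetric])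
  finally show "integral UNIV (\<lambda>y. F (\<sigma> y)) = integral UNIV F" by simp
qed

text \<open>Reindexing both sides reduces this to the theorem for a well-ordered index type and values in \<open>real^1\<close>. Compact
  support makes all functions integrable.\<close>

lemma change_of_variables:
  fixes \<psi> :: "real^'n \<Rightarrow> real^'n" and f :: "real^'n \<Rightarrow> real"
  assumes S: "open S" and T: "open (\<psi> ` S)" and inj: "inj_on \<psi> S" and sm: "smooth_on \<psi> S"
    and f: "continuous_on (\<psi> ` S) f" "supported (\<psi> ` S) K f"
    and K': "supported S K' (\<lambda>x. f (\<psi> x))"
  shows "integral S (\<lambda>x. \<bar>det (jac \<psi> x)\<bar> * f (\<psi> x)) = integral (\<psi> ` S) f"
proof -
  \<comment> \<open>\<open>\<sigma>\<close> and \<open>\<tau>\<close> rename coordinates and are inverse to each other; \<open>\<psi>'\<close> and \<open>S'\<close> are \<open>\<psi>\<close> and \<open>S\<close> in the renamed coordinates.\<close>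
  obtain \<pi>' :: "'n idx \<Rightarrow> 'n" where p': "bij \<pi>'" using ex_index_bijection by blast
  define \<pi> where "\<pi> = inv \<pi>'"
  have \<pi>: "bij \<pi>" unfolding \<pi>_def by (rule bij_imp_bij_inv[OF p'])
  have r: "\<pi>' (\<pi> k) = k" and l: "\<pi> (\<pi>' j) = j" for k j
    using p' by (simp_all add: \<pi>_def bij_is_surj bij_is_inj surj_f_inv_f)
  define \<sigma> :: "real^'n idx \<Rightarrow> real^'n" where "\<sigma> y = (\<chi> k. y $ \<pi> k)" for y
  define \<tau> :: "real^'n \<Rightarrow> real^'n idx" where "\<tau> x = (\<chi> i. x $ \<pi>' i)" for x
  have st: "\<sigma> (\<tau> x) = x" and ts: "\<tau> (\<sigma> y) = y" for x y by (simp_all add: \<sigma>_def \<tau>_def r l)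
  have lt: "bounded_linear \<tau>" and ls: "bounded_linear \<sigma>"
    unfolding linear_conv_bounded_linear[symmetric]
    by (auto intro!: linearI simp: \<tau>_def \<sigma>_def vec_eq_iff)
  define S' where "S' = \<sigma> -` S"
  have S': "open S'" unfolding S'_def
    by (rule open_vimage[OF S linear_continuous_on[OF ls]])
  define \<psi>' where "\<psi>' y = \<tau> (\<psi> (\<sigma> y))" for y
  define D where "D y v = \<tau> (frechet_derivative \<psi> (at (\<sigma> y)) (\<sigma> v))" for y v
  have der: "(\<psi>' has_derivative D y) (at y within S')" if "y \<in> S'" for y
  proof -
    have "\<psi> differentiable (at (\<sigma> y))" using sm that smooth_on_differentiable by (auto simp: S'_def)
    then have "(\<psi> has_derivative frechet_derivative \<psi> (at (\<sigma> y))) (at (\<sigma> y))" using frechet_derivative_works by blast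
    then have "((\<lambda>y. \<psi> (\<sigma> y)) has_derivative (\<lambda>v. frechet_derivative \<psi> (at (\<sigma> y)) (\<sigma> v))) (at y)"
      by (rule has_derivative_compose[OF bounded_linear_imp_has_derivative[OF ls]])
    from bounded_linear.has_derivative[OF lt this] show ?thesis
      unfolding \<psi>'_def[abs_def] D_def[abs_def] by (rule has_derivative_at_withinI)
  qed
  have inj': "inj_on \<psi>' S'"
  proof (rule inj_onI)
    fix x y assume "x \<in> S'" "y \<in> S'" "\<psi>' x = \<psi>' y"
    then have "\<psi> (\<sigma> x) = \<psi> (\<sigma> y)" unfolding \<psi>'_def by (metis st)
    then have "\<sigma> x = \<sigma> y" using inj \<open>x \<in> S'\<close> \<open>y \<in> S'\<close> by (auto simp: S'_def inj_on_def)
    then show "x = y" by (metis ts)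
  qed
  have img: "\<psi>' ` S' = \<sigma> -` (\<psi> ` S)"
  proof (intro set_eqI iffI)
    fix z assume "z \<in> \<psi>' ` S'"
    then show "z \<in> \<sigma> -` (\<psi> ` S)" by (auto simp: \<psi>'_def S'_def st)
  next
    fix z assume "z \<in> \<sigma> -` (\<psi> ` S)"
    then obtain x where x: "x \<in> S" "\<sigma> z = \<psi> x" by auto
    have "\<psi>' (\<tau> x) = z" unfolding \<psi>'_def st x(2)[symmetric] by (rule ts)
    then show "z \<in> \<psi>' ` S'" using x(1) by (auto simp: S'_def st intro!: image_eqI[of _ _ "\<tau> x"])
  qed
  have dt: "det (matrix (D y)) = det (jac \<psi> (\<sigma> y))" for y
  proof -
    have sa: "\<sigma> (axis j 1) = axis (\<pi>' j) 1" for j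
      using r l by (auto simp: \<sigma>_def vec_eq_iff axis_def)
    have "matrix (D y) = (\<chi> i j. jac \<psi> (\<sigma> y) $ \<pi>' i $ \<pi>' j)"
      unfolding matrix_def jac_def D_def[abs_def] \<tau>_def sa by simp
    then show ?thesis using det_reindex[OF p'] by simp
  qed
  define F where "F = zext (\<psi> ` S) f"
  have F: "continuous_on UNIV F" "compact K" "\<And>x. x \<notin> K \<Longrightarrow> F x = 0"
    using zext_continuous[OF T f] zext_zero[OF f(2)] f(2) by (auto simp: F_def supported_def)
  note IF = integral_reindex[OF \<pi> F, folded \<sigma>_def]
  define L where "L x = \<bar>det (jac \<psi> x)\<bar> * f (\<psi> x)" for x
  have cL: "continuous_on S L"
  proof -
    have "smooth_on (\<lambda>x. jac \<psi> x $ m $ i) S" for m i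
      by (rule smooth_on_cong[OF S jac_component[OF smooth_on_differentiable[OF sm], symmetric]
            smooth_on_partial[OF smooth_on_component[OF S sm]]])
    then have "continuous_on S (\<lambda>x. det (jac \<psi> x))"
      unfolding det_def by (intro continuous_intros smooth_on_continuous)
    then show ?thesis unfolding L_def[abs_def]
      by (intro continuous_intros continuous_on_compose2[OF f(1) smooth_on_continuous[OF sm]]) auto
  qed
  have sL: "supported S K' L" using K' by (auto simp: supported_def L_def)
  have FL: "continuous_on UNIV (zext S L)" "compact K'" "\<And>x. x \<notin> K' \<Longrightarrow> zext S L x = 0"
    using zext_continuous[OF S cL sL] zext_zero[OF sL] sL by (auto simp: supported_def)
  note IL = integral_reindex[OF \<pi> FL, folded \<sigma>_def]
  have "(\<lambda>y. f (\<sigma> y)) absolutely_integrable_on (\<psi>' ` S')"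
  proof -
    have "(\<lambda>y. if y \<in> \<psi>' ` S' then f (\<sigma> y) else 0) = (\<lambda>y. F (\<sigma> y))"
      unfolding img by (auto simp: F_def zext_def)
    then show ?thesis using IF(2) absolutely_integrable_restrict_UNIV[of "\<psi>' ` S'" "\<lambda>y. f (\<sigma> y)"] by simp
  qed
  moreover have "bounded_linear (\<lambda>t::real. (\<chi> i::1. t) :: real^1)"
    unfolding linear_conv_bounded_linear[symmetric] by (auto intro!: linearI simp: vec_eq_iff)
  ultimately have a: "(\<lambda>y. (\<chi> i::1. f (\<sigma> y)) :: real^1) absolutely_integrable_on (\<psi>' ` S')"
    by (drule_tac absolutely_integrable_linear) (auto simp: o_def)
  have "(\<lambda>x. \<bar>det (matrix (D x))\<bar> *\<^sub>R ((\<chi> i::1. f (\<sigma> (\<psi>' x))) :: real^1)) absolutely_integrable_on S' \<and>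
     integral S' (\<lambda>x. \<bar>det (matrix (D x))\<bar> *\<^sub>R ((\<chi> i::1. f (\<sigma> (\<psi>' x))) :: real^1)) = integral (\<psi>' ` S') (\<lambda>y. (\<chi> i::1. f (\<sigma> y)) :: real^1)"
    using has_absolute_integral_change_of_variables[of S' \<psi>' D "\<lambda>y. (\<chi> i::1. f (\<sigma> y)) :: real^1" "integral (\<psi>' ` S') (\<lambda>y. (\<chi> i::1. f (\<sigma> y)) :: real^1)"]
      S' der inj' a by auto
  then have A: "(\<lambda>x. \<bar>det (matrix (D x))\<bar> *\<^sub>R ((\<chi> i::1. f (\<sigma> (\<psi>' x))) :: real^1)) absolutely_integrable_on S'"
    and B: "integral S' (\<lambda>x. \<bar>det (matrix (D x))\<bar> *\<^sub>R ((\<chi> i::1. f (\<sigma> (\<psi>' x))) :: real^1)) = integral (\<psi>' ` S') (\<lambda>y. (\<chi> i::1. f (\<sigma> y)) :: real^1)" by auto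
  have comp: "integral X g $ 1 = integral X (\<lambda>x. g x $ 1)" if "g absolutely_integrable_on X" for X and g :: "real^'n idx \<Rightarrow> real^1"
    using integral_linear[OF _ bounded_linear_vec_nth[of 1], of g X] that set_lebesgue_integral_eq_integral(1)[OF that]
    by (simp add: o_def)
  have "integral (\<psi> ` S) f = integral UNIV F" by (simp add: F_def zext_integral)
  also have "\<dots> = integral UNIV (\<lambda>y. F (\<sigma> y))" by (rule IF(1)[symmetric])
  also have "(\<lambda>y. F (\<sigma> y)) = zext (\<psi>' ` S') (\<lambda>y. f (\<sigma> y))"
    unfolding img by (auto simp: F_def zext_def)
  also have "integral UNIV (zext (\<psi>' ` S') (\<lambda>y. f (\<sigma> y))) = integral (\<psi>' ` S') (\<lambda>y. f (\<sigma> y))"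
    by (rule zext_integral)
  also have "\<dots> = integral S' (\<lambda>x. \<bar>det (matrix (D x))\<bar> * f (\<sigma> (\<psi>' x)))"
    using arg_cong[OF B, of "\<lambda>v. v $ 1"] by (simp add: comp[OF A] comp[OF a])
  also have "\<dots> = integral UNIV (zext S' (\<lambda>x. \<bar>det (matrix (D x))\<bar> * f (\<sigma> (\<psi>' x))))"
    by (rule zext_integral[symmetric])
  also have "zext S' (\<lambda>x. \<bar>det (matrix (D x))\<bar> * f (\<sigma> (\<psi>' x))) = (\<lambda>y. zext S L (\<sigma> y))"
    by (auto simp: zext_def L_def dt \<psi>'_def st S'_def)
  also have "integral UNIV (\<lambda>y. zext S L (\<sigma> y)) = integral S L" by (simp add: IL(1) zext_integral)
  finally show ?thesis by (simp add: L_def[abs_def])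
qed

section \<open>Metrics on the manifold in charts\<close>

lemma quadratic_entries: "(\<And>\<xi> \<zeta>. \<xi> \<bullet> (A *v \<zeta>) = \<xi> \<bullet> (B *v \<zeta>)) \<Longrightarrow> A = (B :: real^'n^'n)"
proof -
  assume e: "\<And>\<xi> \<zeta>. \<xi> \<bullet> (A *v \<zeta>) = \<xi> \<bullet> (B *v \<zeta>)"
  have "A $ i $ j = B $ i $ j" for i j
    using e[of "axis i 1" "axis j 1"] by (simp add: inner_axis' matrix_vector_mul_component inner_axis)
  then show ?thesis by (simp add: vec_eq_iff)
qed

lemma pullback_form: "\<xi> \<bullet> ((transpose J ** B ** J) *v \<zeta>) = (J *v \<xi>) \<bullet> (B *v (J *v \<zeta>))" for B J :: "real^'n^'n"
proof -
  have "(transpose J ** B ** J) *v \<zeta> = (B *v (J *v \<zeta>)) v* J"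
    by (simp add: matrix_vector_mul_assoc[symmetric])
  then show ?thesis by (metis dot_lmul_matrix inner_commute)
qed

locale manifold =
  fixes M :: "'a::t2_space set" and A :: "('a, 'n::finite) chart set"
  assumes cm: "compact_manifold M A"
begin

lemma compact_M: "compact M" and atlas: "smooth_atlas M A"
  using cm by (auto simp: compact_manifold_def)

lemma chart: assumes "c \<in> A"
  shows "openin (top_of_set M) (cdom c)" "open (cimg c)" "homeomorphism (cdom c) (cimg c) (cmap c) (cinv c)"
  using atlas assms by (auto simp: smooth_atlas_def chart_on_def)

lemma cdom_M: "c \<in> A \<Longrightarrow> cdom c \<subseteq> M"
  using chart(1) openin_imp_subset by blast

lemma cinv_cmap: "c \<in> A \<Longrightarrow> p \<in> cdom c \<Longrightarrow> cinv c (cmap c p) = p"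
  and cmap_cinv: "c \<in> A \<Longrightarrow> x \<in> cimg c \<Longrightarrow> cmap c (cinv c x) = x"
  and cinv_dom: "c \<in> A \<Longrightarrow> x \<in> cimg c \<Longrightarrow> cinv c x \<in> cdom c"
  using homeomorphism_apply1[OF chart(3)] homeomorphism_apply2[OF chart(3)] homeomorphism_image2[OF chart(3)]
  by blast+

lemma cmap_img: "p \<in> cdom c \<Longrightarrow> cmap c p \<in> cimg c" by simp

lemma chart_exists: "p \<in> M \<Longrightarrow> \<exists>c\<in>A. p \<in> cdom c"
  using atlas by (auto simp: smooth_atlas_def)

lemma continuous_cmap: "c \<in> A \<Longrightarrow> continuous_on (cdom c) (cmap c)"
  and continuous_cinv: "c \<in> A \<Longrightarrow> continuous_on (cimg c) (cinv c)"
  using chart(3) homeomorphism_def by blast+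

definition overlap :: "('a, 'n) chart \<Rightarrow> ('a, 'n) chart \<Rightarrow> (real^'n) set"
  where "overlap c d = cmap c ` (cdom c \<inter> cdom d)"

lemma overlap_iff:
  assumes c: "c \<in> A" shows "x \<in> overlap c d \<longleftrightarrow> x \<in> cimg c \<and> cinv c x \<in> cdom d"
proof
  assume "x \<in> overlap c d"
  then obtain p where "p \<in> cdom c" "p \<in> cdom d" "x = cmap c p" by (auto simp: overlap_def)
  then show "x \<in> cimg c \<and> cinv c x \<in> cdom d" by (simp add: cinv_cmap[OF c])
next
  assume "x \<in> cimg c \<and> cinv c x \<in> cdom d"
  then show "x \<in> overlap c d"
    unfolding overlap_def using cinv_dom[OF c, of x] cmap_cinv[OF c, of x] by (intro image_eqI[of _ _ "cinv c x"]) auto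
qed

lemma open_overlap: assumes "c \<in> A" "d \<in> A" shows "open (overlap c d)"
proof -
  have "openin (top_of_set (cdom c)) (cdom c \<inter> cdom d)"
    using openin_subset_trans[OF openin_Int[OF chart(1)[OF assms(1)] chart(1)[OF assms(2)]]] cdom_M[OF assms(1)] by blast
  then have "openin (top_of_set (cimg c)) (overlap c d)"
    unfolding overlap_def by (rule homeomorphism_imp_open_map[OF chart(3)[OF assms(1)]])
  then show ?thesis using openin_open_trans chart(2)[OF assms(1)] by blast
qed

lemma smooth_transition: "c \<in> A \<Longrightarrow> d \<in> A \<Longrightarrow> smooth_on (transition c d) (overlap c d)"
  using atlas by (auto simp: smooth_atlas_def overlap_def)

lemma diff_transition: "c \<in> A \<Longrightarrow> d \<in> A \<Longrightarrow> x \<in> overlap c d \<Longrightarrow> transition c d differentiable (at x)"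
  using smooth_on_differentiable[OF smooth_transition] .

lemma transition_apply: "c \<in> A \<Longrightarrow> p \<in> cdom c \<Longrightarrow> transition c d (cmap c p) = cmap d p"
  by (simp add: transition_def cinv_cmap)

lemma transition_maps: "c \<in> A \<Longrightarrow> d \<in> A \<Longrightarrow> x \<in> overlap c d \<Longrightarrow> transition c d x \<in> overlap d c"
  by (auto simp: overlap_def transition_apply)

lemma transition_image: "c \<in> A \<Longrightarrow> d \<in> A \<Longrightarrow> transition c d ` overlap c d = overlap d c"
proof (intro equalityI subsetI)
  fix y assume c: "c \<in> A" "d \<in> A" and "y \<in> overlap d c"
  then obtain p where "p \<in> cdom c" "p \<in> cdom d" "y = cmap d p" by (auto simp: overlap_def)
  then show "y \<in> transition c d ` overlap c d"
    using c by (auto simp: overlap_def transition_apply intro!: image_eqI[of _ _ "cmap c p"])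
qed (auto simp: transition_maps)

lemma transition_inj: "c \<in> A \<Longrightarrow> d \<in> A \<Longrightarrow> inj_on (transition c d) (overlap c d)"
  by (auto simp: inj_on_def overlap_def transition_apply) (metis cinv_cmap)

lemma cinv_transition: "c \<in> A \<Longrightarrow> d \<in> A \<Longrightarrow> x \<in> overlap c d \<Longrightarrow> cinv d (transition c d x) = cinv c x"
  by (auto simp: overlap_def transition_apply cinv_cmap)

text \<open>The chain rule for transition maps; it makes tangent vectors well defined.\<close>

lemma derivative_cocycle:
  assumes "c \<in> A" "d \<in> A" "e \<in> A" "p \<in> cdom c" "p \<in> cdom d" "p \<in> cdom e"
  shows "frechet_derivative (transition c e) (at (cmap c p)) \<xi>
    = frechet_derivative (transition d e) (at (cmap d p)) (frechet_derivative (transition c d) (at (cmap c p)) \<xi>)"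
proof -
  let ?x = "cmap c p"
  have x: "?x \<in> overlap c d" "?x \<in> overlap c e" "transition c d ?x = cmap d p" "cmap d p \<in> overlap d e"
    using assms by (auto simp: overlap_def transition_apply)
  have h: "((\<lambda>y. transition d e (transition c d y)) has_derivative
     (\<lambda>\<xi>. frechet_derivative (transition d e) (at (cmap d p)) (frechet_derivative (transition c d) (at ?x) \<xi>))) (at ?x)"
  proof -
    have "(transition c d has_derivative frechet_derivative (transition c d) (at ?x)) (at ?x)"
      using diff_transition[OF assms(1,2) x(1)] frechet_derivative_works by blast
    moreover have "(transition d e has_derivative frechet_derivative (transition d e) (at (cmap d p))) (at (transition c d ?x))"
      using diff_transition[OF assms(2,3) x(4)] frechet_derivative_works x(3) by metis
    ultimately show ?thesis by (rule has_derivative_compose)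
  qed
  have "(transition c e has_derivative
     (\<lambda>\<xi>. frechet_derivative (transition d e) (at (cmap d p)) (frechet_derivative (transition c d) (at ?x) \<xi>))) (at ?x)"
  proof (rule has_derivative_transform_within_open[OF h])
    show "open (overlap c d \<inter> overlap c e)" using assms by (intro open_Int open_overlap)
    show "?x \<in> overlap c d \<inter> overlap c e" using x by simp
    fix y assume "y \<in> overlap c d \<inter> overlap c e"
    then obtain q where "q \<in> cdom c" "q \<in> cdom d" "y = cmap c q" using assms by (auto simp: overlap_def)
    then show "transition d e (transition c d y) = transition c e y" using assms by (simp add: transition_apply)
  qed
  from frechet_derivative_at[OF this] show ?thesis by metis
qed

lemma derivative_self:
  assumes "c \<in> A" "p \<in> cdom c" shows "frechet_derivative (transition c c) (at (cmap c p)) \<xi> = \<xi>"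
proof -
  have "(transition c c has_derivative (\<lambda>\<xi>. \<xi>)) (at (cmap c p))"
    by (rule has_derivative_transform_within_open[OF has_derivative_ident chart(2)[OF assms(1)]])
      (use assms in \<open>auto simp: transition_apply\<close>)
  from frechet_derivative_at[OF this] show ?thesis by metis
qed

lemma jac_transition_inverse:
  assumes "c \<in> A" "d \<in> A" "p \<in> cdom c" "p \<in> cdom d"
  shows "jac (transition d c) (cmap d p) *v (jac (transition c d) (cmap c p) *v \<xi>) = \<xi>"
  using derivative_cocycle[OF assms(1,2,1,3,4,3)] derivative_self[OF assms(1,3)]
    jac_mult[OF diff_transition[OF assms(1,2)]] jac_mult[OF diff_transition[OF assms(2,1)]] assms
  by (simp add: overlap_def)

lemma jac_transition_invertible:
  assumes c: "c \<in> A" "d \<in> A" and x: "x \<in> overlap c d" shows "invertible (jac (transition c d) x)"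
proof -
  obtain p where p: "p \<in> cdom c" "p \<in> cdom d" "x = cmap c p" using x by (auto simp: overlap_def)
  have "(jac (transition d c) (cmap d p) ** jac (transition c d) x) *v \<xi> = mat 1 *v \<xi>" for \<xi>
    using jac_transition_inverse[OF c p(1,2)] p(3) by (simp add: matrix_vector_mul_assoc[symmetric])
  then have "jac (transition d c) (cmap d p) ** jac (transition c d) x = mat 1"
    using matrix_eq by blast
  then show ?thesis using invertible_left_inverse by blast
qed

lemma coord_change_transition:
  assumes "c \<in> A" "d \<in> A" shows "coord_change (overlap c d) (overlap d c) (transition c d)"
  using assms by unfold_locales
    (auto simp: open_overlap transition_maps smooth_transition jac_transition_invertible)

text \<open>The tangent vector whose coordinate vector in the chart \<open>c\<close> is \<open>\<xi>\<close>.\<close>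

definition tvec_of :: "('a, 'n) chart \<Rightarrow> 'a \<Rightarrow> real^'n \<Rightarrow> ('a, 'n) tvec"
  where "tvec_of c p \<xi> = (\<lambda>d. if d \<in> charts_at A p then frechet_derivative (transition c d) (at (cmap c p)) \<xi> else 0)"

lemma charts_at_iff: "c \<in> charts_at A p \<longleftrightarrow> c \<in> A \<and> p \<in> cdom c"
  by (auto simp: charts_at_def)

lemma coord_vec_tvec: "coord_vec A c i p = tvec_of c p (axis i 1)"
  by (simp add: coord_vec_def tvec_of_def)

lemma tvec_of_tangent: "c \<in> A \<Longrightarrow> p \<in> cdom c \<Longrightarrow> tvec_of c p \<xi> \<in> tangent_space A p"
  by (auto simp: tangent_space_def tvec_of_def charts_at_iff intro!: derivative_cocycle)

lemma tvec_of_self: "c \<in> A \<Longrightarrow> p \<in> cdom c \<Longrightarrow> tvec_of c p \<xi> c = \<xi>"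
  by (simp add: tvec_of_def charts_at_iff derivative_self)

lemma tangent_eq_tvec_of:
  assumes "c \<in> A" "p \<in> cdom c" and v: "v \<in> tangent_space A p" shows "v = tvec_of c p (v c)"
proof
  fix d
  have c: "c \<in> charts_at A p" using assms by (simp add: charts_at_iff)
  show "v d = tvec_of c p (v c) d"
    using v c unfolding tangent_space_def tvec_of_def mem_Collect_eq by (cases "d \<in> charts_at A p") metis+
qed

lemma tvec_of_change:
  assumes "c \<in> A" "d \<in> A" "p \<in> cdom c" "p \<in> cdom d"
  shows "tvec_of c p \<xi> = tvec_of d p (jac (transition c d) (cmap c p) *v \<xi>)"
proof -
  have "cmap c p \<in> overlap c d" using assms by (auto simp: overlap_def)
  then have "jac (transition c d) (cmap c p) *v \<xi> = tvec_of c p \<xi> d"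
    using assms by (simp add: tvec_of_def charts_at_iff jac_mult diff_transition)
  then show ?thesis using tangent_eq_tvec_of[OF assms(2,4) tvec_of_tangent[OF assms(1,3)]] by metis
qed

lemma tvec_of_linear:
  assumes "c \<in> A" "p \<in> cdom c"
  shows "tvec_of c p (a *\<^sub>R \<xi> + b *\<^sub>R \<zeta>) = (\<lambda>d. a *\<^sub>R tvec_of c p \<xi> d + b *\<^sub>R tvec_of c p \<zeta> d)"
proof
  fix d
  show "tvec_of c p (a *\<^sub>R \<xi> + b *\<^sub>R \<zeta>) d = a *\<^sub>R tvec_of c p \<xi> d + b *\<^sub>R tvec_of c p \<zeta> d"
  proof (cases "d \<in> charts_at A p")
    case True
    then have "cmap c p \<in> overlap c d" "d \<in> A" using assms by (auto simp: overlap_def charts_at_iff)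
    then have "linear (frechet_derivative (transition c d) (at (cmap c p)))"
      using linear_frechet_derivative diff_transition assms by blast
    then show ?thesis using True by (simp add: tvec_of_def linear_add linear_scale)
  qed (simp add: tvec_of_def)
qed

lemma form_components:
  assumes h: "sym_bilinear_on (tangent_space A p) (h p)" and c: "c \<in> A" "p \<in> cdom c"
  shows "h p (tvec_of c p \<xi>) (tvec_of c p \<zeta>) = \<xi> \<bullet> (components A h c (cmap c p) *v \<zeta>)"
proof -
  define B where "B \<xi> \<zeta> = h p (tvec_of c p \<xi>) (tvec_of c p \<zeta>)" for \<xi> \<zeta>
  have sym: "B \<xi> \<zeta> = B \<zeta> \<xi>" for \<xi> \<zeta>
    using h tvec_of_tangent[OF c] by (simp add: B_def sym_bilinear_on_def)
  have "B (a *\<^sub>R \<xi> + b *\<^sub>R \<xi>') \<zeta> = a * B \<xi> \<zeta> + b * B \<xi>' \<zeta>" for a b \<xi> \<xi>' \<zeta>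
    using h tvec_of_tangent[OF c] unfolding B_def tvec_of_linear[OF c] sym_bilinear_on_def by blast
  from this[of 1 _ 1] this[of _ _ 0] have l1: "linear (\<lambda>\<xi>. B \<xi> \<zeta>)" for \<zeta>
    by (intro linearI) auto
  have l2: "linear (\<lambda>\<zeta>. B \<xi> \<zeta>)" for \<xi>
  proof -
    have e: "(\<lambda>\<zeta>. B \<xi> \<zeta>) = (\<lambda>\<zeta>. B \<zeta> \<xi>)" by (rule ext) (rule sym)
    show ?thesis by (subst e) (rule l1)
  qed
  have e: "v = (\<Sum>i\<in>UNIV. v $ i *\<^sub>R axis i 1)" for v :: "real^'n"
    using basis_expansion[of v] by (simp add: scalar_mult_eq_scaleR)
  have "B \<xi> \<zeta> = (\<Sum>i\<in>UNIV. \<xi> $ i * B (axis i 1) \<zeta>)"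
    by (subst e[of \<xi>]) (simp add: linear_sum[OF l1] linear_scale[OF l1])
  also have "\<dots> = (\<Sum>i\<in>UNIV. \<xi> $ i * (\<Sum>j\<in>UNIV. \<zeta> $ j * B (axis i 1) (axis j 1)))"
    by (subst e[of \<zeta>]) (simp add: linear_sum[OF l2] linear_scale[OF l2])
  also have "\<dots> = \<xi> \<bullet> (components A h c (cmap c p) *v \<zeta>)"
    by (simp add: inner_vec_def matrix_vector_mult_def components_def cinv_cmap[OF c] coord_vec_tvec B_def mult.commute)
  finally show ?thesis by (simp add: B_def)
qed

lemma metrics_sym_bilinear: "h \<in> metrics M A \<Longrightarrow> p \<in> M \<Longrightarrow> sym_bilinear_on (tangent_space A p) (h p)"
  by (simp add: metrics_def)

lemma metric_components:
  assumes h: "h \<in> metrics M A" and c: "c \<in> A" "p \<in> cdom c"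
  shows "h p (tvec_of c p \<xi>) (tvec_of c p \<zeta>) = \<xi> \<bullet> (components A h c (cmap c p) *v \<zeta>)"
  using form_components[of p h c] metrics_sym_bilinear[OF h] cdom_M c by blast

lemma metric_field_components:
  assumes h: "h \<in> metrics M A" and c: "c \<in> A"
  shows "metric_field (cimg c) (components A h c)"
  unfolding metric_field_def
proof (intro conjI ballI)
  show "open (cimg c)" by (rule chart(2)[OF c])
  show "msmooth (components A h c) (cimg c)"
    using h c by (auto simp: metrics_def msmooth_def)
  fix x assume x: "x \<in> cimg c"
  define p where "p = cinv c x"
  have p: "p \<in> cdom c" "cmap c p = x" "p \<in> M"
    using cinv_dom[OF c x] cmap_cinv[OF c x] cdom_M[OF c] unfolding p_def by blast+
  let ?G = "components A h c x"
  have f: "h p (tvec_of c p \<xi>) (tvec_of c p \<zeta>) = \<xi> \<bullet> (?G *v \<zeta>)" for \<xi> \<zeta>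
    using metric_components[OF h c p(1)] p(2) by simp
  have "\<xi> \<bullet> (?G *v \<zeta>) = \<zeta> \<bullet> (?G *v \<xi>)" for \<xi> \<zeta>
    using metrics_sym_bilinear[OF h p(3)] tvec_of_tangent[OF c p(1)]
    by (simp add: f[symmetric] sym_bilinear_on_def)
  then have "transpose ?G = ?G"
    by (intro quadratic_entries) (metis dot_lmul_matrix inner_commute transpose_matrix_vector)
  moreover have "\<xi> \<bullet> (?G *v \<xi>) > 0" if "\<xi> \<noteq> 0" for \<xi>
  proof -
    have "tvec_of c p \<xi> \<noteq> (\<lambda>_. 0)" using tvec_of_self[OF c p(1), of \<xi>] that by metis
    then have "0 < h p (tvec_of c p \<xi>) (tvec_of c p \<xi>)"
      using h p(3) tvec_of_tangent[OF c p(1)] by (simp add: metrics_def pos_definite_on_def)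
    then show ?thesis by (simp add: f)
  qed
  ultimately show "posdef ?G" by (simp add: posdef_def)
qed

text \<open>Both sides evaluate \<open>h\<close> on the same tangent vectors, written in the charts \<open>c\<close> and \<open>d\<close>. All transformation laws
  for changes of coordinates apply to the components of a metric through this lemma.\<close>

lemma components_pull_back:
  assumes h: "h \<in> metrics M A" and c: "c \<in> A" and d: "d \<in> A"
  shows "coord_change.pulls_back (overlap c d) (overlap d c) (transition c d) (components A h c) (components A h d)"
proof -
  interpret coord_change "overlap c d" "overlap d c" "transition c d"
    by (rule coord_change_transition[OF c d])
  have "components A h c x = transpose (J x) ** components A h d (transition c d x) ** J x" if x: "x \<in> overlap c d" for x
  proof (rule quadratic_entries)
    fix \<xi> \<zeta>
    obtain p where p: "p \<in> cdom c" "p \<in> cdom d" "x = cmap c p" using x by (auto simp: overlap_def)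
    have "\<xi> \<bullet> (components A h c x *v \<zeta>) = h p (tvec_of c p \<xi>) (tvec_of c p \<zeta>)"
      using metric_components[OF h c p(1)] p(3) by simp
    also have "\<dots> = (J x *v \<xi>) \<bullet> (components A h d (transition c d x) *v (J x *v \<zeta>))"
      unfolding tvec_of_change[OF c d p(1,2)] p(3) transition_apply[OF c p(1)]
      by (rule metric_components[OF h d p(2)])
    finally show "\<xi> \<bullet> (components A h c x *v \<zeta>)
      = \<xi> \<bullet> ((transpose (J x) ** components A h d (transition c d x) ** J x) *v \<zeta>)"
      by (simp only: pullback_form)
  qed
  moreover have "overlap c d \<subseteq> cimg c" "overlap d c \<subseteq> cimg d" by (auto simp: overlap_def)
  ultimately show ?thesis
    unfolding pulls_back_def
    using metric_field_subset[OF metric_field_components[OF h]] c d open_overlap by blast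
qed

lemma chart_at_in: assumes "p \<in> M" shows "chart_at A p \<in> A" "p \<in> cdom (chart_at A p)"
proof -
  obtain c where "c \<in> charts_at A p" using chart_exists[OF assms] charts_at_iff by metis
  then have "chart_at A p \<in> charts_at A p" unfolding chart_at_def by (rule someI)
  then show "chart_at A p \<in> A" "p \<in> cdom (chart_at A p)" by (simp_all only: charts_at_iff)
qed

lemma scalar_curvature_chart:
  assumes h: "h \<in> metrics M A" and c: "c \<in> A" "p \<in> cdom c"
  shows "scalar_curvature A h p = scalar_coord (components A h c) (cmap c p)"
proof -
  define d where "d = chart_at A p"
  have d: "d \<in> A" "p \<in> cdom d" using chart_at_in[of p] cdom_M[OF c(1)] c(2) unfolding d_def by blast+
  interpret coord_change "overlap c d" "overlap d c" "transition c d"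
    by (rule coord_change_transition[OF c(1) d(1)])
  have "cmap c p \<in> overlap c d" using c d by (auto simp: overlap_def)
  from scalar_transform[OF components_pull_back[OF h c(1) d(1)] this] show ?thesis
    by (simp add: scalar_curvature_def d_def[symmetric] Let_def transition_apply[OF c])
qed

lemma ricci_chart:
  assumes h: "h \<in> metrics M A" and c: "c \<in> A" "p \<in> cdom c"
  shows "ricci A h p (tvec_of c p \<xi>) (tvec_of c p \<xi>) = \<xi> \<bullet> (Ric (components A h c) (cmap c p) *v \<xi>)"
proof -
  define d where "d = chart_at A p"
  have d: "d \<in> A" "p \<in> cdom d" using chart_at_in[of p] cdom_M[OF c(1)] c(2) unfolding d_def by blast+
  interpret coord_change "overlap c d" "overlap d c" "transition c d"
    by (rule coord_change_transition[OF c(1) d(1)])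
  have x: "cmap c p \<in> overlap c d" using c d by (auto simp: overlap_def)
  define \<zeta> where "\<zeta> = J (cmap c p) *v \<xi>"
  have v: "tvec_of c p \<xi> d = \<zeta>"
    using tvec_of_change[OF c(1) d(1) c(2) d(2)] tvec_of_self[OF d] by (simp add: \<zeta>_def)
  have "ricci A h p (tvec_of c p \<xi>) (tvec_of c p \<xi>) = \<zeta> \<bullet> (Ric (components A h d) (cmap d p) *v \<zeta>)"
    unfolding ricci_def d_def[symmetric] Let_def v
    by (simp add: inner_vec_def matrix_vector_mult_def Ric_def sum_distrib_left mult.commute mult.left_commute)
  also have "\<dots> = \<xi> \<bullet> (Ric (components A h c) (cmap c p) *v \<xi>)"
    unfolding Ric_transform[OF components_pull_back[OF h c(1) d(1)] x] pullback_form \<zeta>_def transition_apply[OF c] ..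
  finally show ?thesis .
qed

section \<open>A partition of unity\<close>

text \<open>A \<open>C\<^sup>1\<close> cut-off; one derivative of the partition of unity is all that the divergence theorem uses.\<close>

definition pos_sq :: "real \<Rightarrow> real" where "pos_sq t = (max 0 t)\<^sup>2"

lemma pos_sq_derivative: "(pos_sq has_real_derivative 2 * max 0 t) (at t)"
proof (cases "t = 0")
  case True
  have "((\<lambda>h. (pos_sq (0 + h) - pos_sq 0) / h) \<longlongrightarrow> 0) (at 0)"
  proof (rule Lim_null_comparison)
    show "\<forall>\<^sub>F h in at 0. norm ((pos_sq (0 + h) - pos_sq 0) / h) \<le> \<bar>h\<bar>"
      by (rule always_eventually) (auto simp: pos_sq_def max_def power2_eq_square)
    show "((\<lambda>h::real. \<bar>h\<bar>) \<longlongrightarrow> 0) (at 0)" by (intro tendsto_rabs_zero tendsto_ident_at)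
  qed
  then show ?thesis using True by (simp add: DERIV_def)
next
  case False
  then consider "t > 0" | "t < 0" by linarith
  then show ?thesis
  proof cases
    case 1
    have d: "((\<lambda>t. t\<^sup>2) has_real_derivative 2 * max 0 t) (at t)"
      using 1 by (auto intro!: derivative_eq_intros)
    show ?thesis
      by (rule has_field_derivative_transform_within_open[OF d, of "{0<..}"]) (use 1 in \<open>auto simp: pos_sq_def\<close>)
  next
    case 2
    have d: "((\<lambda>t. 0) has_real_derivative 2 * max 0 t) (at t)" using 2 by auto
    show ?thesis
      by (rule has_field_derivative_transform_within_open[OF d, of "{..<0}"]) (use 2 in \<open>auto simp: pos_sq_def\<close>)
  qed
qed

definition ball_bump :: "real^'n \<Rightarrow> real \<Rightarrow> real^'n \<Rightarrow> real"
  where "ball_bump x r y = pos_sq (r\<^sup>2 - (y - x) \<bullet> (y - x))"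

lemma ball_bump_C1: "Ck_on 1 (ball_bump x r) S"
proof -
  have d: "(ball_bump x r has_derivative (\<lambda>v. 2 * max 0 (r\<^sup>2 - (y - x) \<bullet> (y - x)) * (- 2 * ((y - x) \<bullet> v)))) (at y)" for y
  proof -
    have q: "((\<lambda>y. r\<^sup>2 - (y - x) \<bullet> (y - x)) has_derivative (\<lambda>v. - 2 * ((y - x) \<bullet> v))) (at y)"
      by (auto intro!: derivative_eq_intros simp: inner_commute)
    have "((\<lambda>y. pos_sq (r\<^sup>2 - (y - x) \<bullet> (y - x))) has_derivative
        (\<lambda>v. 2 * max 0 (r\<^sup>2 - (y - x) \<bullet> (y - x)) * (- 2 * ((y - x) \<bullet> v)))) (at y)"
      by (rule has_derivative_compose[OF q pos_sq_derivative[unfolded has_field_derivative_def]])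
    then show ?thesis by (simp add: ball_bump_def[abs_def])
  qed
  have "continuous_on S (\<lambda>y. 2 * max 0 (r\<^sup>2 - (y - x) \<bullet> (y - x)) * (- 2 * ((y - x) \<bullet> v)))" for v
    by (intro continuous_intros)
  moreover have "frechet_derivative (ball_bump x r) (at y) v = 2 * max 0 (r\<^sup>2 - (y - x) \<bullet> (y - x)) * (- 2 * ((y - x) \<bullet> v))" for y v
    using frechet_derivative_at[OF d] by metis
  ultimately show ?thesis using differentiableI[OF d] by simp
qed

lemma ball_bump_iff: "ball_bump x r y \<noteq> 0 \<longleftrightarrow> dist x y < \<bar>r\<bar>"
proof -
  have "(y - x) \<bullet> (y - x) = (dist x y)\<^sup>2"
    by (metis dist_commute dist_norm power2_norm_eq_inner)
  then have "ball_bump x r y \<noteq> 0 \<longleftrightarrow> (dist x y)\<^sup>2 < r\<^sup>2"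
    by (auto simp: ball_bump_def pos_sq_def max_def)
  also have "\<dots> \<longleftrightarrow> dist x y < \<bar>r\<bar>" by (metis abs_le_square_iff abs_of_nonneg linorder_not_le zero_le_dist)
  finally show ?thesis .
qed

lemma ball_bump_nonneg: "0 \<le> ball_bump x r y"
  by (simp add: ball_bump_def pos_sq_def)

end

lemma smooth_defect_field:
  fixes G H :: "real^'n \<Rightarrow> real^'n^'n"
  assumes MG: "metric_field S G" and MH: "metric_field S H"
  shows "smooth_on (\<lambda>x. defect_field G H x $ k) S"
proof -
  have S: "open S" using MG by (simp add: metric_field_def)
  have g: "smooth_on (\<lambda>x. Gam G k x $ a $ b) S" "smooth_on (\<lambda>x. Gam H k x $ a $ b) S" for k a b
    using msmooth_Gam[OF MG] msmooth_Gam[OF MH] by (simp_all add: msmooth_def)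
  have d: "smooth_on (\<lambda>x. conn_diff G H k x $ a $ b) S" for k a b
    unfolding conn_diff_def by (simp, intro smooth_on_diff S g)
  have i: "smooth_on (\<lambda>y. matrix_inv (H y) $ i $ j) S" for i j
    using msmooth_inv[OF MH] by (simp add: msmooth_def)
  show ?thesis
    unfolding defect_field_def trace_def matrix_mult_nth
    by (simp, intro smooth_on_diff smooth_on_sum smooth_on_mult d i S)
qed

lemma divergence_scale:
  fixes X :: "real^'n \<Rightarrow> real^'n"
  assumes f: "f differentiable (at x)" and X: "\<And>k. (\<lambda>y. X y $ k) differentiable (at x)"
  shows "divergence G (\<lambda>y. f y *\<^sub>R X y) x = f x * divergence G X x + (\<Sum>k\<in>UNIV. X x $ k * partial k f x)"
  by (simp add: divergence_def partial_mult[OF f X] sum.distrib sum_distrib_left algebra_simps)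

text \<open>Two metrics on \<open>M\<close>, with a finite cover of \<open>M\<close> by coordinate balls: ball \<open>i\<close> has centre \<open>ce i\<close> and radius \<open>ra i\<close> in
  the chart \<open>ch i\<close>.\<close>

locale metric_pair = manifold M A
  for M :: "'a::t2_space set" and A :: "('a, 'n::finite) chart set" +
  fixes I :: "'i set" and ch :: "'i \<Rightarrow> ('a, 'n) chart" and ce :: "'i \<Rightarrow> real^'n" and ra :: "'i \<Rightarrow> real"
    and g h :: "('a, 'n) form2"
  assumes fin: "finite I" and chA: "\<And>i. i \<in> I \<Longrightarrow> ch i \<in> A" and ra: "\<And>i. i \<in> I \<Longrightarrow> 0 < ra i"
    and sub: "\<And>i. i \<in> I \<Longrightarrow> cball (ce i) (ra i) \<subseteq> cimg (ch i)"
    and cov: "\<And>p. p \<in> M \<Longrightarrow> \<exists>i\<in>I. p \<in> cdom (ch i) \<and> dist (ce i) (cmap (ch i) p) < ra i"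
    and gM: "g \<in> metrics M A" and hM: "h \<in> metrics M A"
begin

definition bump :: "'i \<Rightarrow> 'a \<Rightarrow> real"
  where "bump i q = (if q \<in> cdom (ch i) then ball_bump (ce i) (ra i) (cmap (ch i) q) else 0)"

text \<open>The closed coordinate ball, as a compact subset of \<open>M\<close> that contains the support of \<open>bump i\<close>.\<close>

definition core :: "'i \<Rightarrow> 'a set" where "core i = cinv (ch i) ` cball (ce i) (ra i)"

lemma compact_core: "i \<in> I \<Longrightarrow> compact (core i)"
  unfolding core_def
  by (intro compact_continuous_image continuous_on_subset[OF continuous_cinv[OF chA] sub] compact_cball)

lemma core_dom: "i \<in> I \<Longrightarrow> core i \<subseteq> cdom (ch i)"
  unfolding core_def using cinv_dom[OF chA] sub by blast

lemma bump_zero: assumes "i \<in> I" "q \<notin> core i" shows "bump i q = 0"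
proof (rule ccontr)
  assume "bump i q \<noteq> 0"
  then have q: "q \<in> cdom (ch i)" "ball_bump (ce i) (ra i) (cmap (ch i) q) \<noteq> 0"
    by (auto simp: bump_def split: if_splits)
  then have "cmap (ch i) q \<in> cball (ce i) (ra i)" using ra[OF assms(1)] by (simp add: ball_bump_iff)
  then have "q \<in> core i"
    unfolding core_def by (rule image_eqI[rotated]) (simp add: cinv_cmap[OF chA[OF assms(1)] q(1)])
  then show False using assms(2) by simp
qed

lemma open_off_core: "i \<in> I \<Longrightarrow> d \<in> A \<Longrightarrow> open (cimg d \<inter> cinv d -` (- core i))"
  by (intro continuous_open_preimage continuous_cinv chart(2) open_Compl compact_imp_closed compact_core)

text \<open>Inside the domain of \<open>ch i\<close> the bump is the cut-off composed with a transition map; the remaining points have a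
  neighbourhood off the core, which is closed as \<open>M\<close> is a Hausdorff space.\<close>

lemma bump_C1:
  assumes i: "i \<in> I" and d: "d \<in> A" shows "Ck_on 1 (\<lambda>y. bump i (cinv d y)) (cimg d)"
proof (rule Ck_on_local)
  fix y assume y: "y \<in> cimg d"
  note c = chA[OF i]
  show "\<exists>T. open T \<and> y \<in> T \<and> Ck_on 1 (\<lambda>y. bump i (cinv d y)) T"
  proof (cases "cinv d y \<in> cdom (ch i)")
    case True
    let ?T = "overlap d (ch i)"
    have yT: "y \<in> ?T" using True y by (simp add: overlap_iff[OF d])
    have "Ck_on 1 (\<lambda>y. ball_bump (ce i) (ra i) (transition d (ch i) y)) ?T"
      by (rule Ck_on_compose[OF open_overlap[OF d c] open_UNIV subset_UNIV ball_bump_C1 smooth_onD[OF smooth_transition[OF d c]]])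
    then have "Ck_on 1 (\<lambda>y. bump i (cinv d y)) ?T"
      by (rule Ck_on_cong[OF open_overlap[OF d c], rotated]) (simp add: bump_def transition_def overlap_iff[OF d])
    then show ?thesis using yT open_overlap[OF d c] by blast
  next
    case False
    let ?T = "cimg d \<inter> cinv d -` (- core i)"
    have "Ck_on 1 (\<lambda>y. bump i (cinv d y)) ?T"
      by (rule Ck_on_cong[OF open_off_core[OF i d] _ Ck_on_const[of 1 0]]) (simp add: bump_zero[OF i])
    moreover have "y \<in> ?T" using y False core_dom[OF i] by blast
    ultimately show ?thesis using open_off_core[OF i d] by blast
  qed
qed

definition total :: "'a \<Rightarrow> real" where "total q = (\<Sum>i\<in>I. bump i q)"

lemma bump_nonneg: "0 \<le> bump i q" by (simp add: bump_def ball_bump_nonneg)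

lemma bump_pos: assumes "p \<in> M" obtains i where "i \<in> I" "bump i p > 0" "p \<in> cdom (ch i)"
proof -
  obtain i where i: "i \<in> I" "p \<in> cdom (ch i)" "dist (ce i) (cmap (ch i) p) < ra i" using cov[OF assms] by blast
  then have "bump i p \<noteq> 0" using ra[OF i(1)] by (simp add: bump_def ball_bump_iff)
  then show thesis using bump_nonneg[of i p] i that by (simp add: less_le)
qed

lemma total_pos: assumes "p \<in> M" shows "total p > 0"
proof -
  obtain i where "i \<in> I" "bump i p > 0" using bump_pos[OF assms] by blast
  then show ?thesis unfolding total_def using fin bump_nonneg by (intro sum_pos2[of I i]) auto
qed

definition part :: "'i \<Rightarrow> 'a \<Rightarrow> real" where "part i q = bump i q * inverse (total q)"

lemma part_nonneg: "p \<in> M \<Longrightarrow> 0 \<le> part i p"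
  using total_pos[of p] bump_nonneg[of i p] by (simp add: part_def)

lemma part_sum: "p \<in> M \<Longrightarrow> (\<Sum>i\<in>I. part i p) = 1"
  using total_pos[of p] by (simp add: part_def sum_distrib_right[symmetric] total_def[symmetric])

lemma part_zero: "i \<in> I \<Longrightarrow> q \<notin> core i \<Longrightarrow> part i q = 0"
  by (simp add: part_def bump_zero)

lemma cinv_M: "d \<in> A \<Longrightarrow> y \<in> cimg d \<Longrightarrow> cinv d y \<in> M"
  using cinv_dom cdom_M by blast

lemma part_C1:
  assumes i: "i \<in> I" and d: "d \<in> A" shows "Ck_on 1 (\<lambda>y. part i (cinv d y)) (cimg d)"
proof -
  have "Ck_on 1 (\<lambda>y. total (cinv d y)) (cimg d)"
    unfolding total_def by (intro Ck_on_sum chart(2)[OF d] bump_C1 d)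
  moreover have "total (cinv d y) \<noteq> 0" if "y \<in> cimg d" for y using total_pos[OF cinv_M[OF d that]] by simp
  ultimately show ?thesis unfolding part_def
    by (intro Ck_on_mult bump_C1 i d Ck_on_inverse chart(2)[OF d])
qed

lemma part_differentiable: "i \<in> I \<Longrightarrow> d \<in> A \<Longrightarrow> y \<in> cimg d \<Longrightarrow> (\<lambda>y. part i (cinv d y)) differentiable (at y)"
  by (rule Ck_on_differentiable[OF part_C1[unfolded One_nat_def]])

section \<open>The divergence theorem on the manifold\<close>

abbreviation "G \<equiv> components A g"
abbreviation "H \<equiv> components A h"

lemma MG: "c \<in> A \<Longrightarrow> metric_field (cimg c) (G c)" and MH: "c \<in> A \<Longrightarrow> metric_field (cimg c) (H c)"
  using metric_field_components gM hM by blast+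

text \<open>The field of \<open>scalar_curvature_decomposition\<close> in every chart.\<close>

definition X :: "('a, 'n) chart \<Rightarrow> real^'n \<Rightarrow> real^'n" where "X c = defect_field (G c) (H c)"

text \<open>The derivative of a function on \<open>M\<close> along the vector field, computed in the chart \<open>c\<close>.\<close>

definition Xd :: "('a, 'n) chart \<Rightarrow> ('a \<Rightarrow> real) \<Rightarrow> real^'n \<Rightarrow> real"
  where "Xd c \<phi> y = (\<Sum>k\<in>UNIV. X c y $ k * partial k (\<lambda>y. \<phi> (cinv c y)) y)"

lemma X_C1: "c \<in> A \<Longrightarrow> Ck_on 1 (\<lambda>y. X c y $ k) (cimg c)"
  unfolding X_def by (rule smooth_onD[OF smooth_defect_field[OF MG MH]])

lemma Xd_change:
  assumes c: "c \<in> A" and d: "d \<in> A" and y: "y \<in> overlap c d"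
    and \<phi>: "(\<lambda>y. \<phi> (cinv d y)) differentiable (at (transition c d y))"
  shows "Xd c \<phi> y = Xd d \<phi> (transition c d y)"
proof -
  interpret coord_change "overlap c d" "overlap d c" "transition c d"
    by (rule coord_change_transition[OF c d])
  have V: "X d (transition c d y) = J y *v X c y"
    unfolding X_def by (rule defect_field_transform[OF components_pull_back[OF gM c d] components_pull_back[OF hM c d] y])
  have p: "partial k (\<lambda>y. \<phi> (cinv c y)) y = (\<Sum>m\<in>UNIV. partial m (\<lambda>y. \<phi> (cinv d y)) (transition c d y) * J y $ m $ k)" for k
  proof -
    have "partial k (\<lambda>y. \<phi> (cinv c y)) y = partial k (\<lambda>y. \<phi> (cinv d (transition c d y))) y"
      by (rule partial_cong[OF open_overlap[OF c d] y]) (simp add: cinv_transition[OF c d])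
    also have "\<dots> = (\<Sum>m\<in>UNIV. partial m (\<lambda>y. \<phi> (cinv d y)) (transition c d y) * J y $ m $ k)"
      by (rule partial_compose[OF \<phi> diff_transition[OF c d y]])
    finally show ?thesis .
  qed
  have "Xd c \<phi> y = (\<Sum>k\<in>UNIV. \<Sum>m\<in>UNIV. J y $ m $ k * X c y $ k * partial m (\<lambda>y. \<phi> (cinv d y)) (transition c d y))"
    by (simp add: Xd_def p sum_distrib_left algebra_simps)
  also have "\<dots> = (\<Sum>m\<in>UNIV. \<Sum>k\<in>UNIV. J y $ m $ k * X c y $ k * partial m (\<lambda>y. \<phi> (cinv d y)) (transition c d y))"
    by (rule sum.swap)
  also have "\<dots> = Xd d \<phi> (transition c d y)"
    by (simp add: Xd_def V matrix_vector_mult_def sum_distrib_right)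
  finally show ?thesis .
qed

lemma vol_change:
  assumes c: "c \<in> A" and d: "d \<in> A" and y: "y \<in> overlap c d"
  shows "vol (G c) y = \<bar>det (jac (transition c d) y)\<bar> * vol (G d) (transition c d y)"
proof -
  interpret coord_change "overlap c d" "overlap d c" "transition c d"
    by (rule coord_change_transition[OF c d])
  have "G c y = transpose (J y) ** G d (transition c d y) ** J y"
    using components_pull_back[OF gM c d] y by (simp add: pulls_back_def)
  then have "det (G c y) = (det (J y))\<^sup>2 * det (G d (transition c d y))"
    by (simp add: det_mul power2_eq_square)
  then show ?thesis by (simp add: vol_def real_sqrt_mult)
qed

lemma integral_change_chart:
  assumes c: "c \<in> A" and d: "d \<in> A" and K: "compact K" "K \<subseteq> cdom c \<inter> cdom d"
    and cf: "continuous_on (cimg d) f'"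
    and z: "\<And>y. y \<in> cimg c \<Longrightarrow> cinv c y \<notin> K \<Longrightarrow> f y = 0" "\<And>y. y \<in> cimg d \<Longrightarrow> cinv d y \<notin> K \<Longrightarrow> f' y = 0"
    and e: "\<And>y. y \<in> overlap c d \<Longrightarrow> f y = f' (transition c d y)"
  shows "integral (cimg c) (\<lambda>y. vol (G c) y * f y) = integral (cimg d) (\<lambda>y. vol (G d) y * f' y)"
proof -
  let ?S = "overlap c d" and ?T = "overlap d c"
  have ST: "?S \<subseteq> cimg c" "?T \<subseteq> cimg d" by (auto simp: overlap_def)
  have KK: "K \<subseteq> cdom c" "K \<subseteq> cdom d" using K by auto
  have out: "cinv a y \<notin> K" if "a \<in> A" "b \<in> A" "K \<subseteq> cdom b" "y \<in> cimg a" "y \<notin> overlap a b" for a b y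
    using that overlap_iff[OF that(1)] by blast
  have cK: "compact (cmap a ` K)" if "a \<in> A" "K \<subseteq> cdom a" for a
    by (rule compact_continuous_image[OF continuous_on_subset[OF continuous_cmap[OF that(1)] that(2)] K(1)])
  have "integral (cimg c) (\<lambda>y. vol (G c) y * f y) = integral ?S (\<lambda>y. vol (G c) y * f y)"
  proof -
    have "zext (cimg c) (\<lambda>y. vol (G c) y * f y) = zext ?S (\<lambda>y. vol (G c) y * f y)"
      using z(1) out[OF c d KK(2)] ST(1) by (auto simp: zext_def fun_eq_iff)
    from arg_cong[OF this, of "integral UNIV"] show ?thesis by (simp only: zext_integral)
  qed
  also have "\<dots> = integral ?S (\<lambda>y. \<bar>det (jac (transition c d) y)\<bar> * (vol (G d) (transition c d y) * f' (transition c d y)))"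
    by (rule integral_cong) (simp add: vol_change[OF c d] e)
  also have "\<dots> = integral (transition c d ` ?S) (\<lambda>y. vol (G d) y * f' y)"
  proof (rule change_of_variables)
    show "open ?S" "open (transition c d ` ?S)" using open_overlap c d by (simp_all add: transition_image)
    show "inj_on (transition c d) ?S" "smooth_on (transition c d) ?S"
      using transition_inj smooth_transition c d by auto
    show "continuous_on (transition c d ` ?S) (\<lambda>y. vol (G d) y * f' y)"
      unfolding transition_image[OF c d]
      by (intro continuous_on_mult continuous_on_subset[OF continuous_vol[OF MG[OF d]] ST(2)] continuous_on_subset[OF cf ST(2)])
    have zf: "f' y = 0" if "y \<in> ?T" "y \<notin> cmap d ` K" for y
    proof (rule z(2))
      show "y \<in> cimg d" using that ST by blast
      show "cinv d y \<notin> K" using that cmap_cinv[OF d, of y] ST by (metis imageI subsetD)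
    qed
    show "supported (transition c d ` ?S) (cmap d ` K) (\<lambda>y. vol (G d) y * f' y)"
      using cK[OF d KK(2)] KK zf unfolding transition_image[OF c d] unfolding supported_def overlap_def by auto
    have "f' (transition c d y) = 0" if "y \<in> ?S" "y \<notin> cmap c ` K" for y
    proof -
      have "cinv c y \<notin> K" using that cmap_cinv[OF c, of y] ST by (metis imageI subsetD)
      then show ?thesis using z(1)[of y] e[OF that(1)] that(1) ST by auto
    qed
    then show "supported ?S (cmap c ` K) (\<lambda>y. vol (G d) (transition c d y) * f' (transition c d y))"
      using cK[OF c KK(1)] KK unfolding supported_def by (auto simp: overlap_def)
  qed
  also have "\<dots> = integral ?T (\<lambda>y. vol (G d) y * f' y)" by (simp add: transition_image[OF c d])
  also have "\<dots> = integral (cimg d) (\<lambda>y. vol (G d) y * f' y)"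
  proof -
    have "zext ?T (\<lambda>y. vol (G d) y * f' y) = zext (cimg d) (\<lambda>y. vol (G d) y * f' y)"
      using z(2) out[OF d c KK(1)] ST(2) by (auto simp: zext_def fun_eq_iff)
    from arg_cong[OF this, of "integral UNIV"] show ?thesis by (simp only: zext_integral)
  qed
  finally show ?thesis .
qed

lemma continuous_part: "i \<in> I \<Longrightarrow> d \<in> A \<Longrightarrow> continuous_on (cimg d) (\<lambda>y. part i (cinv d y))"
  using Ck_on_continuous[OF part_C1] .

lemma continuous_Xd:
  assumes "i \<in> I" "d \<in> A" shows "continuous_on (cimg d) (Xd d (part i))"
proof -
  have p: "Ck_on (Suc 0) (\<lambda>y. part i (cinv d y)) (cimg d)" using part_C1[OF assms] by simp
  have "continuous_on (cimg d) (partial k (\<lambda>y. part i (cinv d y)))" for k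
    using Ck_on_partial[OF p] by simp
  then show ?thesis unfolding Xd_def[abs_def]
    by (intro continuous_on_sum continuous_on_mult Ck_on_continuous[OF X_C1[OF assms(2)]])
qed

lemma Xd_zero:
  assumes i: "i \<in> I" and d: "d \<in> A" and y: "y \<in> cimg d" "cinv d y \<notin> core i" shows "Xd d (part i) y = 0"
proof -
  have "partial k (\<lambda>y. part i (cinv d y)) y = partial k (\<lambda>_. 0) y" for k
    by (rule partial_cong[OF open_off_core[OF i d]]) (use y in \<open>auto simp: part_zero[OF i]\<close>)
  then show ?thesis by (simp add: Xd_def)
qed

lemma chart_supported:
  assumes i: "i \<in> I" and z: "\<And>y. y \<in> cimg (ch i) \<Longrightarrow> cinv (ch i) y \<notin> core i \<Longrightarrow> f y = 0"
  shows "supported (cimg (ch i)) (cball (ce i) (ra i)) f"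
proof -
  have "cinv (ch i) y \<notin> core i" if y: "y \<in> cimg (ch i)" "y \<notin> cball (ce i) (ra i)" for y
  proof
    assume "cinv (ch i) y \<in> core i"
    then obtain w where w: "w \<in> cball (ce i) (ra i)" "cinv (ch i) y = cinv (ch i) w" by (auto simp: core_def)
    have "w \<in> cimg (ch i)" using w(1) sub[OF i] by blast
    from cmap_cinv[OF chA[OF i] y(1)] cmap_cinv[OF chA[OF i] this] w(2) have "y = w" by metis
    then show False using w y by simp
  qed
  then show ?thesis using z sub[OF i] by (auto simp: supported_def)
qed

lemma chart_integrable:
  assumes i: "i \<in> I" and cf: "continuous_on (cimg (ch i)) f"
    and z: "\<And>y. y \<in> cimg (ch i) \<Longrightarrow> cinv (ch i) y \<notin> core i \<Longrightarrow> f y = 0"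
  shows "(\<lambda>y. vol (G (ch i)) y * f y) integrable_on cimg (ch i)"
  using z by (intro supported_integrable[OF chart(2)[OF chA[OF i]] _ chart_supported[OF i]]
      continuous_on_mult continuous_vol[OF MG[OF chA[OF i]]] cf) auto

lemma continuous_divergence:
  assumes c: "c \<in> A" shows "continuous_on (cimg c) (divergence (G c) (X c))"
proof -
  have 1: "continuous_on (cimg c) (partial k (\<lambda>y. X c y $ k))" for k
    using Ck_on_partial[of 0 "\<lambda>y. X c y $ k"] X_C1[OF c, of k] by simp
  have 2: "continuous_on (cimg c) (\<lambda>x. Gam (G c) k x $ i $ j)" for k i j
    using msmooth_Gam[OF MG[OF c]] smooth_on_continuous unfolding msmooth_def by blast
  show ?thesis unfolding divergence_def[abs_def] trace_def
    by (intro continuous_on_add continuous_on_sum continuous_on_mult 1 2 Ck_on_continuous[OF X_C1[OF c]])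
qed

text \<open>The integral over \<open>M\<close> of the divergence of \<open>X\<close>. With the partition of unity \<open>\<phi>\<^sub>i\<close>, the divergence theorem
  in chart \<open>i\<close> turns it into \<open>- \<Sum>\<^sub>i \<integral> X\<phi>\<^sub>i = - \<Sum>\<^sub>i\<^sub>j \<integral> \<phi>\<^sub>j X\<phi>\<^sub>i\<close>. Each term is supported in two charts and can be moved
  from chart \<open>i\<close> to chart \<open>j\<close>, where the sum over \<open>i\<close> becomes \<open>X 1 = 0\<close>.\<close>

lemma sum_divergence_zero:
  "(\<Sum>i\<in>I. integral (cimg (ch i)) (\<lambda>y. vol (G (ch i)) y * (part i (cinv (ch i) y) * divergence (G (ch i)) (X (ch i)) y))) = 0"
proof -
  let ?int = "\<lambda>i f. integral (cimg (ch i)) (\<lambda>y. vol (G (ch i)) y * f y)"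
  have one: "?int i (\<lambda>y. part i (cinv (ch i) y) * divergence (G (ch i)) (X (ch i)) y)
      = - (\<Sum>j\<in>I. ?int i (\<lambda>y. part j (cinv (ch i) y) * Xd (ch i) (part i) y))" if i: "i \<in> I" for i
  proof -
    let ?c = "ch i"
    note c = chA[OF i]
    let ?P = "\<lambda>y. part i (cinv ?c y) * divergence (G ?c) (X ?c) y"
    have iP: "(\<lambda>y. vol (G ?c) y * ?P y) integrable_on cimg ?c"
      by (rule chart_integrable[OF i]) (auto intro!: continuous_on_mult continuous_part continuous_divergence i c simp: part_zero[OF i])
    have iX: "(\<lambda>y. vol (G ?c) y * Xd ?c (part i) y) integrable_on cimg ?c"
      by (rule chart_integrable[OF i]) (auto intro!: continuous_Xd Xd_zero i c)
    have iXj: "(\<lambda>y. vol (G ?c) y * (part j (cinv ?c y) * Xd ?c (part i) y)) integrable_on cimg ?c" if j: "j \<in> I" for j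
      by (rule chart_integrable[OF i]) (auto intro!: continuous_on_mult continuous_part continuous_Xd Xd_zero i j c)
    have sup: "supported (cimg ?c) (cball (ce i) (ra i)) (\<lambda>y. part i (cinv ?c y))"
      by (rule chart_supported[OF i]) (simp add: part_zero[OF i])
    have "0 = integral (cimg ?c) (\<lambda>y. vol (G ?c) y * divergence (G ?c) (\<lambda>y. part i (cinv ?c y) *\<^sub>R X ?c y) y)"
    proof (rule divergence_theorem_chart[OF MG[OF c], where K = "cball (ce i) (ra i)", symmetric])
      show "Ck_on 1 (\<lambda>x. (part i (cinv ?c x) *\<^sub>R X ?c x) $ k) (cimg ?c)" for k
        using Ck_on_mult[OF chart(2)[OF c] part_C1[OF i c] X_C1[OF c, of k]] by simp
    qed (use sup in \<open>auto simp: supported_def\<close>)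
    also have "\<dots> = integral (cimg ?c) (\<lambda>y. vol (G ?c) y * ?P y + vol (G ?c) y * Xd ?c (part i) y)"
    proof (rule integral_cong)
      fix y assume y: "y \<in> cimg ?c"
      have "(\<lambda>y. X ?c y $ k) differentiable (at y)" for k
        by (rule Ck_on_differentiable[OF X_C1[OF c, unfolded One_nat_def] y])
      then show "vol (G ?c) y * divergence (G ?c) (\<lambda>y. part i (cinv ?c y) *\<^sub>R X ?c y) y
          = vol (G ?c) y * ?P y + vol (G ?c) y * Xd ?c (part i) y"
        by (simp add: divergence_scale part_differentiable[OF i c y] Xd_def distrib_left)
    qed
    also have "\<dots> = ?int i ?P + ?int i (Xd ?c (part i))" by (rule integral_add[OF iP iX])
    finally have "?int i ?P = - ?int i (Xd ?c (part i))" by simp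
    also have "?int i (Xd ?c (part i)) = integral (cimg ?c) (\<lambda>y. \<Sum>j\<in>I. vol (G ?c) y * (part j (cinv ?c y) * Xd ?c (part i) y))"
    proof (rule integral_cong)
      fix y assume y: "y \<in> cimg ?c"
      have "(\<Sum>j\<in>I. vol (G ?c) y * (part j (cinv ?c y) * Xd ?c (part i) y))
         = (\<Sum>j\<in>I. part j (cinv ?c y)) * (vol (G ?c) y * Xd ?c (part i) y)"
        unfolding sum_distrib_right by (rule sum.cong[OF refl]) (rule mult.left_commute)
      then show "vol (G ?c) y * Xd ?c (part i) y = (\<Sum>j\<in>I. vol (G ?c) y * (part j (cinv ?c y) * Xd ?c (part i) y))"
        by (simp add: part_sum[OF cinv_M[OF c y]])
    qed
    also have "\<dots> = (\<Sum>j\<in>I. ?int i (\<lambda>y. part j (cinv ?c y) * Xd ?c (part i) y))"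
      by (rule integral_sum[OF fin iXj])
    finally show ?thesis .
  qed
  have two: "?int i (\<lambda>y. part j (cinv (ch i) y) * Xd (ch i) (part i) y)
      = ?int j (\<lambda>y. part j (cinv (ch j) y) * Xd (ch j) (part i) y)" if i: "i \<in> I" and j: "j \<in> I" for i j
  proof (rule integral_change_chart[OF chA[OF i] chA[OF j], of "core i \<inter> core j"])
    note c = chA[OF i] and d = chA[OF j]
    show "compact (core i \<inter> core j)" by (intro compact_Int compact_core i j)
    show "core i \<inter> core j \<subseteq> cdom (ch i) \<inter> cdom (ch j)" using core_dom i j by blast
    show "continuous_on (cimg (ch j)) (\<lambda>y. part j (cinv (ch j) y) * Xd (ch j) (part i) y)"
      by (intro continuous_on_mult continuous_part continuous_Xd i j d)
    show "part j (cinv (ch i) y) * Xd (ch i) (part i) y = 0" if "y \<in> cimg (ch i)" "cinv (ch i) y \<notin> core i \<inter> core j" for y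
      using that part_zero[OF j] Xd_zero[OF i c] by auto
    show "part j (cinv (ch j) y) * Xd (ch j) (part i) y = 0" if "y \<in> cimg (ch j)" "cinv (ch j) y \<notin> core i \<inter> core j" for y
      using that part_zero[OF j] Xd_zero[OF i d] by auto
    show "part j (cinv (ch i) y) * Xd (ch i) (part i) y
       = part j (cinv (ch j) (transition (ch i) (ch j) y)) * Xd (ch j) (part i) (transition (ch i) (ch j) y)"
      if y: "y \<in> overlap (ch i) (ch j)" for y
    proof -
      have "transition (ch i) (ch j) y \<in> cimg (ch j)" using transition_maps[OF c d y] by (auto simp: overlap_def)
      then show ?thesis
        by (simp add: cinv_transition[OF c d y] Xd_change[OF c d y part_differentiable[OF i d]])
    qed
  qed
  have three: "(\<Sum>i\<in>I. ?int j (\<lambda>y. part j (cinv (ch j) y) * Xd (ch j) (part i) y)) = 0" if j: "j \<in> I" for j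
  proof -
    let ?d = "ch j"
    note d = chA[OF j]
    have "(\<Sum>i\<in>I. ?int j (\<lambda>y. part j (cinv ?d y) * Xd ?d (part i) y))
       = integral (cimg ?d) (\<lambda>y. \<Sum>i\<in>I. vol (G ?d) y * (part j (cinv ?d y) * Xd ?d (part i) y))"
    proof (rule integral_sum[OF fin, symmetric])
      fix i assume i: "i \<in> I"
      show "(\<lambda>y. vol (G ?d) y * (part j (cinv ?d y) * Xd ?d (part i) y)) integrable_on cimg ?d"
        by (rule chart_integrable[OF j]) (auto intro!: continuous_on_mult continuous_part continuous_Xd i j d simp: part_zero[OF j])
    qed
    also have "\<dots> = integral (cimg ?d) (\<lambda>y. 0)"
    proof (rule integral_cong)
      fix y assume y: "y \<in> cimg ?d"
      have s: "(\<Sum>i\<in>I. partial k (\<lambda>y. part i (cinv ?d y)) y) = 0" for k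
      proof -
        have "(\<Sum>i\<in>I. partial k (\<lambda>y. part i (cinv ?d y)) y) = partial k (\<lambda>y. \<Sum>i\<in>I. part i (cinv ?d y)) y"
          by (rule partial_sum[symmetric]) (rule part_differentiable[OF _ d y])
        also have "\<dots> = partial k (\<lambda>_. 1) y"
          by (rule partial_cong[OF chart(2)[OF d] y]) (simp add: part_sum[OF cinv_M[OF d]])
        finally show ?thesis by simp
      qed
      have "(\<Sum>i\<in>I. Xd ?d (part i) y) = (\<Sum>k\<in>UNIV. \<Sum>i\<in>I. X ?d y $ k * partial k (\<lambda>y. part i (cinv ?d y)) y)"
        unfolding Xd_def by (rule sum.swap)
      also have "\<dots> = 0" by (simp add: sum_distrib_left[symmetric] s)
      finally show "(\<Sum>i\<in>I. vol (G ?d) y * (part j (cinv ?d y) * Xd ?d (part i) y)) = 0"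
        by (simp add: sum_distrib_left[symmetric])
    qed
    finally show ?thesis by simp
  qed
  have "(\<Sum>i\<in>I. ?int i (\<lambda>y. part i (cinv (ch i) y) * divergence (G (ch i)) (X (ch i)) y))
     = - (\<Sum>i\<in>I. \<Sum>j\<in>I. ?int j (\<lambda>y. part j (cinv (ch j) y) * Xd (ch j) (part i) y))"
    by (subst sum_negf[symmetric], rule sum.cong[OF refl])
      (subst one, assumption, rule arg_cong[of _ _ uminus], rule sum.cong[OF refl], rule two)
  also have "(\<Sum>i\<in>I. \<Sum>j\<in>I. ?int j (\<lambda>y. part j (cinv (ch j) y) * Xd (ch j) (part i) y))
     = (\<Sum>j\<in>I. \<Sum>i\<in>I. ?int j (\<lambda>y. part j (cinv (ch j) y) * Xd (ch j) (part i) y))" by (rule sum.swap)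
  finally show ?thesis by (simp add: three)
qed

text \<open>A nonnegative continuous function that is at most a divergence has integral zero, so it vanishes.\<close>

lemma scalar_curvature_rigid:
  assumes ge: "\<And>p. p \<in> M \<Longrightarrow> scalar_curvature A h p \<ge> scalar_curvature A g p"
    and le: "\<And>i y. i \<in> I \<Longrightarrow> y \<in> cball (ce i) (ra i) \<Longrightarrow>
      scalar_coord (H (ch i)) y \<le> scalar_coord (G (ch i)) y + divergence (G (ch i)) (X (ch i)) y"
    and p: "p \<in> M"
  shows "scalar_curvature A h p = scalar_curvature A g p"
proof -
  define f where "f i y = part i (cinv (ch i) y) * (scalar_coord (H (ch i)) y - scalar_coord (G (ch i)) y)" for i y
  let ?int = "\<lambda>i f. integral (cimg (ch i)) (\<lambda>y. vol (G (ch i)) y * f y)"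
  have sc: "scalar_coord (H (ch i)) y - scalar_coord (G (ch i)) y
      = scalar_curvature A h (cinv (ch i) y) - scalar_curvature A g (cinv (ch i) y)" if "i \<in> I" "y \<in> cimg (ch i)" for i y
    using scalar_curvature_chart[OF gM chA[OF that(1)] cinv_dom[OF chA[OF that(1)] that(2)]]
      scalar_curvature_chart[OF hM chA[OF that(1)] cinv_dom[OF chA[OF that(1)] that(2)]]
      cmap_cinv[OF chA[OF that(1)] that(2)] by simp
  have cf: "continuous_on (cimg (ch i)) (f i)" if i: "i \<in> I" for i
    unfolding f_def by (intro continuous_on_mult continuous_on_diff continuous_part i chA
        smooth_on_continuous smooth_scalar MG MH)
  have zf: "f i y = 0" if "i \<in> I" "y \<in> cimg (ch i)" "cinv (ch i) y \<notin> core i" for i y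
    using that part_zero by (simp add: f_def)
  have nf: "0 \<le> vol (G (ch i)) y * f i y" if i: "i \<in> I" and y: "y \<in> cimg (ch i)" for i y
    using vol_pos[OF MG[OF chA[OF i]] y] part_nonneg[OF cinv_M[OF chA[OF i] y]] ge[OF cinv_M[OF chA[OF i] y]]
    by (simp add: f_def sc[OF i y])
  have le_int: "?int i (f i) \<le> ?int i (\<lambda>y. part i (cinv (ch i) y) * divergence (G (ch i)) (X (ch i)) y)" if i: "i \<in> I" for i
  proof (rule integral_le)
    note c = chA[OF i]
    show "(\<lambda>y. vol (G (ch i)) y * f i y) integrable_on cimg (ch i)" by (rule chart_integrable[OF i cf[OF i] zf[OF i]])
    show "(\<lambda>y. vol (G (ch i)) y * (part i (cinv (ch i) y) * divergence (G (ch i)) (X (ch i)) y)) integrable_on cimg (ch i)"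
      by (rule chart_integrable[OF i]) (auto intro!: continuous_on_mult continuous_part continuous_divergence i c simp: part_zero[OF i])
    fix y assume y: "y \<in> cimg (ch i)"
    have "f i y \<le> part i (cinv (ch i) y) * divergence (G (ch i)) (X (ch i)) y"
    proof (cases "cinv (ch i) y \<in> core i")
      case True
      then obtain w where w: "w \<in> cball (ce i) (ra i)" "cinv (ch i) y = cinv (ch i) w" by (auto simp: core_def)
      have "w \<in> cimg (ch i)" using w(1) sub[OF i] by blast
      from cmap_cinv[OF c y] cmap_cinv[OF c this] w(2) have "y = w" by metis
      then show ?thesis
        unfolding f_def using le[OF i w(1)] by (intro mult_left_mono part_nonneg cinv_M c y) auto
    next
      case False
      then show ?thesis by (simp add: f_def part_zero[OF i])
    qed
    then show "vol (G (ch i)) y * f i y \<le> vol (G (ch i)) y * (part i (cinv (ch i) y) * divergence (G (ch i)) (X (ch i)) y)"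
      using vol_pos[OF MG[OF c] y] by (intro mult_left_mono) auto
  qed
  have "(\<Sum>i\<in>I. ?int i (f i)) \<le> 0"
    using sum_mono[of I "\<lambda>i. ?int i (f i)", OF le_int] sum_divergence_zero by simp
  moreover have pos: "0 \<le> ?int i (f i)" if i: "i \<in> I" for i
    by (rule integral_nonneg[OF chart_integrable[OF i cf[OF i] zf[OF i]] nf[OF i]])
  ultimately have zero: "?int i (f i) \<le> 0" if i: "i \<in> I" for i
    using member_le_sum[of i I "\<lambda>i. ?int i (f i)"] i fin by force
  obtain i where i: "i \<in> I" "bump i p > 0" "p \<in> cdom (ch i)" using bump_pos[OF p] .
  note c = chA[OF i(1)]
  have y: "cmap (ch i) p \<in> cimg (ch i)" using i(3) by simp
  have "vol (G (ch i)) (cmap (ch i) p) * f i (cmap (ch i) p) = 0"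
  proof (rule nonneg_integral_zero[OF chart(2)[OF c] _ chart_supported[OF i(1)] nf[OF i(1)] zero[OF i(1)] y])
    show "continuous_on (cimg (ch i)) (\<lambda>y. vol (G (ch i)) y * f i y)"
      by (intro continuous_on_mult continuous_vol[OF MG[OF c]] cf i)
    show "vol (G (ch i)) y * f i y = 0" if "y \<in> cimg (ch i)" "cinv (ch i) y \<notin> core i" for y
      using zf[OF i(1) that] by simp
  qed
  then have "f i (cmap (ch i) p) = 0" using vol_pos[OF MG[OF c] y] by simp
  moreover have "part i p > 0" using i(2) total_pos[OF p] by (simp add: part_def)
  ultimately show ?thesis
    unfolding f_def sc[OF i(1) y] cinv_cmap[OF c i(3)] by simp
qed

end

section \<open>Neighbourhoods in the \<open>C\<^sup>2\<close>-topology\<close>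

context manifold
begin

text \<open>Compactness of \<open>M\<close> turns the local inequality into a finite intersection of \<open>C\<^sup>2\<close>-neighbourhoods. Closeness
  is required on the ball of radius \<open>2r\<close> and the inequality is available on the ball of radius \<open>r\<close>, because the gradient
  estimate loses a margin. The predicate \<open>R\<close> is the global form of the assumption that \<open>h\<close> is larger than \<open>g\<close>.\<close>

lemma rigidity_neighbourhood:
  assumes gM: "g \<in> metrics M A"
    and loc: "\<And>c x r. c \<in> A \<Longrightarrow> 0 < r \<Longrightarrow> cball x (2 * r) \<subseteq> cimg c \<Longrightarrow>
      \<exists>\<epsilon>>0. \<forall>h\<in>metrics M A. C2_close (cball x (2 * r)) \<epsilon> (components A g c) (components A h c) \<longrightarrow> R h \<longrightarrow>
        (\<forall>y\<in>cball x r. scalar_coord (components A h c) y \<le> scalar_coord (components A g c) y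
          + divergence (components A g c) (defect_field (components A g c) (components A h c)) y)"
  shows "\<exists>U. openin (C2_topology M A) U \<and> g \<in> U \<and>
    (\<forall>h\<in>U. R h \<longrightarrow> (\<forall>p\<in>M. scalar_curvature A h p \<ge> scalar_curvature A g p) \<longrightarrow>
       (\<forall>p\<in>M. scalar_curvature A h p = scalar_curvature A g p))"
proof -
  have "\<exists>c r. c \<in> A \<and> p \<in> cdom c \<and> 0 < r \<and> cball (cmap c p) (2 * r) \<subseteq> cimg c" if p: "p \<in> M" for p
  proof -
    obtain c where c: "c \<in> A" "p \<in> cdom c" using chart_exists[OF p] by blast
    then obtain e where "e > 0" "cball (cmap c p) e \<subseteq> cimg c"
      using chart(2)[OF c(1)] open_contains_cball by (metis cmap_img)
    then show ?thesis using c by (intro exI[of _ c] exI[of _ "e/2"]) auto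
  qed
  then obtain ch ra where ch: "\<And>p. p \<in> M \<Longrightarrow> ch p \<in> A" "\<And>p. p \<in> M \<Longrightarrow> p \<in> cdom (ch p)"
    and ra: "\<And>p. p \<in> M \<Longrightarrow> 0 < ra p" "\<And>p. p \<in> M \<Longrightarrow> cball (cmap (ch p) p) (2 * ra p) \<subseteq> cimg (ch p)" by metis
  define ce where "ce p = cmap (ch p) p" for p
  define N where "N p = {q \<in> cdom (ch p). dist (ce p) (cmap (ch p) q) < ra p}" for p
  have oN: "openin (top_of_set M) (N p)" if p: "p \<in> M" for p
  proof -
    have "N p = cdom (ch p) \<inter> cmap (ch p) -` ball (ce p) (ra p)" by (auto simp: N_def)
    then have "openin (top_of_set (cdom (ch p))) (N p)"
      using continuous_openin_preimage_gen[OF continuous_cmap[OF ch(1)[OF p]] open_ball] by simp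
    then show ?thesis using openin_trans chart(1)[OF ch(1)[OF p]] by blast
  qed
  have "M \<subseteq> \<Union>(N ` M)" using ch ra by (auto simp: N_def ce_def)
  then obtain D where D: "D \<subseteq> N ` M" "finite D" "M \<subseteq> \<Union>D"
    using compact_M[unfolded compact_eq_openin_cover] oN by (metis (no_types, lifting) imageE)
  then obtain I where I: "I \<subseteq> M" "finite I" "D = N ` I" by (metis finite_subset_image)
  have cov: "\<exists>i\<in>I. p \<in> cdom (ch i) \<and> dist (ce i) (cmap (ch i) p) < ra i" if "p \<in> M" for p
    using D(3) I(3) that by (auto simp: N_def)
  have sub2: "cball (ce p) (2 * ra p) \<subseteq> cimg (ch p)" if "p \<in> M" for p using ra(2)[OF that] by (simp add: ce_def)
  obtain \<epsilon> where \<epsilon>: "\<And>i. i \<in> M \<Longrightarrow> 0 < \<epsilon> i" and est: "\<And>i h y. i \<in> M \<Longrightarrow> h \<in> metrics M A \<Longrightarrow>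
      C2_close (cball (ce i) (2 * ra i)) (\<epsilon> i) (components A g (ch i)) (components A h (ch i)) \<Longrightarrow> R h \<Longrightarrow>
      y \<in> cball (ce i) (ra i) \<Longrightarrow> scalar_coord (components A h (ch i)) y \<le> scalar_coord (components A g (ch i)) y
          + divergence (components A g (ch i)) (defect_field (components A g (ch i)) (components A h (ch i))) y"
    using loc[OF ch(1) ra(1) sub2] by metis
  define W where "W i = C2_nbhd M A g (ch i) (cball (ce i) (2 * ra i)) (\<epsilon> i)" for i
  define U where "U = \<Inter> (insert (metrics M A) (W ` I))"
  have oW: "openin (C2_topology M A) (W i)" if "i \<in> I" for i
    unfolding C2_topology_def
  proof (rule topology_generated_by_Basis)
    have i: "i \<in> M" using I that by blast
    show "W i \<in> insert (metrics M A) {C2_nbhd M A g c K \<epsilon> | g c K \<epsilon>.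
       g \<in> metrics M A \<and> c \<in> A \<and> compact K \<and> K \<subseteq> cimg c \<and> \<epsilon> > 0}"
      unfolding W_def using gM ch(1)[OF i] sub2[OF i] \<epsilon>[OF i] compact_cball by blast
  qed
  have oM: "openin (C2_topology M A) (metrics M A)"
    unfolding C2_topology_def by (rule topology_generated_by_Basis) simp
  have "openin (C2_topology M A) U"
    unfolding U_def using I oW oM by (intro openin_Inter) auto
  moreover have "g \<in> U"
  proof -
    \<comment> \<open>The difference of \<open>g\<close> with itself is the zero function.\<close>
    have pz: "partial l (\<lambda>x::real^'n. 0) = (\<lambda>x. 0)" for l by (rule ext) simp
    have "g \<in> W i" if "i \<in> I" for i
      using gM \<epsilon>[of i] I that by (auto simp: W_def C2_nbhd_def Let_def pz)
    then show ?thesis using gM by (auto simp: U_def)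
  qed
  moreover have "scalar_curvature A h p = scalar_curvature A g p"
    if h: "h \<in> U" "R h" and ge: "\<forall>p\<in>M. scalar_curvature A h p \<ge> scalar_curvature A g p" and p: "p \<in> M" for h p
  proof -
    have hM: "h \<in> metrics M A" using h by (auto simp: U_def)
    interpret metric_pair M A I ch ce ra g h
    proof
      show "cball (ce i) (ra i) \<subseteq> cimg (ch i)" if "i \<in> I" for i
      proof -
        have i: "i \<in> M" using I that by blast
        have "cball (ce i) (ra i) \<subseteq> cball (ce i) (2 * ra i)" using ra(1)[OF i] by (intro subset_cball) simp
        then show ?thesis using sub2[OF i] by blast
      qed
    qed (use I ch ra cov gM hM in auto)
    show ?thesis
    proof (rule scalar_curvature_rigid[OF _ _ p])
      fix i y assume i: "i \<in> I" and y: "y \<in> cball (ce i) (ra i)"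
      have "h \<in> W i" using h i by (auto simp: U_def)
      then have "C2_close (cball (ce i) (2 * ra i)) (\<epsilon> i) (components A g (ch i)) (components A h (ch i))"
        by (simp add: W_def C2_nbhd_def C2_close_def)
      then show "scalar_coord (components A h (ch i)) y \<le> scalar_coord (components A g (ch i)) y + divergence (components A g (ch i)) (X (ch i)) y"
        unfolding X_def using est[OF _ hM _ h(2) y] i I by blast
    qed (use ge in blast)
  qed
  ultimately show ?thesis by blast
qed

lemma ricci_positive_chart:
  assumes gM: "g \<in> metrics M A" and pos: "\<forall>p\<in>M. pos_definite_on (tangent_space A p) (ricci A g p)"
    and c: "c \<in> A" and x: "x \<in> cimg c" and nz: "\<xi> \<noteq> 0"
  shows "0 < \<xi> \<bullet> (Ric (components A g c) x *v \<xi>)"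
proof -
  define p where "p = cinv c x"
  have p: "p \<in> cdom c" "cmap c p = x" "p \<in> M"
    using cinv_dom[OF c x] cmap_cinv[OF c x] cdom_M[OF c] unfolding p_def by blast+
  have "tvec_of c p \<xi> \<noteq> (\<lambda>_. 0)" using tvec_of_self[OF c p(1), of \<xi>] nz by metis
  then have "0 < ricci A g p (tvec_of c p \<xi>) (tvec_of c p \<xi>)"
    using pos p(3) tvec_of_tangent[OF c p(1)] by (simp add: pos_definite_on_def)
  then show ?thesis using ricci_chart[OF gM c p(1)] p(2) by simp
qed

lemma ricci_scalar_negative_chart:
  assumes gM: "g \<in> metrics M A"
    and neg: "\<forall>p\<in>M. neg_definite_on (tangent_space A p) (\<lambda>v w. 2 * ricci A g p v w - scalar_curvature A g p * g p v w)"
    and c: "c \<in> A" and x: "x \<in> cimg c" and nz: "\<xi> \<noteq> 0"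
  shows "2 * (\<xi> \<bullet> (Ric (components A g c) x *v \<xi>))
    - scalar_coord (components A g c) x * (\<xi> \<bullet> (components A g c x *v \<xi>)) < 0"
proof -
  define p where "p = cinv c x"
  have p: "p \<in> cdom c" "cmap c p = x" "p \<in> M"
    using cinv_dom[OF c x] cmap_cinv[OF c x] cdom_M[OF c] unfolding p_def by blast+
  have "tvec_of c p \<xi> \<noteq> (\<lambda>_. 0)" using tvec_of_self[OF c p(1), of \<xi>] nz by metis
  then have "2 * ricci A g p (tvec_of c p \<xi>) (tvec_of c p \<xi>)
      - scalar_curvature A g p * g p (tvec_of c p \<xi>) (tvec_of c p \<xi>) < 0"
    using neg p(3) tvec_of_tangent[OF c p(1)] by (simp add: neg_definite_on_def)
  then show ?thesis
    using ricci_chart[OF gM c p(1)] metric_components[OF gM c p(1)] scalar_curvature_chart[OF gM c p(1)] p(2) by simp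
qed

end

section \<open>Rigidity of scalar curvature\<close>

theorem lemma0p4:
  fixes M :: "'a::t2_space set" and A :: "('a, 'n::finite) chart set" and g :: "('a, 'n) form2"
  assumes "compact_manifold M A"
    and "g \<in> metrics M A"
    and "\<forall>p\<in>M. pos_definite_on (tangent_space A p) (ricci A g p)"
  shows "(\<exists>U. openin (C2_topology M A) U \<and> g \<in> U \<and>
            (\<forall>h\<in>U. (\<forall>p\<in>M. \<forall>v\<in>tangent_space A p. tnorm h p v \<ge> tnorm g p v) \<longrightarrow>
               (\<forall>p\<in>M. scalar_curvature A h p \<ge> scalar_curvature A g p) \<longrightarrow>
               (\<forall>p\<in>M. scalar_curvature A h p = scalar_curvature A g p))) \<and>
         ((\<forall>p\<in>M. neg_definite_on (tangent_space A p)
                   (\<lambda>v w. 2 * ricci A g p v w - scalar_curvature A g p * g p v w)) \<longrightarrow>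
          (\<exists>U'. openin (C2_topology M A) U' \<and> g \<in> U' \<and>
            (\<forall>h\<in>U' \<inter> area_larger_metrics M A g.
               (\<forall>p\<in>M. scalar_curvature A h p \<ge> scalar_curvature A g p) \<longrightarrow>
               (\<forall>p\<in>M. scalar_curvature A h p = scalar_curvature A g p))))"
proof (intro conjI impI)
  interpret manifold M A by unfold_locales (rule assms(1))
  note gM = assms(2) and pos = ricci_positive_chart[OF assms(2,3)]
  define R1 where "R1 h \<longleftrightarrow> (\<forall>p\<in>M. \<forall>v\<in>tangent_space A p. tnorm h p v \<ge> tnorm g p v)" for h
  have "\<exists>U. openin (C2_topology M A) U \<and> g \<in> U \<and>
    (\<forall>h\<in>U. R1 h \<longrightarrow> (\<forall>p\<in>M. scalar_curvature A h p \<ge> scalar_curvature A g p) \<longrightarrow>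
       (\<forall>p\<in>M. scalar_curvature A h p = scalar_curvature A g p))"
  proof (rule rigidity_neighbourhood[OF gM])
    fix c x and r :: real assume c: "c \<in> A" and r: "0 < r" "cball x (2 * r) \<subseteq> cimg c"
    obtain \<epsilon> where e: "\<epsilon> > 0" "\<And>H y. metric_field (cimg c) H \<Longrightarrow> C2_close (cball x (2 * r)) \<epsilon> (components A g c) H \<Longrightarrow>
       (\<And>y \<xi>. y \<in> cball x (2 * r) \<Longrightarrow> \<xi> \<bullet> (components A g c y *v \<xi>) \<le> \<xi> \<bullet> (H y *v \<xi>)) \<Longrightarrow> y \<in> cball x r \<Longrightarrow>
       scalar_coord H y \<le> scalar_coord (components A g c) y + divergence (components A g c) (defect_field (components A g c) H) y"
      using length_estimate[OF metric_field_components[OF gM c] r(2,1) pos[OF c]] by metis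
    have cone: "\<xi> \<bullet> (components A g c y *v \<xi>) \<le> \<xi> \<bullet> (components A h c y *v \<xi>)"
      if h: "h \<in> metrics M A" "R1 h" and y: "y \<in> cimg c" for h y \<xi>
    proof -
      have p: "cinv c y \<in> cdom c" "cinv c y \<in> M" "cmap c (cinv c y) = y"
        using cinv_dom[OF c y] cdom_M[OF c] cmap_cinv[OF c y] by auto
      have "tnorm g (cinv c y) (tvec_of c (cinv c y) \<xi>) \<le> tnorm h (cinv c y) (tvec_of c (cinv c y) \<xi>)"
        using h(2) p(2) tvec_of_tangent[OF c p(1)] by (simp add: R1_def)
      then show ?thesis
        using metric_components[OF gM c p(1)] metric_components[OF h(1) c p(1)] p(3) by (simp add: tnorm_def)
    qed
    show "\<exists>\<epsilon>>0. \<forall>h\<in>metrics M A. C2_close (cball x (2 * r)) \<epsilon> (components A g c) (components A h c) \<longrightarrow> R1 h \<longrightarrow>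
        (\<forall>y\<in>cball x r. scalar_coord (components A h c) y \<le> scalar_coord (components A g c) y
          + divergence (components A g c) (defect_field (components A g c) (components A h c)) y)"
      using e(1) e(2)[OF metric_field_components[OF _ c] _ cone] r(2) by (intro exI[of _ \<epsilon>]) blast
  qed
  then show "\<exists>U. openin (C2_topology M A) U \<and> g \<in> U \<and>
            (\<forall>h\<in>U. (\<forall>p\<in>M. \<forall>v\<in>tangent_space A p. tnorm h p v \<ge> tnorm g p v) \<longrightarrow>
               (\<forall>p\<in>M. scalar_curvature A h p \<ge> scalar_curvature A g p) \<longrightarrow>
               (\<forall>p\<in>M. scalar_curvature A h p = scalar_curvature A g p))"
    unfolding R1_def by blast
next
  interpret manifold M A by unfold_locales (rule assms(1))
  note gM = assms(2) and pos = ricci_positive_chart[OF assms(2,3)]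
  assume neg: "\<forall>p\<in>M. neg_definite_on (tangent_space A p)
                   (\<lambda>v w. 2 * ricci A g p v w - scalar_curvature A g p * g p v w)"
  define R2 where "R2 h \<longleftrightarrow> (\<forall>p\<in>M. \<forall>v\<in>tangent_space A p. \<forall>w\<in>tangent_space A p. wedge_norm h p v w \<ge> wedge_norm g p v w)" for h
  have "\<exists>U. openin (C2_topology M A) U \<and> g \<in> U \<and>
    (\<forall>h\<in>U. R2 h \<longrightarrow> (\<forall>p\<in>M. scalar_curvature A h p \<ge> scalar_curvature A g p) \<longrightarrow>
       (\<forall>p\<in>M. scalar_curvature A h p = scalar_curvature A g p))"
  proof (rule rigidity_neighbourhood[OF gM])
    fix c x and r :: real assume c: "c \<in> A" and r: "0 < r" "cball x (2 * r) \<subseteq> cimg c"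
    obtain \<epsilon> where e: "\<epsilon> > 0" "\<And>H y. metric_field (cimg c) H \<Longrightarrow> C2_close (cball x (2 * r)) \<epsilon> (components A g c) H \<Longrightarrow>
       (\<And>y \<xi> \<zeta>. y \<in> cball x (2 * r) \<Longrightarrow> area_form (components A g c y) \<xi> \<zeta> \<le> area_form (H y) \<xi> \<zeta>) \<Longrightarrow> y \<in> cball x r \<Longrightarrow>
       scalar_coord H y \<le> scalar_coord (components A g c) y + divergence (components A g c) (defect_field (components A g c) H) y"
      using area_estimate[OF metric_field_components[OF gM c] r(2,1) pos[OF c] ricci_scalar_negative_chart[OF gM neg c]] by metis
    have cone: "area_form (components A g c y) \<xi> \<zeta> \<le> area_form (components A h c y) \<xi> \<zeta>"
      if h: "h \<in> metrics M A" "R2 h" and y: "y \<in> cimg c" for h y \<xi> \<zeta>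
    proof -
      have p: "cinv c y \<in> cdom c" "cinv c y \<in> M" "cmap c (cinv c y) = y"
        using cinv_dom[OF c y] cdom_M[OF c] cmap_cinv[OF c y] by auto
      have "wedge_norm g (cinv c y) (tvec_of c (cinv c y) \<xi>) (tvec_of c (cinv c y) \<zeta>)
          \<le> wedge_norm h (cinv c y) (tvec_of c (cinv c y) \<xi>) (tvec_of c (cinv c y) \<zeta>)"
        using h(2) p(2) tvec_of_tangent[OF c p(1)] by (simp add: R2_def)
      then show ?thesis
        using metric_components[OF gM c p(1)] metric_components[OF h(1) c p(1)] p(3)
        by (simp add: wedge_norm_def area_form_def)
    qed
    show "\<exists>\<epsilon>>0. \<forall>h\<in>metrics M A. C2_close (cball x (2 * r)) \<epsilon> (components A g c) (components A h c) \<longrightarrow> R2 h \<longrightarrow>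
        (\<forall>y\<in>cball x r. scalar_coord (components A h c) y \<le> scalar_coord (components A g c) y
          + divergence (components A g c) (defect_field (components A g c) (components A h c)) y)"
      using e(1) e(2)[OF metric_field_components[OF _ c] _ cone] r(2) by (intro exI[of _ \<epsilon>]) blast
  qed
  then obtain U where U: "openin (C2_topology M A) U" "g \<in> U"
    and eq: "\<And>h p. h \<in> U \<Longrightarrow> R2 h \<Longrightarrow> \<forall>p\<in>M. scalar_curvature A h p \<ge> scalar_curvature A g p \<Longrightarrow> p \<in> M \<Longrightarrow>
       scalar_curvature A h p = scalar_curvature A g p" by metis
  have "R2 h" if "h \<in> area_larger_metrics M A g" for h
    using that by (simp add: R2_def area_larger_metrics_def)
  with U eq show "\<exists>U'. openin (C2_topology M A) U' \<and> g \<in> U' \<and>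
            (\<forall>h\<in>U' \<inter> area_larger_metrics M A g.
               (\<forall>p\<in>M. scalar_curvature A h p \<ge> scalar_curvature A g p) \<longrightarrow>
               (\<forall>p\<in>M. scalar_curvature A h p = scalar_curvature A g p))"
    by (intro exI[of _ U]) auto
qed

end
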